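(* Suppose $\mu\in(-\frac14,0)$ and $V:(0,1)\to[0,+\infty)$ is continuous and satisfies $$V(r)\leq\frac1{r^2(-\ln r)^2}\quad\text{for } r\in(0,1).$$ Let $m_\mu=4\pi\sqrt{1+4\mu}$. Then the following conclusions hold: (i) For radially symmetric functions in $\mathcal H^1_{V,\mu,0}(B_1)$, $$\sup_{u\ \text{radial},\ \|u\|_{V,\mu}\leq1}\int_{B_1}e^{m_\mu|u|^2}dx<\infty,$$ and this result is optimal: if $\alpha>m_\mu$ and $\lim_{r\to0^+}V(r)r^2(-\ln r)^2=1$, then there exists a sequence $\{u_n\}$ of radially symmetric functions which concentrates at the origin such that $\|u_n\|_{V,\mu}\leq1$ and $\int_{B_1}e^{\alpha|u_n|^2}dx\to\infty$ as $n\to+\infty$. (ii) For general functions in $\mathcal H^1_{V,\mu,0}(B_1)$: if in addition $V$ is decreasing in $(0,1)$, then $$\sup_{\|u\|_{V,\mu}\leq1}\int_{B_1}e^{m_\mu|u|^2}dx<\infty.$$ (iii) The result in (ii) is optimal: if $\lim_{r\to0^+}V(r)r^2(-\ln r)^2=1$, then for any $\alpha>m_\mu$ there exists a sequence $\{u_n\}$ concentrating at the origin such that $\|u_n\|_{V,\mu}\leq1$ and $\int_{B_1}e^{\alpha|u_n|^2}dx\to\infty$ as $n\to\infty$.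
   Context: $B_1$ is the open unit ball centered at the origin in $\mathbb R^2$, and $B_r(x_0)$ is the open ball of radius $r$ centered at $x_0$. $\mathcal H^1_{V,\mu,0}(B_1)$ is the completion of $C_c^\infty(B_1\setminus\{0\})$ under the norm $$\|u\|_{V,\mu}=\Big(\int_{B_1}\big(|\nabla u|^2+\mu V(|x|)u^2\big)dx\Big)^{1/2}.$$ A sequence $\{u_n\}$ is said to be concentrating at a point $x_0$ if for any $r\in(0,1)$ and any $\epsilon>0$ there exists $n_0>0$ such that for all $n\ge n_0$, $$\int_{B_1\setminus B_r(x_0)}\big(|\nabla u_n|^2+\mu V(|x|)u_n^2\big)dx<\epsilon.$$ *)

theory Defs
  imports "HOL-Analysis.Analysis"
begin

type_synonym plane = "real ^ 2"

abbreviation B1 :: "plane set" where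
  "B1 \<equiv> ball 0 1"

definition pderiv_at :: "2 \<Rightarrow> (plane \<Rightarrow> real) \<Rightarrow> plane \<Rightarrow> real" where
  "pderiv_at i f x = frechet_derivative f (at x) (axis i 1)"

definition grad :: "(plane \<Rightarrow> real) \<Rightarrow> plane \<Rightarrow> plane" where
  "grad f x = (\<chi> i. pderiv_at i f x)"

(* C^infinity: all iterated partial derivatives exist and are (Frechet) differentiable,
   hence also continuous. *)
definition smooth :: "(plane \<Rightarrow> real) \<Rightarrow> bool" where
  "smooth f \<longleftrightarrow> (\<forall>is x. (foldr pderiv_at is f) differentiable (at x))"

(* Functions on \<Omega> are represented by their extension by zero to the whole plane. *)
definition Cc_infty :: "plane set \<Rightarrow> (plane \<Rightarrow> real) set" where
  "Cc_infty \<Omega> = {\<phi>. smooth \<phi> \<and> compact (closure {x. \<phi> x \<noteq> 0}) \<and> closure {x. \<phi> x \<noteq> 0} \<subseteq> \<Omega>}"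

definition locally_integrable_on_B1 :: "(plane \<Rightarrow> 'b::euclidean_space) \<Rightarrow> bool" where
  "locally_integrable_on_B1 f \<longleftrightarrow>
     (\<forall>K. compact K \<longrightarrow> K \<subseteq> B1 \<longrightarrow> set_integrable lebesgue K f)"

definition is_weak_grad :: "(plane \<Rightarrow> real) \<Rightarrow> (plane \<Rightarrow> plane) \<Rightarrow> bool" where
  "is_weak_grad u G \<longleftrightarrow> locally_integrable_on_B1 u \<and> locally_integrable_on_B1 G \<and>
     (\<forall>\<phi>\<in>Cc_infty B1. \<forall>i.
        (LINT x:B1|lebesgue. u x * pderiv_at i \<phi> x) = - (LINT x:B1|lebesgue. (G x $ i) * \<phi> x))"

(* A weak gradient is unique up to null sets, so integrals of it do not depend on the choice. *)
definition weak_grad :: "(plane \<Rightarrow> real) \<Rightarrow> plane \<Rightarrow> plane" where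
  "weak_grad u = (SOME G. is_weak_grad u G)"

(* The integral over S of |G|^2 + \<mu> V(|x|) u^2, where G plays the role of the gradient of u. *)
definition energy ::
  "(real \<Rightarrow> real) \<Rightarrow> real \<Rightarrow> plane set \<Rightarrow> (plane \<Rightarrow> real) \<Rightarrow> (plane \<Rightarrow> plane) \<Rightarrow> real" where
  "energy V \<mu> S u G = (LINT x:S|lebesgue. (norm (G x))\<^sup>2 + \<mu> * V (norm x) * (u x)\<^sup>2)"

definition test_norm :: "(real \<Rightarrow> real) \<Rightarrow> real \<Rightarrow> (plane \<Rightarrow> real) \<Rightarrow> real" where
  "test_norm V \<mu> \<phi> = sqrt (energy V \<mu> B1 \<phi> (grad \<phi>))"

definition test_Cauchy :: "(real \<Rightarrow> real) \<Rightarrow> real \<Rightarrow> (nat \<Rightarrow> plane \<Rightarrow> real) \<Rightarrow> bool" where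
  "test_Cauchy V \<mu> \<phi> \<longleftrightarrow> (\<forall>n. \<phi> n \<in> Cc_infty (B1 - {0})) \<and>
     (\<forall>\<epsilon>>0. \<exists>N. \<forall>m\<ge>N. \<forall>n\<ge>N. test_norm V \<mu> (\<lambda>x. \<phi> m x - \<phi> n x) < \<epsilon>)"

(* The completion of Cc_infty (B1 - {0}) under test_norm, realized as a space of functions:
   its elements are the L^2(B1)-limits of the sequences that are Cauchy for the norm.  For
   \<mu> in (-1/4, 0) and 0 <= V(r) <= 1/(r^2 (ln r)^2), Leray's inequality makes test_norm
   equivalent to the Dirichlet norm, so every Cauchy sequence has an L^2-limit, and two Cauchy
   sequences are equivalent iff their L^2-limits agree almost everywhere.  Elements are
   functions, not classes modulo null sets; membership, H_norm and all integrals below are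
   invariant under changes on null sets.  The values of u outside B1 play no role. *)
definition H_space :: "(real \<Rightarrow> real) \<Rightarrow> real \<Rightarrow> (plane \<Rightarrow> real) set" where
  "H_space V \<mu> = {u. u \<in> borel_measurable (lebesgue_on B1) \<and>
     (\<exists>\<phi>. test_Cauchy V \<mu> \<phi> \<and>
       (\<lambda>n. \<integral>\<^sup>+x\<in>B1. ennreal ((\<phi> n x - u x)\<^sup>2) \<partial>lebesgue) \<longlonglongrightarrow> 0)}"

(* On H_space this is the limit of test_norm along any approximating Cauchy sequence. *)
definition H_norm :: "(real \<Rightarrow> real) \<Rightarrow> real \<Rightarrow> (plane \<Rightarrow> real) \<Rightarrow> real" where
  "H_norm V \<mu> u = sqrt (energy V \<mu> B1 u (weak_grad u))"

(* A class modulo null sets is radially symmetric iff it has a representative of this kind. *)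
definition radial :: "(plane \<Rightarrow> real) \<Rightarrow> bool" where
  "radial u \<longleftrightarrow> (\<forall>x\<in>B1. \<forall>y\<in>B1. norm x = norm y \<longrightarrow> u x = u y)"

definition concentrating_at ::
  "(real \<Rightarrow> real) \<Rightarrow> real \<Rightarrow> (nat \<Rightarrow> plane \<Rightarrow> real) \<Rightarrow> plane \<Rightarrow> bool" where
  "concentrating_at V \<mu> u x\<^sub>0 \<longleftrightarrow>
     (\<forall>r\<in>{0<..<1}. \<forall>\<epsilon>>0. \<exists>n\<^sub>0>0. \<forall>n\<ge>n\<^sub>0.
        energy V \<mu> (B1 - ball x\<^sub>0 r) (u n) (weak_grad (u n)) < \<epsilon>)"

definition exp_integral :: "real \<Rightarrow> (plane \<Rightarrow> real) \<Rightarrow> ennreal" where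
  "exp_integral \<alpha> u = (\<integral>\<^sup>+x\<in>B1. ennreal (exp (\<alpha> * \<bar>u x\<bar>\<^sup>2)) \<partial>lebesgue)"

definition m_crit :: "real \<Rightarrow> real" where
  "m_crit \<mu> = 4 * pi * sqrt (1 + 4 * \<mu>)"

end

theory Submission
  imports Defs "HOL-Complex_Analysis.Great_Picard"
begin

text \<open>Put \<open>l = sqrt (1 + 4 * \<mu>)\<close>, \<open>a = (1 - l) / 2\<close> and \<open>x = exp (- t) (cos \<theta>, sin \<theta>)\<close>. For a radial function
  \<open>u(x) = w(t)\<close> the bound on \<open>V\<close> and \<open>a (1 - a) = - \<mu>\<close> give
  \<open>energy u \<ge> 2 \<pi> \<integral> (w'\<^sup>2 + \<mu> w\<^sup>2 / t\<^sup>2) dt \<ge> 2 \<pi> \<integral> (w' - a w / t)\<^sup>2 dt\<close>,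
  and the last integral controls the growth of \<open>w\<close>: \<open>t powr (- a) w\<close> is an integral of \<open>t powr (- a) (w' - a w / t)\<close>, so that
  Cauchy-Schwarz gives \<open>2 \<pi> l w\<^sup>2 \<le> t\<close>, and Moser's level set argument bounds \<open>\<integral> exp (4 \<pi> l w\<^sup>2 - 2 t) dt\<close>.
  If \<open>V\<close> is decreasing, a general function is replaced by a radial one through polarizations. They preserve the
  exponential integral, do not decrease the potential term and do not increase the nonlocal energies
  \<open>\<integral>\<integral> (u x - u y)\<^sup>2\<close> over \<open>norm (x - y) < e\<close>, which determine the Dirichlet energy as \<open>e \<rightarrow> 0\<close>. A function of least second
  moment in the compact set of Lipschitz functions with these properties is radial.
  Optimality is seen on \<open>w(t) = sqrt t * g (ln (t / T))\<close> with \<open>T \<rightarrow> \<infinity>\<close> and \<open>g y\<close> close to \<open>exp (- l \<bar>y\<bar> / 2)\<close>.\<close>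

section \<open>A one-dimensional Moser inequality\<close>

text \<open>The powers \<open>t powr s\<close> that solve the Euler equation
  \<open>w'' = \<mu> * w / t\<^sup>2\<close> have \<open>s * (1 - s) = - \<mu>\<close>, and
  \<open>a\<close> is the smaller root: the one for which
  \<open>t powr (- 2 * a) = t powr (l - 1)\<close> is integrable at \<open>t = 0\<close>, the
  boundary of the disc. Its integral \<open>t powr l / l\<close> is the source of the factor
  \<open>l\<close> in \<open>m_crit\<close>. Approximations of a radial element need not be radial.
  Their circle means are used instead, which do not increase the deviation from the ground state.
  For general functions the obstacle is that a minimizer among Lipschitz functions has no continuous
  gradient. The nonlocal energies make gradients avoidable until the minimizer is mollified: being
  convex and translation invariant, they do not grow under mollification. For optimality,
  \<open>w = sqrt t * g (ln t)\<close> turns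
  \<open>w'\<^sup>2 + \<mu> * w\<^sup>2 / t\<^sup>2\<close> into
  \<open>g'\<^sup>2 + l\<^sup>2 / 4 * g\<^sup>2\<close> up to an exact derivative, so moving the
  peak to \<open>T\<close> costs no energy while the support shrinks to the origin.\<close>

lemma cauchy_schwarz_integral:
  fixes f g :: "'a \<Rightarrow> real"
  assumes [measurable]: "f \<in> borel_measurable M" "g \<in> borel_measurable M"
    and f2: "integrable M (\<lambda>x. (f x)\<^sup>2)" and g2: "integrable M (\<lambda>x. (g x)\<^sup>2)"
  shows "integrable M (\<lambda>x. f x * g x)"
    and "(\<integral>x. f x * g x \<partial>M)\<^sup>2 \<le> (\<integral>x. (f x)\<^sup>2 \<partial>M) * (\<integral>x. (g x)\<^sup>2 \<partial>M)"
proof -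
  show fg: "integrable M (\<lambda>x. f x * g x)"
  proof (rule Bochner_Integration.integrable_bound[OF Bochner_Integration.integrable_add[OF f2 g2]])
    have "\<bar>a * b\<bar> \<le> a\<^sup>2 + b\<^sup>2" for a b :: real
    proof -
      have "2 * (\<bar>a\<bar> * \<bar>b\<bar>) \<le> a\<^sup>2 + b\<^sup>2" "0 \<le> \<bar>a\<bar> * \<bar>b\<bar>"
        using sum_squares_bound[of "\<bar>a\<bar>" "\<bar>b\<bar>"] by auto
      then show ?thesis unfolding abs_mult by linarith
    qed
    then show "AE x in M. norm (f x * g x) \<le> norm ((f x)\<^sup>2 + (g x)\<^sup>2)" by simp
  qed simp
  define A B C where "A = (\<integral>x. (f x)\<^sup>2 \<partial>M)" and "B = (\<integral>x. f x * g x \<partial>M)" and "C = (\<integral>x. (g x)\<^sup>2 \<partial>M)"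
  have A0: "A \<ge> 0" and C0: "C \<ge> 0" unfolding A_def C_def by (auto intro!: integral_nonneg_AE)
  have q: "A - 2 * s * B + s\<^sup>2 * C \<ge> 0" for s
  proof -
    have "0 \<le> (\<integral>x. (f x - s * g x)\<^sup>2 \<partial>M)" by (auto intro!: integral_nonneg_AE)
    also have "(\<lambda>x. (f x - s * g x)\<^sup>2) = (\<lambda>x. (f x)\<^sup>2 - 2 * s * (f x * g x) + s\<^sup>2 * (g x)\<^sup>2)"
      by (auto simp: power2_eq_square algebra_simps)
    also have "(\<integral>x. (f x)\<^sup>2 - 2 * s * (f x * g x) + s\<^sup>2 * (g x)\<^sup>2 \<partial>M) = A - 2 * s * B + s\<^sup>2 * C"
      using f2 g2 fg by (simp add: A_def B_def C_def)
    finally show ?thesis .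
  qed
  show "B\<^sup>2 \<le> A * C"
  proof (cases "C = 0")
    case True
    have "B = 0"
    proof (rule ccontr)
      assume "B \<noteq> 0"
      \<comment> \<open>For \<open>C = 0\<close> the quadratic form is affine in \<open>s\<close>;
        at this \<open>s\<close> it takes the value -1.\<close>
      then show False using q[of "(A + 1) / (2 * B)"] True by simp
    qed
    then show ?thesis using True by simp
  next
    case False
    then have "C > 0" using C0 by simp
    \<comment> \<open>\<open>B / C\<close> minimizes the quadratic form in \<open>s\<close>.\<close>
    have "0 \<le> C * (A - 2 * (B / C) * B + (B / C)\<^sup>2 * C)"
      using q[of "B / C"] \<open>C > 0\<close> by simp
    also have "\<dots> = A * C - B\<^sup>2" using \<open>C > 0\<close> by (simp add: power2_eq_square field_simps)
    finally show ?thesis by simp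
  qed
qed

lemma cauchy_schwarz_continuous:
  fixes f g :: "real \<Rightarrow> real"
  assumes f: "continuous_on {a..b} f" and g: "continuous_on {a..b} g"
  shows "(integral {a..b} (\<lambda>x. f x * g x))\<^sup>2
    \<le> integral {a..b} (\<lambda>x. (f x)\<^sup>2) * integral {a..b} (\<lambda>x. (g x)\<^sup>2)"
proof -
  let ?M = "lebesgue_on {a..b}"
  have eq: "integral {a..b} h = integral\<^sup>L ?M h" and int: "integrable ?M h"
    if "continuous_on {a..b} h" for h :: "real \<Rightarrow> real"
  proof -
    have "h absolutely_integrable_on {a..b}" using that by (rule absolutely_integrable_continuous_real)
    then show int: "integrable ?M h" by (simp add: set_integrable_def integrable_restrict_space)
    show "integral {a..b} h = integral\<^sup>L ?M h"
      using lebesgue_integral_eq_integral[OF int] by simp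
  qed
  have m: "h \<in> borel_measurable ?M" if "continuous_on {a..b} h" for h :: "real \<Rightarrow> real"
    using int[OF that] by simp
  show ?thesis
    using cauchy_schwarz_integral(2)[OF m[OF f] m[OF g] int[OF continuous_on_power[OF f]] int[OF continuous_on_power[OF g]]]
    by (simp only: eq[OF continuous_on_mult[OF f g]] eq[OF continuous_on_power[OF f]] eq[OF continuous_on_power[OF g]])
qed

text \<open>For \<open>level_set_close\<close>, where \<open>s1\<close>, \<open>s2\<close> are the
  powers \<open>t powr l\<close> of two points of a level set. Squaring the hypothesis on the roots
  and inserting the gap bounds \<open>D = s2 - s1\<close> by terms in which \<open>D\<close> occurs
  with total coefficient at most 1/2, plus 5 times \<open>\<epsilon> * s1\<close>; hence the
  constant 10.\<close>

lemma quadratic_gap_bound: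
  fixes A1 A2 s1 s2 \<rho> \<epsilon> :: real
  assumes "0 \<le> A1" "A1 \<le> s1" "0 \<le> A2" "s1 \<le> s2" "0 \<le> \<rho>" "\<rho> \<le> \<epsilon>" "\<epsilon> \<le> 1/4"
    and A2: "sqrt A2 \<le> sqrt A1 + sqrt ((s2 - s1) * \<rho>)" and gap: "s2 - A2 \<le> \<epsilon> * s1"
  shows "s2 \<le> s1 * (1 + 10 * \<epsilon>)"
proof -
  define D where "D = s2 - s1"
  have D: "D \<ge> 0" "0 \<le> s1" using assms by (auto simp: D_def)
  have "sqrt A2 \<le> sqrt s1 + sqrt (D * \<epsilon>)"
    using A2 real_sqrt_le_mono[OF \<open>A1 \<le> s1\<close>] real_sqrt_le_mono[OF mult_left_mono[OF \<open>\<rho> \<le> \<epsilon>\<close> D(1)]]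
    by (simp only: D_def)
  then have "(sqrt A2)\<^sup>2 \<le> (sqrt s1 + sqrt (D * \<epsilon>))\<^sup>2"
    using assms by (intro power_mono) auto
  also have "\<dots> = s1 + D * \<epsilon> + 2 * sqrt s1 * sqrt (D * \<epsilon>)"
    using D assms by (simp add: power2_sum)
  finally have 1: "A2 \<le> s1 + D * \<epsilon> + 2 * sqrt s1 * sqrt (D * \<epsilon>)" using assms by simp
  \<comment> \<open>Weights 1/2 and 2: only \<open>D / 4\<close> of the mixed term has to be
    absorbed on the left.\<close>
  have "2 * (sqrt D / 2) * (2 * sqrt (s1 * \<epsilon>)) \<le> (sqrt D / 2)\<^sup>2 + (2 * sqrt (s1 * \<epsilon>))\<^sup>2"
    by (rule sum_squares_bound)
  then have 2: "2 * sqrt s1 * sqrt (D * \<epsilon>) \<le> D / 4 + 4 * (s1 * \<epsilon>)"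
    using D assms by (simp add: power_mult_distrib power_divide real_sqrt_mult algebra_simps)
  have "D * \<epsilon> \<le> D * (1/4)" using D assms by (intro mult_left_mono) auto
  moreover have "A2 \<le> s1 + p + W \<Longrightarrow> W \<le> D / 4 + 4 * x \<Longrightarrow> s2 - A2 \<le> x \<Longrightarrow> p \<le> D * (1/4) \<Longrightarrow> D \<le> 10 * x"
    for p W x :: real using D_def by linarith
  ultimately have "D \<le> 10 * (s1 * \<epsilon>)" using 1 2 gap unfolding mult.commute[of \<epsilon> s1] by blast
  then show ?thesis by (simp add: D_def algebra_simps)
qed

text \<open>\<open>w\<close> is a profile in the variable \<open>t = - ln (norm x)\<close>. It
  vanishes near \<open>t = 0\<close>, that is near the boundary circle, but may be arbitrary for
  large \<open>t\<close>. The bound \<open>1 / (2 * pi)\<close> is the energy bound 1 in the plane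
  divided by the range of the angle.\<close>

locale hardy_1d =
  fixes l a :: real and w w' :: "real \<Rightarrow> real" and t0 :: real
  assumes l: "0 < l" "l < 1" and a_def: "a = (1 - l) / 2"
    and der: "\<And>t. t > 0 \<Longrightarrow> (w has_real_derivative w' t) (at t)"
    and cont: "continuous_on {0<..} w'"
    and t0: "t0 > 0" "\<And>t. 0 < t \<Longrightarrow> t \<le> t0 \<Longrightarrow> w t = 0"
    and energy: "\<And>t1 t2. 0 < t1 \<Longrightarrow> t1 \<le> t2 \<Longrightarrow>
        integral {t1..t2} (\<lambda>t. (w' t - a * w t / t)\<^sup>2) \<le> 1 / (2 * pi)"
begin

definition "E t1 t2 = integral {t1..t2} (\<lambda>t. (w' t - a * w t / t)\<^sup>2)"

lemma cont_w: "continuous_on {0<..} w"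
  using der by (intro continuous_at_imp_continuous_on) (auto intro: DERIV_isCont)

lemma cont_subset: "0 < t1 \<Longrightarrow> continuous_on {t1..t2} w" "0 < t1 \<Longrightarrow> continuous_on {t1..t2} w'"
  by (rule continuous_on_subset[OF cont_w], auto) (rule continuous_on_subset[OF cont], auto)

lemma cont_E: "0 < t1 \<Longrightarrow> continuous_on {t1..t2} (\<lambda>t. (w' t - a * w t / t)\<^sup>2)"
  by (intro continuous_intros cont_subset) auto

lemma E_nonneg: "0 < t1 \<Longrightarrow> 0 \<le> E t1 t2"
  unfolding E_def by (intro integral_nonneg integrable_continuous_real cont_E) auto

lemma E_add: "0 < t1 \<Longrightarrow> t1 \<le> t2 \<Longrightarrow> t2 \<le> t3 \<Longrightarrow> E t1 t2 + E t2 t3 = E t1 t3"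
  unfolding E_def by (intro Henstock_Kurzweil_Integration.integral_combine integrable_continuous_real cont_E) auto

lemma increment:
  assumes "0 < t1" "t1 \<le> t2"
  shows "(w t2 * t2 powr -a - w t1 * t1 powr -a)\<^sup>2 \<le> (t2 powr l - t1 powr l) / l * E t1 t2"
proof -
  have "((\<lambda>t. w t * t powr -a) has_real_derivative t powr -a * (w' t - a * w t / t)) (at t within {t1..t2})"
    if "t \<in> {t1..t2}" for t
  proof -
    have "t > 0" using that assms by auto
    have "((\<lambda>t. w t * t powr -a) has_real_derivative w' t * t powr -a + (-a * t powr (-a - 1)) * w t) (at t within {t1..t2})"
      using \<open>t > 0\<close> by (auto intro!: derivative_eq_intros DERIV_subset[OF der])
    moreover have "t powr (-a-1) = t powr -a / t" using \<open>t > 0\<close> by (simp add: powr_diff)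
    ultimately show ?thesis by (simp add: algebra_simps)
  qed
  then have "((\<lambda>t. t powr -a * (w' t - a * w t / t)) has_integral (w t2 * t2 powr -a - w t1 * t1 powr -a)) {t1..t2}"
    using assms by (intro fundamental_theorem_of_calculus) (auto simp: has_real_derivative_iff_has_vector_derivative)
  then have 1: "w t2 * t2 powr -a - w t1 * t1 powr -a = integral {t1..t2} (\<lambda>t. t powr -a * (w' t - a * w t / t))"
    by (simp add: integral_unique)
  have "((\<lambda>t. t powr l / l) has_real_derivative (t powr -a)\<^sup>2) (at t within {t1..t2})" if "t \<in> {t1..t2}" for t
  proof -
    have "t > 0" using that assms by auto
    have e: "(t powr -a)\<^sup>2 = t powr (l - 1)"
      by (simp add: power2_eq_square powr_add[symmetric] a_def diff_divide_distrib)
    show ?thesis unfolding e using \<open>t > 0\<close> l by (auto intro!: derivative_eq_intros)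
  qed
  then have "((\<lambda>t. (t powr -a)\<^sup>2) has_integral (t2 powr l / l - t1 powr l / l)) {t1..t2}"
    using assms by (intro fundamental_theorem_of_calculus) (auto simp: has_real_derivative_iff_has_vector_derivative)
  then have 2: "integral {t1..t2} (\<lambda>t. (t powr -a)\<^sup>2) = (t2 powr l - t1 powr l) / l"
    by (simp add: integral_unique diff_divide_distrib)
  show ?thesis unfolding 1 2[symmetric] E_def
    using assms by (intro cauchy_schwarz_continuous) (auto intro!: continuous_intros cont_subset)
qed

text \<open>Normalized so that the growth bound reads \<open>A t \<le> t powr l\<close> and the
  increments of \<open>sqrt (A t)\<close> are controlled by \<open>2 * pi * E\<close>, a quantity of
  size at most 1.\<close>

definition "A t = 2 * pi * l * (w t * t powr -a)\<^sup>2"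
text \<open>The exponent in \<open>moser\<close> is \<open>- 2 * gap t\<close>; the sublevel sets of
  \<open>gap\<close> are Moser's level sets.\<close>

definition "gap t = t - 2 * pi * l * (w t)\<^sup>2"

lemma A_nonneg: "0 \<le> A t" using l by (simp add: A_def)

lemma A_gap: assumes "t > 0" shows "gap t = t powr (1 - l) * (t powr l - A t)"
proof -
  have 1: "t powr (1 - l) * t powr l = t" using assms by (simp add: powr_add[symmetric])
  have "t powr (1-l) * (t powr -a)\<^sup>2 = 1"
    using assms by (simp add: power2_eq_square powr_add[symmetric] a_def field_simps)
  then have "t powr (1-l) * A t = 2 * pi * l * (w t)\<^sup>2"
    by (simp add: A_def power_mult_distrib)
  with 1 show ?thesis by (simp add: gap_def right_diff_distrib)
qed

lemma sqrt_A: "sqrt (A t) = sqrt (2 * pi * l) * \<bar>w t * t powr -a\<bar>"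
  by (simp add: A_def real_sqrt_mult)

lemma A_increment:
  assumes "0 < t1" "t1 \<le> t2"
  shows "sqrt (A t2) \<le> sqrt (A t1) + sqrt ((t2 powr l - t1 powr l) * (2 * pi * E t1 t2))"
proof -
  have "\<bar>w t2 * t2 powr -a - w t1 * t1 powr -a\<bar> \<le> sqrt ((t2 powr l - t1 powr l) / l * E t1 t2)"
    using increment[OF assms] real_sqrt_le_mono by fastforce
  then have "\<bar>w t2 * t2 powr -a\<bar> \<le> \<bar>w t1 * t1 powr -a\<bar> + sqrt ((t2 powr l - t1 powr l) / l * E t1 t2)" by linarith
  then have "sqrt (2*pi*l) * \<bar>w t2 * t2 powr -a\<bar> \<le> sqrt (2*pi*l) * (\<bar>w t1 * t1 powr -a\<bar> + sqrt ((t2 powr l - t1 powr l) / l * E t1 t2))"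
    using l by (intro mult_left_mono) auto
  also have "\<dots> = sqrt (A t1) + sqrt ((2*pi*l) * ((t2 powr l - t1 powr l) / l * E t1 t2))"
    by (simp only: sqrt_A distrib_left real_sqrt_mult[of "2*pi*l" "(t2 powr l - t1 powr l) / l * E t1 t2"])
  also have "(2*pi*l) * ((t2 powr l - t1 powr l) / l * E t1 t2) = (t2 powr l - t1 powr l) * (2 * pi * E t1 t2)"
    using l by simp
  finally show ?thesis by (simp add: sqrt_A)
qed

lemma A_le: assumes "t1 > 0"
  obtains \<tau> where "0 < \<tau>" "\<tau> \<le> t1" "A t1 \<le> t1 powr l * (2 * pi * E \<tau> t1)"
proof -
  \<comment> \<open>The minimum keeps \<tau> to the left of \<open>t1\<close> and inside the region
    where \<open>w\<close> vanishes, so the whole value at \<open>t1\<close> has been built up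
    between \<tau> and \<open>t1\<close>.\<close>
  define \<tau> where "\<tau> = min t0 t1"
  have \<tau>: "0 < \<tau>" "\<tau> \<le> t1" "w \<tau> = 0" using t0 assms by (auto simp: \<tau>_def)
  then have "A \<tau> = 0" by (simp add: A_def)
  then have "sqrt (A t1) \<le> sqrt ((t1 powr l - \<tau> powr l) * (2 * pi * E \<tau> t1))"
    using A_increment[OF \<tau>(1,2)] by simp
  then have "A t1 \<le> (t1 powr l - \<tau> powr l) * (2 * pi * E \<tau> t1)" by simp
  also have "\<dots> \<le> t1 powr l * (2 * pi * E \<tau> t1)"
    using E_nonneg[OF \<tau>(1)] by (intro mult_right_mono) auto
  finally show ?thesis using that \<tau> by blast
qed

lemma A_le_powr: assumes "t > 0" shows "A t \<le> t powr l"
proof -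
  obtain \<tau> where t: "0 < \<tau>" "\<tau> \<le> t" "A t \<le> t powr l * (2 * pi * E \<tau> t)" by (rule A_le[OF assms])
  have "2 * pi * E \<tau> t \<le> 1" using energy[OF t(1,2)] by (simp add: E_def field_simps)
  then have "t powr l * (2 * pi * E \<tau> t) \<le> t powr l * 1" by (intro mult_left_mono) auto
  then show ?thesis using t(3) by linarith
qed

lemma gap_nonneg: "t > 0 \<Longrightarrow> 0 \<le> gap t"
  using A_le_powr by (simp add: A_gap)

text \<open>A small gap at \<open>t1\<close> means that nearly the whole energy was spent before
  \<open>t1\<close>; at most the fraction \<open>k / t1\<close> is left. With so little energy
  \<open>w\<close> cannot keep pace with the root of \<open>t\<close>, so a second point with a
  small gap must be near. The condition \<open>4 * k < t1\<close> makes this fraction at most 1/4,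
  as \<open>quadratic_gap_bound\<close> requires.\<close>

lemma level_set_close:
  assumes k: "k > 0" and t1: "4 * k < t1" "gap t1 \<le> k" and t2: "t1 \<le> t2" "gap t2 \<le> k"
  shows "t2 - t1 \<le> 10 / l * exp (10 / l) * k"
proof -
  define s1 s2 where "s1 = t1 powr l" and "s2 = t2 powr l"
  define \<epsilon> where "\<epsilon> = k / t1"
  have p: "t1 > 0" "t2 > 0" using k t1 t2 by auto
  have s: "0 < s1" "s1 \<le> s2" using p t2 l by (auto simp: s1_def s2_def intro!: powr_mono2)
  have \<epsilon>: "0 < \<epsilon>" "\<epsilon> \<le> 1/4" using k t1 p by (auto simp: \<epsilon>_def field_simps)
  obtain \<tau> where \<tau>: "0 < \<tau>" "\<tau> \<le> t1" "A t1 \<le> s1 * (2 * pi * E \<tau> t1)"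
    using A_le[OF p(1)] unfolding s1_def by metis
  have "E \<tau> t1 + E t1 t2 \<le> 1 / (2 * pi)"
    using E_add[of \<tau> t1 t2] energy[of \<tau> t2] \<tau>(1,2) t2 unfolding E_def by linarith
  then have "2 * pi * (E \<tau> t1 + E t1 t2) \<le> 2 * pi * (1 / (2 * pi))" by (intro mult_left_mono) auto
  \<comment> \<open>The energy after \<open>t1\<close> is at most what the part before
    \<open>t1\<close> leaves over.\<close>
  then have e1: "2 * pi * E t1 t2 \<le> 1 - 2 * pi * E \<tau> t1" by (simp add: distrib_left)
  also have "\<dots> \<le> 1 - A t1 / s1"
    using \<tau>(3) s by (simp add: pos_divide_le_eq mult.commute)
  also have "\<dots> = (s1 - A t1) / s1" using s by (simp add: diff_divide_distrib)
  also have "\<dots> = gap t1 / t1"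
  proof -
    define q where "q = t1 powr (1 - l)"
    have "q > 0" using p by (simp add: q_def)
    have "q * s1 = t1" using p by (simp add: q_def s1_def powr_add[symmetric])
    moreover have "gap t1 = q * (s1 - A t1)" using A_gap[OF p(1)] by (simp add: q_def s1_def)
    ultimately have "gap t1 / t1 = (q * (s1 - A t1)) / (q * s1)" by simp
    then show ?thesis using \<open>q > 0\<close> by simp
  qed
  also have "\<dots> \<le> \<epsilon>" unfolding \<epsilon>_def using t1 p by (intro divide_right_mono) auto
  finally have \<rho>: "2 * pi * E t1 t2 \<le> \<epsilon>" .
  have g2: "s2 - A t2 \<le> \<epsilon> * s1"
  proof -
    have "(s2 - A t2) = t2 powr (l - 1) * gap t2"
      using A_gap[OF p(2)] p powr_add[of t2 "l - 1" "1 - l"] by (simp add: s2_def)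
    also have "\<dots> \<le> t2 powr (l - 1) * k" using t2 by (intro mult_left_mono) auto
    also have "\<dots> \<le> t1 powr (l - 1) * k"
      using t2 p k l by (intro mult_right_mono powr_mono2') auto
    also have "\<dots> = \<epsilon> * s1" using p by (simp add: \<epsilon>_def s1_def powr_diff)
    finally show ?thesis .
  qed
  have "s2 \<le> s1 * (1 + 10 * \<epsilon>)"
    using A_increment[OF p(1) t2(1)] E_nonneg[OF p(1)] A_nonneg A_le_powr[OF p(1)] s \<epsilon> \<rho> g2
    by (intro quadratic_gap_bound[of "A t1" s1 "A t2" s2 "2 * pi * E t1 t2" \<epsilon>]) (simp_all only: s1_def s2_def, simp?)
  \<comment> \<open>In exponential form the factor survives the passage from \<open>t powr l\<close>
    back to \<open>t\<close> by the power \<open>1 / l\<close>.\<close>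
  also have "\<dots> \<le> s1 * exp (10 * \<epsilon>)" using s by (intro mult_left_mono exp_ge_add_one_self) auto
  finally have "s2 powr (1 / l) \<le> (s1 * exp (10 * \<epsilon>)) powr (1 / l)"
    using s l by (intro powr_mono2) auto
  also have "\<dots> = s1 powr (1 / l) * exp (10 * \<epsilon>) powr (1 / l)"
    by (rule powr_mult)
  also have "exp (10 * \<epsilon>) powr (1 / l) = exp (10 * \<epsilon> / l)" by (simp add: powr_def)
  also have "s1 powr (1 / l) = t1" unfolding s1_def powr_powr using l p by simp
  also have "s2 powr (1 / l) = t2" unfolding s2_def powr_powr using l p by simp
  finally have t2le: "t2 \<le> t1 * exp (10 * \<epsilon> / l)" .
  define y where "y = 10 * \<epsilon> / l"
  have y: "0 \<le> y" "y \<le> 10 / l" using \<epsilon> l by (auto simp: y_def field_simps)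
  \<comment> \<open>Since \<open>t1 * y = 10 * k / l\<close>, the position \<open>t1\<close> cancels
    and the bound depends on \<open>k\<close> and \<open>l\<close> alone.\<close>
  have "exp y - 1 \<le> y * exp y"
    using exp_ge_add_one_self[of "-y"] by (simp add: exp_minus field_simps)
  also have "\<dots> \<le> y * exp (10 / l)" using y by (intro mult_left_mono) auto
  finally have "t1 * (exp y - 1) \<le> t1 * (y * exp (10 / l))" using p by (intro mult_left_mono) auto
  also have "\<dots> = 10 / l * exp (10 / l) * k" using p by (simp add: y_def \<epsilon>_def)
  finally have "t1 * exp y - t1 \<le> 10 / l * exp (10 / l) * k" by (simp only: right_diff_distrib mult_1_right)
  moreover have "t2 \<le> t1 * exp y" using t2le unfolding y_def .
  ultimately show ?thesis by linarith
qed

lemma measurable_w: "(\<lambda>t. indicator {0<..} t * w t) \<in> borel_measurable borel"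
  by (rule borel_measurable_continuous_on_indicator[OF _ cont_w, unfolded real_scaleR_def]) auto

text \<open>Beyond \<open>4 * k\<close> any one point of the level set has all others within
  distance \<open>c * k\<close>, by \<open>level_set_close\<close> applied in both orders. The
  constant is 4 for the initial interval plus \<open>2 * c\<close> for the interval around that
  point.\<close>

lemma emeasure_level_set:
  assumes k: "k > 0"
  shows "emeasure lborel {t. 0 < t \<and> gap t \<le> k} \<le> ennreal ((4 + 20 / l * exp (10 / l)) * k)"
proof -
  define c where "c = 10 / l * exp (10 / l)"
  have c: "c > 0" using l by (simp add: c_def)
  have "\<exists>\<tau>. {t. 0 < t \<and> gap t \<le> k} \<subseteq> {0..4*k} \<union> {\<tau> - c * k .. \<tau> + c * k}"
  proof (cases "\<exists>\<tau>>4*k. gap \<tau> \<le> k")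
    case True
    then obtain \<tau> where \<tau>: "\<tau> > 4 * k" "gap \<tau> \<le> k" by blast
    have "\<bar>t - \<tau>\<bar> \<le> c * k" if "4 * k < t" "gap t \<le> k" for t
      using level_set_close[OF k that] level_set_close[OF k \<tau>] that \<tau> c_def by (cases "t \<le> \<tau>") force+
    then show ?thesis by (intro exI[of _ \<tau>]) (force simp: abs_le_iff not_le)
  next
    case False
    then show ?thesis by force
  qed
  then obtain \<tau> where "{t. 0 < t \<and> gap t \<le> k} \<subseteq> {0..4*k} \<union> {\<tau> - c * k .. \<tau> + c * k}" by blast
  then have "emeasure lborel {t. 0 < t \<and> gap t \<le> k} \<le> emeasure lborel ({0..4*k} \<union> {\<tau> - c * k .. \<tau> + c * k})"
    by (intro emeasure_mono) auto
  also have "\<dots> \<le> emeasure lborel {0..4*k} + emeasure lborel {\<tau> - c * k .. \<tau> + c * k}"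
    by (intro emeasure_subadditive) auto
  also have "\<dots> = ennreal (4 * k + 2 * (c * k))"
    using c k by (simp add: ennreal_plus[symmetric] del: ennreal_plus)
  finally show ?thesis by (simp add: c_def algebra_simps)
qed

text \<open>The half-line is cut into layers where \<open>gap\<close> lies between consecutive
  integers. On a layer the integrand is at most \<open>exp (- 2 * k)\<close>, while its length grows
  only linearly in \<open>k\<close>.\<close>

lemma moser:
  "(\<integral>\<^sup>+t\<in>{0<..}. ennreal (exp (4 * pi * l * (w t)\<^sup>2 - 2 * t)) \<partial>lborel)
     \<le> (\<Sum>k. ennreal ((4 + 20 / l * exp (10 / l)) * (exp (-1)) ^ k))"
proof -
  \<comment> \<open>Extension by 0 to the left half-line gives a Borel function on the whole line,
    since \<open>w\<close> is only known to be continuous for positive arguments.\<close>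
  define G where "G t = (if t > 0 then gap t else 0)" for t
  have [measurable]: "G \<in> borel_measurable borel"
  proof -
    have "G = (\<lambda>t. indicator {0<..} t * t - 2 * pi * l * (indicator {0<..} t * w t)\<^sup>2)"
      by (auto simp: G_def gap_def indicator_def fun_eq_iff)
    then show ?thesis using measurable_w by simp
  qed
  have s: "{t. 0 < t \<and> G t \<le> k} = {t. 0 < t \<and> gap t \<le> k}" for k by (auto simp: G_def)
  have [measurable]: "{t. 0 < t \<and> G t \<le> k} \<in> sets borel" for k by measurable
  have "ennreal (exp (4 * pi * l * (w t)\<^sup>2 - 2 * t)) * indicator {0<..} t
     \<le> (\<Sum>k. ennreal (exp (- 2 * real k)) * indicator {t. 0 < t \<and> G t \<le> real k + 1} t)" for t
  proof (cases "t > 0")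
    case True
    define k where "k = nat \<lfloor>gap t\<rfloor>"
    have g: "real k \<le> gap t" "gap t \<le> real k + 1" using gap_nonneg[OF True] by (auto simp: k_def)
    have "ennreal (exp (4 * pi * l * (w t)\<^sup>2 - 2 * t)) * indicator {0<..} t = ennreal (exp (- 2 * gap t))"
      using True by (simp add: gap_def algebra_simps)
    also have "\<dots> \<le> ennreal (exp (- 2 * real k)) * indicator {t. 0 < t \<and> G t \<le> real k + 1} t"
      using g True by (auto simp: G_def)
    also have "\<dots> \<le> (\<Sum>k. ennreal (exp (- 2 * real k)) * indicator {t. 0 < t \<and> G t \<le> real k + 1} t)"
      by (rule sum_le_suminf[of _ "{k}", simplified sum.insert[OF finite.emptyI] sum.empty add_0_right empty_iff not_False_eq_True]) auto
    finally show ?thesis .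
  qed simp
  then have "(\<integral>\<^sup>+t\<in>{0<..}. ennreal (exp (4 * pi * l * (w t)\<^sup>2 - 2 * t)) \<partial>lborel)
    \<le> (\<integral>\<^sup>+t. (\<Sum>k. ennreal (exp (- 2 * real k)) * indicator {t. 0 < t \<and> G t \<le> real k + 1} t) \<partial>lborel)"
    by (intro nn_integral_mono)
  also have "\<dots> = (\<Sum>k. ennreal (exp (- 2 * real k)) * emeasure lborel {t. 0 < t \<and> G t \<le> real k + 1})"
    by (subst nn_integral_suminf) (auto simp: nn_integral_cmult_indicator)
  also have "\<dots> \<le> (\<Sum>k. ennreal ((4 + 20 / l * exp (10 / l)) * (exp (-1)) ^ k))"
  proof (intro suminf_le)
    fix k :: nat
    let ?C = "4 + 20 / l * exp (10 / l)"
    have C: "?C > 0" using l by (simp add: add_pos_pos)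
    have "ennreal (exp (- 2 * real k)) * emeasure lborel {t. 0 < t \<and> G t \<le> real k + 1}
      \<le> ennreal (exp (- 2 * real k)) * ennreal (?C * (real k + 1))"
      unfolding s by (intro mult_left_mono emeasure_level_set) auto
    also have "\<dots> = ennreal (exp (- 2 * real k) * (?C * (real k + 1)))"
      using C by (subst ennreal_mult) auto
    \<comment> \<open>One of the two factors \<open>exp (- k)\<close> pays for the linear growth
      \<open>k + 1\<close>.\<close>
    also have "\<dots> \<le> ennreal (exp (- 2 * real k) * (?C * exp (real k)))"
      using exp_ge_add_one_self[of "real k"] C by (intro ennreal_leI mult_left_mono) (auto simp: add.commute)
    also have "exp (- 2 * real k) * (?C * exp (real k)) = ?C * exp (-1) ^ k"
      by (simp add: exp_of_nat_mult[symmetric] exp_add[symmetric])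
    finally show "ennreal (exp (- 2 * real k)) * emeasure lborel {t. 0 < t \<and> G t \<le> real k + 1} \<le> ennreal (?C * exp (-1) ^ k)" .
  qed auto
  finally show ?thesis .
qed

end

text \<open>The sum of the geometric series in \<open>moser\<close>. It depends on \<open>l\<close>
  only, which makes all later bounds uniform.\<close>

definition "moser_const l = (4 + 20 / l * exp (10 / l)) / (1 - exp (-1 :: real))"

lemma (in hardy_1d) moser_integral:
  "(\<integral>\<^sup>+t\<in>{0<..}. ennreal (exp (4 * pi * l * (w t)\<^sup>2 - 2 * t)) \<partial>lborel) \<le> ennreal (moser_const l)"
proof -
  have C: "4 + 20 / l * exp (10 / l) > 0" using l by (simp add: add_pos_pos)
  have "(\<lambda>k. (4 + 20 / l * exp (10 / l)) * (exp (-1)) ^ k) sums ((4 + 20 / l * exp (10 / l)) * (1 / (1 - exp (-1))))"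
    by (intro sums_mult geometric_sums) auto
  then have "(\<Sum>k. ennreal ((4 + 20 / l * exp (10 / l)) * (exp (-1)) ^ k)) = ennreal (moser_const l)"
    using C by (subst suminf_ennreal_eq) (auto simp: moser_const_def)
  then show ?thesis using moser by simp
qed

section \<open>Logarithmic polar coordinates\<close>

lemma borel_measurable_vector2 [measurable]:
  "f \<in> borel_measurable M \<Longrightarrow> g \<in> borel_measurable M \<Longrightarrow> (\<lambda>p. vector [f p, g p] :: real^2) \<in> borel_measurable M"
proof -
  assume "f \<in> borel_measurable M" "g \<in> borel_measurable M"
  moreover have "(\<lambda>p. vector [f p, g p] :: real^2) = (\<lambda>p. f p *\<^sub>R axis 1 1 + g p *\<^sub>R axis 2 1)"
    by (auto simp: vec_eq_iff forall_2 axis_def fun_eq_iff)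
  ultimately show ?thesis by simp
qed

lemma lborel_vec2: "(lborel :: (real^2) measure) = distr (lborel \<Otimes>\<^sub>M lborel) borel (\<lambda>(x, y). vector [x, y])"
proof (rule lborel_eqI)
  fix l u :: "real^2" assume le: "\<And>b. b \<in> Basis \<Longrightarrow> l \<bullet> b \<le> u \<bullet> b"
  have le: "l $ i \<le> u $ i" for i using le[of "axis i 1"] by (auto simp: Basis_vec_def inner_axis)
  have [measurable]: "(\<lambda>(x, y). vector [x, y] :: real^2) \<in> borel_measurable (lborel \<Otimes>\<^sub>M lborel)"
    unfolding split_beta by measurable
  have "emeasure (distr (lborel \<Otimes>\<^sub>M lborel) borel (\<lambda>(x, y). vector [x, y] :: real^2)) (box l u)
    = emeasure (lborel \<Otimes>\<^sub>M lborel) ((\<lambda>(x, y). vector [x, y] :: real^2) -` box l u \<inter> space (lborel \<Otimes>\<^sub>M lborel))"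
    by (subst emeasure_distr) auto
  also have "(\<lambda>(x, y). vector [x, y] :: real^2) -` box l u \<inter> space (lborel \<Otimes>\<^sub>M lborel)
     = box (l $ 1) (u $ 1) \<times> box (l $ 2) (u $ 2)"
    by (auto simp: mem_box_cart forall_2 space_pair_measure)
  also have "emeasure (lborel \<Otimes>\<^sub>M lborel) \<dots> = ennreal ((u $ 1 - l $ 1) * (u $ 2 - l $ 2))"
    using le[of 1] le[of 2] by (subst lborel.emeasure_pair_measure_Times) (auto simp: ennreal_mult)
  also have "(u $ 1 - l $ 1) * (u $ 2 - l $ 2) = (\<Prod>b\<in>Basis. (u - l) \<bullet> b)"
  proof -
    have "(\<Prod>b\<in>Basis. (u - l) \<bullet> b) = (\<Prod>i\<in>UNIV. (u - l) $ i)"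
      unfolding Basis_vec_def
      by (subst prod.reindex_bij_betw[of "\<lambda>i. axis i 1" UNIV, symmetric])
         (auto simp: bij_betw_def inj_on_def axis_eq_axis inner_axis)
    then show ?thesis by (simp add: UNIV_2)
  qed
  finally show "emeasure (distr (lborel \<Otimes>\<^sub>M lborel) borel (\<lambda>(x, y). vector [x, y] :: real^2)) (box l u)
    = (\<Prod>b\<in>Basis. (u - l) \<bullet> b)" by simp
qed simp

lemma nn_integral_lborel_vec2:
  fixes f :: "real^2 \<Rightarrow> ennreal"
  assumes [measurable]: "f \<in> borel_measurable borel"
  shows "(\<integral>\<^sup>+x. f x \<partial>lborel) = (\<integral>\<^sup>+x. \<integral>\<^sup>+y. f (vector [x, y]) \<partial>lborel \<partial>lborel)"
proof -
  have [measurable]: "(\<lambda>(x, y). vector [x, y] :: real^2) \<in> borel_measurable (lborel \<Otimes>\<^sub>M lborel)"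
    unfolding split_beta by measurable
  have "(\<integral>\<^sup>+x. f x \<partial>lborel) = (\<integral>\<^sup>+p. f (case p of (x, y) \<Rightarrow> vector [x, y]) \<partial>(lborel \<Otimes>\<^sub>M lborel))"
    by (subst lborel_vec2) (simp add: nn_integral_distr)
  also have "\<dots> = (\<integral>\<^sup>+x. \<integral>\<^sup>+y. f (vector [x, y]) \<partial>lborel \<partial>lborel)"
    by (subst lborel.nn_integral_fst[symmetric]) (auto simp: split_beta)
  finally show ?thesis .
qed

text \<open>Polar coordinates with the radius written as \<open>exp (- t)\<close>; in complex notation, \<open>exp (- t + \<i> \<theta>)\<close>.\<close>

definition logpolar :: "real \<Rightarrow> real \<Rightarrow> plane" where
  "logpolar t \<theta> = vector [exp (- t) * cos \<theta>, exp (- t) * sin \<theta>]"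

lemma logpolar_nth [simp]:
  "logpolar t \<theta> $ 1 = exp (- t) * cos \<theta>" "logpolar t \<theta> $ 2 = exp (- t) * sin \<theta>"
  by (simp_all add: logpolar_def)

lemma norm_vec2: "norm (x :: real^2) = sqrt ((x $ 1)\<^sup>2 + (x $ 2)\<^sup>2)"
  by (simp add: norm_vec_def L2_set_def UNIV_2)

lemma norm_logpolar [simp]: "norm (logpolar t \<theta>) = exp (- t)"
  by (simp add: norm_vec2 power_mult_distrib distrib_left[symmetric])

text \<open>Both angles 0 and \<open>2 * pi\<close> are excluded, so that the map is injective on an
  open set; the points of the disc that are missed lie on the axis \<open>x $ 2 = 0\<close>, a null
  set.\<close>

definition "logpolar_strip = {p :: real^2. 0 < p $ 1 \<and> 0 < p $ 2 \<and> p $ 2 < 2 * pi}"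

abbreviation "logpolar_map \<equiv> \<lambda>p :: real^2. logpolar (p $ 1) (p $ 2)"

lemma borel_measurable_vec_nth [measurable]: "(\<lambda>x :: real^2. x $ i) \<in> borel_measurable borel"
  by (intro borel_measurable_continuous_onI continuous_intros)

lemma borel_measurable_logpolar:
  "f \<in> borel_measurable M \<Longrightarrow> g \<in> borel_measurable M \<Longrightarrow> (\<lambda>p. logpolar (f p) (g p)) \<in> borel_measurable M"
  unfolding logpolar_def
  by (intro borel_measurable_vector2 borel_measurable_times borel_measurable_continuous_on[of exp] borel_measurable_uminus
      borel_measurable_continuous_on[of cos] borel_measurable_continuous_on[of sin] continuous_intros)

lemma inj_on_logpolar_map: "inj_on logpolar_map logpolar_strip"
proof (rule inj_onI)
  fix p q assume p: "p \<in> logpolar_strip" and q: "q \<in> logpolar_strip" and eq: "logpolar_map p = logpolar_map q"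
  have 1: "p $ 1 = q $ 1" using arg_cong[OF eq, of norm] by simp
  have "cos (p $ 2) = cos (q $ 2)" "sin (p $ 2) = sin (q $ 2)"
    using arg_cong[OF eq, of "\<lambda>x. x $ 1"] arg_cong[OF eq, of "\<lambda>x. x $ 2"] 1 by auto
  then have "cos (p $ 2 - q $ 2) = 1" by (simp add: cos_diff power2_eq_square[symmetric])
  then obtain n where n: "p $ 2 - q $ 2 = real_of_int n * (2 * pi)" by (auto simp: cos_one_2pi_int)
  have "\<bar>p $ 2 - q $ 2\<bar> < 2 * pi" using p q by (auto simp: logpolar_strip_def)
  then have "\<bar>real_of_int n\<bar> * (2 * pi) < 1 * (2 * pi)" unfolding n by (simp add: abs_mult)
  then have "\<bar>real_of_int n\<bar> < 1" by (subst (asm) mult_less_cancel_right) auto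
  then have "n = 0" by linarith
  then show "p = q" using n 1 by (simp add: vec_eq_iff forall_2)
qed

lemma logpolar_map_image:
  "B1 - {x. x $ 2 = 0} \<subseteq> logpolar_map ` logpolar_strip" "logpolar_map ` logpolar_strip \<subseteq> B1"
proof -
  show "logpolar_map ` logpolar_strip \<subseteq> B1" by (auto simp: logpolar_strip_def)
  show "B1 - {x. x $ 2 = 0} \<subseteq> logpolar_map ` logpolar_strip"
  proof
    fix x :: plane assume x: "x \<in> B1 - {x. x $ 2 = 0}"
    then have n: "0 < norm x" "norm x < 1" by auto
    have "(x $ 1 / norm x)\<^sup>2 + (x $ 2 / norm x)\<^sup>2 = 1"
      using n by (simp add: power_divide add_divide_distrib[symmetric]) (simp add: norm_vec2)
    then obtain \<theta> where \<theta>: "0 \<le> \<theta>" "\<theta> < 2 * pi" "x $ 1 / norm x = cos \<theta>" "x $ 2 / norm x = sin \<theta>"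
      by (rule sincos_total_2pi)
    have "\<theta> \<noteq> 0" using \<theta>(4) x n by auto
    then have "vector [- ln (norm x), \<theta>] \<in> logpolar_strip"
      using \<theta> n by (simp add: logpolar_strip_def ln_less_zero)
    moreover have "logpolar_map (vector [- ln (norm x), \<theta>]) = x"
      using n \<theta>(3,4)[symmetric] by (simp add: vec_eq_iff forall_2)
    ultimately show "x \<in> logpolar_map ` logpolar_strip" by (intro image_eqI[where x = "vector [- ln (norm x), \<theta>]"]) simp_all
  qed
qed

lemma has_derivative_logpolar_map:
  "(logpolar_map has_derivative (\<lambda>h. vector
     [- exp (- p $ 1) * cos (p $ 2) * h $ 1 - exp (- p $ 1) * sin (p $ 2) * h $ 2,
      - exp (- p $ 1) * sin (p $ 2) * h $ 1 + exp (- p $ 1) * cos (p $ 2) * h $ 2])) (at p within S)"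
  (is "(_ has_derivative ?D) _")
proof -
  have nth: "((\<lambda>p :: real^2. p $ i) has_derivative (\<lambda>h. h $ i)) (at p within S)" for i
    by (intro bounded_linear_imp_has_derivative bounded_linear_vec_nth)
  have "((\<lambda>p. logpolar_map p \<bullet> b) has_derivative (\<lambda>h. ?D h \<bullet> b)) (at p within S)" if "b \<in> Basis" for b
  proof -
    from \<open>b \<in> Basis\<close> obtain i where b: "b = axis i 1" by (auto simp: Basis_vec_def)
    have "i = 1 \<or> i = 2" by (rule exhaust_2)
    then show ?thesis
    proof
      assume i: "i = 1"
      show ?thesis unfolding b i
        by (auto simp: inner_axis algebra_simps fun_eq_iff intro!: derivative_eq_intros nth)
    next
      assume i: "i = 2"
      show ?thesis unfolding b i
        by (auto simp: inner_axis algebra_simps fun_eq_iff intro!: derivative_eq_intros nth)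
    qed
  qed
  then show ?thesis by (subst has_derivative_componentwise_within) blast
qed

text \<open>The sign is negative because a growing \<open>t\<close> shrinks the radius. The change
  of variables uses the absolute value, which combines the radius and the factor from its
  exponential form.\<close>

lemma det_logpolar_map:
  "det (matrix (\<lambda>h :: real^2. vector
     [- exp (- t) * cos \<theta> * h $ 1 - exp (- t) * sin \<theta> * h $ 2,
      - exp (- t) * sin \<theta> * h $ 1 + exp (- t) * cos \<theta> * h $ 2] :: real^2)) = - exp (- 2 * t)"
proof -
  have "- (exp (- t) * cos \<theta> * (exp (- t) * cos \<theta>)) - exp (- t) * sin \<theta> * (exp (- t) * sin \<theta>)
    = - (exp (-t) * exp (-t) * ((cos \<theta>)\<^sup>2 + (sin \<theta>)\<^sup>2))"
    by (simp only: power2_eq_square) algebra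
  also have "\<dots> = - exp (- 2 * t)" by (simp add: exp_add[symmetric])
  finally show ?thesis by (simp add: det_2 matrix_def axis_def)
qed

lemma measurable_logpolar_strip [measurable]: "logpolar_strip \<in> sets borel"
  unfolding logpolar_strip_def by measurable

lemma emeasure_logpolar:
  assumes [measurable]: "A \<in> sets borel"
  shows "emeasure lborel (A \<inter> B1) =
    (\<integral>\<^sup>+p. indicator (logpolar_strip \<inter> logpolar_map -` A) p * ennreal (exp (- 2 * p $ 1)) \<partial>lborel)"
proof -
  let ?S = "logpolar_strip \<inter> logpolar_map -` A"
  have m: "logpolar_map \<in> borel_measurable borel" by (intro borel_measurable_logpolar borel_measurable_vec_nth)
  have S: "?S \<in> sets borel" using measurable_sets[OF m assms] by (auto)
  have im: "logpolar_map ` ?S = A \<inter> logpolar_map ` logpolar_strip" by auto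
  have neg: "negligible {x :: plane. x $ 2 = 0}"
    using negligible_standard_hyperplane_cart by blast
  \<comment> \<open>The image of the strip differs from the disc only on the axis that was cut
    out.\<close>
  have nd: "negligible (sym_diff (A \<inter> B1) (logpolar_map ` ?S))"
    by (rule negligible_subset[OF neg]) (use logpolar_map_image in \<open>auto simp: im\<close>)
  have B: "A \<inter> B1 \<in> lmeasurable"
    by (intro bounded_set_imp_lmeasurable) (auto intro: bounded_subset[OF bounded_ball])
  have I: "logpolar_map ` ?S \<in> lmeasurable" "measure lebesgue (logpolar_map ` ?S) = measure lebesgue (A \<inter> B1)"
    using lmeasurable_negligible_symdiff[OF B nd] measure_negligible_symdiff[OF B nd] by auto
  have "((\<lambda>p. \<bar>det (matrix (\<lambda>h. vector
     [- exp (- p $ 1) * cos (p $ 2) * h $ 1 - exp (- p $ 1) * sin (p $ 2) * h $ 2,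
      - exp (- p $ 1) * sin (p $ 2) * h $ 1 + exp (- p $ 1) * cos (p $ 2) * h $ 2] :: real^2))\<bar>)
     has_integral measure lebesgue (A \<inter> B1)) ?S"
    by (rule has_measure_differentiable_image[THEN iffD1, OF _ has_derivative_logpolar_map])
       (use S I inj_on_logpolar_map in \<open>auto intro: inj_on_subset\<close>)
  then have "((\<lambda>p. exp (- 2 * p $ 1)) has_integral measure lebesgue (A \<inter> B1)) ?S"
    by (simp only: det_logpolar_map) simp
  then have "(\<integral>\<^sup>+p. ennreal (indicator ?S p * exp (- 2 * p $ 1)) \<partial>lborel) = ennreal (measure lebesgue (A \<inter> B1))"
    by (intro nn_integral_has_integral_lebesgue) auto
  also have "\<dots> = emeasure lborel (A \<inter> B1)"
    using emeasure_eq_ennreal_measure[OF fmeasurableD2[OF B]] by simp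
  finally show ?thesis by (simp add: ennreal_mult' ennreal_indicator)
qed

theorem nn_integral_logpolar:
  fixes f :: "plane \<Rightarrow> ennreal"
  assumes [measurable]: "f \<in> borel_measurable borel"
  shows "(\<integral>\<^sup>+x\<in>B1. f x \<partial>lborel) =
    (\<integral>\<^sup>+t\<in>{0<..}. (\<integral>\<^sup>+\<theta>\<in>{0<..<2*pi}. f (logpolar t \<theta>) \<partial>lborel) * ennreal (exp (- 2 * t)) \<partial>lborel)"
proof -
  define h :: "plane \<Rightarrow> ennreal" where "h p = indicator logpolar_strip p * ennreal (exp (- 2 * p $ 1))" for p
  have [measurable]: "h \<in> borel_measurable borel" unfolding h_def by measurable
  have m[measurable]: "logpolar_map \<in> borel_measurable borel" by (intro borel_measurable_logpolar borel_measurable_vec_nth)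
  \<comment> \<open>As an equality of measures the formula needs checking on Borel sets only, and
    there it is \<open>emeasure_logpolar\<close>.\<close>
  have eq: "density lborel (indicator B1) = distr (density lborel h) borel logpolar_map" (is "?L = ?R")
  proof (rule measure_eqI)
    fix A assume "A \<in> sets ?L"
    then have [measurable]: "A \<in> sets borel" by simp
    have B: "logpolar_map -` A \<in> sets borel"
      using measurable_sets[OF m \<open>A \<in> sets borel\<close>] by simp
    have "emeasure ?L A = (\<integral>\<^sup>+x. indicator B1 x * indicator A x \<partial>lborel)"
      by (rule emeasure_density) (simp_all only: borel_measurable_indicator sets_lborel \<open>A \<in> sets borel\<close> borel_open[OF open_ball])
    also have "\<dots> = (\<integral>\<^sup>+x. indicator (A \<inter> B1) x \<partial>lborel)"
      by (simp only: indicator_inter_arith mult.commute)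
    also have "\<dots> = emeasure lborel (A \<inter> B1)" by (rule nn_integral_indicator) simp
    also have "\<dots> = (\<integral>\<^sup>+p. h p * indicator (logpolar_map -` A) p \<partial>lborel)"
      unfolding emeasure_logpolar[OF \<open>A \<in> sets borel\<close>]
      by (intro nn_integral_cong) (simp only: h_def indicator_inter_arith mult_ac)
    also have "\<dots> = emeasure (density lborel h) (logpolar_map -` A)"
      using B by (intro emeasure_density[symmetric]) simp_all
    also have "\<dots> = emeasure ?R A"
      using m \<open>A \<in> sets borel\<close> emeasure_distr[of logpolar_map "density lborel h" borel A] by simp
    finally show "emeasure ?L A = emeasure ?R A" .
  qed simp
  have iB: "(indicator B1 :: plane \<Rightarrow> ennreal) \<in> borel_measurable lborel"
    by (intro borel_measurable_indicator) simp
  have fg: "(\<lambda>p. f (logpolar_map p)) \<in> borel_measurable lborel"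
    using measurable_compose[OF m assms] by simp
  have "(\<integral>\<^sup>+x\<in>B1. f x \<partial>lborel) = (\<integral>\<^sup>+x. f x \<partial>?L)"
    by (subst nn_integral_density[OF iB]) (simp_all add: mult.commute)
  also have "\<dots> = (\<integral>\<^sup>+p. h p * f (logpolar_map p) \<partial>lborel)"
    unfolding eq using m fg
    by (subst nn_integral_distr) (simp_all add: nn_integral_density)
  also have "\<dots> = (\<integral>\<^sup>+t. \<integral>\<^sup>+\<theta>. h (vector [t, \<theta>]) * f (logpolar t \<theta>) \<partial>lborel \<partial>lborel)"
    using fg by (subst nn_integral_lborel_vec2) simp_all
  also have "\<dots> = (\<integral>\<^sup>+t\<in>{0<..}. (\<integral>\<^sup>+\<theta>\<in>{0<..<2*pi}. f (logpolar t \<theta>) \<partial>lborel) * ennreal (exp (- 2 * t)) \<partial>lborel)"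
  proof (rule nn_integral_cong)
    fix t :: real
    have "(\<integral>\<^sup>+\<theta>. h (vector [t, \<theta>]) * f (logpolar t \<theta>) \<partial>lborel)
      = (\<integral>\<^sup>+\<theta>. (indicator {0<..} t * ennreal (exp (- 2 * t))) * (f (logpolar t \<theta>) * indicator {0<..<2*pi} \<theta>) \<partial>lborel)"
      by (intro nn_integral_cong) (auto simp: h_def logpolar_strip_def indicator_def)
    also have "\<dots> = (indicator {0<..} t * ennreal (exp (- 2 * t))) * (\<integral>\<^sup>+\<theta>\<in>{0<..<2*pi}. f (logpolar t \<theta>) \<partial>lborel)"
    proof (rule nn_integral_cmult)
      have "(\<lambda>\<theta>. f (logpolar t \<theta>)) \<in> borel_measurable borel"
        using measurable_compose[OF borel_measurable_logpolar[OF borel_measurable_const measurable_ident_sets[OF refl]] assms] by simp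
      then show "(\<lambda>\<theta>. f (logpolar t \<theta>) * indicator {0<..<2*pi} \<theta>) \<in> borel_measurable lborel" by simp
    qed
    finally show "(\<integral>\<^sup>+\<theta>. h (vector [t, \<theta>]) * f (logpolar t \<theta>) \<partial>lborel)
      = (\<integral>\<^sup>+\<theta>\<in>{0<..<2*pi}. f (logpolar t \<theta>) \<partial>lborel) * ennreal (exp (- 2 * t)) * indicator {0<..} t"
      by (simp add: mult_ac)
  qed
  finally show ?thesis .
qed

section \<open>Smooth functions with compact support\<close>

text \<open>For \<open>k = 0\<close> this is the classical smooth function that is flat at 0. The
  powers in the denominator close the family under differentiation: the derivative is a combination
  of members with indices \<open>k + 1\<close> and \<open>k + 2\<close>.\<close>

definition bump :: "nat \<Rightarrow> real \<Rightarrow> real" where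
  "bump k t = (if t > 0 then exp (- 1 / t) / t ^ k else 0)"

lemma bump_tendsto_0: "(bump k \<longlongrightarrow> 0) (at_right 0)"
proof -
  have "((\<lambda>x :: real. x ^ k / exp x) \<longlongrightarrow> 0) at_top" by (rule tendsto_power_div_exp_0)
  then have "((\<lambda>t :: real. (inverse t) ^ k / exp (inverse t)) \<longlongrightarrow> 0) (at_right 0)"
    by (rule filterlim_compose[OF _ filterlim_inverse_at_top_right])
  then show ?thesis
    by (rule Lim_transform_eventually)
       (auto simp: eventually_at_filter bump_def exp_minus field_simps intro!: always_eventually)
qed

lemma bump_has_derivative: "(bump k has_real_derivative bump (k + 2) t - real k * bump (k + 1) t) (at t)"
proof -
  consider "t > 0" | "t < 0" | "t = 0" by linarith
  then show ?thesis
  proof cases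
    case 1
    have "((\<lambda>t. exp (- 1 / t) / t ^ k) has_real_derivative
      (exp (- 1 / t) * (1 / t\<^sup>2) * t ^ k - exp (- 1 / t) * (real k * t ^ (k - 1))) / (t ^ k * t ^ k)) (at t)"
      using 1 by (auto intro!: derivative_eq_intros simp: power2_eq_square)
    moreover have "(exp (- 1 / t) * (1 / t\<^sup>2) * t ^ k - exp (- 1 / t) * (real k * t ^ (k - 1))) / (t ^ k * t ^ k)
      = bump (k + 2) t - real k * bump (k + 1) t"
    proof (cases k)
      case 0
      then show ?thesis using 1 by (simp add: bump_def power2_eq_square)
    next
      case (Suc m)
      then show ?thesis using 1
        by (simp add: bump_def power2_eq_square field_simps)
    qed
    ultimately show ?thesis
      using 1 by (auto intro: DERIV_cong_ev[THEN iffD1, rotated 3]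
        has_field_derivative_transform_within_open[of _ _ _ "{0<..}"] simp: bump_def)
  next
    case 2
    have "((\<lambda>t. 0) has_real_derivative 0) (at t)" by simp
    then have "(bump k has_real_derivative 0) (at t)"
      by (rule has_field_derivative_transform_within_open[of _ _ _ "{..<0}"]) (use 2 in \<open>auto simp: bump_def\<close>)
    then show ?thesis using 2 by (simp add: bump_def)
  next
    case 3
    have "((\<lambda>h. (bump k h - bump k 0) / h) \<longlongrightarrow> 0) (at_left 0)"
      by (rule tendsto_eventually) (auto simp: eventually_at_filter bump_def)
    \<comment> \<open>On the right of 0 the difference quotient at 0 is itself a member of the
      family, the one with index \<open>Suc k\<close>.\<close>
    moreover have "((\<lambda>h. (bump k h - bump k 0) / h) \<longlongrightarrow> 0) (at_right 0)"
      by (rule Lim_transform_eventually[OF bump_tendsto_0[of "Suc k"]])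
         (auto simp: eventually_at_filter bump_def)
    ultimately have "((\<lambda>h. (bump k h - bump k 0) / h) \<longlongrightarrow> 0) (at 0)"
      by (rule filterlim_split_at)
    then show ?thesis using 3 by (simp add: has_field_derivative_iff bump_def)
  qed
qed

lemma bump_nonneg: "0 \<le> bump k t" by (simp add: bump_def)
lemma bump_0_le_1: "bump 0 t \<le> 1" by (simp add: bump_def)

text \<open>A class of functions which is closed under partial differentiation by construction, so that
  smoothness of its members needs no computation of derivatives.\<close>

inductive elem_smooth :: "plane set \<Rightarrow> (plane \<Rightarrow> real) \<Rightarrow> bool" for S where
  const: "elem_smooth S (\<lambda>x. c)"
| coord: "elem_smooth S (\<lambda>x. x $ i)"
| add: "elem_smooth S f \<Longrightarrow> elem_smooth S g \<Longrightarrow> elem_smooth S (\<lambda>x. f x + g x)"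
| mult: "elem_smooth S f \<Longrightarrow> elem_smooth S g \<Longrightarrow> elem_smooth S (\<lambda>x. f x * g x)"
| bump: "elem_smooth S f \<Longrightarrow> elem_smooth S (\<lambda>x. bump k (f x))"
| exp: "elem_smooth S f \<Longrightarrow> elem_smooth S (\<lambda>x. exp (f x))"
| inverse: "elem_smooth S f \<Longrightarrow> (\<And>x. x \<in> S \<Longrightarrow> f x \<noteq> 0) \<Longrightarrow> elem_smooth S (\<lambda>x. inverse (f x))"
| ln: "elem_smooth S f \<Longrightarrow> (\<And>x. x \<in> S \<Longrightarrow> f x > 0) \<Longrightarrow> elem_smooth S (\<lambda>x. ln (f x))"

lemma elem_smooth_diff:
  assumes "elem_smooth S f" "elem_smooth S g" shows "elem_smooth S (\<lambda>x. f x - g x)"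
  using elem_smooth.add[OF assms(1) elem_smooth.mult[OF elem_smooth.const[of S "-1"] assms(2)]] by simp

lemma elem_smooth_deriv:
  assumes "elem_smooth S f"
  shows "\<exists>D. (\<forall>x\<in>S. (f has_derivative (\<lambda>h. \<Sum>i\<in>UNIV. D i x * h $ i)) (at x)) \<and> (\<forall>i. elem_smooth S (D i))"
proof -
  \<comment> \<open>All outer functions of one variable are treated alike: the chain rule multiplies
    the partial derivatives of the inner function by a factor that lies in the class again.\<close>
  have chain: "\<exists>D. (\<forall>x\<in>S. ((\<lambda>x. F (f x)) has_derivative (\<lambda>h. \<Sum>i\<in>UNIV. D i x * h $ i)) (at x)) \<and> (\<forall>i. elem_smooth S (D i))"
    if D: "\<forall>x\<in>S. (f has_derivative (\<lambda>h. \<Sum>i\<in>UNIV. D i x * h $ i)) (at x)" "\<forall>i. elem_smooth S (D i)"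
      and F: "\<And>x. x \<in> S \<Longrightarrow> (F has_real_derivative F' x) (at (f x))" "elem_smooth S F'"
    for D :: "2 \<Rightarrow> plane \<Rightarrow> real" and f F F'
  proof (intro exI conjI ballI allI)
    fix x assume x: "x \<in> S"
    have "((\<lambda>x. F (f x)) has_derivative (\<lambda>h. (\<Sum>i\<in>UNIV. D i x * h $ i) * F' x)) (at x)"
      using has_derivative_compose[OF D(1)[rule_format, OF x] F(1)[OF x, unfolded has_field_derivative_def]]
      by (simp add: mult.commute)
    then show "((\<lambda>x. F (f x)) has_derivative (\<lambda>h. \<Sum>i\<in>UNIV. (F' x * D i x) * h $ i)) (at x)"
      by (simp add: sum_distrib_left sum_distrib_right mult_ac)
  next
    fix i show "elem_smooth S (\<lambda>x. F' x * D i x)" using D F by (intro elem_smooth.mult) auto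
  qed
  show ?thesis using assms
  proof induction
    case (const c)
    show ?case by (intro exI[of _ "\<lambda>i x. 0"]) (auto intro: elem_smooth.const)
  next
    case (coord i)
    have "((\<lambda>x :: plane. x $ i) has_derivative (\<lambda>h. h $ i)) (at x)" for x
      by (intro bounded_linear_imp_has_derivative bounded_linear_vec_nth)
    then show ?case
      by (intro exI[of _ "\<lambda>j x. if j = i then 1 else 0"])
         (auto simp: if_distrib[of "\<lambda>c. c * _"] cong: if_cong intro: elem_smooth.const)
  next
    case (add f g)
    then obtain D E where "\<forall>x\<in>S. (f has_derivative (\<lambda>h. \<Sum>i\<in>UNIV. D i x * h $ i)) (at x)" "\<forall>i. elem_smooth S (D i)"
      "\<forall>x\<in>S. (g has_derivative (\<lambda>h. \<Sum>i\<in>UNIV. E i x * h $ i)) (at x)" "\<forall>i. elem_smooth S (E i)" by blast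
    then show ?case
      by (intro exI[of _ "\<lambda>i x. D i x + E i x"])
         (auto simp: distrib_right sum.distrib intro: elem_smooth.intros has_derivative_add)
  next
    case (mult f g)
    then obtain D E where DE: "\<And>x. x\<in>S \<Longrightarrow> (f has_derivative (\<lambda>h. \<Sum>i\<in>UNIV. D i x * h $ i)) (at x)" "\<forall>i. elem_smooth S (D i)"
      "\<And>x. x\<in>S \<Longrightarrow> (g has_derivative (\<lambda>h. \<Sum>i\<in>UNIV. E i x * h $ i)) (at x)" "\<forall>i. elem_smooth S (E i)" by blast
    show ?case
    proof (intro exI[of _ "\<lambda>i x. f x * E i x + D i x * g x"] conjI ballI allI)
      fix x assume x: "x \<in> S"
      show "((\<lambda>x. f x * g x) has_derivative (\<lambda>h. \<Sum>i\<in>UNIV. (f x * E i x + D i x * g x) * h $ i)) (at x)"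
        by (rule has_derivative_eq_rhs[OF has_derivative_mult[OF DE(1)[OF x] DE(3)[OF x]]])
           (simp add: fun_eq_iff sum_distrib_left sum_distrib_right sum.distrib[symmetric] algebra_simps)
    next
      fix i show "elem_smooth S (\<lambda>x. f x * E i x + D i x * g x)"
        using DE mult by (intro elem_smooth.add elem_smooth.mult) auto
    qed
  next
    case (bump f k)
    then obtain D where "\<forall>x\<in>S. (f has_derivative (\<lambda>h. \<Sum>i\<in>UNIV. D i x * h $ i)) (at x)" "\<forall>i. elem_smooth S (D i)" by blast
    then show ?case
      by (rule chain[where F'="\<lambda>x. bump (k + 2) (f x) - real k * bump (k + 1) (f x)"])
         (rule bump_has_derivative, intro elem_smooth_diff elem_smooth.intros bump)
  next
    case (exp f)
    then obtain D where "\<forall>x\<in>S. (f has_derivative (\<lambda>h. \<Sum>i\<in>UNIV. D i x * h $ i)) (at x)" "\<forall>i. elem_smooth S (D i)" by blast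
    then show ?case
      by (rule chain[where F'="\<lambda>x. exp (f x)"]) (auto intro!: elem_smooth.intros exp)
  next
    case (inverse f)
    then obtain D where "\<forall>x\<in>S. (f has_derivative (\<lambda>h. \<Sum>i\<in>UNIV. D i x * h $ i)) (at x)" "\<forall>i. elem_smooth S (D i)" by blast
    then show ?case
    proof (rule chain[where F'="\<lambda>x. (-1) * (inverse (f x) * inverse (f x))"])
      show "(inverse has_real_derivative (-1) * (inverse (f x) * inverse (f x))) (at (f x))" if "x \<in> S" for x
        using DERIV_inverse[OF inverse(2)[OF that]] by (simp add: power2_eq_square)
      show "elem_smooth S (\<lambda>x. (-1) * (inverse (f x) * inverse (f x)))"
        by (intro elem_smooth.mult elem_smooth.const elem_smooth.inverse inverse)
    qed
  next
    case (ln f)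
    then obtain D where "\<forall>x\<in>S. (f has_derivative (\<lambda>h. \<Sum>i\<in>UNIV. D i x * h $ i)) (at x)" "\<forall>i. elem_smooth S (D i)" by blast
    then show ?case
    proof (rule chain[where F'="\<lambda>x. inverse (f x)"])
      show "(ln has_real_derivative inverse (f x)) (at (f x))" if "x \<in> S" for x
        using ln(2)[OF that] by (auto intro!: derivative_eq_intros simp: inverse_eq_divide)
      show "elem_smooth S (\<lambda>x. inverse (f x))"
        by (rule elem_smooth.inverse[OF ln(1)]) (metis ln(2) less_irrefl)
    qed
  qed
qed

lemma sum_mult_axis: "(\<Sum>i\<in>UNIV. D i * (axis j 1 :: real^2) $ i) = D j"
  by (simp add: axis_def if_distrib cong: if_cong)

lemma pderiv_at_eq:
  assumes "(f has_derivative F) (at x)" shows "pderiv_at i f x = F (axis i 1)"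
  using frechet_derivative_at[OF assms] by (simp add: pderiv_at_def)

text \<open>The open sets \<open>S\<close> and the complement of \<open>K\<close> cover the plane.
  On the first \<open>U\<close> is an elementary expression, on the second it is 0, and this
  description passes to every partial derivative. So expressions such as \<open>ln (norm x)\<close>,
  singular outside \<open>S\<close>, can be used once a cutoff has made the function vanish
  there.\<close>

lemma smooth_elem_smooth:
  assumes S: "open S" and K: "closed K" "K \<subseteq> S" and f: "elem_smooth S f"
    and U: "\<And>x. x \<in> S \<Longrightarrow> U x = f x" "\<And>x. x \<notin> K \<Longrightarrow> U x = 0"
  shows "smooth U"
proof -
  define P where "P U \<longleftrightarrow> (\<exists>f. elem_smooth S f \<and> (\<forall>x\<in>S. U x = f x) \<and> (\<forall>x. x \<notin> K \<longrightarrow> U x = 0))" for U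
  have step: "(\<forall>x. U differentiable (at x)) \<and> P (pderiv_at i U)" if PU: "P U" for U i
  proof -
    obtain f where f: "elem_smooth S f" "\<And>x. x \<in> S \<Longrightarrow> U x = f x" and 0: "\<And>x. x \<notin> K \<Longrightarrow> U x = 0"
      using PU unfolding P_def by blast
    obtain D where D: "\<And>x. x\<in>S \<Longrightarrow> (f has_derivative (\<lambda>h. \<Sum>i\<in>UNIV. D i x * h $ i)) (at x)" "\<forall>i. elem_smooth S (D i)"
      using elem_smooth_deriv[OF f(1)] by blast
    have 1: "(U has_derivative (\<lambda>h. \<Sum>i\<in>UNIV. D i x * h $ i)) (at x)" if "x \<in> S" for x
      by (rule has_derivative_transform_within_open[OF D(1)[OF that] S that]) (simp add: f)
    have 2: "(U has_derivative (\<lambda>h. 0)) (at x)" if "x \<notin> K" for x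
      by (rule has_derivative_transform_within_open[OF has_derivative_const, of "-K"]) (use that 0 K in auto)
    have "P (pderiv_at i U)" unfolding P_def
    proof (intro exI[of _ "D i"] conjI ballI allI impI)
      show "pderiv_at i U x = D i x" if "x \<in> S" for x
        using pderiv_at_eq[OF 1[OF that]] by (simp add: sum_mult_axis)
      show "pderiv_at i U x = 0" if "x \<notin> K" for x using pderiv_at_eq[OF 2[OF that]] by simp
    qed (use D in auto)
    moreover have "U differentiable (at x)" for x
      using 1[of x] 2[of x] K by (cases "x \<in> S") (auto simp: differentiable_def)
    ultimately show ?thesis by blast
  qed
  have "P U" unfolding P_def using f U by blast
  then have "P (foldr pderiv_at is U)" for "is" by (induction "is") (use step in auto)
  then show ?thesis using step unfolding smooth_def by blast
qed

section \<open>Gradients, C1 functions of compact support and integration by parts\<close>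

lemma grad_has_derivative:
  assumes "f differentiable (at x)" shows "(f has_derivative (\<lambda>h. grad f x \<bullet> h)) (at x)"
proof -
  have D: "(f has_derivative frechet_derivative f (at x)) (at x)"
    using assms by (simp add: frechet_derivative_works)
  have "frechet_derivative f (at x) h = grad f x \<bullet> h" for h
  proof -
    have "h = (\<Sum>i\<in>UNIV. h $ i *\<^sub>R axis i 1)"
      by (simp add: vec_eq_iff axis_def if_distrib cong: if_cong)
    then have "frechet_derivative f (at x) h = frechet_derivative f (at x) (\<Sum>i\<in>UNIV. h $ i *\<^sub>R axis i 1)"
      by (rule arg_cong)
    also have "\<dots> = (\<Sum>i\<in>UNIV. h $ i * frechet_derivative f (at x) (axis i 1))"
      by (simp only: linear_sum[OF has_derivative_linear[OF D]] linear_scale[OF has_derivative_linear[OF D]] real_scaleR_def)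
    finally have "frechet_derivative f (at x) h = (\<Sum>i\<in>UNIV. h $ i * frechet_derivative f (at x) (axis i 1))" .
    then show ?thesis by (simp add: grad_def pderiv_at_def inner_vec_def mult.commute)
  qed
  then have "frechet_derivative f (at x) = (\<lambda>h. grad f x \<bullet> h)" by (rule ext)
  with D show ?thesis by simp
qed

lemma grad_eq:
  assumes "(f has_derivative (\<lambda>h. g \<bullet> h)) (at x)" shows "grad f x = g"
  by (simp add: vec_eq_iff grad_def pderiv_at_eq[OF assms] inner_axis)

text \<open>The gradient is carried along as an argument, so that estimates apply to differences and
  multiples without computing a \<open>grad\<close> again. One derivative is all that the energy
  estimates use.\<close>

definition C1c :: "plane set \<Rightarrow> (plane \<Rightarrow> real) \<Rightarrow> (plane \<Rightarrow> plane) \<Rightarrow> bool" where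
  "C1c \<Omega> f g \<longleftrightarrow> (\<forall>x. (f has_derivative (\<lambda>h. g x \<bullet> h)) (at x)) \<and> continuous_on UNIV g \<and>
     (\<exists>K. compact K \<and> K \<subseteq> \<Omega> \<and> (\<forall>x. x \<notin> K \<longrightarrow> f x = 0))"

lemma C1c_derivative: "C1c \<Omega> f g \<Longrightarrow> (f has_derivative (\<lambda>h. g x \<bullet> h)) (at x within S)"
  unfolding C1c_def using has_derivative_at_withinI by blast

lemma C1c_continuous: "C1c \<Omega> f g \<Longrightarrow> continuous_on S f" "C1c \<Omega> f g \<Longrightarrow> continuous_on S g"
proof -
  assume "C1c \<Omega> f g"
  then show "continuous_on S f"
    using has_derivative_continuous_on[of S f "\<lambda>x h. g x \<bullet> h"] C1c_derivative by blast
qed (auto simp: C1c_def intro: continuous_on_subset)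

lemma C1c_support:
  assumes "C1c \<Omega> f g"
  obtains K where "compact K" "K \<subseteq> \<Omega>" "\<And>x. x \<notin> K \<Longrightarrow> f x = 0" "\<And>x. x \<notin> K \<Longrightarrow> g x = 0"
proof -
  obtain K where K: "compact K" "K \<subseteq> \<Omega>" "\<And>x. x \<notin> K \<Longrightarrow> f x = 0"
    using assms unfolding C1c_def by blast
  have "g x = 0" if "x \<notin> K" for x
  proof -
    have "(f has_derivative (\<lambda>h. 0 \<bullet> h)) (at x)"
      by (rule has_derivative_transform_within_open[of "\<lambda>x. 0" _ _ _ "-K"])
         (use that K in \<open>auto intro: compact_imp_closed\<close>)
    then have "(\<lambda>h. g x \<bullet> h) = (\<lambda>h. 0 \<bullet> h)"
      using C1c_derivative[OF assms] by (rule has_derivative_unique[rotated])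
    then show ?thesis by (metis inner_eq_zero_iff inner_zero_left)
  qed
  with K that show ?thesis by blast
qed

lemma C1c_mono: "C1c \<Omega> f g \<Longrightarrow> \<Omega> \<subseteq> \<Omega>' \<Longrightarrow> C1c \<Omega>' f g"
  unfolding C1c_def by blast

lemma C1c_diff:
  assumes "C1c \<Omega> f g" "C1c \<Omega> f' g'" shows "C1c \<Omega> (\<lambda>x. f x - f' x) (\<lambda>x. g x - g' x)"
proof -
  obtain K where K: "compact K" "K \<subseteq> \<Omega>" "\<And>x. x \<notin> K \<Longrightarrow> f x = 0" by (rule C1c_support[OF assms(1)]) blast
  obtain K' where K': "compact K'" "K' \<subseteq> \<Omega>" "\<And>x. x \<notin> K' \<Longrightarrow> f' x = 0" by (rule C1c_support[OF assms(2)]) blast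
  show ?thesis unfolding C1c_def
  proof (intro conjI allI exI[of _ "K \<union> K'"])
    fix x show "((\<lambda>x. f x - f' x) has_derivative (\<lambda>h. (g x - g' x) \<bullet> h)) (at x)"
      using has_derivative_diff[OF C1c_derivative[OF assms(1)] C1c_derivative[OF assms(2)]]
      by (simp add: inner_diff_left)
  qed (use K K' C1c_continuous[OF assms(1)] C1c_continuous[OF assms(2)] in \<open>auto intro: continuous_intros compact_Un\<close>)
qed

lemma C1c_cmult:
  assumes "C1c \<Omega> f g" shows "C1c \<Omega> (\<lambda>x. c * f x) (\<lambda>x. c *\<^sub>R g x)"
proof -
  obtain K where K: "compact K" "K \<subseteq> \<Omega>" "\<And>x. x \<notin> K \<Longrightarrow> f x = 0" by (rule C1c_support[OF assms]) blast
  show ?thesis unfolding C1c_def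
  proof (intro conjI allI exI[of _ K])
    fix x show "((\<lambda>x. c * f x) has_derivative (\<lambda>h. (c *\<^sub>R g x) \<bullet> h)) (at x)"
      using has_derivative_mult_right[OF C1c_derivative[OF assms]] by simp
  qed (use K C1c_continuous[OF assms] in \<open>auto intro: continuous_intros\<close>)
qed

lemma smooth_grad:
  assumes "smooth f"
  shows "(f has_derivative (\<lambda>h. grad f x \<bullet> h)) (at x)" "continuous_on S (grad f)"
proof -
  have d: "foldr pderiv_at is f differentiable (at x)" for "is" x using assms unfolding smooth_def by blast
  show "(f has_derivative (\<lambda>h. grad f x \<bullet> h)) (at x)"
    using d[of "[]"] by (intro grad_has_derivative) simp
  have "isCont (pderiv_at i f) x" for i x
    using differentiable_imp_continuous_within[OF d[of "[i]"]] by simp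
  then show "continuous_on S (grad f)" unfolding grad_def
    by (intro continuous_on_vec_lambda continuous_at_imp_continuous_on) auto
qed

lemma C1c_Cc_infty: "\<phi> \<in> Cc_infty \<Omega> \<Longrightarrow> C1c \<Omega> \<phi> (grad \<phi>)"
  unfolding C1c_def Cc_infty_def using smooth_grad closure_subset[of "{x. \<phi> x \<noteq> 0}"]
  by (auto intro!: exI[of _ "closure {x. \<phi> x \<noteq> 0}"])

lemma integrable_continuous_compact_support:
  fixes h :: "'a::euclidean_space \<Rightarrow> 'b::{banach, second_countable_topology}"
  assumes "continuous_on UNIV h" "compact K" "\<And>x. x \<notin> K \<Longrightarrow> h x = 0"
  shows "integrable lborel h"
proof -
  have "integrable lborel (\<lambda>x. indicator K x *\<^sub>R h x)"
    by (rule borel_integrable_compact) (use assms in \<open>auto intro: continuous_on_subset\<close>)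
  also have "(\<lambda>x. indicator K x *\<^sub>R h x) = h" using assms(3) by (auto simp: indicator_def fun_eq_iff)
  finally show ?thesis .
qed

lemma continuous_compact_support_bounded:
  fixes h :: "'a::euclidean_space \<Rightarrow> 'b::real_normed_vector"
  assumes "continuous_on UNIV h" "compact K" "\<And>x. x \<notin> K \<Longrightarrow> h x = 0"
  obtains B where "B > 0" "\<And>x. norm (h x) \<le> B"
proof -
  have "bounded (h ` K)"
    by (intro compact_imp_bounded compact_continuous_image) (use assms in \<open>auto intro: continuous_on_subset\<close>)
  then obtain B where "B > 0" "\<And>x. x \<in> K \<Longrightarrow> norm (h x) \<le> B" by (auto simp: bounded_pos)
  then show ?thesis using that[of B] assms(3) by (metis norm_zero less_imp_le)
qed

lemma C1c_bounded:
  assumes "C1c \<Omega> f g"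
  obtains B where "B > 0" "\<And>x. \<bar>f x\<bar> \<le> B" "\<And>x. norm (g x) \<le> B"
proof -
  obtain K where K: "compact K" "K \<subseteq> \<Omega>" "\<And>x. x \<notin> K \<Longrightarrow> f x = 0" "\<And>x. x \<notin> K \<Longrightarrow> g x = 0"
    by (rule C1c_support[OF assms]) blast
  obtain b1 where b1: "b1 > 0" "\<And>x. norm (f x) \<le> b1"
    using continuous_compact_support_bounded[OF C1c_continuous(1)[OF assms] K(1,3)] by blast
  obtain b2 where b2: "b2 > 0" "\<And>x. norm (g x) \<le> b2"
    using continuous_compact_support_bounded[OF C1c_continuous(2)[OF assms] K(1,4)] by blast
  show ?thesis using that[of "max b1 b2"] b1 b2 by (auto simp: le_max_iff_disj)
qed

lemma C1c_lipschitz: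
  assumes "C1c \<Omega> f g" and B: "\<And>x. norm (g x) \<le> B"
  shows "\<bar>f x - f y\<bar> \<le> B * norm (x - y)"
proof -
  have "norm (f x - f y) \<le> B * norm (x - y)"
  proof (rule differentiable_bound[of UNIV])
    show "(f has_derivative (\<lambda>h. g x \<bullet> h)) (at x within UNIV)" for x by (rule C1c_derivative[OF assms(1)])
    show "onorm (\<lambda>h. g x \<bullet> h) \<le> B" for x
      using B[of x] by (intro onorm_le) (metis Cauchy_Schwarz_ineq2 mult_right_mono norm_ge_zero order_trans real_norm_def)
  qed auto
  then show ?thesis by simp
qed

lemma nn_integral_translate:
  fixes f :: "'a::euclidean_space \<Rightarrow> ennreal"
  assumes [measurable]: "f \<in> borel_measurable borel"
  shows "(\<integral>\<^sup>+x. f (x + a) \<partial>lborel) = (\<integral>\<^sup>+x. f x \<partial>lborel)"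
  by (subst (2) lborel_distr_plus[of a, symmetric]) (simp add: nn_integral_distr add.commute)

lemma integral_translate:
  fixes f :: "plane \<Rightarrow> real"
  assumes "integrable lborel f"
  shows "integrable lborel (\<lambda>x. f (x + a))" "(\<integral>x. f (x + a) \<partial>lborel) = (\<integral>x. f x \<partial>lborel)"
proof -
  have [measurable]: "f \<in> borel_measurable borel" using assms by simp
  have 1: "integrable (distr lborel borel ((+) a)) f" using assms by (simp add: lborel_distr_plus)
  then show "integrable lborel (\<lambda>x. f (x + a))"
    by (subst (asm) integrable_distr_eq) (auto simp: add.commute)
  have "(\<integral>x. f (x + a) \<partial>lborel) = (\<integral>x. f x \<partial>distr lborel borel ((+) a))"
    by (subst integral_distr) (auto simp: add.commute)
  then show "(\<integral>x. f (x + a) \<partial>lborel) = (\<integral>x. f x \<partial>lborel)" by (simp add: lborel_distr_plus)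
qed

text \<open>By translation invariance every difference quotient of \<open>f\<close> has integral 0,
  and the quotients converge to the partial derivative with a common integrable bound.\<close>

lemma integral_grad_zero:
  assumes fg: "C1c UNIV f g"
  shows "(\<integral>x. g x $ i \<partial>lborel) = 0"
proof -
  obtain K where K: "compact K" "\<And>x. x \<notin> K \<Longrightarrow> f x = 0" by (rule C1c_support[OF fg]) blast
  obtain B where B: "B > 0" "\<And>x. norm (g x) \<le> B" by (rule C1c_bounded[OF fg]) blast
  obtain R where R: "\<And>x. x \<in> K \<Longrightarrow> norm x \<le> R" using compact_imp_bounded[OF K(1)] by (auto simp: bounded_iff)
  define e :: plane where "e = axis i 1"
  have ne: "norm e = 1" by (simp add: e_def norm_axis_1)
  have int: "integrable lborel f"
    using integrable_continuous_compact_support[OF C1c_continuous(1)[OF fg] K] .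
  define h where "h n = inverse (real (Suc n))" for n
  have h: "0 < h n" "h n \<le> 1" for n by (auto simp: h_def inverse_le_1_iff)
  define q where "q n x = (f (x + h n *\<^sub>R e) - f x) / h n" for n x
  have q0: "(\<integral>x. q n x \<partial>lborel) = 0" for n
    unfolding q_def using integral_translate[OF int, of "h n *\<^sub>R e"] int by simp
  have "(\<lambda>n. \<integral>x. q n x \<partial>lborel) \<longlonglongrightarrow> (\<integral>x. g x $ i \<partial>lborel)"
  \<comment> \<open>The Lipschitz constant bounds the quotients. As the steps \<open>h n\<close> are
    at most 1, they all vanish outside the ball of radius \<open>R + 1\<close>.\<close>
  proof (rule integral_dominated_convergence[where w="\<lambda>x. B * indicator (cball 0 (R + 1)) x"])
    have [measurable]: "f \<in> borel_measurable borel" using int by simp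
    show "q n \<in> borel_measurable lborel" for n unfolding q_def by measurable
    have "continuous_on UNIV (\<lambda>x. g x $ i)" using C1c_continuous(2)[OF fg] by (intro continuous_intros)
    then show "(\<lambda>x. g x $ i) \<in> borel_measurable lborel" using borel_measurable_continuous_onI by simp
    show "integrable lborel (\<lambda>x :: plane. B * indicator (cball 0 (R + 1)) x)"
      using emeasure_lborel_cball_finite[of "0 :: plane" "R + 1"] by auto
    show "AE x in lborel. (\<lambda>n. q n x) \<longlonglongrightarrow> g x $ i"
    proof (rule AE_I2)
      fix x
      have d: "((\<lambda>s. f (x + s *\<^sub>R e)) has_real_derivative (g x \<bullet> e)) (at 0)"
      proof -
        have 1: "((\<lambda>s. x + s *\<^sub>R e) has_derivative (\<lambda>s. s *\<^sub>R e)) (at 0)" by (auto intro!: derivative_eq_intros)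
        have "((\<lambda>s. f (x + s *\<^sub>R e)) has_derivative (\<lambda>s. g x \<bullet> (s *\<^sub>R e))) (at 0)"
          using has_derivative_compose[OF 1, of f "\<lambda>h. g x \<bullet> h"] C1c_derivative[OF fg, of x UNIV] by simp
        then show ?thesis by (simp add: has_field_derivative_def mult.commute[of "g x \<bullet> e"] mult_commute_abs)
      qed
      have "h \<longlonglongrightarrow> 0" unfolding h_def by (rule LIMSEQ_inverse_real_of_nat)
      then have "filterlim h (at 0) sequentially" unfolding filterlim_at
        using h(1) by (auto intro!: always_eventually simp: dual_order.strict_implies_not_eq)
      then have "(\<lambda>n. (f (x + h n *\<^sub>R e) - f (x + 0 *\<^sub>R e)) / (h n - 0)) \<longlonglongrightarrow> g x \<bullet> e"
        using d unfolding has_field_derivative_iff by (rule filterlim_compose[rotated])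
      then show "(\<lambda>n. q n x) \<longlonglongrightarrow> g x $ i" by (simp add: q_def e_def inner_axis)
    qed
    show "AE x in lborel. norm (q n x) \<le> B * indicator (cball 0 (R + 1)) x" for n
    proof (rule AE_I2)
      fix x
      have "\<bar>f (x + h n *\<^sub>R e) - f x\<bar> \<le> B * h n"
        using C1c_lipschitz[OF fg B(2), of "x + h n *\<^sub>R e" x] h[of n] ne by simp
      then have b: "\<bar>q n x\<bar> \<le> B" using h[of n] by (simp add: q_def field_simps)
      show "norm (q n x) \<le> B * indicator (cball 0 (R + 1)) x"
      proof (cases "norm x \<le> R + 1")
        case False
        have "norm x \<le> norm (x + h n *\<^sub>R e) + norm (h n *\<^sub>R e)" using norm_triangle_ineq4[of "x + h n *\<^sub>R e" "h n *\<^sub>R e"] by simp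
        then have "norm (x + h n *\<^sub>R e) > R" "norm x > R" using False h[of n] ne by auto
        then have "f (x + h n *\<^sub>R e) = 0" "f x = 0" using R K(2) by (force simp: not_le[symmetric])+
        then show ?thesis using B by (simp add: q_def)
      qed (use b in simp)
    qed
  qed
  then have "(\<lambda>n :: nat. 0 :: real) \<longlonglongrightarrow> (\<integral>x. g x $ i \<partial>lborel)" by (simp only: q0)
  from LIMSEQ_unique[OF this tendsto_const] show ?thesis by simp
qed

text \<open>The product of \<open>f\<close> and \<psi> inherits the compact support of
  \<open>f\<close>, so \<open>integral_grad_zero\<close> applies to it and the product rule gives
  the formula.\<close>

lemma integration_by_parts:
  assumes fg: "C1c \<Omega> f g" and \<psi>: "\<And>x. (\<psi> has_derivative (\<lambda>h. \<psi>' x \<bullet> h)) (at x)" "continuous_on UNIV \<psi>'"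
  shows "(\<integral>x. f x * \<psi>' x $ i \<partial>lborel) = - (\<integral>x. g x $ i * \<psi> x \<partial>lborel)"
    "integrable lborel (\<lambda>x. f x * \<psi>' x $ i)" "integrable lborel (\<lambda>x. g x $ i * \<psi> x)"
proof -
  have c\<psi>: "continuous_on UNIV \<psi>" 
    by (rule has_derivative_continuous_on[of _ _ "\<lambda>x h. \<psi>' x \<bullet> h"]) (simp add: \<psi>(1))
  obtain K where K: "compact K" "\<And>x. x \<notin> K \<Longrightarrow> f x = 0" "\<And>x. x \<notin> K \<Longrightarrow> g x = 0" by (rule C1c_support[OF fg]) blast
  show i1: "integrable lborel (\<lambda>x. f x * \<psi>' x $ i)"
    by (rule integrable_continuous_compact_support[OF _ K(1)])
       (use K \<psi> C1c_continuous[OF fg] in \<open>auto intro!: continuous_intros\<close>)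
  show i2: "integrable lborel (\<lambda>x. g x $ i * \<psi> x)"
    by (rule integrable_continuous_compact_support[OF _ K(1)])
       (use K c\<psi> C1c_continuous[OF fg] in \<open>auto intro!: continuous_intros\<close>)
  have "C1c UNIV (\<lambda>x. f x * \<psi> x) (\<lambda>x. f x *\<^sub>R \<psi>' x + \<psi> x *\<^sub>R g x)" unfolding C1c_def
  proof (intro conjI allI exI[of _ K])
    fix x show "((\<lambda>x. f x * \<psi> x) has_derivative (\<lambda>h. (f x *\<^sub>R \<psi>' x + \<psi> x *\<^sub>R g x) \<bullet> h)) (at x)"
      by (rule has_derivative_eq_rhs[OF has_derivative_mult[OF C1c_derivative[OF fg] \<psi>(1)]])
         (simp add: inner_add_left mult.commute)
  qed (use K \<psi> c\<psi> C1c_continuous[OF fg] in \<open>auto intro!: continuous_intros\<close>)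
  from integral_grad_zero[OF this, of i] i1 i2
  show "(\<integral>x. f x * \<psi>' x $ i \<partial>lborel) = - (\<integral>x. g x $ i * \<psi> x \<partial>lborel)"
    by (simp add: mult.commute)
qed

section \<open>The fundamental lemma of the calculus of variations\<close>

definition box_bump :: "plane \<Rightarrow> plane \<Rightarrow> nat \<Rightarrow> plane \<Rightarrow> real" where
  "box_bump a b n x = bump 0 (real n * ((x $ 1 - a $ 1) * (b $ 1 - x $ 1))) * bump 0 (real n * ((x $ 2 - a $ 2) * (b $ 2 - x $ 2)))"

lemma box_bump_bounds: "0 \<le> box_bump a b n x" "box_bump a b n x \<le> 1"
  unfolding box_bump_def by (auto intro!: mult_nonneg_nonneg mult_le_one bump_nonneg bump_0_le_1)

lemma box_bump_outside:
  assumes "a $ 1 \<le> b $ 1" "a $ 2 \<le> b $ 2" "x \<notin> box a b" shows "box_bump a b n x = 0"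
proof -
  have "(s - p) * (q - s) \<le> 0" if "p \<le> q" "\<not> (p < s \<and> s < q)" for p q s :: real
    using that by (auto simp: mult_le_0_iff not_less)
  then have "(x $ i - a $ i) * (b $ i - x $ i) \<le> 0" if "a $ i \<le> b $ i" "\<not> (a $ i < x $ i \<and> x $ i < b $ i)" for i using that by blast
  moreover have "bump 0 (real n * c) = 0" if "c \<le> 0" for c
    using that by (auto simp: bump_def zero_less_mult_iff)
  ultimately show ?thesis using assms by (auto simp: box_bump_def mem_box_cart forall_2)
qed

text \<open>Inside the box both products are positive, say \<open>c\<close>, and
  \<open>bump 0 (n * c) = exp (- 1 / (n * c))\<close> tends to 1. Together with
  \<open>box_bump_outside\<close> the bumps are smooth approximations of the indicator of the open
  box.\<close>

lemma box_bump_tendsto: "x \<in> box a b \<Longrightarrow> (\<lambda>n. box_bump a b n x) \<longlonglongrightarrow> 1"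
proof -
  assume x: "x \<in> box a b"
  have "(\<lambda>n. bump 0 (real n * c)) \<longlonglongrightarrow> 1" if "c > 0" for c
  proof -
    have "(\<lambda>n. exp (- (1 / c) / real n)) \<longlonglongrightarrow> exp 0"
      by (intro tendsto_exp lim_const_over_n)
    moreover have "eventually (\<lambda>n. exp (- (1 / c) / real n) = bump 0 (real n * c)) sequentially"
      using eventually_gt_at_top[of 0] by eventually_elim (use that in \<open>simp add: bump_def field_simps\<close>)
    ultimately show ?thesis using Lim_transform_eventually by fastforce
  qed
  then have "(\<lambda>n. box_bump a b n x) \<longlonglongrightarrow> 1 * 1"
    unfolding box_bump_def using x by (intro tendsto_mult) (auto simp: mem_box_cart forall_2)
  then show ?thesis by simp
qed

lemma box_bump_Cc_infty:
  assumes ab: "a $ 1 \<le> b $ 1" "a $ 2 \<le> b $ 2" and sub: "cbox a b \<subseteq> \<Omega>" shows "box_bump a b n \<in> Cc_infty \<Omega>"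
proof -
  have 0: "box_bump a b n x = 0" if "x \<notin> cbox a b" for x
    using box_bump_outside[OF ab] that box_subset_cbox by blast
  have "elem_smooth UNIV (box_bump a b n)"
    unfolding box_bump_def[abs_def] by (intro elem_smooth.intros elem_smooth_diff)
  then have "smooth (box_bump a b n)"
    by (intro smooth_elem_smooth[of UNIV "cbox a b" "box_bump a b n"]) (use 0 in auto)
  moreover have c: "closure {x. box_bump a b n x \<noteq> 0} \<subseteq> cbox a b"
    by (rule closure_minimal) (use 0 in auto)
  moreover have "compact (closure {x. box_bump a b n x \<noteq> 0})"
    using bounded_subset[OF bounded_cbox c] by (simp add: compact_eq_bounded_closed)
  ultimately show ?thesis using sub unfolding Cc_infty_def by auto
qed


lemma AE_lebesgue_negligible: "negligible N \<Longrightarrow> AE x in lebesgue. x \<notin> N"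
  by (rule AE_not_in) (simp add: negligible_iff_null_sets)

text \<open>The box bumps are admissible test functions bounded by 1, so dominated convergence
  replaces them by the indicator of the open box. The faces of the box have measure 0.\<close>

lemma integral_box_eq_0:
  fixes G :: "plane \<Rightarrow> real"
  assumes ab: "a $ 1 \<le> b $ 1" "a $ 2 \<le> b $ 2" and sub: "cbox a b \<subseteq> B1"
    and int: "set_integrable lebesgue (cbox a b) G"
    and zero: "\<And>\<phi>. \<phi> \<in> Cc_infty B1 \<Longrightarrow> (LINT x:B1|lebesgue. G x * \<phi> x) = 0"
  shows "integral (cbox a b) G = 0"
proof -
  have bint: "set_integrable lebesgue (box a b) G"
    by (rule set_integrable_subset[OF int]) (auto simp: box_subset_cbox)
  define F where "F = (\<lambda>x. indicator (box a b) x * G x)"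
  have F: "integrable lebesgue F" using bint by (simp add: set_integrable_def F_def)
  have Fm: "F \<in> borel_measurable lebesgue" using F by simp
  have eq: "indicator B1 x *\<^sub>R (G x * box_bump a b n x) = F x * box_bump a b n x" for n x
    using box_bump_outside[OF ab, of x n] sub box_subset_cbox[of a b]
    by (cases "x \<in> box a b") (auto simp: F_def)
  have "(\<lambda>n. \<integral>x. F x * box_bump a b n x \<partial>lebesgue) \<longlonglongrightarrow> (\<integral>x. F x \<partial>lebesgue)"
  proof (rule integral_dominated_convergence[where w="\<lambda>x. \<bar>F x\<bar>"])
    show "integrable lebesgue (\<lambda>x. \<bar>F x\<bar>)" using F by simp
    show "(\<lambda>x. F x * box_bump a b n x) \<in> borel_measurable lebesgue" for n
    proof -
      have "continuous_on UNIV (box_bump a b n)"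
        by (rule C1c_continuous[OF C1c_Cc_infty[OF box_bump_Cc_infty[OF ab sub]]])
      then have "box_bump a b n \<in> borel_measurable lborel" by (simp add: borel_measurable_continuous_onI)
      then show ?thesis by (intro borel_measurable_times[OF Fm measurable_completion])
    qed
    show "AE x in lebesgue. (\<lambda>n. F x * box_bump a b n x) \<longlonglongrightarrow> F x"
    proof (rule AE_I2)
      fix x show "(\<lambda>n. F x * box_bump a b n x) \<longlonglongrightarrow> F x"
      proof (cases "x \<in> box a b")
        case True
        then show ?thesis using tendsto_mult[OF tendsto_const box_bump_tendsto[OF True], of "F x"] by simp
      qed (simp add: F_def)
    qed
    show "AE x in lebesgue. norm (F x * box_bump a b n x) \<le> \<bar>F x\<bar>" for n
      using box_bump_bounds[of a b n] by (intro AE_I2) (auto simp: abs_mult intro: mult_left_le)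
  qed (rule Fm)
  moreover have "(\<integral>x. F x * box_bump a b n x \<partial>lebesgue) = 0" for n
    using zero[OF box_bump_Cc_infty[OF ab sub, of n]] unfolding set_lebesgue_integral_def eq .
  ultimately have "(\<integral>x. F x \<partial>lebesgue) = 0" using LIMSEQ_unique[OF _ tendsto_const] by simp
  then have "integral (box a b) G = 0"
    using set_lebesgue_integral_eq_integral(2)[OF bint] by (simp add: set_lebesgue_integral_def F_def)
  then show ?thesis by (simp add: integral_open_interval)
qed

text \<open>All small cubes have integral 0, and at almost every point the value of \<open>G\<close>
  is the limit of its averages over shrinking cubes (Lebesgue differentiation).\<close>

lemma fundamental_lemma:
  fixes G :: "plane \<Rightarrow> real"
  assumes int: "\<And>K. compact K \<Longrightarrow> K \<subseteq> B1 \<Longrightarrow> set_integrable lebesgue K G"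
    and zero: "\<And>\<phi>. \<phi> \<in> Cc_infty B1 \<Longrightarrow> (LINT x:B1|lebesgue. G x * \<phi> x) = 0"
  shows "AE x in lebesgue. x \<in> B1 \<longrightarrow> G x = 0"
proof -
  have "AE x in lebesgue. x \<in> ball 0 r \<longrightarrow> G x = 0" if r: "r < 1" for r
  proof -
    \<comment> \<open>Local integrability is available on compact subsets of the disc; cutting off
      at radius \<open>r\<close> yields a function that is integrable on every box.\<close>
    define f where "f x = (if x \<in> cball 0 r then G x else 0)" for x
    have "set_integrable lebesgue (cball 0 r) G" by (rule int) (use r in auto)
    then have "f absolutely_integrable_on UNIV"
      unfolding f_def[abs_def] absolutely_integrable_restrict_UNIV .
    then have "f absolutely_integrable_on cbox a b" for a b
      by (rule set_integrable_subset) auto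
    then have "f integrable_on cbox a b" for a b by (rule set_lebesgue_integral_eq_integral(1))
    \<comment> \<open>Lebesgue's differentiation theorem for cubes with lower corner
      \<open>x\<close>.\<close>
    then obtain N where N: "negligible N"
      "\<And>x e. x \<notin> N \<Longrightarrow> 0 < e \<Longrightarrow> \<exists>d>0. \<forall>h. 0 < h \<and> h < d \<longrightarrow>
         norm (integral (cbox x (x + h *\<^sub>R One)) f /\<^sub>R h ^ DIM(plane) - f x) < e"
      by (rule integrable_ccontinuous_explicit[of f]) blast
    have G0: "G x = 0" if x: "x \<notin> N" "x \<in> ball 0 r" for x
    proof (rule ccontr)
      assume "G x \<noteq> 0"
      moreover have fx: "f x = G x" using x by (simp add: f_def)
      ultimately obtain d where d: "d > 0" "\<And>h. 0 < h \<Longrightarrow> h < d \<Longrightarrow>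
         norm (integral (cbox x (x + h *\<^sub>R One)) f /\<^sub>R h ^ DIM(plane) - f x) < \<bar>f x\<bar>"
        using N(2)[OF x(1), of "\<bar>f x\<bar>"] by auto
      obtain e where e: "e > 0" "ball x e \<subseteq> ball 0 r" using x(2) open_ball open_contains_ball by blast
      \<comment> \<open>The distance to \<open>x\<close> in the cube is at most its l1 norm, hence
        at most \<open>2 * h\<close>; the quarter keeps the cube inside the ball of radius
        \<open>e\<close>.\<close>
      define h where "h = min (d / 2) (e / 4)"
      have h: "0 < h" "h < d" "h \<le> e / 4" using d e by (auto simp: h_def)
      have One: "(One :: plane) $ i = 1" for i
        by (simp add: cart_eq_inner_axis)
      then have One': "(\<Sum>b\<in>(Basis :: plane set). b $ i) = 1" for i by simp
      have "cbox x (x + h *\<^sub>R One) \<subseteq> ball x e"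
      proof
        fix y assume "y \<in> cbox x (x + h *\<^sub>R One)"
        then have "\<bar>(y - x) $ i\<bar> \<le> h" for i
          using h by (auto simp: mem_box_cart One' abs_le_iff algebra_simps dest!: spec[of _ i])
        then have "norm (y - x) \<le> (\<Sum>i\<in>(UNIV :: 2 set). h)"
          by (intro order_trans[OF norm_le_l1_cart] sum_mono)
        then have "norm (y - x) \<le> e / 2" using h by (simp add: UNIV_2)
        then show "y \<in> ball x e" using e by (simp add: dist_norm norm_minus_commute)
      qed
      then have sub: "cbox x (x + h *\<^sub>R One) \<subseteq> ball 0 r" using e by blast
      have "integral (cbox x (x + h *\<^sub>R One)) f = integral (cbox x (x + h *\<^sub>R One)) G"
        by (rule integral_cong) (use sub in \<open>auto simp: f_def\<close>)
      also have "\<dots> = 0"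
      proof (rule integral_box_eq_0)
        show sub': "cbox x (x + h *\<^sub>R One) \<subseteq> B1" using sub r by (auto simp: subset_iff)
        show "set_integrable lebesgue (cbox x (x + h *\<^sub>R One)) G" by (rule int) (use sub' in auto)
      qed (use h zero in \<open>simp_all add: One'\<close>)
      finally show False using d(2)[of h] h by simp
    qed
    show ?thesis
      by (rule AE_mp[OF AE_lebesgue_negligible[OF N(1)]], rule AE_I2) (simp add: G0)
  qed
  \<comment> \<open>Countably many radii exhaust the disc, so the exceptional sets still form a null
    set.\<close>
  then have "AE x in lebesgue. \<forall>n. x \<in> ball 0 (1 - inverse (real (Suc n))) \<longrightarrow> G x = 0"
    by (subst AE_all_countable) auto
  then show ?thesis
  proof eventually_elim
    case (elim x)
    show ?case
    proof
      assume "x \<in> B1"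
      then have "0 < 1 - norm x" by simp
      then obtain n where "inverse (real (Suc n)) < 1 - norm x" using reals_Archimedean by blast
      then show "G x = 0" using elim[rule_format, of n] by simp
    qed
  qed
qed

section \<open>The energy space\<close>

lemma ennreal_suminf_finite_summable:
  fixes f :: "nat \<Rightarrow> ennreal"
  assumes "(\<Sum>k. f k) \<noteq> \<infinity>"
  shows "summable (\<lambda>k. enn2real (f k))" "f k \<noteq> \<infinity>"
proof -
  have fin: "f k \<noteq> \<infinity>" for k
  proof -
    have "f k \<le> (\<Sum>k. f k)" using sum_le_suminf[of f "{k}"] by simp
    then show ?thesis using assms by (auto simp: top_unique)
  qed
  then show "f k \<noteq> \<infinity>" .
  have "(\<Sum>k. ennreal (enn2real (f k))) = (\<Sum>k. f k)" using fin by (simp add: less_top)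
  then show "summable (\<lambda>k. enn2real (f k))" using assms by (intro summable_suminf_not_top) auto
qed

text \<open>Along indices where the integrals are below \<open>(1/2) ^ k\<close> the sum of the
  functions has a finite integral, hence is finite almost everywhere, and its terms tend to
  0.\<close>

lemma nn_integral_tendsto_0_AE_subseq:
  fixes h :: "nat \<Rightarrow> 'a \<Rightarrow> ennreal"
  assumes [measurable]: "\<And>n. h n \<in> borel_measurable M" and lim: "(\<lambda>n. \<integral>\<^sup>+x. h n x \<partial>M) \<longlonglongrightarrow> 0"
  obtains r where "strict_mono r" "AE x in M. (\<lambda>k. h (r k) x) \<longlonglongrightarrow> 0"
proof -
  have "\<exists>N. \<forall>n\<ge>N. (\<integral>\<^sup>+x. h n x \<partial>M) < ennreal ((1/2) ^ k)" for k :: nat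
    using order_tendstoD(2)[OF lim, of "ennreal ((1/2) ^ k)"] by (auto simp: eventually_sequentially)
  then obtain N where N: "\<And>k n. N k \<le> n \<Longrightarrow> (\<integral>\<^sup>+x. h n x \<partial>M) < ennreal ((1/2) ^ k)" by metis
  \<comment> \<open>The partial sums dominate each \<open>N k\<close>, and the summand
    \<open>k\<close> makes the sequence strictly increasing.\<close>
  define r where "r k = (\<Sum>j\<le>k. N j) + k" for k
  have r: "strict_mono r" by (rule strict_monoI_Suc) (simp add: r_def)
  have Nr: "N k \<le> r k" for k
    using member_le_sum[of k "{..k}" N] by (simp add: r_def)
  have "(\<integral>\<^sup>+x. (\<Sum>k. h (r k) x) \<partial>M) = (\<Sum>k. \<integral>\<^sup>+x. h (r k) x \<partial>M)"
    by (rule nn_integral_suminf) simp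
  also have "\<dots> \<le> (\<Sum>k. ennreal ((1/2) ^ k))"
    by (intro suminf_le less_imp_le N Nr) auto
  also have "\<dots> = ennreal (\<Sum>k. (1/2) ^ k)" by (rule suminf_ennreal2) auto
  finally have "(\<integral>\<^sup>+x. (\<Sum>k. h (r k) x) \<partial>M) \<noteq> \<infinity>" by (auto simp: top_unique)
  then have "AE x in M. (\<Sum>k. h (r k) x) \<noteq> \<infinity>" by (intro nn_integral_PInf_AE) auto
  then have "AE x in M. (\<lambda>k. h (r k) x) \<longlonglongrightarrow> 0"
  proof eventually_elim
    case (elim x)
    have "(\<lambda>k. ennreal (enn2real (h (r k) x))) \<longlonglongrightarrow> ennreal 0"
      using ennreal_suminf_finite_summable(1)[OF elim] by (intro tendsto_ennrealI summable_LIMSEQ_zero)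
    then show ?case using ennreal_suminf_finite_summable(2)[OF elim] by (simp add: less_top)
  qed
  with r that show ?thesis by blast
qed

lemma AE_subseq_L2:
  fixes f :: "nat \<Rightarrow> 'a \<Rightarrow> 'b::{banach, second_countable_topology}"
  assumes [measurable]: "\<And>n. f n \<in> borel_measurable M" "g \<in> borel_measurable M"
    and lim: "(\<lambda>n. \<integral>\<^sup>+x. ennreal ((norm (f n x - g x))\<^sup>2) \<partial>M) \<longlonglongrightarrow> 0"
  obtains r where "strict_mono r" "AE x in M. (\<lambda>k. f (r k) x) \<longlonglongrightarrow> g x"
proof -
  obtain r where r: "strict_mono r" "AE x in M. (\<lambda>k. ennreal ((norm (f (r k) x - g x))\<^sup>2)) \<longlonglongrightarrow> 0"
    by (rule nn_integral_tendsto_0_AE_subseq[OF _ lim]) auto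
  have "AE x in M. (\<lambda>k. f (r k) x) \<longlonglongrightarrow> g x"
    using r(2)
  proof eventually_elim
    case (elim x)
    then have "(\<lambda>k. ennreal ((norm (f (r k) x - g x))\<^sup>2)) \<longlonglongrightarrow> ennreal 0" by simp
    then have "(\<lambda>k. (norm (f (r k) x - g x))\<^sup>2) \<longlonglongrightarrow> 0"
      by (subst (asm) tendsto_ennreal_iff) auto
    then have "(\<lambda>k. sqrt ((norm (f (r k) x - g x))\<^sup>2)) \<longlonglongrightarrow> sqrt 0" by (rule tendsto_real_sqrt)
    then have "(\<lambda>k. norm (f (r k) x - g x)) \<longlonglongrightarrow> 0" by simp
    then show ?case by (simp add: tendsto_norm_zero_iff LIM_zero_iff)
  qed
  with r that show ?thesis by blast
qed

text \<open>Fatou's lemma in the shape in which bounds on approximating functions are handed on to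
  their limits, here and in all later sections.\<close>

lemma nn_integral_fatou_AE:
  fixes h :: "nat \<Rightarrow> 'a \<Rightarrow> ennreal"
  assumes [measurable]: "\<And>n. h n \<in> borel_measurable M"
    and lim: "AE x in M. (\<lambda>k. h k x) \<longlonglongrightarrow> g x" and le: "eventually (\<lambda>k. (\<integral>\<^sup>+x. h k x \<partial>M) \<le> c) sequentially"
  shows "(\<integral>\<^sup>+x. g x \<partial>M) \<le> c"
proof -
  have "(\<integral>\<^sup>+x. g x \<partial>M) = (\<integral>\<^sup>+x. liminf (\<lambda>k. h k x) \<partial>M)"
    by (rule nn_integral_cong_AE) (use lim in \<open>auto elim!: eventually_mono dest: lim_imp_Liminf[rotated]\<close>)
  also have "\<dots> \<le> liminf (\<lambda>k. \<integral>\<^sup>+x. h k x \<partial>M)" by (rule nn_integral_liminf) simp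
  also have "\<dots> \<le> limsup (\<lambda>k. \<integral>\<^sup>+x. h k x \<partial>M)" by (rule Liminf_le_Limsup) simp
  also have "\<dots> \<le> c" using le by (rule Limsup_bounded)
  finally show ?thesis .
qed

text \<open>The Riesz-Fischer argument: a rapidly converging subsequence converges almost
  everywhere, and Fatou's lemma turns its limit into the L2 limit of the whole sequence. No
  integrability of the single functions is assumed, only that of their differences.\<close>

lemma L2_complete:
  fixes f :: "nat \<Rightarrow> 'a \<Rightarrow> 'b::{banach, second_countable_topology}"
  assumes [measurable]: "\<And>n. f n \<in> borel_measurable M"
    and Cauchy: "\<And>e. e > 0 \<Longrightarrow> \<exists>N. \<forall>m\<ge>N. \<forall>n\<ge>N. (\<integral>\<^sup>+x. ennreal ((norm (f m x - f n x))\<^sup>2) \<partial>M) \<le> ennreal e"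
  obtains G where "G \<in> borel_measurable M" "(\<lambda>n. \<integral>\<^sup>+x. ennreal ((norm (f n x - G x))\<^sup>2) \<partial>M) \<longlonglongrightarrow> 0"
proof -
  \<comment> \<open>The rate 1/4 leaves \<open>(1/2) ^ k\<close> after the squared differences have
    been weighted with \<open>2 ^ k\<close>.\<close>
  have "\<exists>N. \<forall>m\<ge>N. \<forall>n\<ge>N. (\<integral>\<^sup>+x. ennreal ((norm (f m x - f n x))\<^sup>2) \<partial>M) \<le> ennreal ((1/4) ^ k)" for k :: nat
    by (rule Cauchy) simp
  then obtain N where N: "\<And>k m n. N k \<le> m \<Longrightarrow> N k \<le> n \<Longrightarrow>
      (\<integral>\<^sup>+x. ennreal ((norm (f m x - f n x))\<^sup>2) \<partial>M) \<le> ennreal ((1/4) ^ k)" by metis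
  define r where "r k = (\<Sum>j\<le>k. N j) + k" for k
  have r: "strict_mono r" by (rule strict_monoI_Suc) (simp add: r_def)
  have Nr: "N k \<le> r k" "N k \<le> r (Suc k)" for k
    using member_le_sum[of k "{..k}" N] by (simp_all add: r_def)
  define d where "d k x = norm (f (r (Suc k)) x - f (r k) x)" for k x
  have [measurable]: "d k \<in> borel_measurable M" for k unfolding d_def by measurable
  have "(\<integral>\<^sup>+x. (\<Sum>k. ennreal (2 ^ k * (d k x)\<^sup>2)) \<partial>M) = (\<Sum>k. \<integral>\<^sup>+x. ennreal (2 ^ k * (d k x)\<^sup>2) \<partial>M)"
    by (rule nn_integral_suminf) simp
  also have "\<dots> \<le> (\<Sum>k. ennreal ((1/2) ^ k))"
  proof (intro suminf_le)
    fix k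
    have "(\<integral>\<^sup>+x. ennreal (2 ^ k * (d k x)\<^sup>2) \<partial>M) = ennreal (2 ^ k) * (\<integral>\<^sup>+x. ennreal ((d k x)\<^sup>2) \<partial>M)"
      by (subst nn_integral_cmult[symmetric]) (auto simp: ennreal_mult)
    also have "\<dots> \<le> ennreal (2 ^ k) * ennreal ((1/4) ^ k)"
      unfolding d_def by (intro mult_left_mono N Nr) auto
    also have "\<dots> = ennreal ((1/2) ^ k)"
      by (simp add: ennreal_mult[symmetric] power_mult_distrib[symmetric])
    finally show "(\<integral>\<^sup>+x. ennreal (2 ^ k * (d k x)\<^sup>2) \<partial>M) \<le> ennreal ((1/2) ^ k)" .
  qed auto
  also have "\<dots> = ennreal (\<Sum>k. (1/2) ^ k)" by (rule suminf_ennreal2) auto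
  finally have "(\<integral>\<^sup>+x. (\<Sum>k. ennreal (2 ^ k * (d k x)\<^sup>2)) \<partial>M) \<noteq> \<infinity>" by (auto simp: top_unique)
  then have ae: "AE x in M. (\<Sum>k. ennreal (2 ^ k * (d k x)\<^sup>2)) \<noteq> \<infinity>" by (intro nn_integral_PInf_AE) auto
  define G where "G x = lim (\<lambda>k. f (r k) x)" for x
  have G[measurable]: "G \<in> borel_measurable M" unfolding G_def[abs_def] by (rule borel_measurable_lim_metric) simp
  have conv: "AE x in M. (\<lambda>k. f (r k) x) \<longlonglongrightarrow> G x"
    using ae
  proof eventually_elim
    case (elim x)
    have s: "summable (\<lambda>k. 2 ^ k * (d k x)\<^sup>2)"
      by (rule summable_suminf_not_top) (use elim in auto)
    have "summable (\<lambda>k. f (r (Suc k)) x - f (r k) x)"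
    proof (rule summable_comparison_test'[OF summable_add[OF s summable_geometric[of "1/2 :: real"]]])
      fix k :: nat
      \<comment> \<open>Bounds the difference itself by its weighted square plus a geometric term,
        so that square summability with weights gives absolute convergence.\<close>
      have "2 * sqrt (2 ^ k) * d k x * sqrt ((1/2) ^ k) \<le> (sqrt (2 ^ k) * d k x)\<^sup>2 + (sqrt ((1/2) ^ k))\<^sup>2"
        using sum_squares_bound[of "sqrt (2 ^ k) * d k x" "sqrt ((1/2) ^ k)"] by (simp add: mult.assoc)
      moreover have "sqrt (2 ^ k) * sqrt ((1/2) ^ k) = (1 :: real)"
        by (simp add: real_sqrt_mult[symmetric] power_mult_distrib[symmetric])
      then have "2 * sqrt (2 ^ k) * d k x * sqrt ((1/2) ^ k) = 2 * d k x"
        by (metis (no_types, lifting) mult.assoc mult.commute mult_1)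
      moreover have "(sqrt (2 ^ k) * d k x)\<^sup>2 + (sqrt ((1/2) ^ k))\<^sup>2 = 2 ^ k * (d k x)\<^sup>2 + (1/2) ^ k"
        by (simp add: power_mult_distrib)
      moreover have "0 \<le> d k x" by (simp add: d_def)
      ultimately show "norm (f (r (Suc k)) x - f (r k) x) \<le> 2 ^ k * (d k x)\<^sup>2 + (1/2) ^ k"
        unfolding d_def[symmetric] by linarith
    qed simp
    then have "convergent (\<lambda>n. \<Sum>k<n. f (r (Suc k)) x - f (r k) x)" by (simp add: summable_iff_convergent)
    then have "convergent (\<lambda>n. f (r n) x - f (r 0) x)" by (simp only: sum_lessThan_telescope[of "\<lambda>k. f (r k) x"])
    then have "convergent (\<lambda>n. f (r n) x - f (r 0) x + f (r 0) x)" by (intro convergent_add convergent_const)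
    then show ?case by (simp add: G_def convergent_LIMSEQ_iff)
  qed
  have "(\<lambda>n. \<integral>\<^sup>+x. ennreal ((norm (f n x - G x))\<^sup>2) \<partial>M) \<longlonglongrightarrow> 0"
  proof (rule order_tendstoI)
    fix c :: ennreal assume c: "0 < c"
    obtain e where e: "e > 0" "ennreal e < c"
      using c by (metis dense ennreal_cases ennreal_less_zero_iff less_top_ennreal not_less_iff_gr_or_eq top_greatest leD)
    obtain N where N: "\<And>m n. N \<le> m \<Longrightarrow> N \<le> n \<Longrightarrow> (\<integral>\<^sup>+x. ennreal ((norm (f m x - f n x))\<^sup>2) \<partial>M) \<le> ennreal e"
      using Cauchy[OF e(1)] by blast
    have "(\<integral>\<^sup>+x. ennreal ((norm (f n x - G x))\<^sup>2) \<partial>M) \<le> ennreal e" if "n \<ge> N" for n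
    \<comment> \<open>The Cauchy estimate for \<open>f n\<close> and \<open>f (r k)\<close> survives
      as \<open>k\<close> grows, for every large \<open>n\<close> and not only along the
      subsequence.\<close>
    proof (rule nn_integral_fatou_AE)
      show "AE x in M. (\<lambda>k. ennreal ((norm (f n x - f (r k) x))\<^sup>2)) \<longlonglongrightarrow> ennreal ((norm (f n x - G x))\<^sup>2)"
        using conv by eventually_elim (intro tendsto_intros)
      show "eventually (\<lambda>k. (\<integral>\<^sup>+x. ennreal ((norm (f n x - f (r k) x))\<^sup>2) \<partial>M) \<le> ennreal e) sequentially"
        using eventually_ge_at_top[of N]
        by eventually_elim (use that seq_suble[OF r] N order_trans in blast)
    qed simp
    then show "eventually (\<lambda>n. (\<integral>\<^sup>+x. ennreal ((norm (f n x - G x))\<^sup>2) \<partial>M) < c) sequentially"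
      using e(2) by (auto simp: eventually_sequentially intro: le_less_trans)
  qed simp
  with G that show ?thesis by blast
qed

text \<open>The difference of the squared norms is at most the squared distance plus twice the
  product of \<open>norm (g x)\<close> with the distance; Cauchy-Schwarz handles the product. Used
  for the gradients and for the functions weighted with the root of the potential.\<close>

lemma L2_norm_tendsto:
  fixes f :: "nat \<Rightarrow> 'a \<Rightarrow> 'b::{real_inner, banach, second_countable_topology}"
  assumes [measurable]: "\<And>n. f n \<in> borel_measurable M" "g \<in> borel_measurable M"
    and int: "\<And>n. integrable M (\<lambda>x. (norm (f n x))\<^sup>2)"
    and lim: "(\<lambda>n. \<integral>\<^sup>+x. ennreal ((norm (f n x - g x))\<^sup>2) \<partial>M) \<longlonglongrightarrow> 0"
  shows "integrable M (\<lambda>x. (norm (g x))\<^sup>2)"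
    and "(\<lambda>n. \<integral>x. (norm (f n x))\<^sup>2 \<partial>M) \<longlonglongrightarrow> (\<integral>x. (norm (g x))\<^sup>2 \<partial>M)"
proof -
  have sq: "(norm (a + b))\<^sup>2 \<le> 2 * (norm a)\<^sup>2 + 2 * (norm b)\<^sup>2" for a b :: 'b
  proof -
    have "(norm (a + b))\<^sup>2 \<le> (norm a + norm b)\<^sup>2" by (intro power_mono norm_triangle_ineq) simp
    also have "\<dots> \<le> 2 * (norm a)\<^sup>2 + 2 * (norm b)\<^sup>2"
      using sum_squares_bound[of "norm a" "norm b"] by (simp add: power2_sum)
    finally show ?thesis .
  qed
  have dint: "integrable M (\<lambda>x. (norm (f n x - g x))\<^sup>2)" if "(\<integral>\<^sup>+x. ennreal ((norm (f n x - g x))\<^sup>2) \<partial>M) < \<infinity>" for n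
    using that by (intro integrableI_nonneg) auto
  have ev: "eventually (\<lambda>n. (\<integral>\<^sup>+x. ennreal ((norm (f n x - g x))\<^sup>2) \<partial>M) < \<infinity>) sequentially"
    by (rule order_tendstoD(2)[OF lim]) simp
  then obtain n where "(\<integral>\<^sup>+x. ennreal ((norm (f n x - g x))\<^sup>2) \<partial>M) < \<infinity>"
    by (auto simp: eventually_sequentially)
  note n = dint[OF this]
  show gint: "integrable M (\<lambda>x. (norm (g x))\<^sup>2)"
  proof (rule Bochner_Integration.integrable_bound)
    show "integrable M (\<lambda>x. 2 * (norm (f n x))\<^sup>2 + 2 * (norm (f n x - g x))\<^sup>2)" using int n by simp
    show "AE x in M. norm ((norm (g x))\<^sup>2) \<le> norm (2 * (norm (f n x))\<^sup>2 + 2 * (norm (f n x - g x))\<^sup>2)"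
    proof (rule AE_I2)
      fix x show "norm ((norm (g x))\<^sup>2) \<le> norm (2 * (norm (f n x))\<^sup>2 + 2 * (norm (f n x - g x))\<^sup>2)"
        using sq[of "f n x" "g x - f n x"] by (simp add: norm_minus_commute)
    qed
  qed simp
  define D where "D n = (\<integral>x. (norm (f n x - g x))\<^sup>2 \<partial>M)" for n
  define C where "C = (\<integral>x. (norm (g x))\<^sup>2 \<partial>M)"
  have bound: "\<bar>(\<integral>x. (norm (f n x))\<^sup>2 \<partial>M) - C\<bar> \<le> D n + 2 * sqrt (C * D n)"
    if "(\<integral>\<^sup>+x. ennreal ((norm (f n x - g x))\<^sup>2) \<partial>M) < \<infinity>" for n
  proof -
    note di = dint[OF that]
    have p: "integrable M (\<lambda>x. norm (g x) * norm (f n x - g x))"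
      "(\<integral>x. norm (g x) * norm (f n x - g x) \<partial>M)\<^sup>2 \<le> C * D n"
      using cauchy_schwarz_integral[of "\<lambda>x. norm (g x)" M "\<lambda>x. norm (f n x - g x)"] di gint
      by (auto simp: C_def D_def)
    have pw: "\<bar>(norm (f n x))\<^sup>2 - (norm (g x))\<^sup>2\<bar> \<le> (norm (f n x - g x))\<^sup>2 + 2 * (norm (g x) * norm (f n x - g x))" for x
    proof -
      have e: "(norm (f n x))\<^sup>2 - (norm (g x))\<^sup>2 = (norm (f n x - g x))\<^sup>2 + 2 * (g x \<bullet> (f n x - g x))"
        by (simp add: power2_norm_eq_inner algebra_simps inner_commute)
      have "\<bar>g x \<bullet> (f n x - g x)\<bar> \<le> norm (g x) * norm (f n x - g x)" by (rule Cauchy_Schwarz_ineq2)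
      then show ?thesis unfolding e using zero_le_power2[of "norm (f n x - g x)"] by linarith
    qed
    have "\<bar>(\<integral>x. (norm (f n x))\<^sup>2 \<partial>M) - C\<bar> = \<bar>\<integral>x. (norm (f n x))\<^sup>2 - (norm (g x))\<^sup>2 \<partial>M\<bar>"
      using int gint by (simp add: C_def)
    also have "\<dots> \<le> (\<integral>x. \<bar>(norm (f n x))\<^sup>2 - (norm (g x))\<^sup>2\<bar> \<partial>M)" by (rule integral_abs_bound)
    also have "\<dots> \<le> (\<integral>x. (norm (f n x - g x))\<^sup>2 + 2 * (norm (g x) * norm (f n x - g x)) \<partial>M)"
      using int gint di p pw by (intro integral_mono) auto
    also have "\<dots> = D n + 2 * (\<integral>x. norm (g x) * norm (f n x - g x) \<partial>M)" using di p by (simp add: D_def)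
    also have "\<dots> \<le> D n + 2 * sqrt (C * D n)" using real_le_rsqrt[OF p(2)] by simp
    finally show ?thesis .
  qed
  have "(\<lambda>n. D n) \<longlonglongrightarrow> 0"
  proof -
    have "(\<lambda>n. enn2real (\<integral>\<^sup>+x. ennreal ((norm (f n x - g x))\<^sup>2) \<partial>M)) \<longlonglongrightarrow> enn2real 0"
      using lim by (intro tendsto_enn2real) auto
    then show ?thesis by (simp add: D_def integral_eq_nn_integral)
  qed
  then have "(\<lambda>n. D n + 2 * sqrt (C * D n)) \<longlonglongrightarrow> 0 + 2 * sqrt (C * 0)" by (intro tendsto_intros)
  then have "(\<lambda>n. D n + 2 * sqrt (C * D n)) \<longlonglongrightarrow> 0" by simp
  then have "(\<lambda>n. (\<integral>x. (norm (f n x))\<^sup>2 \<partial>M) - C) \<longlonglongrightarrow> 0"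
    by (rule Lim_null_comparison[rotated]) (use ev bound in \<open>auto elim: eventually_mono\<close>)
  then show "(\<lambda>n. \<integral>x. (norm (f n x))\<^sup>2 \<partial>M) \<longlonglongrightarrow> (\<integral>x. (norm (g x))\<^sup>2 \<partial>M)"
    unfolding C_def by (simp add: LIM_zero_iff)
qed

section \<open>Leray's inequality, proved ray by ray\<close>

lemma nn_integral_logpolar_swap:
  fixes f :: "plane \<Rightarrow> ennreal"
  assumes [measurable]: "f \<in> borel_measurable borel"
  shows "(\<integral>\<^sup>+x\<in>B1. f x \<partial>lborel) =
    (\<integral>\<^sup>+\<theta>\<in>{0<..<2*pi}. (\<integral>\<^sup>+t\<in>{0<..}. f (logpolar t \<theta>) * ennreal (exp (- 2 * t)) \<partial>lborel) \<partial>lborel)"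
proof -
  have m: "(\<lambda>p. f (logpolar (fst p) (snd p))) \<in> borel_measurable (lborel \<Otimes>\<^sub>M lborel)"
    by (rule measurable_compose[OF borel_measurable_logpolar assms]) measurable
  define h where "h = (\<lambda>t \<theta>. f (logpolar t \<theta>) * ennreal (exp (- 2 * t)) * indicator {0<..<2*pi} \<theta> * indicator {0<..} t)"
  have h: "(\<lambda>p. h (fst p) (snd p)) \<in> borel_measurable (lborel \<Otimes>\<^sub>M lborel)"
    unfolding h_def by (intro borel_measurable_times_ennreal m; measurable)
  have mt: "(\<lambda>\<theta>. f (logpolar t \<theta>)) \<in> borel_measurable lborel" for t
    using measurable_compose[OF borel_measurable_logpolar[OF borel_measurable_const measurable_ident_sets[OF refl]] assms] by simp
  have m\<theta>: "(\<lambda>t. f (logpolar t \<theta>)) \<in> borel_measurable lborel" for \<theta>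
    using measurable_compose[OF borel_measurable_logpolar[OF measurable_ident_sets[OF refl] borel_measurable_const] assms] by simp
  have "(\<integral>\<^sup>+x\<in>B1. f x \<partial>lborel) = (\<integral>\<^sup>+t. \<integral>\<^sup>+\<theta>. h t \<theta> \<partial>lborel \<partial>lborel)"
    unfolding nn_integral_logpolar[OF assms]
  proof (rule nn_integral_cong)
    fix t :: real
    have "(\<integral>\<^sup>+\<theta>. h t \<theta> \<partial>lborel) = (\<integral>\<^sup>+\<theta>. (ennreal (exp (- 2 * t)) * indicator {0<..} t) * (f (logpolar t \<theta>) * indicator {0<..<2*pi} \<theta>) \<partial>lborel)"
      by (simp only: h_def mult_ac)
    also have "\<dots> = (ennreal (exp (- 2 * t)) * indicator {0<..} t) * (\<integral>\<^sup>+\<theta>\<in>{0<..<2*pi}. f (logpolar t \<theta>) \<partial>lborel)"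
      using mt by (intro nn_integral_cmult borel_measurable_times_ennreal) simp_all
    finally show "(\<integral>\<^sup>+\<theta>\<in>{0<..<2*pi}. f (logpolar t \<theta>) \<partial>lborel) * ennreal (exp (- 2 * t)) * indicator {0<..} t = (\<integral>\<^sup>+\<theta>. h t \<theta> \<partial>lborel)"
      by (simp only: mult_ac)
  qed
  also have "\<dots> = (\<integral>\<^sup>+\<theta>. \<integral>\<^sup>+t. h t \<theta> \<partial>lborel \<partial>lborel)"
    by (rule lborel_pair.Fubini'[symmetric]) (use h in \<open>simp add: split_beta'\<close>)
  also have "\<dots> = (\<integral>\<^sup>+\<theta>\<in>{0<..<2*pi}. (\<integral>\<^sup>+t\<in>{0<..}. f (logpolar t \<theta>) * ennreal (exp (- 2 * t)) \<partial>lborel) \<partial>lborel)"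
  proof (rule nn_integral_cong)
    fix \<theta> :: real
    have "(\<integral>\<^sup>+t. h t \<theta> \<partial>lborel) = (\<integral>\<^sup>+t. indicator {0<..<2*pi} \<theta> * (f (logpolar t \<theta>) * ennreal (exp (- 2 * t)) * indicator {0<..} t) \<partial>lborel)"
      by (simp only: h_def mult_ac)
    also have "\<dots> = indicator {0<..<2*pi} \<theta> * (\<integral>\<^sup>+t\<in>{0<..}. f (logpolar t \<theta>) * ennreal (exp (- 2 * t)) \<partial>lborel)"
      using m\<theta> by (intro nn_integral_cmult borel_measurable_times_ennreal) simp_all
    finally show "(\<integral>\<^sup>+t. h t \<theta> \<partial>lborel) = (\<integral>\<^sup>+t\<in>{0<..}. f (logpolar t \<theta>) * ennreal (exp (- 2 * t)) \<partial>lborel) * indicator {0<..<2*pi} \<theta>"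
      by (simp only: mult_ac)
  qed
  finally show ?thesis .
qed

text \<open>Expanding the square, the difference of the integrands is the derivative of
  \<open>a * (w t)\<^sup>2 / t\<close>. The boundary term at \<open>T\<close> is kept because
  profiles of functions that do not vanish at the origin will be inserted as well.\<close>

lemma ground_state_1d:
  fixes w w' :: "real \<Rightarrow> real"
  assumes st: "0 < s" "s \<le> T" and der: "\<And>t. t \<in> {s..T} \<Longrightarrow> (w has_real_derivative w' t) (at t within {s..T})"
    and cont: "continuous_on {s..T} w'" and bd: "w s = 0"
  shows "integral {s..T} (\<lambda>t. (w' t)\<^sup>2)
    = integral {s..T} (\<lambda>t. (w' t - a * w t / t)\<^sup>2) + a * (1 - a) * integral {s..T} (\<lambda>t. (w t)\<^sup>2 / t\<^sup>2) + a * (w T)\<^sup>2 / T"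
proof -
  have cw: "continuous_on {s..T} w" using der by (rule DERIV_continuous_on)
  have nz: "\<And>t. t \<in> {s..T} \<Longrightarrow> t \<noteq> 0" using st by auto
  have i1: "(\<lambda>t. (w' t - a * w t / t)\<^sup>2) integrable_on {s..T}"
    and i2: "(\<lambda>t. (w t)\<^sup>2 / t\<^sup>2) integrable_on {s..T}"
    by (intro integrable_continuous_real continuous_intros cw cont; use nz in force)+
  have "((\<lambda>t. (w' t)\<^sup>2 - (w' t - a * w t / t)\<^sup>2 - a * (1 - a) * ((w t)\<^sup>2 / t\<^sup>2)) has_integral (a * (w T)\<^sup>2 / T - a * (w s)\<^sup>2 / s)) {s..T}"
  proof (rule fundamental_theorem_of_calculus[OF st(2)])
    fix t assume t: "t \<in> {s..T}"
    have "((\<lambda>t. a * (w t)\<^sup>2 / t) has_real_derivative (a * (2 * w t * w' t) * t - a * (w t)\<^sup>2) / (t * t)) (at t within {s..T})"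
      using nz[OF t] by (auto intro!: derivative_eq_intros der[OF t] simp: field_simps power2_eq_square)
    also have "(a * (2 * w t * w' t) * t - a * (w t)\<^sup>2) / (t * t) = (w' t)\<^sup>2 - (w' t - a * w t / t)\<^sup>2 - a * (1 - a) * ((w t)\<^sup>2 / t\<^sup>2)"
      using nz[OF t] by (simp add: field_simps power2_eq_square)
    finally show "((\<lambda>t. a * (w t)\<^sup>2 / t) has_vector_derivative (w' t)\<^sup>2 - (w' t - a * w t / t)\<^sup>2 - a * (1 - a) * ((w t)\<^sup>2 / t\<^sup>2)) (at t within {s..T})"
      by (simp add: has_real_derivative_iff_has_vector_derivative)
  qed
  then have h0: "((\<lambda>t. (w' t)\<^sup>2 - (w' t - a * w t / t)\<^sup>2 - a * (1 - a) * ((w t)\<^sup>2 / t\<^sup>2)) has_integral a * (w T)\<^sup>2 / T) {s..T}"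
    using bd by simp
  have "((\<lambda>t. ((w' t)\<^sup>2 - (w' t - a * w t / t)\<^sup>2 - a * (1 - a) * ((w t)\<^sup>2 / t\<^sup>2)) + ((w' t - a * w t / t)\<^sup>2 + a * (1 - a) * ((w t)\<^sup>2 / t\<^sup>2)))
     has_integral (a * (w T)\<^sup>2 / T + (integral {s..T} (\<lambda>t. (w' t - a * w t / t)\<^sup>2) + a * (1 - a) * integral {s..T} (\<lambda>t. (w t)\<^sup>2 / t\<^sup>2)))) {s..T}"
    by (intro has_integral_add h0 has_integral_mult_right integrable_integral i1 i2)
  then show ?thesis by (simp add: integral_unique)
qed

lemma nn_integral_eq_integral_support:
  fixes h :: "real \<Rightarrow> real"
  assumes "0 < s" "continuous_on {s..T} h" "\<And>t. t > 0 \<Longrightarrow> t \<notin> {s..T} \<Longrightarrow> h t = 0" "\<And>t. t > 0 \<Longrightarrow> 0 \<le> h t"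
  shows "(\<integral>\<^sup>+t\<in>{0<..}. ennreal (h t) \<partial>lborel) = ennreal (integral {s..T} h)"
proof -
  have "(\<integral>\<^sup>+t\<in>{0<..}. ennreal (h t) \<partial>lborel) = (\<integral>\<^sup>+t\<in>{s..T}. ennreal (h t) \<partial>lborel)"
    using assms(1,3) by (intro nn_integral_cong) (auto simp: indicator_def)
  also have "\<dots> = ennreal (integral {s..T} h)"
    using assms by (intro nn_integral_has_integral_lebesgue' integrable_integral integrable_continuous_real) auto
  finally show ?thesis .
qed

lemma logpolar_has_derivative:
  "((\<lambda>t. logpolar t \<theta>) has_vector_derivative - logpolar t \<theta>) (at t within S)"
proof -
  have e: "logpolar t \<theta> = exp (- t) *\<^sub>R logpolar 0 \<theta>" for t by (simp add: vec_eq_iff forall_2)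
  have "((\<lambda>t. exp (- t) *\<^sub>R logpolar 0 \<theta>) has_vector_derivative (- exp (- t)) *\<^sub>R logpolar 0 \<theta>) (at t within S)"
    by (auto intro!: derivative_eq_intros)
  moreover have "(\<lambda>t. logpolar t \<theta>) = (\<lambda>t. exp (- t) *\<^sub>R logpolar 0 \<theta>)" using e by (rule ext)
  moreover have "- logpolar t \<theta> = (- exp (- t)) *\<^sub>R logpolar 0 \<theta>" using e[of t] by simp
  ultimately show ?thesis by (simp only:)
qed

lemma DERIV_along_logpolar:
  assumes "(\<phi> has_derivative (\<lambda>h. g \<bullet> h)) (at (logpolar t \<theta>))"
  shows "((\<lambda>t. \<phi> (logpolar t \<theta>)) has_real_derivative - (g \<bullet> logpolar t \<theta>)) (at t within S)"
proof -
  have "((\<lambda>t. \<phi> (logpolar t \<theta>)) has_derivative (\<lambda>h. g \<bullet> (h *\<^sub>R - logpolar t \<theta>))) (at t within S)"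
    using has_derivative_compose[OF logpolar_has_derivative[unfolded has_vector_derivative_def] assms] .
  then show ?thesis unfolding has_field_derivative_def
    by (rule has_derivative_eq_rhs) (simp add: fun_eq_iff mult.commute)
qed

lemma continuous_on_logpolar: "continuous_on S (\<lambda>t. logpolar t \<theta>)"
  by (rule continuous_on_vector_derivative[OF logpolar_has_derivative])

text \<open>The bound imposed on \<open>V\<close>, written on the plane. In logarithmic polar
  coordinates it becomes the Hardy weight \<open>1 / t\<^sup>2\<close>, the Jacobian
  included.\<close>

definition leray_weight :: "plane \<Rightarrow> real" where
  "leray_weight x = 1 / ((norm x)\<^sup>2 * (ln (norm x))\<^sup>2)"

lemma leray_weight_nonneg: "0 \<le> leray_weight x" by (simp add: leray_weight_def)

lemma leray_weight_logpolar: "leray_weight (logpolar t \<theta>) * exp (- 2 * t) = 1 / t\<^sup>2"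
proof -
  have "(exp (- t))\<^sup>2 = exp (- 2 * t)" by (simp add: power2_eq_square exp_add[symmetric])
  then show ?thesis by (simp add: leray_weight_def)
qed

lemma compact_annulus:
  assumes "compact K" "K \<subseteq> B1 - {0}"
  obtains s T where "0 < s" "s \<le> T" "\<And>t \<theta>. t \<notin> {s<..<T} \<Longrightarrow> logpolar t \<theta> \<notin> K"
proof (cases "K = {}")
  case True
  then show ?thesis using that[of 1 1] by simp
next
  case False
  have c: "continuous_on K norm" by (intro continuous_intros)
  obtain x where x: "x \<in> K" "\<And>y. y \<in> K \<Longrightarrow> norm x \<le> norm y" using continuous_attains_inf[OF assms(1) False c] by blast
  obtain z where z: "z \<in> K" "\<And>y. y \<in> K \<Longrightarrow> norm y \<le> norm z" using continuous_attains_sup[OF assms(1) False c] by blast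
  have p: "0 < norm x" "norm x \<le> norm z" "norm z < 1" using x z assms by auto
  have l: "ln (norm x) \<le> ln (norm z)" "ln (norm z) < 0" using p ln_less_zero[of "norm z"] by (simp_all only: ln_le_cancel_iff less_le_trans)
  show ?thesis
  \<comment> \<open>Halving the lower end and adding 1 to the upper end leaves a margin, so that the
    endpoints themselves already belong to rays outside \<open>K\<close>.\<close>
  proof (rule that[of "- ln (norm z) / 2" "- ln (norm x) + 1"])
    show "logpolar t \<theta> \<notin> K" if "t \<notin> {- ln (norm z) / 2<..<- ln (norm x) + 1}" for t \<theta>
    proof
      assume "logpolar t \<theta> \<in> K"
      then have "norm x \<le> exp (- t)" "exp (- t) \<le> norm z" using x(2) z(2) by fastforce+
      then have "ln (norm x) \<le> - t" "- t \<le> ln (norm z)" using p ln_mono[of "norm x" "exp (- t)"] ln_mono[of "exp (- t)" "norm z"] by simp_all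
      then show False using that l by auto
    qed
  qed (use l in auto)
qed


text \<open>The squared deviation \<open>(w' - a * w / t)\<^sup>2\<close> written on the plane:
  differentiation in \<open>t\<close> is minus the inner product of the gradient with
  \<open>x\<close>, and \<open>t = - ln (norm x)\<close>. The denominator cancels the
  Jacobian.\<close>

definition ground_dev :: "real \<Rightarrow> (plane \<Rightarrow> real) \<Rightarrow> (plane \<Rightarrow> plane) \<Rightarrow> plane \<Rightarrow> real" where
  "ground_dev a \<phi> g x = (g x \<bullet> x - a * \<phi> x / ln (norm x))\<^sup>2 / (norm x)\<^sup>2"

lemma ground_dev_nonneg: "0 \<le> ground_dev a \<phi> g x" by (simp add: ground_dev_def)

lemma borel_measurable_leray_weight [measurable]: "leray_weight \<in> borel_measurable borel"
  unfolding leray_weight_def[abs_def] by measurable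

lemma borel_measurable_ground_dev:
  "\<phi> \<in> borel_measurable borel \<Longrightarrow> g \<in> borel_measurable borel \<Longrightarrow> ground_dev a \<phi> g \<in> borel_measurable borel"
  unfolding ground_dev_def[abs_def]
  by (intro borel_measurable_divide borel_measurable_power borel_measurable_diff borel_measurable_inner
      borel_measurable_times borel_measurable_const borel_measurable_ln borel_measurable_norm measurable_ident_sets refl)

lemma C1c_measurable:
  assumes "C1c \<Omega> f g" shows "f \<in> borel_measurable borel" "g \<in> borel_measurable borel"
  using C1c_continuous[OF assms] borel_measurable_continuous_onI by auto

lemma sets_B1 [measurable]: "B1 \<in> sets borel" by simp

lemma exp_norm_logpolar: "x / (norm (logpolar t \<theta>))\<^sup>2 * exp (- 2 * t) = x"
  by (simp add: power2_eq_square exp_add[symmetric])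

text \<open>On each ray the test function vanishes near both ends, so \<open>ground_state_1d\<close>
  holds there without boundary terms; integration over the angle gives the identity for the radial
  part of the gradient.\<close>

lemma ground_state_plane:
  assumes \<phi>: "C1c (B1 - {0}) \<phi> g" and a: "0 \<le> a" "a \<le> 1"
  shows "(\<integral>\<^sup>+x\<in>B1. ennreal ((g x \<bullet> x)\<^sup>2 / (norm x)\<^sup>2) \<partial>lborel) =
     (\<integral>\<^sup>+x\<in>B1. ennreal (ground_dev a \<phi> g x) \<partial>lborel)
     + ennreal (a * (1 - a)) * (\<integral>\<^sup>+x\<in>B1. ennreal (leray_weight x * (\<phi> x)\<^sup>2) \<partial>lborel)"
proof -
  obtain K where K: "compact K" "K \<subseteq> B1 - {0}" "\<And>x. x \<notin> K \<Longrightarrow> \<phi> x = 0" "\<And>x. x \<notin> K \<Longrightarrow> g x = 0"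
    by (rule C1c_support[OF \<phi>]) blast
  obtain s T where st: "0 < s" "s \<le> T" "\<And>t \<theta>. t \<notin> {s<..<T} \<Longrightarrow> logpolar t \<theta> \<notin> K"
    by (rule compact_annulus[OF K(1,2)]) blast
  note [measurable] = C1c_measurable[OF \<phi>] borel_measurable_ground_dev[OF C1c_measurable[OF \<phi>], of a]
  define F where "F x = ennreal (ground_dev a \<phi> g x) + ennreal (a * (1 - a)) * ennreal (leray_weight x * (\<phi> x)\<^sup>2)" for x
  have c: "0 \<le> a * (1 - a)" using a by simp
  have F: "F x = ennreal (ground_dev a \<phi> g x + a * (1 - a) * (leray_weight x * (\<phi> x)\<^sup>2))" for x
    using c ground_dev_nonneg[of a \<phi> g x] leray_weight_nonneg[of x]
    by (simp add: F_def ennreal_mult[symmetric] ennreal_plus[symmetric] del: ennreal_plus)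
  have [measurable]: "F \<in> borel_measurable borel" unfolding F_def[abs_def] by measurable
  have "(\<integral>\<^sup>+x\<in>B1. ennreal ((g x \<bullet> x)\<^sup>2 / (norm x)\<^sup>2) \<partial>lborel) = (\<integral>\<^sup>+x\<in>B1. F x \<partial>lborel)"
  proof (subst (1 2) nn_integral_logpolar_swap)
    show "(\<integral>\<^sup>+\<theta>\<in>{0<..<2*pi}. (\<integral>\<^sup>+t\<in>{0<..}. ennreal ((g (logpolar t \<theta>) \<bullet> logpolar t \<theta>)\<^sup>2 / (norm (logpolar t \<theta>))\<^sup>2) * ennreal (exp (- 2 * t)) \<partial>lborel) \<partial>lborel)
      = (\<integral>\<^sup>+\<theta>\<in>{0<..<2*pi}. (\<integral>\<^sup>+t\<in>{0<..}. F (logpolar t \<theta>) * ennreal (exp (- 2 * t)) \<partial>lborel) \<partial>lborel)"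
    proof (rule nn_integral_cong)
      fix \<theta> :: real
      define w where "w t = \<phi> (logpolar t \<theta>)" for t
      define w' where "w' t = - (g (logpolar t \<theta>) \<bullet> logpolar t \<theta>)" for t
      have der: "(w has_real_derivative w' t) (at t within S)" for t S
        unfolding w_def w'_def by (rule DERIV_along_logpolar[OF C1c_derivative[OF \<phi>]])
      have cw: "continuous_on S w" for S using der by (rule DERIV_continuous_on)
      have cw': "continuous_on S w'" for S unfolding w'_def
        by (intro continuous_intros continuous_on_logpolar continuous_on_compose2[OF C1c_continuous(2)[OF \<phi>, of UNIV]]) auto
      have z: "w t = 0" "w' t = 0" if "t \<notin> {s<..<T}" for t
        using K st(3)[OF that] by (auto simp: w_def w'_def)
      have nz: "\<And>t. t \<in> {s..T} \<Longrightarrow> t \<noteq> 0" using st by auto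
      have "ennreal ((g (logpolar t \<theta>) \<bullet> logpolar t \<theta>)\<^sup>2 / (norm (logpolar t \<theta>))\<^sup>2) * ennreal (exp (- 2 * t)) = ennreal ((w' t)\<^sup>2)" for t
        by (subst ennreal_mult[symmetric]) (simp_all only: exp_norm_logpolar, simp_all add: w'_def)
      then have "(\<integral>\<^sup>+t\<in>{0<..}. ennreal ((g (logpolar t \<theta>) \<bullet> logpolar t \<theta>)\<^sup>2 / (norm (logpolar t \<theta>))\<^sup>2) * ennreal (exp (- 2 * t)) \<partial>lborel)
        = (\<integral>\<^sup>+t\<in>{0<..}. ennreal ((w' t)\<^sup>2) \<partial>lborel)" by simp
      also have "\<dots> = ennreal (integral {s..T} (\<lambda>t. (w' t)\<^sup>2))"
        by (rule nn_integral_eq_integral_support) (use st z in \<open>auto intro!: continuous_intros cw'\<close>)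
      also have "integral {s..T} (\<lambda>t. (w' t)\<^sup>2) = integral {s..T} (\<lambda>t. (w' t - a * w t / t)\<^sup>2) + a * (1 - a) * integral {s..T} (\<lambda>t. (w t)\<^sup>2 / t\<^sup>2)"
        using ground_state_1d[OF st(1,2) der cw', of a] z by simp
      also have "\<dots> = integral {s..T} (\<lambda>t. (w' t - a * w t / t)\<^sup>2 + a * (1 - a) * ((w t)\<^sup>2 / t\<^sup>2))"
      proof -
        have i1: "(\<lambda>t. (w' t - a * w t / t)\<^sup>2) integrable_on {s..T}" and i2: "(\<lambda>t. (w t)\<^sup>2 / t\<^sup>2) integrable_on {s..T}"
          by (intro integrable_continuous_real continuous_intros cw cw'; use nz in force)+
        show ?thesis
          unfolding Henstock_Kurzweil_Integration.integral_add[OF i1 integrable_on_mult_right[OF i2]]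
            Henstock_Kurzweil_Integration.integral_mult_right ..
      qed
      also have "ennreal \<dots> = (\<integral>\<^sup>+t\<in>{0<..}. ennreal ((w' t - a * w t / t)\<^sup>2 + a * (1 - a) * ((w t)\<^sup>2 / t\<^sup>2)) \<partial>lborel)"
      proof (rule nn_integral_eq_integral_support[symmetric])
        show "continuous_on {s..T} (\<lambda>t. (w' t - a * w t / t)\<^sup>2 + a * (1 - a) * ((w t)\<^sup>2 / t\<^sup>2))"
          by (intro continuous_intros cw cw'; use nz in force)
        show "0 \<le> (w' t - a * w t / t)\<^sup>2 + a * (1 - a) * ((w t)\<^sup>2 / t\<^sup>2)" for t using c by simp
      qed (use st z in auto)
      also have "\<dots> = (\<integral>\<^sup>+t\<in>{0<..}. F (logpolar t \<theta>) * ennreal (exp (- 2 * t)) \<partial>lborel)"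
      proof (rule nn_integral_cong)
        fix t :: real
        have "F (logpolar t \<theta>) * ennreal (exp (- 2 * t)) = ennreal ((ground_dev a \<phi> g (logpolar t \<theta>) + a * (1 - a) * (leray_weight (logpolar t \<theta>) * (\<phi> (logpolar t \<theta>))\<^sup>2)) * exp (- 2 * t))"
          unfolding F using c ground_dev_nonneg[of a \<phi> g "logpolar t \<theta>"] leray_weight_nonneg[of "logpolar t \<theta>"]
          by (intro ennreal_mult[symmetric]) auto
        also have "(ground_dev a \<phi> g (logpolar t \<theta>) + a * (1 - a) * (leray_weight (logpolar t \<theta>) * (\<phi> (logpolar t \<theta>))\<^sup>2)) * exp (- 2 * t)
          = ground_dev a \<phi> g (logpolar t \<theta>) * exp (- 2 * t) + a * (1 - a) * (w t)\<^sup>2 * (leray_weight (logpolar t \<theta>) * exp (- 2 * t))"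
          by (simp add: w_def algebra_simps)
        also have "\<dots> = (w' t - a * w t / t)\<^sup>2 + a * (1 - a) * ((w t)\<^sup>2 / t\<^sup>2)"
        proof -
          have "ground_dev a \<phi> g (logpolar t \<theta>) * exp (- 2 * t) = (g (logpolar t \<theta>) \<bullet> logpolar t \<theta> + a * \<phi> (logpolar t \<theta>) / t)\<^sup>2"
            unfolding ground_dev_def exp_norm_logpolar by simp
          also have "\<dots> = (w' t - a * w t / t)\<^sup>2" by (simp add: w_def w'_def power2_eq_square algebra_simps)
          finally show ?thesis unfolding leray_weight_logpolar by simp
        qed
        finally show "ennreal ((w' t - a * w t / t)\<^sup>2 + a * (1 - a) * ((w t)\<^sup>2 / t\<^sup>2)) * indicator {0<..} t
          = F (logpolar t \<theta>) * ennreal (exp (- 2 * t)) * indicator {0<..} t" by simp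
      qed
      finally show "(\<integral>\<^sup>+t\<in>{0<..}. ennreal ((g (logpolar t \<theta>) \<bullet> logpolar t \<theta>)\<^sup>2 / (norm (logpolar t \<theta>))\<^sup>2) * ennreal (exp (- 2 * t)) \<partial>lborel) * indicator {0<..<2*pi} \<theta>
        = (\<integral>\<^sup>+t\<in>{0<..}. F (logpolar t \<theta>) * ennreal (exp (- 2 * t)) \<partial>lborel) * indicator {0<..<2*pi} \<theta>" by simp
    qed
  qed measurable
  also have "\<dots> = (\<integral>\<^sup>+x. ennreal (ground_dev a \<phi> g x) * indicator B1 x + ennreal (a * (1 - a)) * (ennreal (leray_weight x * (\<phi> x)\<^sup>2) * indicator B1 x) \<partial>lborel)"
    by (simp only: F_def distrib_right mult.assoc)
  also have "\<dots> = (\<integral>\<^sup>+x\<in>B1. ennreal (ground_dev a \<phi> g x) \<partial>lborel)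
     + ennreal (a * (1 - a)) * (\<integral>\<^sup>+x\<in>B1. ennreal (leray_weight x * (\<phi> x)\<^sup>2) \<partial>lborel)"
    by (subst nn_integral_add; measurable?) (subst nn_integral_cmult; measurable?)
  finally show ?thesis .
qed

text \<open>The radial part of the gradient is at most the full gradient, by Cauchy-Schwarz for
  \<open>g x\<close> and the direction of \<open>x\<close>.\<close>

lemma leray_inequality:
  assumes \<phi>: "C1c (B1 - {0}) \<phi> g" and a: "0 \<le> a" "a \<le> 1"
  shows "(\<integral>\<^sup>+x\<in>B1. ennreal (ground_dev a \<phi> g x) \<partial>lborel)
     + ennreal (a * (1 - a)) * (\<integral>\<^sup>+x\<in>B1. ennreal (leray_weight x * (\<phi> x)\<^sup>2) \<partial>lborel)
     \<le> (\<integral>\<^sup>+x. ennreal ((norm (g x))\<^sup>2) \<partial>lborel)"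
proof -
  have "(g x \<bullet> x)\<^sup>2 / (norm x)\<^sup>2 \<le> (norm (g x))\<^sup>2" for x
  proof (cases "x = 0")
    case False
    have "\<bar>g x \<bullet> x\<bar>\<^sup>2 \<le> (norm (g x) * norm x)\<^sup>2" by (intro power_mono Cauchy_Schwarz_ineq2) simp
    then show ?thesis using False by (simp add: field_simps power_mult_distrib)
  qed simp
  then have "(\<integral>\<^sup>+x\<in>B1. ennreal ((g x \<bullet> x)\<^sup>2 / (norm x)\<^sup>2) \<partial>lborel) \<le> (\<integral>\<^sup>+x. ennreal ((norm (g x))\<^sup>2) \<partial>lborel)"
    by (intro nn_integral_mono) (auto simp: indicator_def intro: ennreal_leI)
  then show ?thesis unfolding ground_state_plane[OF assms] .
qed

lemma ennreal_add_le_imp: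
  assumes "x + ennreal b \<le> ennreal c" "0 \<le> b" shows "x \<le> ennreal (c - b)"
proof (cases x)
  case (real r)
  then have le: "ennreal (r + b) \<le> ennreal c" using assms by (simp add: ennreal_plus)
  show ?thesis
  proof (cases "0 \<le> c")
    case True
    then have "r + b \<le> c" using le by simp
    then show ?thesis using real by (auto intro: ennreal_leI)
  next
    case False
    then have "ennreal (r + b) = 0" using le by (simp add: ennreal_neg)
    then have "r = 0" using real assms by simp
    then show ?thesis using real by simp
  qed
qed (use assms in \<open>simp add: top_unique\<close>)

lemma AE_lborel_nonzero: "AE x in lborel. x \<noteq> (0 :: plane)" by (rule AE_lborel_singleton)

section \<open>The potential and the energy of test functions\<close>

locale leray_potential =
  fixes \<mu> :: real and V :: "real \<Rightarrow> real"
  assumes mu: "- 1 / 4 < \<mu>" "\<mu> < 0"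
    and V_cont: "continuous_on {0<..<1} V"
    and V_nonneg: "\<And>r. 0 < r \<Longrightarrow> r < 1 \<Longrightarrow> 0 \<le> V r"
    and V_le: "\<And>r. 0 < r \<Longrightarrow> r < 1 \<Longrightarrow> V r \<le> 1 / (r\<^sup>2 * (- ln r)\<^sup>2)"
begin

text \<open>The values of \<open>V\<close> outside the open unit interval are unspecified; the
  extension by 0 is Borel measurable on the plane and lets potential integrals run over all of
  it.\<close>

definition W :: "plane \<Rightarrow> real" where "W x = indicator (B1 - {0}) x * V (norm x)"

lemma W_measurable [measurable]: "W \<in> borel_measurable borel"
proof -
  have "continuous_on (B1 - {0}) (\<lambda>x. V (norm x))"
    by (rule continuous_on_compose2[OF V_cont]) (auto intro!: continuous_intros)
  then have "(\<lambda>x. indicator (B1 - {0}) x *\<^sub>R V (norm x)) \<in> borel_measurable borel"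
    by (intro borel_measurable_continuous_on_indicator) auto
  then show ?thesis by (simp add: W_def[abs_def])
qed

lemma W_nonneg: "0 \<le> W x" using V_nonneg[of "norm x"] by (auto simp: W_def indicator_def)

lemma W_le: "W x \<le> leray_weight x"
  using V_le[of "norm x"] leray_weight_nonneg[of x] by (auto simp: W_def indicator_def leray_weight_def)

lemma W_outside: "x \<notin> B1 \<Longrightarrow> W x = 0" by (simp add: W_def)

definition D :: "(plane \<Rightarrow> plane) \<Rightarrow> real" where "D g = (\<integral>x. (norm (g x))\<^sup>2 \<partial>lborel)"
definition P :: "(plane \<Rightarrow> real) \<Rightarrow> real" where "P u = (\<integral>x. W x * (u x)\<^sup>2 \<partial>lborel)"

lemma D_integrable:
  assumes "C1c (B1 - {0}) \<phi> g" shows "integrable lborel (\<lambda>x. (norm (g x))\<^sup>2)"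
proof -
  obtain K where K: "compact K" "\<And>x. x \<notin> K \<Longrightarrow> g x = 0" by (rule C1c_support[OF assms]) blast
  show ?thesis
    by (rule integrable_continuous_compact_support[OF _ K(1)])
       (use K C1c_continuous[OF assms] in \<open>auto intro!: continuous_intros\<close>)
qed

lemma D_nonneg: "0 \<le> D g" unfolding D_def by (intro integral_nonneg_AE) simp
lemma P_nonneg: "0 \<le> P g" unfolding P_def using W_nonneg by (intro integral_nonneg_AE) simp

lemma nn_D:
  assumes "C1c (B1 - {0}) \<phi> g" shows "(\<integral>\<^sup>+x. ennreal ((norm (g x))\<^sup>2) \<partial>lborel) = ennreal (D g)"
  unfolding D_def by (intro nn_integral_eq_integral D_integrable[OF assms]) simp

lemma nn_W_le:
  "(\<integral>\<^sup>+x. ennreal (W x * (u x)\<^sup>2) \<partial>lborel) \<le> (\<integral>\<^sup>+x\<in>B1. ennreal (leray_weight x * (u x)\<^sup>2) \<partial>lborel)"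
  using W_le W_outside by (intro nn_integral_mono) (auto simp: indicator_def intro!: ennreal_leI mult_right_mono)

text \<open>\<open>a = 1/2\<close> maximizes \<open>a * (1 - a)\<close>, and the maximal value 1/4
  gives the constant 4.\<close>

lemma nn_W_le_D:
  assumes "C1c (B1 - {0}) \<phi> g" shows "(\<integral>\<^sup>+x. ennreal (W x * (\<phi> x)\<^sup>2) \<partial>lborel) \<le> ennreal (4 * D g)"
proof -
  let ?X = "(\<integral>\<^sup>+x\<in>B1. ennreal (leray_weight x * (\<phi> x)\<^sup>2) \<partial>lborel)"
  have "ennreal (1/2 * (1 - 1/2)) * ?X \<le> (\<integral>\<^sup>+x\<in>B1. ennreal (ground_dev (1/2) \<phi> g x) \<partial>lborel) + ennreal (1/2 * (1 - 1/2)) * ?X"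
    by simp
  also have "\<dots> \<le> ennreal (D g)"
    using leray_inequality[OF assms, of "1/2"] unfolding nn_D[OF assms] by simp
  finally have "ennreal 4 * (ennreal (1/4) * ?X) \<le> ennreal 4 * ennreal (D g)" by (intro mult_left_mono) simp_all
  then have "?X \<le> ennreal (4 * D g)"
    using D_nonneg by (simp only: mult.assoc[symmetric] ennreal_mult[symmetric]) simp
  then show ?thesis using nn_W_le order_trans by blast
qed

lemma P_integrable:
  assumes "C1c (B1 - {0}) \<phi> g" shows "integrable lborel (\<lambda>x. W x * (\<phi> x)\<^sup>2)"
proof (rule integrableI_nonneg)
  show "(\<lambda>x. W x * (\<phi> x)\<^sup>2) \<in> borel_measurable lborel" using C1c_measurable(1)[OF assms] by measurable
  show "(\<integral>\<^sup>+x. ennreal (W x * (\<phi> x)\<^sup>2) \<partial>lborel) < \<infinity>" using nn_W_le_D[OF assms] by (simp add: le_less_trans)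
qed (simp add: W_nonneg)

lemma nn_P:
  assumes "C1c (B1 - {0}) \<phi> g" shows "(\<integral>\<^sup>+x. ennreal (W x * (\<phi> x)\<^sup>2) \<partial>lborel) = ennreal (P \<phi>)"
  unfolding P_def by (intro nn_integral_eq_integral P_integrable[OF assms]) (simp add: W_nonneg)

lemma P_le_D: assumes "C1c (B1 - {0}) \<phi> g" shows "P \<phi> \<le> 4 * D g"
  using nn_W_le_D[OF assms] unfolding nn_P[OF assms] by (simp add: D_nonneg)

text \<open>\<open>energy\<close> is a Lebesgue integral of representatives fixed only modulo null
  sets. Borel representatives move it to \<open>lborel\<close>, and the integrability of both terms
  allows it to be split.\<close>

lemma energy_eq:
  assumes S: "S \<in> sets borel" "S \<subseteq> B1" and m[measurable]: "u1 \<in> borel_measurable borel" "G \<in> borel_measurable borel"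
    and u: "AE x in lebesgue. x \<in> B1 \<longrightarrow> u x = u1 x" and G': "AE x in lebesgue. x \<in> B1 \<longrightarrow> G' x = G x"
    and int: "integrable lborel (\<lambda>x. (norm (G x))\<^sup>2)" "integrable lborel (\<lambda>x. W x * (u1 x)\<^sup>2)"
  shows "energy V \<mu> S u G' = (\<integral>x. indicator S x * (norm (G x))\<^sup>2 \<partial>lborel) + \<mu> * (\<integral>x. indicator S x * (W x * (u1 x)\<^sup>2) \<partial>lborel)"
proof -
  define h where "h = (\<lambda>x. indicator S x * (norm (G x))\<^sup>2 + \<mu> * (indicator S x * (W x * (u1 x)\<^sup>2)))"
  have [measurable]: "S \<in> sets borel" by (rule S)
  have i: "integrable lborel (\<lambda>x. indicator S x * (norm (G x))\<^sup>2)" "integrable lborel (\<lambda>x. indicator S x * (W x * (u1 x)\<^sup>2))"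
    using integrable_mult_indicator[OF _ int(1), of S] integrable_mult_indicator[OF _ int(2), of S] S by simp_all
  then have hm: "h \<in> borel_measurable lborel" unfolding h_def by (intro borel_measurable_add borel_measurable_times borel_measurable_const) auto
  have ae: "AE x in lebesgue. h x = indicator S x *\<^sub>R ((norm (G' x))\<^sup>2 + \<mu> * V (norm x) * (u x)\<^sup>2)"
    using u G' AE_completion[OF AE_lborel_nonzero]
  proof eventually_elim
    case (elim x)
    then show ?case using S by (cases "x \<in> S") (auto simp: h_def W_def)
  qed
  have "energy V \<mu> S u G' = (\<integral>x. h x \<partial>lebesgue)"
    unfolding energy_def set_lebesgue_integral_def
    by (rule integral_cong_AE) (use ae borel_measurable_AE[OF measurable_completion[OF hm] ae] measurable_completion[OF hm] in \<open>auto elim: eventually_mono\<close>)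
  also have "\<dots> = (\<integral>x. h x \<partial>lborel)" by (rule integral_completion[OF hm])
  also have "\<dots> = (\<integral>x. indicator S x * (norm (G x))\<^sup>2 \<partial>lborel) + \<mu> * (\<integral>x. indicator S x * (W x * (u1 x)\<^sup>2) \<partial>lborel)"
    unfolding h_def using i by simp
  finally show ?thesis .
qed

lemma energy_B1_eq:
  assumes m: "u1 \<in> borel_measurable borel" "G \<in> borel_measurable borel"
    and u: "AE x in lebesgue. x \<in> B1 \<longrightarrow> u x = u1 x" and G': "AE x in lebesgue. x \<in> B1 \<longrightarrow> G' x = G x"
    and out: "AE x in lborel. x \<notin> B1 \<longrightarrow> G x = 0"
    and int: "integrable lborel (\<lambda>x. (norm (G x))\<^sup>2)" "integrable lborel (\<lambda>x. W x * (u1 x)\<^sup>2)"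
  shows "energy V \<mu> B1 u G' = D G + \<mu> * P u1"
proof -
  have "(\<integral>x. indicator B1 x * (norm (G x))\<^sup>2 \<partial>lborel) = D G" unfolding D_def
    by (rule integral_cong_AE) (use out m in \<open>auto simp: indicator_def elim!: eventually_mono\<close>)
  moreover have "(\<lambda>x. indicator B1 x * (W x * (u1 x)\<^sup>2)) = (\<lambda>x. W x * (u1 x)\<^sup>2)"
    using W_outside by (auto simp: indicator_def fun_eq_iff)
  ultimately show ?thesis using energy_eq[OF sets_B1 order_refl m u G' int] by (simp add: P_def)
qed

lemma energy_test:
  assumes "C1c (B1 - {0}) \<phi> g" shows "energy V \<mu> B1 \<phi> g = D g + \<mu> * P \<phi>"
proof -
  obtain K where K: "K \<subseteq> B1 - {0}" "\<And>x. x \<notin> K \<Longrightarrow> g x = 0" by (rule C1c_support[OF assms]) blast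
  have "AE x in lborel. x \<notin> B1 \<longrightarrow> g x = 0" by (rule AE_I2) (use K in blast)
  then show ?thesis
    by (rule energy_B1_eq[rotated 4]) (use C1c_measurable[OF assms] D_integrable[OF assms] P_integrable[OF assms] in auto)
qed

text \<open>Coercivity: the factor equals \<open>l\<^sup>2\<close> and is positive, so sequences
  that are Cauchy for the energy have gradients that are Cauchy in L2.\<close>

lemma energy_test_ge: assumes "C1c (B1 - {0}) \<phi> g" shows "(1 + 4 * \<mu>) * D g \<le> energy V \<mu> B1 \<phi> g"
proof -
  have "(- \<mu>) * P \<phi> \<le> (- \<mu>) * (4 * D g)" using mu P_le_D[OF assms] by (intro mult_left_mono) auto
  then show ?thesis unfolding energy_test[OF assms] by (simp add: algebra_simps)
qed

definition l :: real where "l = sqrt (1 + 4 * \<mu>)"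
definition a :: real where "a = (1 - l) / 2"

lemma l: "0 < l" "l < 1" "l\<^sup>2 = 1 + 4 * \<mu>"
  using mu by (auto simp: l_def real_sqrt_lt_1_iff)

lemma a: "0 \<le> a" "a \<le> 1" "a * (1 - a) = - \<mu>"
proof -
  have "a * (1 - a) = (1 - l\<^sup>2) / 4" by (simp add: a_def power2_eq_square field_simps)
  then show "a * (1 - a) = - \<mu>" by (simp add: l(3))
qed (use l in \<open>auto simp: a_def\<close>)

text \<open>Because \<open>a * (1 - a) = - \<mu>\<close>, the Leray term in
  \<open>leray_inequality\<close> is at least the potential term that the energy subtracts.\<close>

lemma ground_dev_le_energy:
  assumes "C1c (B1 - {0}) \<phi> g"
  shows "(\<integral>\<^sup>+x\<in>B1. ennreal (ground_dev a \<phi> g x) \<partial>lborel) \<le> ennreal (energy V \<mu> B1 \<phi> g)"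
proof -
  have "(\<integral>\<^sup>+x\<in>B1. ennreal (ground_dev a \<phi> g x) \<partial>lborel) + ennreal (- \<mu> * P \<phi>)
    = (\<integral>\<^sup>+x\<in>B1. ennreal (ground_dev a \<phi> g x) \<partial>lborel) + ennreal (- \<mu>) * (\<integral>\<^sup>+x. ennreal (W x * (\<phi> x)\<^sup>2) \<partial>lborel)"
    using mu P_nonneg by (subst ennreal_mult) (auto simp: nn_P[OF assms])
  also have "\<dots> \<le> (\<integral>\<^sup>+x\<in>B1. ennreal (ground_dev a \<phi> g x) \<partial>lborel) + ennreal (- \<mu>) * (\<integral>\<^sup>+x\<in>B1. ennreal (leray_weight x * (\<phi> x)\<^sup>2) \<partial>lborel)"
    by (intro add_left_mono mult_left_mono nn_W_le) simp
  also have "\<dots> \<le> ennreal (D g)" using leray_inequality[OF assms a(1,2)] unfolding a(3) nn_D[OF assms] .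
  finally show ?thesis
    using ennreal_add_le_imp[of _ "- \<mu> * P \<phi>" "D g"] mu P_nonneg by (simp add: energy_test[OF assms] mult_nonpos_nonneg)
qed

lemma test_norm_eq:
  assumes "\<phi> \<in> Cc_infty (B1 - {0})" shows "test_norm V \<mu> \<phi> = sqrt (D (grad \<phi>) + \<mu> * P \<phi>)"
  unfolding test_norm_def energy_test[OF C1c_Cc_infty[OF assms]] ..

end

section \<open>Weak gradients and elements of the completion\<close>

lemma locally_integrable_L2:
  fixes f :: "plane \<Rightarrow> 'b::euclidean_space"
  assumes f1: "f1 \<in> borel_measurable borel" "integrable lborel (\<lambda>x. (norm (f1 x))\<^sup>2)"
    and ae: "AE x in lebesgue. x \<in> B1 \<longrightarrow> f x = f1 x"
  shows "locally_integrable_on_B1 f"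
  unfolding locally_integrable_on_B1_def set_integrable_def
proof (intro allI impI)
  fix K :: "plane set" assume K: "compact K" "K \<subseteq> B1"
  have Kb: "K \<in> sets borel" using K by (simp add: borel_compact)
  have i: "integrable lborel (\<lambda>x. indicator K x *\<^sub>R f1 x)"
  proof (rule Bochner_Integration.integrable_bound)
    have "emeasure lborel K < \<infinity>" using emeasure_bounded_finite[OF compact_imp_bounded[OF K(1)]] .
    then have "integrable lborel (indicator K :: plane \<Rightarrow> real)" using Kb by simp
    then show "integrable lborel (\<lambda>x. indicator K x + (norm (f1 x))\<^sup>2)" using f1(2) by simp
    show "(\<lambda>x. indicator K x *\<^sub>R f1 x) \<in> borel_measurable lborel" using Kb f1 by simp
    have "t \<le> 1 + t\<^sup>2" for t :: real
      using zero_le_power2[of "t - 1/2"] by (simp add: power2_eq_square algebra_simps)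
    then show "AE x in lborel. norm (indicator K x *\<^sub>R f1 x) \<le> norm (indicator K x + (norm (f1 x))\<^sup>2)"
      by (intro AE_I2) (auto simp: indicator_def)
  qed
  have m: "(\<lambda>x. indicator K x *\<^sub>R f1 x) \<in> borel_measurable lborel" using i by simp
  have ae': "AE x in lebesgue. indicator K x *\<^sub>R f1 x = indicator K x *\<^sub>R f x"
    using ae by eventually_elim (use K in \<open>auto simp: indicator_def\<close>)
  have "integrable lebesgue (\<lambda>x. indicator K x *\<^sub>R f1 x)" using i integrable_completion[OF m] by simp
  then show "integrable lebesgue (\<lambda>x. indicator K x *\<^sub>R f x)"
    by (rule integrable_cong_AE_imp)
       (use ae' borel_measurable_AE[OF measurable_completion[OF m] ae'] in \<open>auto elim: eventually_mono\<close>)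
qed

lemma weak_grad_unique:
  assumes "is_weak_grad u G" "is_weak_grad u G'"
  shows "AE x in lebesgue. x \<in> B1 \<longrightarrow> G x = G' x"
proof -
  have "AE x in lebesgue. x \<in> B1 \<longrightarrow> G x $ i - G' x $ i = 0" for i
  proof (rule fundamental_lemma)
    have comp: "set_integrable lebesgue K (\<lambda>x. H x $ i)" if "locally_integrable_on_B1 H" "compact K" "K \<subseteq> B1" for H :: "plane \<Rightarrow> plane" and K
    proof -
      have "integrable lebesgue (\<lambda>x. (indicator K x *\<^sub>R H x) \<bullet> axis i 1)"
        using that by (intro integrable_inner_left) (auto simp: locally_integrable_on_B1_def set_integrable_def)
      then show ?thesis by (simp add: set_integrable_def inner_axis)
    qed
    have G: "locally_integrable_on_B1 G" "locally_integrable_on_B1 G'" using assms by (auto simp: is_weak_grad_def)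
    show "set_integrable lebesgue K (\<lambda>x. G x $ i - G' x $ i)" if "compact K" "K \<subseteq> B1" for K
      using comp[OF G(1) that] comp[OF G(2) that] by (rule set_integral_diff(1))
    fix \<phi> assume \<phi>: "\<phi> \<in> Cc_infty B1"
    note c = C1c_Cc_infty[OF \<phi>]
    obtain K where K: "compact K" "K \<subseteq> B1" "\<And>x. x \<notin> K \<Longrightarrow> \<phi> x = 0" by (rule C1c_support[OF c]) blast
    obtain B where B: "\<And>x. \<bar>\<phi> x\<bar> \<le> B" by (rule C1c_bounded[OF c]) blast
    have int: "set_integrable lebesgue B1 (\<lambda>x. H x $ i * \<phi> x)" if "locally_integrable_on_B1 H" for H :: "plane \<Rightarrow> plane"
    proof -
      have k: "integrable lebesgue (\<lambda>x. indicator K x *\<^sub>R H x $ i)"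
        using comp[OF that K(1,2)] by (simp add: set_integrable_def)
      have \<phi>m: "\<phi> \<in> borel_measurable lebesgue" using C1c_measurable(1)[OF c] by (simp add: measurable_completion)
      have "integrable lebesgue (\<lambda>x. \<phi> x * (indicator K x *\<^sub>R H x $ i))"
      proof (rule Bochner_Integration.integrable_bound[OF integrable_mult_right[OF k, of B]])
        show "(\<lambda>x. \<phi> x * (indicator K x *\<^sub>R H x $ i)) \<in> borel_measurable lebesgue" using \<phi>m k by (intro borel_measurable_times) auto
        show "AE x in lebesgue. norm (\<phi> x * (indicator K x *\<^sub>R H x $ i)) \<le> norm (B * (indicator K x *\<^sub>R H x $ i))"
          using B by (intro AE_I2) (auto simp: abs_mult intro!: mult_right_mono order_trans[OF B abs_ge_self])
      qed
      also have "(\<lambda>x. \<phi> x * (indicator K x *\<^sub>R H x $ i)) = (\<lambda>x. indicator B1 x *\<^sub>R (H x $ i * \<phi> x))"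
        using K by (auto simp: indicator_def fun_eq_iff)
      finally show ?thesis unfolding set_integrable_def .
    qed
    have "(LINT x:B1|lebesgue. G x $ i * \<phi> x) = (LINT x:B1|lebesgue. G' x $ i * \<phi> x)"
    proof -
      have "(LINT x:B1|lebesgue. u x * pderiv_at i \<phi> x) = - (LINT x:B1|lebesgue. G x $ i * \<phi> x)"
        "(LINT x:B1|lebesgue. u x * pderiv_at i \<phi> x) = - (LINT x:B1|lebesgue. G' x $ i * \<phi> x)"
        using assms \<phi> unfolding is_weak_grad_def by blast+
      then show ?thesis by simp
    qed
    then show "(LINT x:B1|lebesgue. (G x $ i - G' x $ i) * \<phi> x) = 0"
      using set_integral_diff(2)[OF int[OF G(1)] int[OF G(2)]] by (simp add: left_diff_distrib)
  qed
  then have "AE x in lebesgue. \<forall>i. x \<in> B1 \<longrightarrow> G x $ i - G' x $ i = 0" by (subst AE_all_countable) auto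
  then show ?thesis by eventually_elim (auto simp: vec_eq_iff)
qed

text \<open>One known weak gradient justifies the choice in \<open>weak_grad\<close>; with
  \<open>weak_grad_unique\<close> every integral of the chosen one can then be computed.\<close>

lemma is_weak_grad_weak_grad: "is_weak_grad u G \<Longrightarrow> is_weak_grad u (weak_grad u)"
  unfolding weak_grad_def using someI[of "is_weak_grad u" G] .

lemma set_lebesgue_integral_B1_eq:
  fixes f :: "plane \<Rightarrow> real"
  assumes [measurable]: "f \<in> borel_measurable borel" and "\<And>x. x \<notin> B1 \<Longrightarrow> f x = 0"
  shows "(LINT x:B1|lebesgue. f x) = (\<integral>x. f x \<partial>lborel)"
proof -
  have "(\<lambda>x. indicator B1 x *\<^sub>R f x) = f" using assms(2) by (auto simp: indicator_def fun_eq_iff)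
  then show ?thesis unfolding set_lebesgue_integral_def by (simp add: integral_completion)
qed

context leray_potential
begin

lemma is_weak_grad_test:
  assumes "C1c B1 \<phi> g" shows "is_weak_grad \<phi> g"
  unfolding is_weak_grad_def
proof (intro conjI ballI allI)
  obtain K where K: "compact K" "K \<subseteq> B1" "\<And>x. x \<notin> K \<Longrightarrow> \<phi> x = 0" "\<And>x. x \<notin> K \<Longrightarrow> g x = 0" by (rule C1c_support[OF assms]) blast
  show "locally_integrable_on_B1 \<phi>"
    by (rule locally_integrable_L2[OF C1c_measurable(1)[OF assms]])
       (auto intro!: integrable_continuous_compact_support[OF _ K(1)] continuous_intros C1c_continuous[OF assms] simp: K)
  show "locally_integrable_on_B1 g"
    by (rule locally_integrable_L2[OF C1c_measurable(2)[OF assms]])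
       (auto intro!: integrable_continuous_compact_support[OF _ K(1)] continuous_intros C1c_continuous[OF assms] simp: K)
  fix \<psi> i assume "\<psi> \<in> Cc_infty B1"
  note \<psi> = C1c_Cc_infty[OF this]
  have e: "grad \<psi> x $ i = pderiv_at i \<psi> x" for x by (simp add: grad_def)
  note ibp = integration_by_parts[OF assms C1c_derivative[OF \<psi>] C1c_continuous(2)[OF \<psi>], of i]
  have "(LINT x:B1|lebesgue. \<phi> x * pderiv_at i \<psi> x) = (\<integral>x. \<phi> x * grad \<psi> x $ i \<partial>lborel)"
    unfolding e[symmetric]
  proof (rule set_lebesgue_integral_B1_eq)
    show "\<phi> x * grad \<psi> x $ i = 0" if "x \<notin> B1" for x using K(3)[OF contra_subsetD[OF K(2) that]] by simp
  qed (use ibp in auto)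
  moreover have "(LINT x:B1|lebesgue. g x $ i * \<psi> x) = (\<integral>x. g x $ i * \<psi> x \<partial>lborel)"
  proof (rule set_lebesgue_integral_B1_eq)
    show "g x $ i * \<psi> x = 0" if "x \<notin> B1" for x using K(4)[OF contra_subsetD[OF K(2) that]] by simp
  qed (use ibp in auto)
  ultimately show "(LINT x:B1|lebesgue. \<phi> x * pderiv_at i \<psi> x) = - (LINT x:B1|lebesgue. g x $ i * \<psi> x)"
    using ibp(1) by simp
qed

lemma weak_grad_test:
  assumes "C1c B1 \<phi> g" shows "AE x in lebesgue. x \<in> B1 \<longrightarrow> weak_grad \<phi> x = g x"
  using weak_grad_unique[OF is_weak_grad_weak_grad[OF is_weak_grad_test[OF assms]] is_weak_grad_test[OF assms]] .

lemma H_space_test: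
  assumes \<phi>: "\<phi> \<in> Cc_infty (B1 - {0})" shows "\<phi> \<in> H_space V \<mu>"
  unfolding H_space_def mem_Collect_eq
proof (intro conjI exI[of _ "\<lambda>n. \<phi>"])
  have "\<phi> \<in> borel_measurable borel" by (rule C1c_measurable(1)[OF C1c_Cc_infty[OF \<phi>]])
  then show "\<phi> \<in> borel_measurable (lebesgue_on B1)"
    by (intro measurable_restrict_space1 measurable_completion) simp
  have "((\<lambda>x :: plane. 0) has_derivative (\<lambda>h. 0 \<bullet> h)) (at x)" for x by simp
  then have "grad (\<lambda>x. 0) = (\<lambda>x. 0)" using grad_eq by blast
  then have "test_norm V \<mu> (\<lambda>x. \<phi> x - \<phi> x) = 0"
    by (simp add: test_norm_def energy_def set_lebesgue_integral_def)
  then show "test_Cauchy V \<mu> (\<lambda>n. \<phi>)" using \<phi> by (simp add: test_Cauchy_def)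
qed simp

lemma integral_tendsto_of_L2:
  fixes f :: "nat \<Rightarrow> plane \<Rightarrow> real"
  assumes [measurable]: "\<And>n. f n \<in> borel_measurable borel" "u \<in> borel_measurable borel"
    and lim: "(\<lambda>n. \<integral>\<^sup>+x. ennreal ((f n x - u x)\<^sup>2) \<partial>lborel) \<longlonglongrightarrow> 0"
    and int: "\<And>n. integrable lborel (\<lambda>x. (f n x)\<^sup>2)"
    and \<psi>: "\<psi> \<in> borel_measurable borel" "integrable lborel (\<lambda>x. (\<psi> x)\<^sup>2)"
  shows "(\<lambda>n. \<integral>x. f n x * \<psi> x \<partial>lborel) \<longlonglongrightarrow> (\<integral>x. u x * \<psi> x \<partial>lborel)"
proof -
  note [measurable] = \<psi>(1)
  have lim': "(\<lambda>n. \<integral>\<^sup>+x. ennreal ((norm (f n x - u x))\<^sup>2) \<partial>lborel) \<longlonglongrightarrow> 0" using lim by simp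
  have uint: "integrable lborel (\<lambda>x. (u x)\<^sup>2)"
    using L2_norm_tendsto(1)[OF _ _ _ lim'] int by simp
  define d where "d n = (\<integral>x. (f n x - u x)\<^sup>2 \<partial>lborel)" for n
  have dint: "integrable lborel (\<lambda>x. (f n x - u x)\<^sup>2)" for n
  proof (rule Bochner_Integration.integrable_bound)
    show "integrable lborel (\<lambda>x. 2 * (f n x)\<^sup>2 + 2 * (u x)\<^sup>2)" using int uint by simp
    have "(s - t)\<^sup>2 \<le> 2 * s\<^sup>2 + 2 * t\<^sup>2" for s t :: real
      using zero_le_power2[of "s + t"] by (simp add: power2_eq_square algebra_simps)
    then show "AE x in lborel. norm ((f n x - u x)\<^sup>2) \<le> norm (2 * (f n x)\<^sup>2 + 2 * (u x)\<^sup>2)" by simp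
  qed simp
  have "(\<lambda>n. enn2real (\<integral>\<^sup>+x. ennreal ((f n x - u x)\<^sup>2) \<partial>lborel)) \<longlonglongrightarrow> enn2real 0"
    using lim by (intro tendsto_enn2real) auto
  then have d0: "d \<longlonglongrightarrow> 0" by (simp add: d_def[abs_def] integral_eq_nn_integral)
  have bound: "norm ((\<integral>x. f n x * \<psi> x \<partial>lborel) - (\<integral>x. u x * \<psi> x \<partial>lborel)) \<le> sqrt (d n * (\<integral>x. (\<psi> x)\<^sup>2 \<partial>lborel))" for n
  proof -
    have "(\<integral>x. f n x * \<psi> x \<partial>lborel) - (\<integral>x. u x * \<psi> x \<partial>lborel) = (\<integral>x. (f n x - u x) * \<psi> x \<partial>lborel)"
      using cauchy_schwarz_integral(1)[of "f n" lborel \<psi>] cauchy_schwarz_integral(1)[of u lborel \<psi>] int uint \<psi>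
      by (simp add: left_diff_distrib)
    moreover have "(\<integral>x. (f n x - u x) * \<psi> x \<partial>lborel)\<^sup>2 \<le> d n * (\<integral>x. (\<psi> x)\<^sup>2 \<partial>lborel)"
      unfolding d_def using dint \<psi> by (intro cauchy_schwarz_integral(2)) auto
    ultimately show ?thesis using real_le_rsqrt[of "\<bar>_\<bar>"] by (simp add: real_le_rsqrt)
  qed
  have "(\<lambda>n. sqrt (d n * (\<integral>x. (\<psi> x)\<^sup>2 \<partial>lborel))) \<longlonglongrightarrow> sqrt (0 * (\<integral>x. (\<psi> x)\<^sup>2 \<partial>lborel))"
    by (intro tendsto_intros d0)
  then have "(\<lambda>n. sqrt (d n * (\<integral>x. (\<psi> x)\<^sup>2 \<partial>lborel))) \<longlonglongrightarrow> 0" by simp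
  then have "(\<lambda>n. (\<integral>x. f n x * \<psi> x \<partial>lborel) - (\<integral>x. u x * \<psi> x \<partial>lborel)) \<longlonglongrightarrow> 0"
    by (rule Lim_null_comparison[OF always_eventually, rotated]) (use bound in blast)
  then show ?thesis by (simp add: LIM_zero_iff)
qed

text \<open>Connects the function space with test functions. By coercivity the gradients of a Cauchy
  sequence converge in L2 to some \<open>G\<close>, which is a weak gradient of \<open>u\<close>; by
  Leray's inequality the potential terms converge too. So \<open>H_norm\<close>, defined through
  \<open>weak_grad\<close>, is the limit of the test norms. The Borel function \<open>u1\<close>
  stands for \<open>u\<close> on the disc.\<close>

lemma H_space_approx:
  assumes u: "u \<in> H_space V \<mu>"
  obtains \<phi> u1 where "\<And>n. \<phi> n \<in> Cc_infty (B1 - {0})" "u1 \<in> borel_measurable borel"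
    "AE x in lebesgue. x \<in> B1 \<longrightarrow> u x = u1 x"
    "(\<lambda>n. \<integral>\<^sup>+x. ennreal ((\<phi> n x - u1 x)\<^sup>2) \<partial>lborel) \<longlonglongrightarrow> 0"
    "(\<lambda>n. test_norm V \<mu> (\<phi> n)) \<longlonglongrightarrow> H_norm V \<mu> u"
proof -
  obtain \<phi> where um: "u \<in> borel_measurable (lebesgue_on B1)" and TC: "test_Cauchy V \<mu> \<phi>"
    and lim0: "(\<lambda>n. \<integral>\<^sup>+x\<in>B1. ennreal ((\<phi> n x - u x)\<^sup>2) \<partial>lebesgue) \<longlonglongrightarrow> 0"
    using u unfolding H_space_def by blast
  have \<phi>: "\<phi> n \<in> Cc_infty (B1 - {0})" for n using TC by (simp add: test_Cauchy_def)
  define g where "g n = grad (\<phi> n)" for n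
  have c: "C1c (B1 - {0}) (\<phi> n) (g n)" for n unfolding g_def by (rule C1c_Cc_infty[OF \<phi>])
  have c1: "C1c B1 (\<phi> n) (g n)" for n using c by (rule C1c_mono) auto
  have out: "\<phi> n x = 0" "g n x = 0" if "x \<notin> B1" for n x
  proof -
    obtain K where "K \<subseteq> B1" "\<And>x. x \<notin> K \<Longrightarrow> \<phi> n x = 0" "\<And>x. x \<notin> K \<Longrightarrow> g n x = 0"
      by (rule C1c_support[OF c1[of n]]) blast
    then show "\<phi> n x = 0" "g n x = 0" using that by blast+
  qed
  have [measurable]: "\<phi> n \<in> borel_measurable borel" "g n \<in> borel_measurable borel" for n
    using C1c_measurable[OF c] by auto
  have "(\<lambda>x. indicator B1 x *\<^sub>R u x) \<in> borel_measurable lebesgue"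
    using um by (subst (asm) borel_measurable_restrict_space_iff) auto
  from completion_ex_borel_measurable_real[OF this]
  obtain u1 where u1': "u1 \<in> borel_measurable lborel" and ae0: "AE x in lborel. indicator B1 x *\<^sub>R u x = u1 x"
    by blast
  have u1[measurable]: "u1 \<in> borel_measurable borel" using u1' by simp
  have ae: "AE x in lebesgue. x \<in> B1 \<longrightarrow> u x = u1 x"
    using AE_completion[OF ae0] by eventually_elim auto
  have lim: "(\<lambda>n. \<integral>\<^sup>+x. ennreal ((\<phi> n x - u1 x)\<^sup>2) \<partial>lborel) \<longlonglongrightarrow> 0"
  proof -
    have "(\<integral>\<^sup>+x\<in>B1. ennreal ((\<phi> n x - u x)\<^sup>2) \<partial>lebesgue) = (\<integral>\<^sup>+x. ennreal ((\<phi> n x - u1 x)\<^sup>2) \<partial>lborel)" for n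
      unfolding nn_integral_completion
    proof (rule nn_integral_cong_AE)
      show "AE x in lborel. ennreal ((\<phi> n x - u x)\<^sup>2) * indicator B1 x = ennreal ((\<phi> n x - u1 x)\<^sup>2)"
        using ae0
      proof eventually_elim
        case (elim x)
        then show ?case using out(1)[of x n] by (cases "x \<in> B1") auto
      qed
    qed
    then show ?thesis using lim0 by simp
  qed
  have diffD: "(\<integral>\<^sup>+x. ennreal ((norm (g m x - g n x))\<^sup>2) \<partial>lborel) = ennreal (D (\<lambda>x. g m x - g n x))" for m n
    by (rule nn_D[OF C1c_diff[OF c c]])
  have gd: "grad (\<lambda>x. \<phi> m x - \<phi> n x) = (\<lambda>x. g m x - g n x)" for m n
    using grad_eq[OF C1c_derivative[OF C1c_diff[OF c c]]] by blast
  have Cauchy: "\<exists>N. \<forall>m\<ge>N. \<forall>n\<ge>N. D (\<lambda>x. g m x - g n x) \<le> e" if "e > 0" for e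
  proof -
    have p: "0 < 1 + 4 * \<mu>" using mu by simp
    have "sqrt ((1 + 4 * \<mu>) * e) > 0" using p that by simp
    then obtain N where N: "\<And>m n. m \<ge> N \<Longrightarrow> n \<ge> N \<Longrightarrow> test_norm V \<mu> (\<lambda>x. \<phi> m x - \<phi> n x) < sqrt ((1 + 4 * \<mu>) * e)"
      using TC unfolding test_Cauchy_def by blast
    have "D (\<lambda>x. g m x - g n x) \<le> e" if "m \<ge> N" "n \<ge> N" for m n
    proof -
      have "energy V \<mu> B1 (\<lambda>x. \<phi> m x - \<phi> n x) (\<lambda>x. g m x - g n x) < (1 + 4 * \<mu>) * e"
        using N[OF that] unfolding test_norm_def gd by simp
      then have "(1 + 4 * \<mu>) * D (\<lambda>x. g m x - g n x) \<le> (1 + 4 * \<mu>) * e"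
        using energy_test_ge[OF C1c_diff[OF c[of m] c[of n]]] by linarith
      then show ?thesis using p by simp
    qed
    then show ?thesis by blast
  qed
  obtain G where G[measurable]: "G \<in> borel_measurable borel" and Glim: "(\<lambda>n. \<integral>\<^sup>+x. ennreal ((norm (g n x - G x))\<^sup>2) \<partial>lborel) \<longlonglongrightarrow> 0"
  proof (rule L2_complete[of g lborel])
    show "\<exists>N. \<forall>m\<ge>N. \<forall>n\<ge>N. (\<integral>\<^sup>+x. ennreal ((norm (g m x - g n x))\<^sup>2) \<partial>lborel) \<le> ennreal e" if "e > 0" for e
      unfolding diffD using Cauchy[OF that] ennreal_leI by blast
  qed auto
  have DG: "integrable lborel (\<lambda>x. (norm (G x))\<^sup>2)" "(\<lambda>n. D (g n)) \<longlonglongrightarrow> D G"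
    unfolding D_def using L2_norm_tendsto[OF _ _ D_integrable[OF c] Glim] by simp_all
  obtain r where r: "strict_mono r" "AE x in lborel. (\<lambda>k. \<phi> (r k) x) \<longlonglongrightarrow> u1 x"
    by (rule AE_subseq_L2[of \<phi> lborel u1]) (use lim in auto)
  \<comment> \<open>The root of the potential as a factor turns the potential term into a squared L2
    norm, to which \<open>L2_norm_tendsto\<close> applies.\<close>
  define F where "F n x = sqrt (W x) * \<phi> n x" for n x
  define F1 where "F1 x = sqrt (W x) * u1 x" for x
  have [measurable]: "F n \<in> borel_measurable borel" "F1 \<in> borel_measurable borel" for n
    unfolding F_def[abs_def] F1_def[abs_def] by measurable
  have Flim: "(\<lambda>n. \<integral>\<^sup>+x. ennreal ((norm (F n x - F1 x))\<^sup>2) \<partial>lborel) \<longlonglongrightarrow> 0"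
  proof (rule order_tendstoI)
    fix b :: ennreal assume "0 < b"
    then obtain e where e: "e > 0" "ennreal e < b"
      by (metis dense ennreal_cases ennreal_less_zero_iff less_top_ennreal not_less_iff_gr_or_eq top_greatest leD)
    \<comment> \<open>The quarter compensates the constant 4 in \<open>nn_W_le_D\<close>.\<close>
    obtain N where N: "\<And>m n. m \<ge> N \<Longrightarrow> n \<ge> N \<Longrightarrow> D (\<lambda>x. g m x - g n x) \<le> e / 4" using Cauchy[of "e / 4"] e by auto
    have "(\<integral>\<^sup>+x. ennreal ((norm (F n x - F1 x))\<^sup>2) \<partial>lborel) \<le> ennreal e" if n: "n \<ge> N" for n
    proof (rule nn_integral_fatou_AE)
      show "AE x in lborel. (\<lambda>k. ennreal ((norm (F n x - F (r k) x))\<^sup>2)) \<longlonglongrightarrow> ennreal ((norm (F n x - F1 x))\<^sup>2)"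
        using r(2) by eventually_elim (unfold F_def F1_def, intro tendsto_intros)
      show "eventually (\<lambda>k. (\<integral>\<^sup>+x. ennreal ((norm (F n x - F (r k) x))\<^sup>2) \<partial>lborel) \<le> ennreal e) sequentially"
        using eventually_ge_at_top[of N]
      proof eventually_elim
        case (elim k)
        then have rk: "r k \<ge> N" using seq_suble[OF r(1), of k] by linarith
        have "(norm (F n x - F (r k) x))\<^sup>2 = W x * (\<phi> n x - \<phi> (r k) x)\<^sup>2" for x
          using W_nonneg[of x] by (simp add: F_def right_diff_distrib[symmetric] power_mult_distrib)
        then have "(\<integral>\<^sup>+x. ennreal ((norm (F n x - F (r k) x))\<^sup>2) \<partial>lborel) \<le> ennreal (4 * D (\<lambda>x. g n x - g (r k) x))"
          using nn_W_le_D[OF C1c_diff[OF c[of n] c[of "r k"]]] by simp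
        also have "\<dots> \<le> ennreal e" using N[OF n rk] by (intro ennreal_leI) simp
        finally show ?case .
      qed
    qed auto
    then show "eventually (\<lambda>n. (\<integral>\<^sup>+x. ennreal ((norm (F n x - F1 x))\<^sup>2) \<partial>lborel) < b) sequentially"
      using e(2) by (auto simp: eventually_sequentially intro: le_less_trans)
  qed simp
  have sq: "(norm (F n x))\<^sup>2 = W x * (\<phi> n x)\<^sup>2" "(norm (F1 x))\<^sup>2 = W x * (u1 x)\<^sup>2" for n x
    using W_nonneg[of x] by (simp_all add: F_def F1_def power_mult_distrib)
  have Pu: "integrable lborel (\<lambda>x. W x * (u1 x)\<^sup>2)" "(\<lambda>n. P (\<phi> n)) \<longlonglongrightarrow> P u1"
    unfolding P_def using L2_norm_tendsto[of F lborel F1, OF _ _ _ Flim, unfolded sq] P_integrable[OF c] by simp_all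
  have i\<phi>: "integrable lborel (\<lambda>x. (\<phi> n x)\<^sup>2)" for n
  proof -
    obtain K where K: "compact K" "\<And>x. x \<notin> K \<Longrightarrow> \<phi> n x = 0" by (rule C1c_support[OF c]) blast
    show ?thesis
      by (rule integrable_continuous_compact_support[OF _ K(1)]) (use K in \<open>auto intro!: continuous_intros C1c_continuous(1)[OF c]\<close>)
  qed
  have iu: "integrable lborel (\<lambda>x. (u1 x)\<^sup>2)"
    using L2_norm_tendsto(1)[of \<phi> lborel u1] lim i\<phi> by simp
  obtain q where q: "strict_mono q" "AE x in lborel. (\<lambda>k. g (q k) x) \<longlonglongrightarrow> G x"
    by (rule AE_subseq_L2[of g lborel G]) (use Glim in auto)
  have Gout: "AE x in lborel. x \<notin> B1 \<longrightarrow> G x = 0" using q(2)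
  proof eventually_elim
    case (elim x)
    show ?case
    proof
      assume "x \<notin> B1"
      then have "(\<lambda>k. 0) \<longlonglongrightarrow> G x" using elim out(2) by simp
      from LIMSEQ_unique[OF this tendsto_const] show "G x = 0" .
    qed
  qed
  \<comment> \<open>Integration by parts holds for every approximating function, and both sides are
    L2 pairings with a fixed test function, hence pass to the limit.\<close>
  have wg: "is_weak_grad u G"
    unfolding is_weak_grad_def
  proof (intro conjI ballI allI)
    show "locally_integrable_on_B1 u" by (rule locally_integrable_L2[OF u1 _ ae]) (use iu in simp)
    show "locally_integrable_on_B1 G" by (rule locally_integrable_L2[OF G DG(1)]) simp
    fix \<psi> i assume "\<psi> \<in> Cc_infty B1"
    note \<psi> = C1c_Cc_infty[OF this]
    obtain K where K: "compact K" "K \<subseteq> B1" "\<And>x. x \<notin> K \<Longrightarrow> \<psi> x = 0" "\<And>x. x \<notin> K \<Longrightarrow> grad \<psi> x = 0" by (rule C1c_support[OF \<psi>]) blast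
    have Kout: "\<psi> x = 0" "grad \<psi> x = 0" if "x \<notin> B1" for x
      using K(3,4)[OF contra_subsetD[OF K(2) that]] by auto
    have e: "pderiv_at i \<psi> x = grad \<psi> x $ i" for x by (simp add: grad_def)
    have [measurable]: "\<psi> \<in> borel_measurable borel" "grad \<psi> \<in> borel_measurable borel" using C1c_measurable[OF \<psi>] by auto
    have [measurable]: "(\<lambda>x. grad \<psi> x $ i) \<in> borel_measurable borel"
      using measurable_compose[OF \<open>grad \<psi> \<in> borel_measurable borel\<close> borel_measurable_vec_nth] .
    have nth [measurable]: "(\<lambda>x. H x $ i) \<in> borel_measurable borel" if "H \<in> borel_measurable borel" for H :: "plane \<Rightarrow> plane"
      using measurable_compose[OF that borel_measurable_vec_nth] .
    have 1: "(LINT x:B1|lebesgue. u x * pderiv_at i \<psi> x) = (\<integral>x. u1 x * grad \<psi> x $ i \<partial>lborel)"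
    proof -
      have "(LINT x:B1|lebesgue. u x * pderiv_at i \<psi> x) = (LINT x:B1|lebesgue. u1 x * grad \<psi> x $ i)"
      proof -
        have aei: "AE x in lebesgue. indicator B1 x *\<^sub>R (u1 x * grad \<psi> x $ i) = indicator B1 x *\<^sub>R (u x * pderiv_at i \<psi> x)"
          using ae by eventually_elim (auto simp: e indicator_def)
        have m: "(\<lambda>x. indicator B1 x *\<^sub>R (u1 x * grad \<psi> x $ i)) \<in> borel_measurable lebesgue"
          by (intro measurable_completion) simp
        show ?thesis unfolding set_lebesgue_integral_def
          by (rule integral_cong_AE[symmetric]) (use m borel_measurable_AE[OF m aei] aei in auto)
      qed
      also have "\<dots> = (\<integral>x. u1 x * grad \<psi> x $ i \<partial>lborel)"
        by (rule set_lebesgue_integral_B1_eq) (use Kout in auto)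
      finally show ?thesis .
    qed
    have 2: "(LINT x:B1|lebesgue. G x $ i * \<psi> x) = (\<integral>x. G x $ i * \<psi> x \<partial>lborel)"
      by (rule set_lebesgue_integral_B1_eq) (use Kout G nth in auto)
    have l1: "(\<lambda>n. \<integral>x. \<phi> n x * grad \<psi> x $ i \<partial>lborel) \<longlonglongrightarrow> (\<integral>x. u1 x * grad \<psi> x $ i \<partial>lborel)"
    proof (rule integral_tendsto_of_L2[OF _ u1 lim i\<phi>])
      show "integrable lborel (\<lambda>x. (grad \<psi> x $ i)\<^sup>2)"
        by (rule integrable_continuous_compact_support[OF _ K(1)]) (use K in \<open>auto intro!: continuous_intros C1c_continuous(2)[OF \<psi>]\<close>)
    qed auto
    have l2: "(\<lambda>n. \<integral>x. g n x $ i * \<psi> x \<partial>lborel) \<longlonglongrightarrow> (\<integral>x. G x $ i * \<psi> x \<partial>lborel)"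
    proof (rule integral_tendsto_of_L2)
      show "integrable lborel (\<lambda>x. (\<psi> x)\<^sup>2)"
        by (rule integrable_continuous_compact_support[OF _ K(1)]) (use K in \<open>auto intro!: continuous_intros C1c_continuous(1)[OF \<psi>]\<close>)
      have le: "(x $ i)\<^sup>2 \<le> (norm x)\<^sup>2" for x :: plane
        using power_mono[OF component_le_norm_cart[of x i] abs_ge_zero, of 2] by simp
      show "integrable lborel (\<lambda>x. (g n x $ i)\<^sup>2)" for n
        by (rule Bochner_Integration.integrable_bound[OF D_integrable[OF c[of n]]]) (use le nth in auto)
      show "(\<lambda>n. \<integral>\<^sup>+x. ennreal ((g n x $ i - G x $ i)\<^sup>2) \<partial>lborel) \<longlonglongrightarrow> 0"
      proof (rule tendsto_sandwich[OF always_eventually always_eventually tendsto_const Glim]; intro allI)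
        show "(\<integral>\<^sup>+x. ennreal ((g n x $ i - G x $ i)\<^sup>2) \<partial>lborel) \<le> (\<integral>\<^sup>+x. ennreal ((norm (g n x - G x))\<^sup>2) \<partial>lborel)" for n
          using le[of "g n _ - G _"] by (intro nn_integral_mono ennreal_leI) (simp add: vector_minus_component[symmetric] del: vector_minus_component)
      qed simp
    qed (use nth in auto)
    have "(\<integral>x. \<phi> n x * grad \<psi> x $ i \<partial>lborel) = - (\<integral>x. g n x $ i * \<psi> x \<partial>lborel)" for n
      by (rule integration_by_parts(1)[OF c C1c_derivative[OF \<psi>] C1c_continuous(2)[OF \<psi>]])
    then have "(\<lambda>n. \<integral>x. \<phi> n x * grad \<psi> x $ i \<partial>lborel) \<longlonglongrightarrow> - (\<integral>x. G x $ i * \<psi> x \<partial>lborel)"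
      using tendsto_minus[OF l2] by simp
    then show "(LINT x:B1|lebesgue. u x * pderiv_at i \<psi> x) = - (LINT x:B1|lebesgue. G x $ i * \<psi> x)"
      unfolding 1 2 by (rule LIMSEQ_unique[OF l1])
  qed
  have wgG: "AE x in lebesgue. x \<in> B1 \<longrightarrow> weak_grad u x = G x"
    by (rule weak_grad_unique[OF is_weak_grad_weak_grad[OF wg] wg])
  have "H_norm V \<mu> u = sqrt (D G + \<mu> * P u1)"
    unfolding H_norm_def using energy_B1_eq[OF u1 G ae wgG Gout DG(1) Pu(1)] by simp
  moreover have "(\<lambda>n. test_norm V \<mu> (\<phi> n)) \<longlonglongrightarrow> sqrt (D G + \<mu> * P u1)"
    unfolding test_norm_eq[OF \<phi>] g_def[symmetric] by (intro tendsto_intros DG Pu)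
  ultimately show ?thesis using that[OF \<phi> u1 ae lim] by simp
qed

end

section \<open>Radial functions\<close>

lemma borel_measurable_logpolar_fst_snd:
  fixes f :: "plane \<Rightarrow> 'b::topological_space"
  assumes "f \<in> borel_measurable borel"
  shows "(\<lambda>p. f (logpolar (fst p) (snd p))) \<in> borel_measurable (lborel \<Otimes>\<^sub>M lborel)"
  by (rule measurable_compose[OF borel_measurable_logpolar assms]) measurable

lemma borel_measurable_logpolar_section:
  fixes f :: "plane \<Rightarrow> 'b::topological_space"
  assumes "f \<in> borel_measurable borel"
  shows "(\<lambda>\<theta>. f (logpolar t \<theta>)) \<in> borel_measurable borel"
  using measurable_compose[OF borel_measurable_logpolar[OF borel_measurable_const measurable_ident_sets[OF refl]] assms] by simp

lemma borel_measurable_circle_integral: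
  fixes f :: "plane \<Rightarrow> ennreal"
  assumes "f \<in> borel_measurable borel"
  shows "(\<lambda>t. \<integral>\<^sup>+\<theta>\<in>{0<..<2*pi}. f (logpolar t \<theta>) \<partial>lborel) \<in> borel_measurable borel"
proof -
  have "(\<lambda>(t, \<theta>). f (logpolar t \<theta>) * indicator {0<..<2*pi} \<theta>) \<in> borel_measurable (lborel \<Otimes>\<^sub>M lborel)"
    unfolding split_beta by (intro borel_measurable_times_ennreal borel_measurable_logpolar_fst_snd assms; measurable)
  then show ?thesis using lborel.borel_measurable_nn_integral by auto
qed

text \<open>A null set of the disc meets almost every circle in a null set of angles, since its
  measure is an integral of circle measures with a positive factor.\<close>

lemma AE_logpolar:
  assumes "AE x in lborel. x \<in> B1 \<longrightarrow> Q x"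
  shows "AE t in lborel. 0 < t \<longrightarrow> (AE \<theta> in lborel. \<theta> \<in> {0<..<2*pi} \<longrightarrow> Q (logpolar t \<theta>))"
proof -
  obtain Z where Z: "Z \<in> null_sets lborel" "{x \<in> space lborel. \<not> (x \<in> B1 \<longrightarrow> Q x)} \<subseteq> Z"
    using assms unfolding eventually_ae_filter by blast
  have Zb: "Z \<in> sets borel" using Z by auto
  have im: "(indicator Z :: plane \<Rightarrow> ennreal) \<in> borel_measurable borel" using Zb by simp
  let ?I = "\<lambda>t. \<integral>\<^sup>+\<theta>\<in>{0<..<2*pi}. indicator Z (logpolar t \<theta>) \<partial>lborel"
  have Im: "?I \<in> borel_measurable borel" by (rule borel_measurable_circle_integral[OF im])
  have "(\<integral>\<^sup>+x\<in>B1. indicator Z x \<partial>lborel) \<le> (\<integral>\<^sup>+x. indicator Z x \<partial>lborel)"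
    by (intro nn_integral_mono) (auto simp: indicator_def)
  also have "\<dots> = 0" using Zb null_setsD1[OF Z(1)] by simp
  finally have "(\<integral>\<^sup>+t\<in>{0<..}. ?I t * ennreal (exp (- 2 * t)) \<partial>lborel) = 0"
    unfolding nn_integral_logpolar[OF im] by simp
  then have "AE t in lborel. ?I t * ennreal (exp (- 2 * t)) * indicator {0<..} t = 0"
    by (subst (asm) nn_integral_0_iff_AE) (use Im in auto)
  then show ?thesis
  proof eventually_elim
    case (elim t)
    show ?case
    proof
      assume t: "0 < t"
      then have "?I t = 0" using elim by (auto simp: ennreal_eq_0_iff)
      then have "AE \<theta> in lborel. indicator Z (logpolar t \<theta>) * indicator {0<..<2*pi} \<theta> = (0 :: ennreal)"
        by (subst (asm) nn_integral_0_iff_AE)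
           (use borel_measurable_logpolar_section[OF im, of t] in auto)
      then show "AE \<theta> in lborel. \<theta> \<in> {0<..<2*pi} \<longrightarrow> Q (logpolar t \<theta>)"
      proof eventually_elim
        case (elim \<theta>)
        show ?case
        proof
          assume "\<theta> \<in> {0<..<2*pi}"
          then have "logpolar t \<theta> \<notin> Z" using elim by (auto simp: indicator_def split: if_splits)
          then have "logpolar t \<theta> \<notin> {x \<in> space lborel. \<not> (x \<in> B1 \<longrightarrow> Q x)}" using Z(2) by blast
          then show "Q (logpolar t \<theta>)" using t by simp
        qed
      qed
    qed
  qed
qed

lemma continuous_on_logpolar2: "continuous_on S (\<lambda>\<theta>. logpolar t \<theta>)"
proof -
  have "(\<lambda>\<theta>. logpolar t \<theta>) = (\<lambda>\<theta>. (exp (- t) * cos \<theta>) *\<^sub>R axis 1 1 + (exp (- t) * sin \<theta>) *\<^sub>R axis 2 1)"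
    by (auto simp: vec_eq_iff forall_2 axis_def fun_eq_iff)
  then show ?thesis by (simp add: continuous_intros)
qed

lemma continuous_on_logpolar_pair: "continuous_on (S :: (real \<times> real) set) (\<lambda>p. logpolar (fst p) (snd p))"
proof -
  have eq: "logpolar (fst p) (snd p) = (exp (- fst p) * cos (snd p)) *\<^sub>R axis 1 1 + (exp (- fst p) * sin (snd p)) *\<^sub>R axis 2 1" for p :: "real \<times> real"
    by (auto simp: vec_eq_iff forall_2 axis_def)
  show ?thesis unfolding eq by (intro continuous_intros)
qed

lemma circle_nn_integral:
  fixes h :: "real \<Rightarrow> real"
  assumes "continuous_on {0..2*pi} h" "\<And>\<theta>. 0 \<le> h \<theta>"
  shows "(\<integral>\<^sup>+\<theta>\<in>{0<..<2*pi}. ennreal (h \<theta>) \<partial>lborel) = ennreal (integral {0..2*pi} h)"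
proof (rule nn_integral_has_integral_lebesgue')
  have "(h has_integral integral {0..2*pi} h) {0..2*pi}"
    using assms by (intro integrable_integral integrable_continuous_real)
  then show "(h has_integral integral {0..2*pi} h) {0<..<2*pi}" by (simp only: has_integral_Icc_iff_Ioo)
qed (use assms in auto)

definition circle_avg :: "(plane \<Rightarrow> real) \<Rightarrow> real \<Rightarrow> real" where
  "circle_avg f t = integral {0..2*pi} (\<lambda>\<theta>. f (logpolar t \<theta>)) / (2 * pi)"

text \<open>Jensen's inequality on a circle, for the mean around any centre \<open>c\<close>:
  \<open>c = 0\<close> serves the energy estimate, and \<open>c\<close> equal to the value of the
  radial limit serves convergence.\<close>

lemma circle_avg_sq_le:
  fixes f :: "plane \<Rightarrow> real"
  assumes f: "continuous_on UNIV f"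
  shows "ennreal ((circle_avg f t - c)\<^sup>2) \<le> ennreal (1 / (2 * pi)) * (\<integral>\<^sup>+\<theta>\<in>{0<..<2*pi}. ennreal ((f (logpolar t \<theta>) - c)\<^sup>2) \<partial>lborel)"
proof -
  have cf: "continuous_on {0..2*pi} (\<lambda>\<theta>. f (logpolar t \<theta>) - c)"
    by (intro continuous_intros continuous_on_compose2[OF f continuous_on_logpolar2]) auto
  have cf0: "continuous_on {0..2*pi} (\<lambda>\<theta>. f (logpolar t \<theta>))"
    by (intro continuous_on_compose2[OF f continuous_on_logpolar2]) auto
  have "integral {0..2*pi} (\<lambda>\<theta>. f (logpolar t \<theta>) - c) = integral {0..2*pi} (\<lambda>\<theta>. f (logpolar t \<theta>)) - 2 * pi * c"
    by (subst Henstock_Kurzweil_Integration.integral_diff) (auto intro: integrable_continuous_real cf0)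
  then have e: "circle_avg f t - c = integral {0..2*pi} (\<lambda>\<theta>. f (logpolar t \<theta>) - c) / (2 * pi)"
    by (simp add: circle_avg_def field_simps)
  have "(integral {0..2*pi} (\<lambda>\<theta>. (f (logpolar t \<theta>) - c) * 1))\<^sup>2
    \<le> integral {0..2*pi} (\<lambda>\<theta>. (f (logpolar t \<theta>) - c)\<^sup>2) * integral {0..2*pi} (\<lambda>\<theta>. 1\<^sup>2)"
    by (intro cauchy_schwarz_continuous cf continuous_intros)
  then have "(circle_avg f t - c)\<^sup>2 \<le> 1 / (2 * pi) * integral {0..2*pi} (\<lambda>\<theta>. (f (logpolar t \<theta>) - c)\<^sup>2)"
    unfolding e by (simp add: field_simps power2_eq_square)
  then have "ennreal ((circle_avg f t - c)\<^sup>2) \<le> ennreal (1 / (2 * pi)) * ennreal (integral {0..2*pi} (\<lambda>\<theta>. (f (logpolar t \<theta>) - c)\<^sup>2))"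
    by (subst ennreal_mult[symmetric]) (auto intro!: ennreal_leI integral_nonneg integrable_continuous_real continuous_intros cf)
  then show ?thesis by (subst circle_nn_integral) (auto intro!: continuous_intros cf)
qed

lemma circle_avg_has_derivative:
  assumes f: "\<And>x. (f has_derivative (\<lambda>h. g x \<bullet> h)) (at x)" and g: "continuous_on UNIV g"
  shows "(circle_avg f has_real_derivative circle_avg (\<lambda>x. - (g x \<bullet> x)) t) (at t)"
    "continuous_on S (circle_avg (\<lambda>x. - (g x \<bullet> x)))"
proof -
  have cf: "continuous_on UNIV f" by (rule has_derivative_continuous_on[of _ _ "\<lambda>x h. g x \<bullet> h"]) (simp add: f)
  have c2: "continuous_on (UNIV \<times> cbox 0 (2 * pi)) (\<lambda>(t, \<theta>). - (g (logpolar t \<theta>) \<bullet> logpolar t \<theta>))"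
    unfolding split_beta
    by (intro continuous_intros continuous_on_compose2[OF g continuous_on_logpolar_pair] continuous_on_logpolar_pair) auto
  have "((\<lambda>t. integral (cbox 0 (2*pi)) (\<lambda>\<theta>. f (logpolar t \<theta>))) has_real_derivative
     integral (cbox 0 (2*pi)) (\<lambda>\<theta>. - (g (logpolar t \<theta>) \<bullet> logpolar t \<theta>))) (at t within UNIV)"
  proof (rule leibniz_rule_field_derivative[OF _ _ c2])
    show "((\<lambda>t. f (logpolar t \<theta>)) has_real_derivative - (g (logpolar t \<theta>) \<bullet> logpolar t \<theta>)) (at t within UNIV)" for t \<theta>
      by (rule DERIV_along_logpolar[OF f])
    show "(\<lambda>\<theta>. f (logpolar t \<theta>)) integrable_on cbox 0 (2*pi)" for t
      by (intro integrable_continuous continuous_on_compose2[OF cf continuous_on_logpolar2]) auto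
  qed auto
  then show "(circle_avg f has_real_derivative circle_avg (\<lambda>x. - (g x \<bullet> x)) t) (at t)"
    unfolding circle_avg_def[abs_def] by (intro DERIV_cdivide) simp
  have "continuous_on UNIV (\<lambda>t. integral (cbox 0 (2*pi)) (\<lambda>\<theta>. - (g (logpolar t \<theta>) \<bullet> logpolar t \<theta>)))"
    using integral_continuous_on_param[of UNIV 0 "2*pi" "\<lambda>t \<theta>. - (g (logpolar t \<theta>) \<bullet> logpolar t \<theta>)"] c2 by simp
  then have "continuous_on UNIV (circle_avg (\<lambda>x. - (g x \<bullet> x)))"
    unfolding circle_avg_def[abs_def] by (intro continuous_intros) auto
  then show "continuous_on S (circle_avg (\<lambda>x. - (g x \<bullet> x)))" using continuous_on_subset by blast
qed

context leray_potential
begin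

text \<open>By Jensen's inequality, averaging over circles does not increase the integral of the
  deviation from the ground state. So the one-dimensional bound becomes available for approximating
  functions that are not radial.\<close>

lemma hardy_1d_circle_avg:
  assumes \<phi>: "C1c (B1 - {0}) \<phi> g" and E: "energy V \<mu> B1 \<phi> g \<le> 1"
  shows "\<exists>t0. hardy_1d l a (circle_avg \<phi>) (circle_avg (\<lambda>x. - (g x \<bullet> x))) t0"
proof -
  obtain K where K: "compact K" "K \<subseteq> B1 - {0}" "\<And>x. x \<notin> K \<Longrightarrow> \<phi> x = 0" by (rule C1c_support[OF \<phi>]) blast
  obtain s T where st: "0 < s" "s \<le> T" "\<And>t \<theta>. t \<notin> {s<..<T} \<Longrightarrow> logpolar t \<theta> \<notin> K"
    by (rule compact_annulus[OF K(1,2)]) blast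
  let ?w = "circle_avg \<phi>" and ?w' = "circle_avg (\<lambda>x. - (g x \<bullet> x))"
  note der = circle_avg_has_derivative[OF C1c_derivative[OF \<phi>] C1c_continuous(2)[OF \<phi>]]
  note cg = C1c_continuous(2)[OF \<phi>, of UNIV] and c\<phi> = C1c_continuous(1)[OF \<phi>, of UNIV]
  have cw: "continuous_on S ?w" for S
    by (rule DERIV_continuous_on[of _ _ ?w']) (rule DERIV_subset[OF der(1) subset_UNIV])
  have "ennreal ((?w' t - a * ?w t / t)\<^sup>2) \<le> ennreal (1 / (2 * pi)) * ((\<integral>\<^sup>+\<theta>\<in>{0<..<2*pi}. ennreal (ground_dev a \<phi> g (logpolar t \<theta>)) \<partial>lborel) * ennreal (exp (- 2 * t)))"
    if t: "t > 0" for t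
  proof -
    \<comment> \<open>On a circle \<open>a / t\<close> is constant, so the deviation of the mean is
      the mean of this function.\<close>
    define k where "k x = - (g x \<bullet> x) - (a / t) * \<phi> x" for x
    have ck: "continuous_on UNIV k" unfolding k_def by (intro continuous_intros cg c\<phi>)
    have "?w' t - a * ?w t / t = circle_avg k t"
    proof -
      have i: "(\<lambda>\<theta>. - (g (logpolar t \<theta>) \<bullet> logpolar t \<theta>)) integrable_on {0..2*pi}" "(\<lambda>\<theta>. \<phi> (logpolar t \<theta>)) integrable_on {0..2*pi}"
        by (intro integrable_continuous_real continuous_intros continuous_on_logpolar2 continuous_on_compose2[OF cg continuous_on_logpolar2] continuous_on_compose2[OF c\<phi> continuous_on_logpolar2]; simp)+
      have "integral {0..2*pi} (\<lambda>\<theta>. k (logpolar t \<theta>)) = integral {0..2*pi} (\<lambda>\<theta>. - (g (logpolar t \<theta>) \<bullet> logpolar t \<theta>)) - (a / t) * integral {0..2*pi} (\<lambda>\<theta>. \<phi> (logpolar t \<theta>))"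
        unfolding k_def Henstock_Kurzweil_Integration.integral_diff[OF i(1) integrable_on_mult_right[OF i(2)]]
          Henstock_Kurzweil_Integration.integral_mult_right ..
      then show ?thesis by (simp add: circle_avg_def diff_divide_distrib)
    qed
    then have "ennreal ((?w' t - a * ?w t / t)\<^sup>2) \<le> ennreal (1 / (2 * pi)) * (\<integral>\<^sup>+\<theta>\<in>{0<..<2*pi}. ennreal ((k (logpolar t \<theta>))\<^sup>2) \<partial>lborel)"
      using circle_avg_sq_le[OF ck, of t 0] by simp
    also have "(\<integral>\<^sup>+\<theta>\<in>{0<..<2*pi}. ennreal ((k (logpolar t \<theta>))\<^sup>2) \<partial>lborel)
       = (\<integral>\<^sup>+\<theta>. ennreal (ground_dev a \<phi> g (logpolar t \<theta>)) * indicator {0<..<2*pi} \<theta> * ennreal (exp (- 2 * t)) \<partial>lborel)"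
    proof (rule nn_integral_cong)
      fix \<theta>
      have "ground_dev a \<phi> g (logpolar t \<theta>) * exp (- 2 * t) = (g (logpolar t \<theta>) \<bullet> logpolar t \<theta> + a * \<phi> (logpolar t \<theta>) / t)\<^sup>2"
        unfolding ground_dev_def exp_norm_logpolar by simp
      also have "\<dots> = (k (logpolar t \<theta>))\<^sup>2" by (simp add: k_def power2_eq_square algebra_simps)
      finally have "ennreal ((k (logpolar t \<theta>))\<^sup>2) = ennreal (ground_dev a \<phi> g (logpolar t \<theta>)) * ennreal (exp (- 2 * t))"
        by (subst ennreal_mult[symmetric]) (auto simp: ground_dev_nonneg)
      then show "ennreal ((k (logpolar t \<theta>))\<^sup>2) * indicator {0<..<2*pi} \<theta> = ennreal (ground_dev a \<phi> g (logpolar t \<theta>)) * indicator {0<..<2*pi} \<theta> * ennreal (exp (- 2 * t))"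
        by (simp only: mult_ac)
    qed
    also have "\<dots> = (\<integral>\<^sup>+\<theta>\<in>{0<..<2*pi}. ennreal (ground_dev a \<phi> g (logpolar t \<theta>)) \<partial>lborel) * ennreal (exp (- 2 * t))"
    proof (rule nn_integral_multc)
      have "(\<lambda>x. ennreal (ground_dev a \<phi> g x)) \<in> borel_measurable borel"
        using borel_measurable_ground_dev[OF C1c_measurable[OF \<phi>]] by measurable
      from borel_measurable_logpolar_section[OF this]
      show "(\<lambda>\<theta>. ennreal (ground_dev a \<phi> g (logpolar t \<theta>)) * indicator {0<..<2*pi} \<theta>) \<in> borel_measurable lborel" by simp
    qed
    finally show ?thesis .
  qed
  then have "(\<integral>\<^sup>+t\<in>{0<..}. ennreal ((?w' t - a * ?w t / t)\<^sup>2) \<partial>lborel)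
    \<le> (\<integral>\<^sup>+t. ennreal (1 / (2 * pi)) * ((\<integral>\<^sup>+\<theta>\<in>{0<..<2*pi}. ennreal (ground_dev a \<phi> g (logpolar t \<theta>)) \<partial>lborel) * ennreal (exp (- 2 * t)) * indicator {0<..} t) \<partial>lborel)"
    by (intro nn_integral_mono) (auto simp: indicator_def)
  also have "\<dots> = ennreal (1 / (2 * pi)) * (\<integral>\<^sup>+x\<in>B1. ennreal (ground_dev a \<phi> g x) \<partial>lborel)"
  proof -
    have gm: "(\<lambda>x. ennreal (ground_dev a \<phi> g x)) \<in> borel_measurable borel"
      using borel_measurable_ground_dev[OF C1c_measurable[OF \<phi>]] by measurable
    show ?thesis unfolding nn_integral_logpolar[OF gm]
      by (rule nn_integral_cmult) (use borel_measurable_circle_integral[OF gm] in \<open>simp\<close>)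
  qed
  also have "\<dots> \<le> ennreal (1 / (2 * pi)) * ennreal 1"
    by (intro mult_left_mono order_trans[OF ground_dev_le_energy[OF \<phi>]] ennreal_leI E) simp
  finally have total: "(\<integral>\<^sup>+t\<in>{0<..}. ennreal ((?w' t - a * ?w t / t)\<^sup>2) \<partial>lborel) \<le> ennreal (1 / (2 * pi))" by simp
  have "hardy_1d l a ?w ?w' s"
  proof
    show "(?w has_real_derivative ?w' t) (at t)" for t by (rule der(1))
    show "continuous_on {0<..} ?w'" by (rule der(2))
    show "?w t = 0" if "t \<le> s" for t
    proof -
      have "\<phi> (logpolar t \<theta>) = 0" for \<theta> using st(3)[of t] K(3) that by auto
      then show ?thesis by (simp add: circle_avg_def)
    qed
    fix t1 t2 :: real assume t12: "0 < t1" "t1 \<le> t2"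
    have "continuous_on {t1..t2} (\<lambda>t. (?w' t - a * ?w t / t)\<^sup>2)"
      using t12 by (intro continuous_intros cw der(2)) auto
    then have "((\<lambda>t. (?w' t - a * ?w t / t)\<^sup>2) has_integral integral {t1..t2} (\<lambda>t. (?w' t - a * ?w t / t)\<^sup>2)) {t1..t2}"
      by (intro integrable_integral integrable_continuous_real)
    then have "ennreal (integral {t1..t2} (\<lambda>t. (?w' t - a * ?w t / t)\<^sup>2)) = (\<integral>\<^sup>+t\<in>{t1..t2}. ennreal ((?w' t - a * ?w t / t)\<^sup>2) \<partial>lborel)"
      by (intro nn_integral_has_integral_lebesgue'[symmetric]) auto
    also have "\<dots> \<le> (\<integral>\<^sup>+t\<in>{0<..}. ennreal ((?w' t - a * ?w t / t)\<^sup>2) \<partial>lborel)"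
      using t12 by (intro nn_integral_mono) (auto simp: indicator_def)
    also note total
    finally show "integral {t1..t2} (\<lambda>t. (?w' t - a * ?w t / t)\<^sup>2) \<le> 1 / (2 * pi)" by simp
  qed (use l st a_def in auto)
  then show ?thesis by blast
qed

lemma exp_integral_eq:
  assumes "u1 \<in> borel_measurable borel" "AE x in lebesgue. x \<in> B1 \<longrightarrow> u x = u1 x"
  shows "exp_integral \<alpha> u = (\<integral>\<^sup>+x\<in>B1. ennreal (exp (\<alpha> * (u1 x)\<^sup>2)) \<partial>lborel)"
proof -
  have "AE x in lborel. x \<in> B1 \<longrightarrow> u x = u1 x" using assms(2) by (simp add: AE_completion_iff)
  then show ?thesis unfolding exp_integral_def nn_integral_completion
    by (intro nn_integral_cong_AE) (auto simp: indicator_def elim!: eventually_mono)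
qed

lemma m_crit_l: "m_crit \<mu> = 4 * pi * l" by (simp add: m_crit_def l_def)

text \<open>Approximating functions may have norms slightly above 1. Dividing by
  \<open>max 1\<close> of the norm brings their energies down to at most 1, and the factors tend to
  1, so the limit function is unchanged.\<close>

lemma H_norm_scaled_tendsto:
  assumes "(\<lambda>n. test_norm V \<mu> (\<phi> n)) \<longlonglongrightarrow> H_norm V \<mu> u" "H_norm V \<mu> u \<le> 1"
  shows "(\<lambda>n. inverse (max 1 (test_norm V \<mu> (\<phi> n)))) \<longlonglongrightarrow> 1"
proof -
  have "(\<lambda>n. inverse (max 1 (test_norm V \<mu> (\<phi> n)))) \<longlonglongrightarrow> inverse (max 1 (H_norm V \<mu> u))"
    using assms by (intro tendsto_intros) auto
  then show ?thesis using assms(2) by (simp add: max_def split: if_splits)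
qed

lemma energy_scaled_le_1:
  assumes "\<phi> \<in> Cc_infty (B1 - {0})"
  shows "energy V \<mu> B1 (\<lambda>x. inverse (max 1 (test_norm V \<mu> \<phi>)) * \<phi> x) (\<lambda>x. inverse (max 1 (test_norm V \<mu> \<phi>)) *\<^sub>R grad \<phi> x) \<le> 1"
proof -
  define c where "c = inverse (max 1 (test_norm V \<mu> \<phi>))"
  note C = C1c_Cc_infty[OF assms]
  have "energy V \<mu> B1 (\<lambda>x. c * \<phi> x) (\<lambda>x. c *\<^sub>R grad \<phi> x) = c\<^sup>2 * energy V \<mu> B1 \<phi> (grad \<phi>)"
    unfolding energy_test[OF C] energy_test[OF C1c_cmult[OF C]] D_def P_def
    by (simp add: power_mult_distrib mult.left_commute[of _ "c\<^sup>2"] distrib_left)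
  also have "\<dots> \<le> 1"
  proof -
    define E where "E = energy V \<mu> B1 \<phi> (grad \<phi>)"
    have "0 \<le> (1 + 4 * \<mu>) * D (grad \<phi>)" using mu D_nonneg by (intro mult_nonneg_nonneg) auto
    then have E0: "0 \<le> E" using energy_test_ge[OF C] unfolding E_def by linarith
    have "E = (test_norm V \<mu> \<phi>)\<^sup>2" using E0 by (simp add: test_norm_def E_def)
    also have "\<dots> \<le> (max 1 (test_norm V \<mu> \<phi>))\<^sup>2"
      using E0 by (intro power_mono) (auto simp: test_norm_def E_def)
    finally have "c\<^sup>2 * E \<le> c\<^sup>2 * (max 1 (test_norm V \<mu> \<phi>))\<^sup>2" by (intro mult_left_mono) auto
    also have "\<dots> = (c * max 1 (test_norm V \<mu> \<phi>))\<^sup>2" by (simp add: power_mult_distrib)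
    also have "c * max 1 (test_norm V \<mu> \<phi>) = 1" by (simp add: c_def)
    finally show ?thesis by (simp add: E_def)
  qed
  finally show ?thesis by (simp add: c_def)
qed

text \<open>The scaled circle means of the approximating functions satisfy the one-dimensional Moser
  bound and converge, for almost every \<open>t\<close> along a subsequence, to the profile of
  \<open>u\<close>; Fatou's lemma carries the bound over.\<close>

lemma radial_moser:
  assumes u: "u \<in> H_space V \<mu>" and rad: "radial u" and n1: "H_norm V \<mu> u \<le> 1"
  shows "exp_integral (m_crit \<mu>) u \<le> ennreal (2 * pi) * ennreal (moser_const l)"
proof -
  obtain \<phi> u1 where \<phi>: "\<And>n. \<phi> n \<in> Cc_infty (B1 - {0})" and u1[measurable]: "u1 \<in> borel_measurable borel"
    and ae: "AE x in lebesgue. x \<in> B1 \<longrightarrow> u x = u1 x"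
    and lim: "(\<lambda>n. \<integral>\<^sup>+x. ennreal ((\<phi> n x - u1 x)\<^sup>2) \<partial>lborel) \<longlonglongrightarrow> 0"
    and tn: "(\<lambda>n. test_norm V \<mu> (\<phi> n)) \<longlonglongrightarrow> H_norm V \<mu> u"
    by (rule H_space_approx[OF u]) blast
  define c where "c n = inverse (max 1 (test_norm V \<mu> (\<phi> n)))" for n
  have c: "c \<longlonglongrightarrow> 1" unfolding c_def by (rule H_norm_scaled_tendsto[OF tn n1])
  note C = C1c_Cc_infty[OF \<phi>]
  have [measurable]: "\<phi> n \<in> borel_measurable borel" for n by (rule C1c_measurable(1)[OF C])
  define \<omega> where "\<omega> t = u (logpolar t 0)" for t
  \<comment> \<open>The contribution of the circle with parameter \<open>t\<close> to the L2 error.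
    Its integral over \<open>t\<close> tends to 0, hence it tends to 0 itself for almost every
    \<open>t\<close> along a subsequence.\<close>
  define H where "H n t = (\<integral>\<^sup>+\<theta>\<in>{0<..<2*pi}. ennreal ((\<phi> n (logpolar t \<theta>) - u1 (logpolar t \<theta>))\<^sup>2) \<partial>lborel) * ennreal (exp (- 2 * t)) * indicator {0<..} t" for n t
  have dm: "(\<lambda>x. ennreal ((\<phi> n x - u1 x)\<^sup>2)) \<in> borel_measurable borel" for n by measurable
  have Hm: "H n \<in> borel_measurable lborel" for n
    unfolding H_def[abs_def] using borel_measurable_circle_integral[OF dm] by simp
  have "(\<integral>\<^sup>+t. H n t \<partial>lborel) = (\<integral>\<^sup>+x\<in>B1. ennreal ((\<phi> n x - u1 x)\<^sup>2) \<partial>lborel)" for n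
    unfolding nn_integral_logpolar[OF dm] H_def ..
  also have "\<dots> n \<le> (\<integral>\<^sup>+x. ennreal ((\<phi> n x - u1 x)\<^sup>2) \<partial>lborel)" for n
    by (intro nn_integral_mono) (auto simp: indicator_def)
  finally have "(\<lambda>n. \<integral>\<^sup>+t. H n t \<partial>lborel) \<longlonglongrightarrow> 0"
    by (intro tendsto_sandwich[OF always_eventually always_eventually tendsto_const lim]) auto
  then obtain r where r: "strict_mono r" "AE t in lborel. (\<lambda>k. H (r k) t) \<longlonglongrightarrow> 0"
    by (rule nn_integral_tendsto_0_AE_subseq[rotated]) (use Hm in auto)
  have "AE x in lborel. x \<in> B1 \<longrightarrow> u x = u1 x" using ae by (simp add: AE_completion_iff)
  from AE_logpolar[OF this]
  have ae\<omega>: "AE t in lborel. 0 < t \<longrightarrow> (AE \<theta> in lborel. \<theta> \<in> {0<..<2*pi} \<longrightarrow> u1 (logpolar t \<theta>) = \<omega> t)"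
  proof eventually_elim
    case (elim t)
    show ?case
    proof
      assume t: "0 < t"
      have "u (logpolar t \<theta>) = \<omega> t" for \<theta>
        using rad t unfolding radial_def \<omega>_def by simp
      then show "AE \<theta> in lborel. \<theta> \<in> {0<..<2*pi} \<longrightarrow> u1 (logpolar t \<theta>) = \<omega> t"
        using elim t by (auto elim: eventually_mono)
    qed
  qed
  have conv: "AE t in lborel. 0 < t \<longrightarrow> (\<lambda>k. circle_avg (\<phi> (r k)) t) \<longlonglongrightarrow> \<omega> t"
    using r(2) ae\<omega>
  proof eventually_elim
    case (elim t)
    show ?case
    proof
      assume t: "0 < t"
      then have ae\<theta>: "AE \<theta> in lborel. \<theta> \<in> {0<..<2*pi} \<longrightarrow> u1 (logpolar t \<theta>) = \<omega> t" using elim by blast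
      \<comment> \<open>For fixed \<open>t\<close> the factor \<open>exp (2 * t)\<close> undoes the
        Jacobian contained in \<open>H\<close>.\<close>
      have bound: "ennreal ((circle_avg (\<phi> n) t - \<omega> t)\<^sup>2) \<le> ennreal (exp (2 * t) / (2 * pi)) * H n t" for n
      proof -
        have "ennreal ((circle_avg (\<phi> n) t - \<omega> t)\<^sup>2) \<le> ennreal (1 / (2 * pi)) * (\<integral>\<^sup>+\<theta>\<in>{0<..<2*pi}. ennreal ((\<phi> n (logpolar t \<theta>) - \<omega> t)\<^sup>2) \<partial>lborel)"
          by (rule circle_avg_sq_le[OF C1c_continuous(1)[OF C]])
        also have "(\<integral>\<^sup>+\<theta>\<in>{0<..<2*pi}. ennreal ((\<phi> n (logpolar t \<theta>) - \<omega> t)\<^sup>2) \<partial>lborel) = (\<integral>\<^sup>+\<theta>\<in>{0<..<2*pi}. ennreal ((\<phi> n (logpolar t \<theta>) - u1 (logpolar t \<theta>))\<^sup>2) \<partial>lborel)"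
          by (rule nn_integral_cong_AE) (use ae\<theta> in \<open>auto simp: indicator_def elim!: eventually_mono\<close>)
        also have "ennreal (1 / (2 * pi)) * \<dots> = ennreal (exp (2 * t) / (2 * pi)) * H n t"
        proof -
          have "ennreal (exp (2 * t) / (2 * pi)) * ennreal (exp (- 2 * t)) = ennreal (1 / (2 * pi))"
            by (subst ennreal_mult[symmetric]) (auto simp: exp_minus)
          then show ?thesis using t unfolding H_def by (simp add: mult_ac) (simp only: mult.assoc[symmetric])
        qed
        finally show ?thesis .
      qed
      have "(\<lambda>k. ennreal (exp (2 * t) / (2 * pi)) * H (r k) t) \<longlonglongrightarrow> ennreal (exp (2 * t) / (2 * pi)) * 0"
        using elim by (intro ennreal_tendsto_cmult) auto
      then have L: "(\<lambda>k. ennreal (exp (2 * t) / (2 * pi)) * H (r k) t) \<longlonglongrightarrow> 0" by simp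
      have "(\<lambda>k. ennreal ((circle_avg (\<phi> (r k)) t - \<omega> t)\<^sup>2)) \<longlonglongrightarrow> 0"
        by (rule tendsto_sandwich[OF _ _ tendsto_const L]) (use bound in auto)
      then have "(\<lambda>k. ennreal ((circle_avg (\<phi> (r k)) t - \<omega> t)\<^sup>2)) \<longlonglongrightarrow> ennreal 0" by simp
      then have "(\<lambda>k. (circle_avg (\<phi> (r k)) t - \<omega> t)\<^sup>2) \<longlonglongrightarrow> 0" by (subst (asm) tendsto_ennreal_iff) auto
      then have "(\<lambda>k. sqrt ((circle_avg (\<phi> (r k)) t - \<omega> t)\<^sup>2)) \<longlonglongrightarrow> sqrt 0" by (rule tendsto_real_sqrt)
      then have "(\<lambda>k. \<bar>circle_avg (\<phi> (r k)) t - \<omega> t\<bar>) \<longlonglongrightarrow> 0" by simp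
      then show "(\<lambda>k. circle_avg (\<phi> (r k)) t) \<longlonglongrightarrow> \<omega> t" by (simp add: tendsto_rabs_zero_iff LIM_zero_iff)
    qed
  qed
  have em: "(\<lambda>x. ennreal (exp (m_crit \<mu> * (u1 x)\<^sup>2))) \<in> borel_measurable borel" by measurable
  define w where "w k t = c (r k) * circle_avg (\<phi> (r k)) t" for k t
  have wavg: "w k = circle_avg (\<lambda>x. c (r k) * \<phi> (r k) x)" for k
    by (auto simp: w_def circle_avg_def fun_eq_iff)
  have moser: "(\<integral>\<^sup>+t\<in>{0<..}. ennreal (exp (4 * pi * l * (w k t)\<^sup>2 - 2 * t)) \<partial>lborel) \<le> ennreal (moser_const l)" for k
  proof -
    obtain t0 where "hardy_1d l a (w k) (circle_avg (\<lambda>x. - ((c (r k) *\<^sub>R grad (\<phi> (r k)) x) \<bullet> x))) t0"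
      using hardy_1d_circle_avg[OF C1c_cmult[OF C] energy_scaled_le_1[OF \<phi>, of "r k"]] unfolding wavg c_def by blast
    then show ?thesis by (rule hardy_1d.moser_integral)
  qed
  have "exp_integral (m_crit \<mu>) u = (\<integral>\<^sup>+x\<in>B1. ennreal (exp (m_crit \<mu> * (u1 x)\<^sup>2)) \<partial>lborel)"
    by (rule exp_integral_eq[OF u1 ae])
  also have "\<dots> = (\<integral>\<^sup>+t\<in>{0<..}. (\<integral>\<^sup>+\<theta>\<in>{0<..<2*pi}. ennreal (exp (m_crit \<mu> * (u1 (logpolar t \<theta>))\<^sup>2)) \<partial>lborel) * ennreal (exp (- 2 * t)) \<partial>lborel)"
    by (rule nn_integral_logpolar[OF em])
  also have "\<dots> = (\<integral>\<^sup>+t. ennreal (2 * pi) * (ennreal (exp (4 * pi * l * (\<omega> t)\<^sup>2 - 2 * t)) * indicator {0<..} t) \<partial>lborel)"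
  proof (rule nn_integral_cong_AE)
    show "AE t in lborel. (\<integral>\<^sup>+\<theta>\<in>{0<..<2*pi}. ennreal (exp (m_crit \<mu> * (u1 (logpolar t \<theta>))\<^sup>2)) \<partial>lborel) * ennreal (exp (- 2 * t)) * indicator {0<..} t
      = ennreal (2 * pi) * (ennreal (exp (4 * pi * l * (\<omega> t)\<^sup>2 - 2 * t)) * indicator {0<..} t)"
      using ae\<omega>
    proof eventually_elim
      case (elim t)
      show ?case
      proof (cases "0 < t")
        case True
        then have "AE \<theta> in lborel. \<theta> \<in> {0<..<2*pi} \<longrightarrow> u1 (logpolar t \<theta>) = \<omega> t" using elim by blast
        then have "(\<integral>\<^sup>+\<theta>\<in>{0<..<2*pi}. ennreal (exp (m_crit \<mu> * (u1 (logpolar t \<theta>))\<^sup>2)) \<partial>lborel) = (\<integral>\<^sup>+\<theta>\<in>{0<..<2*pi}. ennreal (exp (m_crit \<mu> * (\<omega> t)\<^sup>2)) \<partial>lborel)"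
          by (intro nn_integral_cong_AE) (auto simp: indicator_def elim!: eventually_mono)
        also have "\<dots> = ennreal (exp (m_crit \<mu> * (\<omega> t)\<^sup>2)) * ennreal (2 * pi)"
          by (subst nn_integral_cmult_indicator) auto
        finally show ?thesis using True
          by (simp add: m_crit_l ennreal_mult[symmetric] exp_diff exp_minus field_simps)
      qed simp
    qed
  qed
  also have "\<dots> \<le> ennreal (2 * pi) * ennreal (moser_const l)"
  proof (rule nn_integral_fatou_AE)
    show "AE t in lborel. (\<lambda>k. ennreal (2 * pi) * (ennreal (exp (4 * pi * l * (w k t)\<^sup>2 - 2 * t)) * indicator {0<..} t)) \<longlonglongrightarrow> ennreal (2 * pi) * (ennreal (exp (4 * pi * l * (\<omega> t)\<^sup>2 - 2 * t)) * indicator {0<..} t)"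
      using conv
    proof eventually_elim
      case (elim t)
      show ?case
      proof (cases "0 < t")
        case True
        have "(\<lambda>k. w k t) \<longlonglongrightarrow> 1 * \<omega> t" unfolding w_def
          using elim True LIMSEQ_subseq_LIMSEQ[OF c r(1)] by (intro tendsto_mult) (auto simp: o_def)
        then have "(\<lambda>k. ennreal (exp (4 * pi * l * (w k t)\<^sup>2 - 2 * t))) \<longlonglongrightarrow> ennreal (exp (4 * pi * l * (1 * \<omega> t)\<^sup>2 - 2 * t))"
          by (intro tendsto_intros)
        then show ?thesis using True by (intro ennreal_tendsto_cmult) auto
      qed simp
    qed
    have wm: "(\<lambda>t. w k t) \<in> borel_measurable borel" for k
      unfolding wavg using circle_avg_has_derivative(1)[OF C1c_derivative[OF C1c_cmult[OF C]] C1c_continuous(2)[OF C1c_cmult[OF C]]]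
      by (intro borel_measurable_continuous_onI continuous_at_imp_continuous_on) (blast intro: DERIV_isCont)
    show "(\<lambda>t. ennreal (2 * pi) * (ennreal (exp (4 * pi * l * (w k t)\<^sup>2 - 2 * t)) * indicator {0<..} t)) \<in> borel_measurable lborel" for k
      using wm by measurable
    show "eventually (\<lambda>k. (\<integral>\<^sup>+t. ennreal (2 * pi) * (ennreal (exp (4 * pi * l * (w k t)\<^sup>2 - 2 * t)) * indicator {0<..} t) \<partial>lborel) \<le> ennreal (2 * pi) * ennreal (moser_const l)) sequentially"
    proof (intro always_eventually allI)
      fix k
      have "(\<integral>\<^sup>+t. ennreal (2 * pi) * (ennreal (exp (4 * pi * l * (w k t)\<^sup>2 - 2 * t)) * indicator {0<..} t) \<partial>lborel)
        = ennreal (2 * pi) * (\<integral>\<^sup>+t\<in>{0<..}. ennreal (exp (4 * pi * l * (w k t)\<^sup>2 - 2 * t)) \<partial>lborel)"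
        by (rule nn_integral_cmult) (use wm in measurable)
      also have "\<dots> \<le> ennreal (2 * pi) * ennreal (moser_const l)" by (intro mult_left_mono moser) simp
      finally show "(\<integral>\<^sup>+t. ennreal (2 * pi) * (ennreal (exp (4 * pi * l * (w k t)\<^sup>2 - 2 * t)) * indicator {0<..} t) \<partial>lborel) \<le> ennreal (2 * pi) * ennreal (moser_const l)" .
    qed
  qed
  finally show ?thesis .
qed

end

section \<open>Polarization\<close>

lemma ennreal_mult_2_le_cancel:
  fixes A B :: ennreal assumes "A + A \<le> B + B" shows "A \<le> B"
proof (rule ccontr)
  assume "\<not> A \<le> B"
  then have "B < A" by simp
  then have "B + B < A + A" by (rule add_strict_mono[OF _ \<open>B < A\<close>])
  then show False using assms by simp
qed

text \<open>The reflection in the line \<open>x \<bullet> n = c\<close>. The sign of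
  \<open>c\<close> puts the origin into the half-plane \<open>x \<bullet> n \<le> c\<close>, the
  side to which polarization moves the larger values.\<close>

locale reflection =
  fixes n :: plane and c :: real
  assumes norm_n: "norm n = 1" and c_nonneg: "0 \<le> c"
begin

definition refl :: "plane \<Rightarrow> plane" where "refl x = x - (2 * (x \<bullet> n - c)) *\<^sub>R n"

lemma nn: "n \<bullet> n = 1" using norm_n by (simp add: norm_eq_1)

lemma refl_inner: "refl x \<bullet> n = 2 * c - x \<bullet> n"
  by (simp add: refl_def inner_diff_left nn)

lemma refl_refl [simp]: "refl (refl x) = x"
  unfolding refl_def[of "refl x"] refl_inner by (simp add: refl_def scaleR_left_diff_distrib)

text \<open>The source of all distance comparisons: the correction is nonnegative exactly when the
  two points do not lie strictly on opposite sides of the line.\<close>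

lemma norm_diff_refl: "(norm (x - refl y))\<^sup>2 = (norm (x - y))\<^sup>2 + 4 * (c - x \<bullet> n) * (c - y \<bullet> n)"
  by (simp add: power2_norm_eq_inner refl_def inner_diff_left inner_diff_right nn inner_commute algebra_simps)

lemma norm_refl_sq: "(norm (refl x))\<^sup>2 = (norm x)\<^sup>2 + 4 * c * (c - x \<bullet> n)"
  using norm_diff_refl[of 0 x] by simp

lemma norm_refl_diff [simp]: "norm (refl x - refl y) = norm (x - y)"
proof -
  have "(norm (refl x - refl y))\<^sup>2 = (norm (x - y))\<^sup>2"
    unfolding norm_diff_refl[of "refl x" y] norm_minus_commute[of "refl x" y] norm_diff_refl[of y x] refl_inner
    by (simp add: norm_minus_commute algebra_simps)
  then show ?thesis by (simp add: power2_eq_iff_nonneg)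
qed

lemma norm_diff_refl_commute: "norm (refl x - y) = norm (x - refl y)"
  using norm_refl_diff[of x "refl y"] by simp

lemma norm_le_refl: "x \<bullet> n \<le> c \<Longrightarrow> norm x \<le> norm (refl x)"
  by (rule power2_le_imp_le) (simp_all add: norm_refl_sq c_nonneg)

lemma norm_diff_le_refl: "x \<bullet> n \<le> c \<Longrightarrow> y \<bullet> n \<le> c \<Longrightarrow> norm (x - y) \<le> norm (x - refl y)"
  by (rule power2_le_imp_le) (simp_all add: norm_diff_refl)

text \<open>Each point or its mirror image lies in the half-plane, so a property that passes from
  the image to the point needs checking there only.\<close>

lemma half_cases:
  assumes "\<And>x. x \<bullet> n \<le> c \<Longrightarrow> Q x" "\<And>x. Q (refl x) \<Longrightarrow> Q x" shows "Q x"
proof (cases "x \<bullet> n \<le> c")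
  case False
  then have "Q (refl x)" by (intro assms(1)) (simp add: refl_inner)
  then show ?thesis by (rule assms(2))
qed (rule assms(1))

lemma continuous_refl: "continuous_on S refl"
  unfolding refl_def[abs_def] by (intro continuous_intros)

lemma refl_measurable [measurable]: "refl \<in> borel_measurable borel"
  by (intro borel_measurable_continuous_onI continuous_refl)

lemma lborel_refl: "distr lborel borel refl = lborel"
proof -
  \<comment> \<open>The linear part, an orthogonal map; a translation along \<open>n\<close>
    completes the reflection.\<close>
  define R where "R x = x - (2 * (x \<bullet> n)) *\<^sub>R n" for x
  have RR: "R (R x) = x" for x
    unfolding R_def by (simp add: inner_diff_left nn scaleR_left_diff_distrib)
  have "linear R" unfolding R_def
    by (intro linearI) (simp_all add: inner_add_left algebra_simps)
  moreover have "norm (R x) = norm x" for x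
  proof -
    have "(norm (R x))\<^sup>2 = (norm x)\<^sup>2"
      by (simp add: power2_norm_eq_inner R_def inner_diff_left inner_diff_right nn inner_commute algebra_simps)
    then show ?thesis by (simp add: power2_eq_iff_nonneg)
  qed
  ultimately have ot: "orthogonal_transformation R" by (simp add: orthogonal_transformation)
  have Rm[measurable]: "R \<in> borel_measurable borel" unfolding R_def
    by (intro borel_measurable_continuous_onI continuous_intros)
  have "lborel = distr lborel borel R"
  proof (rule lborel_eqI)
    fix l u :: plane assume lu: "\<And>b. b \<in> Basis \<Longrightarrow> l \<bullet> b \<le> u \<bullet> b"
    have pre: "R -` box l u = R ` box l u" using RR 
    proof (intro set_eqI iffI)
      fix x assume "x \<in> R -` box l u"
      then show "x \<in> R ` box l u" by (intro image_eqI[of x R "R x"]) (simp_all add: RR)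
    qed (auto simp: RR)
    have bm: "box l u \<in> lmeasurable" by simp
    have "emeasure (distr lborel borel R) (box l u) = emeasure lborel (R -` box l u)"
      using Rm by (subst emeasure_distr) simp_all
    also have "\<dots> = emeasure lebesgue (R ` box l u)"
      using measurable_sets[OF Rm, of "box l u"] unfolding pre by simp
    also have "\<dots> = ennreal (measure lebesgue (R ` box l u))"
      by (rule emeasure_eq_ennreal_measure[OF fmeasurableD2[OF measurable_orthogonal_image[OF ot bm]]])
    also have "measure lebesgue (R ` box l u) = measure lebesgue (box l u)"
      by (rule measure_orthogonal_image[OF ot bm])
    also have "\<dots> = (\<Prod>b\<in>Basis. (u - l) \<bullet> b)"
      using lu by (simp add: measure_lborel_box_eq)
    finally show "emeasure (distr lborel borel R) (box l u) = (\<Prod>b\<in>Basis. (u - l) \<bullet> b)" .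
  qed simp
  then have R: "distr lborel borel R = lborel" by simp
  have eq: "refl = (\<lambda>x. (2 * c) *\<^sub>R n + R x)" by (auto simp: refl_def R_def fun_eq_iff algebra_simps)
  have "distr lborel borel refl = distr (distr lborel borel R) borel ((+) ((2 * c) *\<^sub>R n))"
    unfolding eq by (subst distr_distr) (auto simp: o_def)
  also have "\<dots> = lborel" unfolding R by (rule lborel_distr_plus)
  finally show ?thesis .
qed

lemma nn_integral_refl:
  fixes f :: "plane \<Rightarrow> ennreal" assumes [measurable]: "f \<in> borel_measurable borel"
  shows "(\<integral>\<^sup>+x. f (refl x) \<partial>lborel) = (\<integral>\<^sup>+x. f x \<partial>lborel)"
  by (subst (2) lborel_refl[symmetric]) (simp add: nn_integral_distr)

lemma integral_refl:
  fixes f :: "plane \<Rightarrow> real" assumes "integrable lborel f"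
  shows "integrable lborel (\<lambda>x. f (refl x))" "(\<integral>x. f (refl x) \<partial>lborel) = (\<integral>x. f x \<partial>lborel)"
proof -
  have [measurable]: "f \<in> borel_measurable borel" using assms by simp
  have "integrable (distr lborel borel refl) f" using assms by (simp add: lborel_refl)
  then show "integrable lborel (\<lambda>x. f (refl x))" by (subst (asm) integrable_distr_eq) auto
  have "(\<integral>x. f (refl x) \<partial>lborel) = (\<integral>x. f x \<partial>distr lborel borel refl)" by (subst integral_distr) auto
  then show "(\<integral>x. f (refl x) \<partial>lborel) = (\<integral>x. f x \<partial>lborel)" by (simp add: lborel_refl)
qed

text \<open>Adding the reflected integrand doubles both integrals, so an inequality for the sums
  over mirror pairs suffices. The origin and its mirror image are left out because a weight
  decreasing in the radius is not controlled at 0.\<close>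

lemma nn_integral_le_by_pairs:
  fixes F G :: "plane \<Rightarrow> ennreal"
  assumes [measurable]: "F \<in> borel_measurable borel" "G \<in> borel_measurable borel"
    and le: "\<And>x. x \<bullet> n \<le> c \<Longrightarrow> x \<noteq> 0 \<Longrightarrow> refl x \<noteq> 0 \<Longrightarrow> F x + F (refl x) \<le> G x + G (refl x)"
  shows "(\<integral>\<^sup>+x. F x \<partial>lborel) \<le> (\<integral>\<^sup>+x. G x \<partial>lborel)"
proof (rule ennreal_mult_2_le_cancel)
  have eq: "(\<integral>\<^sup>+x. H x \<partial>lborel) + (\<integral>\<^sup>+x. H x \<partial>lborel) = (\<integral>\<^sup>+x. H x + H (refl x) \<partial>lborel)" if [measurable]: "H \<in> borel_measurable borel" for H :: "plane \<Rightarrow> ennreal"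
    by (subst nn_integral_add) (auto simp: nn_integral_refl[OF that])
  have all: "x \<noteq> 0 \<longrightarrow> refl x \<noteq> 0 \<longrightarrow> F x + F (refl x) \<le> G x + G (refl x)" for x
    by (rule half_cases) (use le in \<open>auto simp: add.commute\<close>)
  show "(\<integral>\<^sup>+x. F x \<partial>lborel) + (\<integral>\<^sup>+x. F x \<partial>lborel) \<le> (\<integral>\<^sup>+x. G x \<partial>lborel) + (\<integral>\<^sup>+x. G x \<partial>lborel)"
    unfolding eq[OF assms(1)] eq[OF assms(2)]
  proof (rule nn_integral_mono_AE)
    show "AE x in lborel. F x + F (refl x) \<le> G x + G (refl x)"
      using AE_lborel_singleton[of 0] AE_lborel_singleton[of "refl 0"]
    proof eventually_elim
      case (elim x)
      then have "refl x \<noteq> 0" using refl_refl[of x] by (intro notI) simp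
      then show ?case using all[of x] elim by blast
    qed
  qed
qed

text \<open>The two-point rearrangement: of the two values at a mirror pair the larger goes to the
  side of the origin.\<close>

definition pol :: "(plane \<Rightarrow> real) \<Rightarrow> plane \<Rightarrow> real" where
  "pol u x = (if x \<bullet> n \<le> c then max (u x) (u (refl x)) else min (u x) (u (refl x)))"

lemma pol_half:
  assumes "x \<bullet> n \<le> c" shows "pol u x = max (u x) (u (refl x))" "pol u (refl x) = min (u x) (u (refl x))"
proof -
  show "pol u x = max (u x) (u (refl x))" using assms by (simp add: pol_def)
  show "pol u (refl x) = min (u x) (u (refl x))"
  proof (cases "x \<bullet> n = c")
    case True
    then have "refl x = x" by (simp add: refl_def)
    then show ?thesis by (simp add: pol_def)
  next
    case False
    then have "\<not> refl x \<bullet> n \<le> c" using assms by (simp add: refl_inner)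
    then show ?thesis by (simp add: pol_def min.commute)
  qed
qed

lemma pol_pair: "(pol u x = u x \<and> pol u (refl x) = u (refl x)) \<or> (pol u x = u (refl x) \<and> pol u (refl x) = u x)"
proof (cases "x \<bullet> n \<le> c")
  case True then show ?thesis by (auto simp: pol_half max_def min_def)
next
  case False
  then have "refl x \<bullet> n \<le> c" by (simp add: refl_inner)
  from pol_half[OF this, of u] show ?thesis by (auto simp: max_def min_def)
qed

text \<open>If polarization exchanges the values at exactly one of two mirror pairs, distances
  across the line come into play. They are at least the distances within one side, and the ordering
  of the two values in each pair supplies the remaining bound.\<close>

lemma pol_lipschitz:
  assumes u: "\<And>x y. \<bar>u x - u y\<bar> \<le> L * norm (x - y)" and L: "0 \<le> L"
  shows "\<bar>pol u x - pol u y\<bar> \<le> L * norm (x - y)"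
proof -
  have HH: "\<bar>pol u x - pol u y\<bar> \<le> L * norm (x - y) \<and> \<bar>pol u (refl x) - pol u (refl y)\<bar> \<le> L * norm (x - y)
     \<and> \<bar>pol u x - pol u (refl y)\<bar> \<le> L * norm (x - refl y)"
    if x: "x \<bullet> n \<le> c" and y: "y \<bullet> n \<le> c" for x y
  proof -
    have le: "L * norm (x - y) \<le> L * norm (x - refl y)" using norm_diff_le_refl[OF x y] L by (intro mult_left_mono)
    have "\<bar>u x - u y\<bar> \<le> L * norm (x - y)" "\<bar>u (refl x) - u (refl y)\<bar> \<le> L * norm (x - y)"
      "\<bar>u x - u (refl y)\<bar> \<le> L * norm (x - refl y)" "\<bar>u (refl x) - u y\<bar> \<le> L * norm (x - refl y)"
      using u[of x y] u[of "refl x" "refl y"] u[of x "refl y"] u[of "refl x" y] by (simp_all add: norm_diff_refl_commute)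
    then show ?thesis using le unfolding pol_half[OF x] pol_half[OF y] by (auto simp: max_def min_def abs_le_iff)
  qed
  have r: "x \<bullet> n \<le> c \<or> refl x \<bullet> n \<le> c" for x by (auto simp: refl_inner)
  consider "x \<bullet> n \<le> c" "y \<bullet> n \<le> c" | "x \<bullet> n \<le> c" "refl y \<bullet> n \<le> c" | "refl x \<bullet> n \<le> c" "y \<bullet> n \<le> c" | "refl x \<bullet> n \<le> c" "refl y \<bullet> n \<le> c"
    using r[of x] r[of y] by blast
  then show ?thesis
  proof cases
    case 1 then show ?thesis using HH by blast
  next
    case 2 then show ?thesis using HH[of x "refl y"] by simp
  next
    case 3 then show ?thesis using HH[of y "refl x"] by (simp add: abs_minus_commute norm_minus_commute)
  next
    case 4 then show ?thesis using HH[of "refl x" "refl y"] by simp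
  qed
qed

lemma pol_nonneg: "(\<And>x. 0 \<le> u x) \<Longrightarrow> 0 \<le> pol u x" by (simp add: pol_def le_max_iff_disj)

text \<open>A point of the half-plane beyond radius \<open>R\<close> has a mirror image that is at
  least as far out. At other points a minimum is taken, and a nonnegative function has minimum 0 as
  soon as one of the values is 0.\<close>

lemma pol_support:
  assumes u: "\<And>x. 0 \<le> u x" "\<And>x. R < norm x \<Longrightarrow> u x = 0" and x: "R < norm x" shows "pol u x = 0"
proof (cases "x \<bullet> n \<le> c")
  case True
  then have "R < norm (refl x)" using norm_le_refl[OF True] x by linarith
  then show ?thesis using u x True by (simp add: pol_def)
next
  case False
  then show ?thesis using u(1)[of "refl x"] u(2)[OF x] by (simp add: pol_def)
qed

text \<open>Polarization only permutes the values within mirror pairs.\<close>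

lemma pol_nn_integral_eq:
  fixes \<Psi> :: "real \<Rightarrow> ennreal"
  assumes "(\<lambda>x. \<Psi> (u x)) \<in> borel_measurable borel" "(\<lambda>x. \<Psi> (pol u x)) \<in> borel_measurable borel"
  shows "(\<integral>\<^sup>+x. \<Psi> (pol u x) \<partial>lborel) = (\<integral>\<^sup>+x. \<Psi> (u x) \<partial>lborel)"
proof (rule antisym)
  have e: "\<Psi> (pol u x) + \<Psi> (pol u (refl x)) = \<Psi> (u x) + \<Psi> (u (refl x))" for x
    using pol_pair[of u x] by (auto simp: add.commute)
  show "(\<integral>\<^sup>+x. \<Psi> (pol u x) \<partial>lborel) \<le> (\<integral>\<^sup>+x. \<Psi> (u x) \<partial>lborel)"
    by (rule nn_integral_le_by_pairs) (use assms e in auto)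
  show "(\<integral>\<^sup>+x. \<Psi> (u x) \<partial>lborel) \<le> (\<integral>\<^sup>+x. \<Psi> (pol u x) \<partial>lborel)"
    by (rule nn_integral_le_by_pairs) (use assms e in auto)
qed

text \<open>The rearrangement inequality for two numbers: the larger square meets the larger weight,
  which belongs to the point nearer to the origin.\<close>

lemma pol_weighted:
  fixes w :: "plane \<Rightarrow> real"
  assumes [measurable]: "w \<in> borel_measurable borel" "u \<in> borel_measurable borel" "pol u \<in> borel_measurable borel"
    and w: "\<And>x. 0 \<le> w x" "\<And>x y. x \<noteq> 0 \<Longrightarrow> norm x \<le> norm y \<Longrightarrow> w y \<le> w x" and u: "\<And>x. 0 \<le> u x"
  shows "(\<integral>\<^sup>+x. ennreal (w x * (u x)\<^sup>2) \<partial>lborel) \<le> (\<integral>\<^sup>+x. ennreal (w x * (pol u x)\<^sup>2) \<partial>lborel)"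
proof (rule nn_integral_le_by_pairs)
  fix x assume x: "x \<bullet> n \<le> c" "x \<noteq> 0" "refl x \<noteq> 0"
  have ww: "w (refl x) \<le> w x" using w(2)[OF x(2) norm_le_refl[OF x(1)]] .
  have "w x * (u x)\<^sup>2 + w (refl x) * (u (refl x))\<^sup>2 \<le> w x * (pol u x)\<^sup>2 + w (refl x) * (pol u (refl x))\<^sup>2"
  proof (cases "u (refl x) \<le> u x")
    case True
    then show ?thesis unfolding pol_half[OF x(1)] by simp
  next
    case False
    then have "(u x)\<^sup>2 \<le> (u (refl x))\<^sup>2" using u[of x] by (intro power_mono) auto
    then have "0 \<le> (w x - w (refl x)) * ((u (refl x))\<^sup>2 - (u x)\<^sup>2)" using ww by (intro mult_nonneg_nonneg) auto
    then show ?thesis unfolding pol_half[OF x(1)] using False by (simp add: max_def min_def algebra_simps)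
  qed
  then show "ennreal (w x * (u x)\<^sup>2) + ennreal (w (refl x) * (u (refl x))\<^sup>2) \<le> ennreal (w x * (pol u x)\<^sup>2) + ennreal (w (refl x) * (pol u (refl x))\<^sup>2)"
    using w(1) by (simp add: ennreal_plus[symmetric] ennreal_leI del: ennreal_plus)
qed measurable

end

section \<open>Nonlocal energies under polarization\<close>

definition nonlocal_energy :: "real \<Rightarrow> (plane \<Rightarrow> real) \<Rightarrow> ennreal" where
  "nonlocal_energy e u = (\<integral>\<^sup>+p. ennreal (of_bool (norm (fst p - snd p) < e) * (u (fst p) - u (snd p))\<^sup>2) \<partial>(lborel \<Otimes>\<^sub>M lborel))"

lemma measurable_nonlocal:
  assumes [measurable]: "u \<in> borel_measurable borel"
  shows "(\<lambda>p :: plane \<times> plane. ennreal (of_bool (norm (fst p - snd p) < e) * (u (fst p) - u (snd p))\<^sup>2)) \<in> borel_measurable (lborel \<Otimes>\<^sub>M lborel)"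
proof -
  have "of_bool (norm (fst p - snd p) < e) = indicator {p. norm (fst p - snd p) < e} p" for p :: "plane \<times> plane"
    by (simp add: indicator_def)
  moreover have "{p :: plane \<times> plane. norm (fst p - snd p) < e} \<in> sets (borel \<Otimes>\<^sub>M borel)"
    unfolding borel_prod by (intro borel_open open_Collect_less continuous_intros)
  then have "(\<lambda>p :: plane \<times> plane. indicator {p. norm (fst p - snd p) < e} p :: real) \<in> borel_measurable (lborel \<Otimes>\<^sub>M lborel)"
    by (intro borel_measurable_indicator) (simp add: sets_pair_measure_cong[OF sets_lborel sets_lborel])
  ultimately show ?thesis by (simp, measurable)
qed

lemma nonlocal_energy_iterated:
  assumes "u \<in> borel_measurable borel"
  shows "nonlocal_energy e u = (\<integral>\<^sup>+x. \<integral>\<^sup>+y. ennreal (of_bool (norm (x - y) < e) * (u x - u y)\<^sup>2) \<partial>lborel \<partial>lborel)"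
  unfolding nonlocal_energy_def using lborel.nn_integral_fst[OF measurable_nonlocal[OF assms]] by simp

text \<open>\<open>a\<close>, \<open>a'\<close> and \<open>b\<close>, \<open>b'\<close> are the
  values at two mirror pairs; \<open>k\<close> weights differences within a side, \<open>k'\<close>
  those across the line. If both pairs are ordered alike, sorting changes nothing in the sum. If
  they are ordered oppositely, sorting exchanges the roles of the two brackets, and it moves the
  smaller bracket to the larger weight.\<close>

lemma two_point_inequality:
  fixes a a' b b' k k' :: real
  assumes "0 \<le> k'" "k' \<le> k"
  shows "k * ((max a a' - max b b')\<^sup>2 + (min a a' - min b b')\<^sup>2) + k' * ((max a a' - min b b')\<^sup>2 + (min a a' - max b b')\<^sup>2)
     \<le> k * ((a - b)\<^sup>2 + (a' - b')\<^sup>2) + k' * ((a - b')\<^sup>2 + (a' - b)\<^sup>2)"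
proof -
  have s: "(a - b')\<^sup>2 + (a' - b)\<^sup>2 - ((a - b)\<^sup>2 + (a' - b')\<^sup>2) = 2 * ((a - a') * (b - b'))" for a b a' b' :: real
    by (simp add: power2_eq_square algebra_simps)
  consider "0 \<le> (a - a') * (b - b')" | "(a - a') * (b - b') < 0" by linarith
  then show ?thesis
  proof cases
    case 1
    then have "(a' \<le> a \<and> b' \<le> b) \<or> (a \<le> a' \<and> b \<le> b')" by (auto simp: zero_le_mult_iff)
    then show ?thesis by (auto simp: max_def min_def add.commute)
  next
    case 2
    then have "(a' \<le> a \<and> b \<le> b') \<or> (a \<le> a' \<and> b' \<le> b)" by (auto simp: mult_less_0_iff)
    moreover have "0 \<le> (k - k') * ((a - b)\<^sup>2 + (a' - b')\<^sup>2 - ((a - b')\<^sup>2 + (a' - b)\<^sup>2))"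
      using s[of a b' a' b] 2 assms by (intro mult_nonneg_nonneg) auto
    ultimately show ?thesis by (auto simp: max_def min_def algebra_simps)
  qed
qed

context reflection
begin

text \<open>The distance kernel is invariant under reflecting both points, and larger within a side
  than across. Grouping the double integral into quadruples formed by two mirror pairs reduces the
  claim to \<open>two_point_inequality\<close>.\<close>

lemma nonlocal_energy_pol:
  assumes u[measurable]: "u \<in> borel_measurable borel" and pu[measurable]: "pol u \<in> borel_measurable borel"
  shows "nonlocal_energy e (pol u) \<le> nonlocal_energy e u"
proof -
  define k :: "plane \<Rightarrow> plane \<Rightarrow> real" where "k x y = of_bool (norm (x - y) < e)" for x y
  define F where "F v x y = ennreal (k x y * (v x - v y)\<^sup>2)" for v :: "plane \<Rightarrow> real" and x y
  \<comment> \<open>The integrand summed over the four reflections of the pair; its double integral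
    is four times the nonlocal energy.\<close>
  define S where "S v x y = (F v x y + F v (refl x) y) + (F v x (refl y) + F v (refl x) (refl y))" for v x y
  have Fm: "(\<lambda>p. F v (fst p) (snd p)) \<in> borel_measurable (borel \<Otimes>\<^sub>M borel)" if "v \<in> borel_measurable borel" for v
    using measurable_nonlocal[OF that, of e] unfolding F_def k_def
    by (simp add: measurable_cong_sets[OF sets_pair_measure_cong[OF sets_lborel sets_lborel] refl])
  have Fm1: "(\<lambda>x. F v (f x) (g x)) \<in> borel_measurable M" if "v \<in> borel_measurable borel" "f \<in> borel_measurable M" "g \<in> borel_measurable M" for v f g and M :: "'z measure"
    using measurable_compose[OF measurable_Pair[OF that(2,3)] Fm[OF that(1)]] by simp
  have Fp: "(\<lambda>p. F v (f (fst p)) (g (snd p))) \<in> borel_measurable (lborel \<Otimes>\<^sub>M lborel)"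
    if "v \<in> borel_measurable borel" "f \<in> borel_measurable borel" "g \<in> borel_measurable borel" for v and f g :: "plane \<Rightarrow> plane"
    by (rule Fm1[OF that(1)]; use that in measurable)
  have id: "(\<lambda>x :: plane. x) \<in> borel_measurable borel" by simp
  have NE: "nonlocal_energy e v = (\<integral>\<^sup>+x. \<integral>\<^sup>+y. F v x y \<partial>lborel \<partial>lborel)" if "v \<in> borel_measurable borel" for v
    unfolding nonlocal_energy_iterated[OF that] F_def k_def ..
  have inner_m: "(\<lambda>x. \<integral>\<^sup>+y. F v (f x) (g y) \<partial>lborel) \<in> borel_measurable borel"
    if "v \<in> borel_measurable borel" "f \<in> borel_measurable borel" "g \<in> borel_measurable borel" for v and f g :: "plane \<Rightarrow> plane"
    using lborel.borel_measurable_nn_integral[of "\<lambda>x y. F v (f x) (g y)" lborel] Fp[OF that] by (simp add: split_beta')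
  have 4: "(\<integral>\<^sup>+x. \<integral>\<^sup>+y. S v x y \<partial>lborel \<partial>lborel) = (nonlocal_energy e v + nonlocal_energy e v) + (nonlocal_energy e v + nonlocal_energy e v)"
    if v: "v \<in> borel_measurable borel" for v
  proof -
    have y: "(\<integral>\<^sup>+y. F v x (refl y) \<partial>lborel) = (\<integral>\<^sup>+y. F v x y \<partial>lborel)" for x
      by (rule nn_integral_refl) (rule Fm1[OF v]; measurable)
    have x: "(\<integral>\<^sup>+x. \<integral>\<^sup>+y. F v (refl x) y \<partial>lborel \<partial>lborel) = (\<integral>\<^sup>+x. \<integral>\<^sup>+y. F v x y \<partial>lborel \<partial>lborel)"
      by (rule nn_integral_refl) (rule inner_m[OF v id id])
    have "(\<integral>\<^sup>+y. S v x y \<partial>lborel) = ((\<integral>\<^sup>+y. F v x y \<partial>lborel) + (\<integral>\<^sup>+y. F v (refl x) y \<partial>lborel)) + ((\<integral>\<^sup>+y. F v x y \<partial>lborel) + (\<integral>\<^sup>+y. F v (refl x) y \<partial>lborel))" for x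
    proof -
      have m: "(\<lambda>y. F v x y) \<in> borel_measurable lborel" "(\<lambda>y. F v (refl x) y) \<in> borel_measurable lborel"
        "(\<lambda>y. F v x (refl y)) \<in> borel_measurable lborel" "(\<lambda>y. F v (refl x) (refl y)) \<in> borel_measurable lborel"
        by ((rule Fm1[OF v]; measurable)+)
      have m12: "(\<lambda>y. F v x y + F v (refl x) y) \<in> borel_measurable lborel"
        and m34: "(\<lambda>y. F v x (refl y) + F v (refl x) (refl y)) \<in> borel_measurable lborel"
        using m by measurable
      show ?thesis
        unfolding S_def nn_integral_add[OF m12 m34] nn_integral_add[OF m(1,2)] nn_integral_add[OF m(3,4)] y ..
    qed
    then have "(\<integral>\<^sup>+x. \<integral>\<^sup>+y. S v x y \<partial>lborel \<partial>lborel) = (\<integral>\<^sup>+x. ((\<integral>\<^sup>+y. F v x y \<partial>lborel) + (\<integral>\<^sup>+y. F v (refl x) y \<partial>lborel)) + ((\<integral>\<^sup>+y. F v x y \<partial>lborel) + (\<integral>\<^sup>+y. F v (refl x) y \<partial>lborel)) \<partial>lborel)"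
      by simp
    also have "\<dots> = ((\<integral>\<^sup>+x. \<integral>\<^sup>+y. F v x y \<partial>lborel \<partial>lborel) + (\<integral>\<^sup>+x. \<integral>\<^sup>+y. F v (refl x) y \<partial>lborel \<partial>lborel)) + ((\<integral>\<^sup>+x. \<integral>\<^sup>+y. F v x y \<partial>lborel \<partial>lborel) + (\<integral>\<^sup>+x. \<integral>\<^sup>+y. F v (refl x) y \<partial>lborel \<partial>lborel))"
      using inner_m[OF v id id] inner_m[OF v refl_measurable id]
      by (simp add: nn_integral_add)
    finally show ?thesis unfolding x NE[OF v] .
  qed
  have "\<forall>y. S (pol u) x y \<le> S u x y" for x
  proof (rule half_cases[of "\<lambda>x. \<forall>y. S (pol u) x y \<le> S u x y"])
    fix x assume "\<forall>y. S (pol u) (refl x) y \<le> S u (refl x) y"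
    moreover have "S v (refl x) y = S v x y" for v y by (simp add: S_def add_ac)
    ultimately show "\<forall>y. S (pol u) x y \<le> S u x y" by simp
  next
    fix x assume x: "x \<bullet> n \<le> c"
    show "\<forall>y. S (pol u) x y \<le> S u x y"
    proof
      fix y
    show "S (pol u) x y \<le> S u x y"
    proof (rule half_cases[of "\<lambda>y. S (pol u) x y \<le> S u x y"])
      fix y assume "S (pol u) x (refl y) \<le> S u x (refl y)"
      moreover have "S v x (refl y) = S v x y" for v by (simp add: S_def add_ac)
      ultimately show "S (pol u) x y \<le> S u x y" by simp
    next
      fix y assume y: "y \<bullet> n \<le> c"
      have kk: "k (refl x) (refl y) = k x y" "k (refl x) y = k x (refl y)" "0 \<le> k x (refl y)" "k x (refl y) \<le> k x y"
        using norm_diff_le_refl[OF x y] by (auto simp: k_def norm_diff_refl_commute)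
      have Sr: "S v x y = ennreal (k x y * ((v x - v y)\<^sup>2 + (v (refl x) - v (refl y))\<^sup>2) + k x (refl y) * ((v x - v (refl y))\<^sup>2 + (v (refl x) - v y)\<^sup>2))" for v
        unfolding S_def F_def kk(1,2) using kk(3,4)
        by (simp add: ennreal_plus[symmetric] algebra_simps del: ennreal_plus)
      show "S (pol u) x y \<le> S u x y"
        unfolding Sr pol_half[OF x] pol_half[OF y] by (intro ennreal_leI two_point_inequality kk)
    qed
    qed
  qed
  then have Sle: "S (pol u) x y \<le> S u x y" for x y by blast
  have "(\<integral>\<^sup>+x. \<integral>\<^sup>+y. S (pol u) x y \<partial>lborel \<partial>lborel) \<le> (\<integral>\<^sup>+x. \<integral>\<^sup>+y. S u x y \<partial>lborel \<partial>lborel)"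
    by (intro nn_integral_mono Sle)
  then show ?thesis unfolding 4[OF u] 4[OF pu]
    by (rule ennreal_mult_2_le_cancel[OF ennreal_mult_2_le_cancel])
qed

end

text \<open>The reflection in the perpendicular bisector of two points.\<close>

lemma bisector:
  fixes x y :: plane
  assumes ne: "x \<noteq> y" and le: "norm x \<le> norm y"
  defines "n \<equiv> (1 / norm (y - x)) *\<^sub>R (y - x)" and "c \<equiv> ((norm y)\<^sup>2 - (norm x)\<^sup>2) / (2 * norm (y - x))"
  shows "reflection n c" "reflection.refl n c x = y" "x \<bullet> n \<le> c"
proof -
  have nyx: "norm (y - x) > 0" using ne by simp
  have "(norm x)\<^sup>2 \<le> (norm y)\<^sup>2" using le by (intro power_mono) auto
  then have c: "c \<ge> 0" using nyx by (simp add: c_def)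
  show "reflection n c" by unfold_locales (use ne c in \<open>auto simp: n_def\<close>)
  then interpret reflection n c .
  have xn: "x \<bullet> n - c = - norm (y - x) / 2"
  proof -
    have "(norm (y - x))\<^sup>2 = (norm y)\<^sup>2 + (norm x)\<^sup>2 - 2 * (x \<bullet> y)"
      by (simp add: power2_norm_eq_inner inner_diff_left inner_diff_right inner_commute)
    moreover have "x \<bullet> n = (x \<bullet> y - (norm x)\<^sup>2) / norm (y - x)"
      by (simp add: n_def inner_diff_right power2_norm_eq_inner)
    ultimately show ?thesis using nyx by (simp add: c_def field_simps power2_eq_square)
  qed
  show "x \<bullet> n \<le> c" using xn nyx by linarith
  show "refl x = y" unfolding refl_def xn using nyx by (simp add: n_def)
qed

section \<open>Radial competitors by minimization\<close>

lemma lipschitz_continuous: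
  fixes u :: "plane \<Rightarrow> real"
  assumes u: "\<And>x y. \<bar>u x - u y\<bar> \<le> L * norm (x - y)" and L: "0 \<le> L"
  shows "continuous_on S u"
proof (rule continuous_onI)
  fix x e assume "0 < (e :: real)"
  show "\<exists>d>0. \<forall>x'\<in>S. dist x' x < d \<longrightarrow> dist (u x') (u x) \<le> e"
  proof (intro exI[of _ "e / (L + 1)"] conjI ballI impI)
    show "0 < e / (L + 1)" using L \<open>0 < e\<close> by simp
    fix x' assume "dist x' x < e / (L + 1)"
    then have "(L + 1) * norm (x' - x) \<le> e" using L by (simp add: dist_norm field_simps)
    moreover have "L * norm (x' - x) \<le> (L + 1) * norm (x' - x)" by (intro mult_right_mono) auto
    ultimately show "dist (u x') (u x) \<le> e" using u[of x' x] by (simp add: dist_real_def)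
  qed
qed

lemma continuous_nonneg_integral_0:
  fixes q :: "plane \<Rightarrow> real"
  assumes "continuous_on UNIV q" "integrable lborel q" "\<And>x. 0 \<le> q x" "(\<integral>x. q x \<partial>lborel) = 0"
  shows "q x = 0"
proof -
  have "AE x in lborel. q x = 0"
    using integral_nonneg_eq_0_iff_AE[OF assms(2)] assms(3,4) by simp
  then have "AE x in lebesgue. x \<in> {x. q x = 0}" by (simp add: AE_completion)
  moreover have "closed {x. q x = 0}" using assms(1) by (intro closed_Collect_eq continuous_intros)
  ultimately show ?thesis using mem_closed_if_AE_lebesgue by blast
qed

lemma nonlocal_energy_Fatou:
  assumes m: "\<And>n. v n \<in> borel_measurable borel" "w \<in> borel_measurable borel"
    and lim: "\<And>x. (\<lambda>n. v n x) \<longlonglongrightarrow> w x" and le: "\<And>n. nonlocal_energy e (v n) \<le> C"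
  shows "nonlocal_energy e w \<le> C"
  unfolding nonlocal_energy_def
proof (rule nn_integral_fatou_AE)
  show "AE p in lborel \<Otimes>\<^sub>M lborel. (\<lambda>k. ennreal (of_bool (norm (fst p - snd p) < e) * (v k (fst p) - v k (snd p))\<^sup>2))
     \<longlonglongrightarrow> ennreal (of_bool (norm (fst p - snd p) < e) * (w (fst p) - w (snd p))\<^sup>2)"
    by (intro AE_I2 tendsto_intros lim)
qed (use le measurable_nonlocal[OF m(1)] in \<open>auto simp: nonlocal_energy_def\<close>)

text \<open>The class of competitors: everything that the polarizations preserve. Minimising the second moment
  over it produces a radial function, so that no rearrangement has to be constructed.\<close>

definition competitor ::
  "(plane \<Rightarrow> real) \<Rightarrow> real \<Rightarrow> real \<Rightarrow> real \<Rightarrow> (plane \<Rightarrow> real) \<Rightarrow> (plane \<Rightarrow> real) \<Rightarrow> bool" where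
  "competitor w m L R v0 v \<longleftrightarrow> (\<forall>x y. \<bar>v x - v y\<bar> \<le> L * norm (x - y)) \<and> (\<forall>x. 0 \<le> v x) \<and> (\<forall>x. R < norm x \<longrightarrow> v x = 0) \<and>
     (\<forall>e. nonlocal_energy e v \<le> nonlocal_energy e v0) \<and>
     (\<integral>\<^sup>+x. ennreal (w x * (v0 x)\<^sup>2) \<partial>lborel) \<le> (\<integral>\<^sup>+x. ennreal (w x * (v x)\<^sup>2) \<partial>lborel) \<and>
     (\<integral>\<^sup>+x. ennreal (exp (m * (v x)\<^sup>2) - 1) \<partial>lborel) = (\<integral>\<^sup>+x. ennreal (exp (m * (v0 x)\<^sup>2) - 1) \<partial>lborel)"

text \<open>\<open>competitor w m L R v0 v0\<close> asks only that \<open>v0\<close> be Lipschitz,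
  nonnegative and supported in the ball; the comparisons of \<open>v0\<close> with itself hold
  trivially. Finiteness of the weight on the ball gives an integrable bound for limits, since
  \<open>w\<close> may blow up at the origin.\<close>

locale symmetrization =
  fixes w :: "plane \<Rightarrow> real" and m L R :: real and v0 :: "plane \<Rightarrow> real"
  assumes m: "0 \<le> m" and L: "0 \<le> L" and R: "0 < R"
    and w_meas: "w \<in> borel_measurable borel" and w_nonneg: "\<And>x. 0 \<le> w x"
    and w_mono: "\<And>x y. x \<noteq> 0 \<Longrightarrow> norm x \<le> norm y \<Longrightarrow> w y \<le> w x"
    and w_int: "(\<integral>\<^sup>+x\<in>cball 0 R. ennreal (w x) \<partial>lborel) < \<infinity>"
    and v0: "competitor w m L R v0 v0"
begin

abbreviation "adm \<equiv> competitor w m L R v0"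

lemma admD:
  assumes "adm v"
  shows "\<bar>v x - v y\<bar> \<le> L * norm (x - y)" "0 \<le> v x" "R < norm x \<Longrightarrow> v x = 0" "continuous_on S v" "v \<in> borel_measurable borel"
    "v x \<le> L * (3 * R)"
proof -
  have lip: "\<bar>v x - v y\<bar> \<le> L * norm (x - y)" for x y using assms by (simp add: competitor_def)
  show "\<bar>v x - v y\<bar> \<le> L * norm (x - y)" by (rule lip)
  show "0 \<le> v x" "R < norm x \<Longrightarrow> v x = 0" using assms by (simp_all add: competitor_def)
  show c: "continuous_on S v" for S by (rule lipschitz_continuous[OF lip L])
  show "v \<in> borel_measurable borel" by (rule borel_measurable_continuous_onI[OF c])
  show "v x \<le> L * (3 * R)"
  proof (cases "R < norm x")
    case True
    then show ?thesis using assms L R by (simp add: competitor_def)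
  next
    case False
    \<comment> \<open>A point at distance \<open>2 * R\<close>, where \<open>v\<close> is 0. It is
      at most \<open>3 * R\<close> away from any point of the ball, which yields the uniform
      bound.\<close>
    define y :: plane where "y = (2 * R) *\<^sub>R axis 1 1"
    have y: "norm y = 2 * R" using R by (simp add: y_def norm_axis_1)
    then have "v y = 0" using assms R by (simp add: competitor_def)
    then have "v x \<le> L * norm (x - y)" using lip[of x y] by simp
    also have "norm (x - y) \<le> norm x + norm y" by (rule norm_triangle_ineq4)
    then have "L * norm (x - y) \<le> L * (3 * R)" using False y L by (intro mult_left_mono) auto
    finally show ?thesis .
  qed
qed

text \<open>The weight increases strictly with the radius, so moving larger values inwards strictly
  lowers \<open>J\<close>.\<close>

definition J :: "(plane \<Rightarrow> real) \<Rightarrow> real" where "J v = (\<integral>x. (norm x)\<^sup>2 * v x \<partial>lborel)"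

lemma integrable_J:
  assumes v: "adm v" shows "integrable lborel (\<lambda>x. (norm x)\<^sup>2 * v x)"
proof (rule integrable_continuous_compact_support[of _ "cball 0 R"])
  show "continuous_on UNIV (\<lambda>x. (norm x)\<^sup>2 * v x)" by (intro continuous_intros admD(4)[OF v])
  show "(norm x)\<^sup>2 * v x = 0" if "x \<notin> cball 0 R" for x using admD(3)[OF v, of x] that by simp
qed simp

lemma J_nonneg: "adm v \<Longrightarrow> 0 \<le> J v"
  unfolding J_def by (intro integral_nonneg_AE AE_I2) (simp add: admD(2))

lemma adm_pol:
  assumes v: "adm v" and r: "reflection n c" shows "adm (reflection.pol n c v)"
proof -
  interpret reflection n c by (rule r)
  have lip: "\<bar>pol v x - pol v y\<bar> \<le> L * norm (x - y)" for x y by (rule pol_lipschitz[OF admD(1)[OF v] L])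
  have meas[measurable]: "pol v \<in> borel_measurable borel" "v \<in> borel_measurable borel"
    using borel_measurable_continuous_onI[OF lipschitz_continuous[OF lip L]] admD(5)[OF v] by auto
  have "(\<integral>\<^sup>+x. ennreal (w x * (v x)\<^sup>2) \<partial>lborel) \<le> (\<integral>\<^sup>+x. ennreal (w x * (pol v x)\<^sup>2) \<partial>lborel)"
    by (rule pol_weighted[OF w_meas meas(2,1) w_nonneg w_mono admD(2)[OF v]])
  moreover have "(\<integral>\<^sup>+x. ennreal (exp (m * (pol v x)\<^sup>2) - 1) \<partial>lborel) = (\<integral>\<^sup>+x. ennreal (exp (m * (v x)\<^sup>2) - 1) \<partial>lborel)"
    by (rule pol_nn_integral_eq) measurable
  moreover have "nonlocal_energy e (pol v) \<le> nonlocal_energy e v0" for e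
    by (rule order_trans[OF nonlocal_energy_pol[OF meas(2,1)]]) (use v in \<open>simp add: competitor_def\<close>)
  moreover have "0 \<le> pol v x" for x by (rule pol_nonneg[OF admD(2)[OF v]])
  moreover have "R < norm x \<Longrightarrow> pol v x = 0" for x by (rule pol_support[OF admD(2)[OF v] admD(3)[OF v]])
  ultimately show ?thesis using v lip unfolding competitor_def by (auto intro: order_trans)
qed

text \<open>The upper bounds on the nonlocal energies pass to the limit by Fatou's lemma. The lower
  bound on the weighted integral and the equality of the exponential integrals need dominated
  convergence, for which the common bound \<open>M\<close> and the common support are used.\<close>

lemma adm_limit:
  assumes v: "\<And>n. adm (v n)" and lim: "\<And>x. (\<lambda>n. v n x) \<longlonglongrightarrow> u x" shows "adm u" "(\<lambda>n. J (v n)) \<longlonglongrightarrow> J u"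
proof -
  have lip: "\<bar>u x - u y\<bar> \<le> L * norm (x - y)" for x y
    by (rule LIMSEQ_le_const2[OF tendsto_rabs[OF tendsto_diff[OF lim lim]]]) (use admD(1)[OF v] in auto)
  have nn: "0 \<le> u x" for x by (rule LIMSEQ_le_const[OF lim]) (use admD(2)[OF v] in auto)
  have sup: "u x = 0" if "R < norm x" for x
    using lim[of x] LIMSEQ_unique[OF tendsto_const, of 0 "u x"] admD(3)[OF v that] by simp
  have um[measurable]: "u \<in> borel_measurable borel" by (rule borel_measurable_continuous_onI[OF lipschitz_continuous[OF lip L]])
  have vm[measurable]: "v n \<in> borel_measurable borel" for n by (rule admD(5)[OF v])
  note w_meas[measurable]
  have [measurable]: "cball (0 :: plane) R \<in> sets borel" by simp
  define M where "M = L * (3 * R)"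
  have M: "v n x \<le> M" "0 \<le> v n x" "R < norm x \<Longrightarrow> v n x = 0" for n x unfolding M_def using admD[OF v] by auto
  have e: "nonlocal_energy e u \<le> nonlocal_energy e v0" for e
    by (rule nonlocal_energy_Fatou[OF vm um lim]) (use v in \<open>simp add: competitor_def\<close>)
  have sq: "(v n x)\<^sup>2 \<le> M\<^sup>2" for n x using M by (intro power_mono) auto
  have "(\<lambda>n. \<integral>\<^sup>+x. ennreal (w x * (v n x)\<^sup>2) \<partial>lborel) \<longlonglongrightarrow> (\<integral>\<^sup>+x. ennreal (w x * (u x)\<^sup>2) \<partial>lborel)"
  proof (rule nn_integral_dominated_convergence[where w="\<lambda>x. ennreal (M\<^sup>2) * (ennreal (w x) * indicator (cball 0 R) x)"])
    show "AE x in lborel. ennreal (w x * (v n x)\<^sup>2) \<le> ennreal (M\<^sup>2) * (ennreal (w x) * indicator (cball 0 R) x)" for n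
    proof (rule AE_I2)
      fix x
      have "w x * (v n x)\<^sup>2 \<le> M\<^sup>2 * w x" using mult_left_mono[OF sq w_nonneg] by (simp add: mult.commute)
      then show "ennreal (w x * (v n x)\<^sup>2) \<le> ennreal (M\<^sup>2) * (ennreal (w x) * indicator (cball 0 R) x)"
        using M(3)[of x n] w_nonneg[of x] by (cases "norm x \<le> R") (auto simp: ennreal_mult[symmetric] intro: ennreal_leI)
    qed
    show "(\<integral>\<^sup>+x. ennreal (M\<^sup>2) * (ennreal (w x) * indicator (cball 0 R) x) \<partial>lborel) < \<infinity>"
      using w_int by (subst nn_integral_cmult) (auto simp: ennreal_mult_less_top)
    show "AE x in lborel. (\<lambda>n. ennreal (w x * (v n x)\<^sup>2)) \<longlonglongrightarrow> ennreal (w x * (u x)\<^sup>2)"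
      by (intro AE_I2 tendsto_intros lim)
  qed measurable
  then have P: "(\<integral>\<^sup>+x. ennreal (w x * (v0 x)\<^sup>2) \<partial>lborel) \<le> (\<integral>\<^sup>+x. ennreal (w x * (u x)\<^sup>2) \<partial>lborel)"
    by (rule LIMSEQ_le_const) (use v in \<open>auto simp: competitor_def\<close>)
  have fin: "emeasure lborel (cball (0 :: plane) R) < \<infinity>" by (rule emeasure_lborel_cball_finite)
  have "(\<lambda>n. \<integral>\<^sup>+x. ennreal (exp (m * (v n x)\<^sup>2) - 1) \<partial>lborel) \<longlonglongrightarrow> (\<integral>\<^sup>+x. ennreal (exp (m * (u x)\<^sup>2) - 1) \<partial>lborel)"
  proof (rule nn_integral_dominated_convergence[where w="\<lambda>x. ennreal (exp (m * M\<^sup>2)) * indicator (cball 0 R) x"])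
    show "AE x in lborel. ennreal (exp (m * (v n x)\<^sup>2) - 1) \<le> ennreal (exp (m * M\<^sup>2)) * indicator (cball 0 R) x" for n
    proof (rule AE_I2)
      fix x
      have "exp (m * (v n x)\<^sup>2) \<le> exp (m * M\<^sup>2)" using mult_left_mono[OF sq m] by simp
      then have "exp (m * (v n x)\<^sup>2) - 1 \<le> exp (m * M\<^sup>2)" by linarith
      then show "ennreal (exp (m * (v n x)\<^sup>2) - 1) \<le> ennreal (exp (m * M\<^sup>2)) * indicator (cball 0 R) x"
        using M(3)[of x n] by (cases "norm x \<le> R") (auto intro: ennreal_leI)
    qed
    show "(\<integral>\<^sup>+x. ennreal (exp (m * M\<^sup>2)) * indicator (cball 0 R) x \<partial>(lborel :: plane measure)) < \<infinity>"
      using fin by (subst nn_integral_cmult_indicator) (auto simp: ennreal_mult_less_top)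
    show "AE x in lborel. (\<lambda>n. ennreal (exp (m * (v n x)\<^sup>2) - 1)) \<longlonglongrightarrow> ennreal (exp (m * (u x)\<^sup>2) - 1)"
      by (intro AE_I2 tendsto_intros lim)
  qed measurable
  moreover have "(\<integral>\<^sup>+x. ennreal (exp (m * (v n x)\<^sup>2) - 1) \<partial>lborel) = (\<integral>\<^sup>+x. ennreal (exp (m * (v0 x)\<^sup>2) - 1) \<partial>lborel)" for n
    using v[of n] by (simp add: competitor_def)
  ultimately have I: "(\<integral>\<^sup>+x. ennreal (exp (m * (u x)\<^sup>2) - 1) \<partial>lborel) = (\<integral>\<^sup>+x. ennreal (exp (m * (v0 x)\<^sup>2) - 1) \<partial>lborel)"
    by (simp add: tendsto_const_iff)
  show "adm u" unfolding competitor_def using lip nn sup e P I by blast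
  show "(\<lambda>n. J (v n)) \<longlonglongrightarrow> J u" unfolding J_def
  proof (rule integral_dominated_convergence[where w="\<lambda>x. (R\<^sup>2 * M) * indicator (cball 0 R) x"])
    show "integrable lborel (\<lambda>x :: plane. (R\<^sup>2 * M) * indicator (cball 0 R) x)" using fin by auto
    show "AE x in lborel. (\<lambda>n. (norm x)\<^sup>2 * v n x) \<longlonglongrightarrow> (norm x)\<^sup>2 * u x" by (intro AE_I2 tendsto_intros lim)
    show "AE x in lborel. norm ((norm x)\<^sup>2 * v n x) \<le> (R\<^sup>2 * M) * indicator (cball 0 R) x" for n
    proof (rule AE_I2)
      fix x
      show "norm ((norm x)\<^sup>2 * v n x) \<le> (R\<^sup>2 * M) * indicator (cball 0 R) x"
      proof (cases "norm x \<le> R")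
        case True
        then have "(norm x)\<^sup>2 * v n x \<le> R\<^sup>2 * M" using M by (intro mult_mono power_mono) auto
        then show ?thesis using True M(2)[of n x] by simp
      qed (use M(3)[of x n] in simp)
    qed
  qed measurable
qed

text \<open>The direct method: the common Lipschitz constant and the common bound make a minimizing
  sequence relatively compact by Arzela-Ascoli, and the class is closed under pointwise
  limits.\<close>

lemma minimizer: obtains v where "adm v" "\<And>u. adm u \<Longrightarrow> J v \<le> J u"
proof -
  define j where "j = (INF v\<in>Collect adm. J v)"
  have bdd: "bdd_below (J ` Collect adm)" using J_nonneg by (intro bdd_belowI[of _ 0]) auto
  have ne: "Collect adm \<noteq> {}" using v0 by auto
  have "\<exists>v. adm v \<and> J v < j + 1 / Suc n" for n
    using cINF_less_iff[OF ne bdd, of "j + 1 / Suc n"] unfolding j_def[symmetric] by auto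
  then obtain v where v: "\<And>n. adm (v n)" "\<And>n. J (v n) < j + 1 / Suc n" by metis
  obtain g k where k: "strict_mono (k :: nat \<Rightarrow> nat)"
    and unif: "\<And>e. 0 < e \<Longrightarrow> \<exists>N. \<forall>n x. n \<ge> N \<and> x \<in> cball 0 R \<longrightarrow> norm (v (k n) x - g x) < e"
  proof (rule Arzela_Ascoli[of "cball (0 :: plane) R" v "L * (3 * R)"])
    show "norm (v n x) \<le> L * (3 * R)" for n x using admD(2,6)[OF v(1)] by simp
    show "\<exists>d>0. \<forall>n y. y \<in> cball 0 R \<and> norm (x - y) < d \<longrightarrow> norm (v n x - v n y) < e" if "0 < e" for x e
    proof (intro exI[of _ "e / (L + 1)"] conjI allI impI)
      show "0 < e / (L + 1)" using L that by simp
      fix n y assume "y \<in> cball 0 R \<and> norm (x - y) < e / (L + 1)"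
      then have "(L + 1) * norm (x - y) < e" using L by (simp add: field_simps)
      moreover have "L * norm (x - y) \<le> (L + 1) * norm (x - y)" by (intro mult_right_mono) auto
      ultimately show "norm (v n x - v n y) < e" using admD(1)[OF v(1)[of n], of x y] by simp
    qed
  qed auto
  \<comment> \<open>Arzela-Ascoli controls the limit on the ball only; outside it all competitors
    are 0.\<close>
  define u where "u x = (if norm x \<le> R then g x else 0)" for x
  have lim: "(\<lambda>n. v (k n) x) \<longlonglongrightarrow> u x" for x
  proof (cases "norm x \<le> R")
    case True
    show ?thesis
    proof (rule LIMSEQ_I)
      fix e :: real assume "0 < e"
      then obtain N where "\<And>n. n \<ge> N \<Longrightarrow> norm (v (k n) x - g x) < e" using unif True by (metis mem_cball_0)
      then show "\<exists>N. \<forall>n\<ge>N. norm (v (k n) x - u x) < e" using True by (auto simp: u_def)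
    qed
  next
    case False
    then show ?thesis using admD(3)[OF v(1)] by (simp add: u_def)
  qed
  have u: "adm u" "(\<lambda>n. J (v (k n))) \<longlonglongrightarrow> J u" using adm_limit[of "\<lambda>n. v (k n)" u] v(1) lim by auto
  have "(\<lambda>n. j + 1 / Suc n) \<longlonglongrightarrow> j + 0" by (intro tendsto_add tendsto_const LIMSEQ_Suc[OF lim_1_over_n])
  then have "(\<lambda>n. j + 1 / Suc (k n)) \<longlonglongrightarrow> j" using LIMSEQ_subseq_LIMSEQ[OF _ k] by (auto simp: o_def)
  from LIMSEQ_le[OF u(2) this] have "J u \<le> j" using v(2) less_imp_le by blast
  then have "J u \<le> J v" if "adm v" for v using cINF_lower[OF bdd, of v] that by (simp add: j_def)
  with u(1) that show ?thesis by blast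
qed

text \<open>Polarize in the bisector of \<open>x\<close> and \<open>y\<close>. The polarized
  function is again admissible and cannot have a larger second moment; minimality forces equality at
  every mirror pair, and for the pair \<open>x\<close>, \<open>y\<close> this means that the larger
  value already sits at \<open>x\<close>.\<close>

lemma minimizer_decreasing:
  assumes v: "adm v" and min: "\<And>u. adm u \<Longrightarrow> J v \<le> J u" and xy: "norm x < norm y"
  shows "v y \<le> v x"
proof -
  have ne: "x \<noteq> y" using xy by auto
  define n where "n = (1 / norm (y - x)) *\<^sub>R (y - x)"
  define c where "c = ((norm y)\<^sup>2 - (norm x)\<^sup>2) / (2 * norm (y - x))"
  note bis = bisector[OF ne less_imp_le[OF xy], folded n_def c_def]
  interpret reflection n c by (rule bis(1))
  note rx = bis(2)
  \<comment> \<open>The loss of second moment at a mirror pair. It is nonnegative and continuous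
    with integral \<open>2 * (J v - J (pol v))\<close>, so minimality makes it vanish
    everywhere.\<close>
  define q where "q z = (norm z)\<^sup>2 * v z + (norm (refl z))\<^sup>2 * v (refl z) - ((norm z)\<^sup>2 * pol v z + (norm (refl z))\<^sup>2 * pol v (refl z))" for z
  have cp: "adm (pol v)" by (rule adm_pol[OF v]) unfold_locales
  have half: "q z = ((norm (refl z))\<^sup>2 - (norm z)\<^sup>2) * max 0 (v (refl z) - v z)" if z: "z \<bullet> n \<le> c" for z
    unfolding q_def pol_half[OF z] by (auto simp: max_def min_def algebra_simps)
  have q0: "0 \<le> q z" for z
  proof (rule half_cases)
    show "0 \<le> q z" if "z \<bullet> n \<le> c" for z
      unfolding half[OF that] using norm_le_refl[OF that] by (intro mult_nonneg_nonneg) (auto intro: power_mono)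
    show "0 \<le> q z" if "0 \<le> q (refl z)" for z using that by (simp add: q_def add.commute)
  qed
  have i: "integrable lborel (\<lambda>z. (norm z)\<^sup>2 * v z)" "integrable lborel (\<lambda>z. (norm z)\<^sup>2 * pol v z)"
    using integrable_J v cp by auto
  note ir = integral_refl[OF i(1)] integral_refl[OF i(2)]
  have iq: "integrable lborel q" unfolding q_def using i ir by simp
  have "(\<integral>z. q z \<partial>lborel) = 2 * J v - 2 * J (pol v)"
    unfolding q_def using i ir by (simp add: J_def)
  moreover have "0 \<le> (\<integral>z. q z \<partial>lborel)" by (intro integral_nonneg_AE AE_I2) (simp add: q0)
  ultimately have Iq: "(\<integral>z. q z \<partial>lborel) = 0" using min[OF cp] by simp
  have cq: "continuous_on UNIV q" unfolding q_def
    by (intro continuous_intros admD(4)[OF v] admD(4)[OF cp] continuous_refl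
        continuous_on_compose2[OF admD(4)[OF v] continuous_refl] continuous_on_compose2[OF admD(4)[OF cp] continuous_refl]) auto
  have "q x = 0" by (rule continuous_nonneg_integral_0[OF cq iq q0 Iq])
  moreover note bis(3)
  ultimately have "((norm y)\<^sup>2 - (norm x)\<^sup>2) * max 0 (v y - v x) = 0" using half[of x] rx by simp
  moreover have "(norm x)\<^sup>2 < (norm y)\<^sup>2" using xy by (intro power_strict_mono) auto
  ultimately show ?thesis using xy by (auto simp: max_def split: if_splits)
qed

theorem radial_competitor:
  obtains v where "adm v" "\<And>x y. norm x = norm y \<Longrightarrow> v x = v y"
proof -
  obtain v where v: "adm v" and min: "\<And>u. adm u \<Longrightarrow> J v \<le> J u" by (rule minimizer) blast
  have le: "v y \<le> v x" if "norm x = norm y" for x y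
  proof (cases "y = 0")
    case True then show ?thesis using that by simp
  next
    case False
    \<comment> \<open>Points of equal norm are not compared by \<open>minimizer_decreasing\<close>;
      moving \<open>y\<close> slightly outwards makes the norms strictly ordered, and continuity
      brings it back.\<close>
    have "(\<lambda>k. (1 + 1 / Suc k) *\<^sub>R y) \<longlonglongrightarrow> (1 + 0) *\<^sub>R y"
      by (intro tendsto_intros LIMSEQ_Suc[OF lim_1_over_n])
    then have l: "(\<lambda>k. (1 + 1 / Suc k) *\<^sub>R y) \<longlonglongrightarrow> y" by simp
    have "isCont v y" using admD(4)[OF v, of UNIV] by (simp add: continuous_on_eq_continuous_at)
    then have "(\<lambda>k. v ((1 + 1 / Suc k) *\<^sub>R y)) \<longlonglongrightarrow> v y" using l by (rule isCont_tendsto_compose)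
    moreover have "v ((1 + 1 / Suc k) *\<^sub>R y) \<le> v x" for k
      by (rule minimizer_decreasing[OF v min]) (use that False in \<open>simp_all add: field_simps\<close>)
    ultimately show ?thesis by (intro LIMSEQ_le_const2) auto
  qed
  show ?thesis by (rule that[OF v]) (use le in \<open>auto intro: antisym\<close>)
qed

end

section \<open>Gradient energy as a limit of difference quotients\<close>

lemma nn_integral_affine:
  fixes f :: "plane \<Rightarrow> ennreal"
  assumes [measurable]: "f \<in> borel_measurable borel" and e: "e \<noteq> 0"
  shows "(\<integral>\<^sup>+y. f y \<partial>lborel) = ennreal (e\<^sup>2) * (\<integral>\<^sup>+z. f (x + e *\<^sub>R z) \<partial>lborel)"
proof -
  have "(\<integral>\<^sup>+y. f y \<partial>lborel) = (\<integral>\<^sup>+y. f y \<partial>density (distr lborel borel (\<lambda>z. x + e *\<^sub>R z)) (\<lambda>_. ennreal (\<bar>e\<bar>^DIM(plane))))"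
    by (subst lborel_affine[OF e, of x]) simp
  also have "\<dots> = (\<integral>\<^sup>+z. ennreal (\<bar>e\<bar>^DIM(plane)) * f (x + e *\<^sub>R z) \<partial>lborel)"
    by (simp add: nn_integral_density nn_integral_distr)
  also have "\<dots> = ennreal (\<bar>e\<bar>^DIM(plane)) * (\<integral>\<^sup>+z. f (x + e *\<^sub>R z) \<partial>lborel)"
    by (rule nn_integral_cmult) measurable
  finally show ?thesis by simp
qed

text \<open>The factor between averaged squared directional derivatives and the squared norm of the
  gradient. Being positive and finite, it can be cancelled in
  \<open>gradient_energy_le\<close>.\<close>

definition disc_moment :: ennreal where
  "disc_moment = (\<integral>\<^sup>+z. ennreal (of_bool (norm z < 1) * (z $ 1)\<^sup>2) \<partial>(lborel :: plane measure))"

lemma of_bool_ball: "of_bool (norm (z :: plane) < 1) = (indicator (ball 0 1) z :: real)"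
  by (simp add: indicator_def)

lemma measurable_ball_mult [measurable (raw)]:
  fixes f :: "plane \<Rightarrow> real"
  shows "f \<in> borel_measurable borel \<Longrightarrow> (\<lambda>z. of_bool (norm z < 1) * f z) \<in> borel_measurable borel"
  unfolding of_bool_ball by measurable

lemma disc_moment_finite: "disc_moment < \<infinity>"
proof -
  have "disc_moment \<le> (\<integral>\<^sup>+z. indicator (ball (0 :: plane) 1) z \<partial>lborel)"
    unfolding disc_moment_def
  proof (rule nn_integral_mono)
    fix z :: plane
    have "(z $ 1)\<^sup>2 \<le> 1" if "norm z < 1"
      using component_le_norm_cart[of z 1] that by (simp add: abs_square_le_1)
    then show "ennreal (of_bool (norm z < 1) * (z $ 1)\<^sup>2) \<le> indicator (ball 0 1) z"
      by (auto simp: indicator_def)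
  qed
  also have "\<dots> < \<infinity>" using emeasure_bounded_finite[OF bounded_ball[of "0 :: plane" 1]] by simp
  finally show ?thesis .
qed

lemma disc_moment_pos: "disc_moment \<noteq> 0"
proof
  assume "disc_moment = 0"
  then have "AE z in (lborel :: plane measure). ennreal (of_bool (norm z < 1) * (z $ 1)\<^sup>2) = (0 :: ennreal)"
    unfolding disc_moment_def by (subst (asm) nn_integral_0_iff_AE) (auto intro!: measurable_compose[OF measurable_ball_mult])
  then have "AE z in (lborel :: plane measure). z \<in> ball 0 1 \<longrightarrow> z \<in> {z. z $ 1 = 0}" by eventually_elim auto
  then have "AE z in (lebesgue :: plane measure). z \<in> ball 0 1 \<longrightarrow> z \<in> {z. z $ 1 = 0}" by (rule AE_completion)
  then have "ball 0 1 \<subseteq> {z :: plane. z $ 1 = 0}"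
    using mem_closed_if_AE_lebesgue_open[OF open_ball closed_Collect_eq[OF continuous_on_component[OF continuous_on_id] continuous_on_const]]
    by blast
  moreover have "(1/2) *\<^sub>R axis 1 1 \<in> ball (0 :: plane) 1" by (simp add: norm_axis_1)
  ultimately have "((1/2) *\<^sub>R axis 1 1 :: plane) $ 1 = 0" by blast
  then show False by simp
qed

lemma measurable_disc_quadratic:
  "(\<lambda>z. ennreal (of_bool (norm z < 1) * (p \<bullet> z)\<^sup>2)) \<in> borel_measurable (borel :: plane measure)"
proof -
  have "continuous_on UNIV (\<lambda>z :: plane. (p \<bullet> z)\<^sup>2)" by (intro continuous_intros)
  then have "(\<lambda>z :: plane. (p \<bullet> z)\<^sup>2) \<in> borel_measurable borel" by (rule borel_measurable_continuous_onI)
  from measurable_ball_mult[OF this] show ?thesis by (rule measurable_compose) simp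
qed

text \<open>A reflection in a line through the origin preserves the disc and carries
  \<open>p\<close> to the multiple of the first unit vector that has the same norm.\<close>

lemma disc_moment_isotropic:
  fixes p :: plane
  shows "(\<integral>\<^sup>+z. ennreal (of_bool (norm z < 1) * (p \<bullet> z)\<^sup>2) \<partial>lborel) = ennreal ((norm p)\<^sup>2) * disc_moment"
proof -
  let ?e = "norm p *\<^sub>R axis 1 1 :: plane"
  have base: "(\<integral>\<^sup>+z. ennreal (of_bool (norm z < 1) * (?e \<bullet> z)\<^sup>2) \<partial>lborel) = ennreal ((norm p)\<^sup>2) * disc_moment"
  proof -
    have "ennreal (of_bool (norm z < 1) * (?e \<bullet> z)\<^sup>2) = ennreal ((norm p)\<^sup>2) * ennreal (of_bool (norm z < 1) * (z $ 1)\<^sup>2)" for z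
      by (simp add: inner_axis' power_mult_distrib ennreal_mult[symmetric] mult_ac)
    then show ?thesis unfolding disc_moment_def by (simp add: nn_integral_cmult)
  qed
  show ?thesis
  proof (cases "p = ?e")
    case True
    then show ?thesis using base by simp
  next
    case False
    have ne: "norm p = norm ?e" by (simp add: norm_axis_1)
    define n where "n = (1 / norm (?e - p)) *\<^sub>R (?e - p)"
    have "((norm ?e)\<^sup>2 - (norm p)\<^sup>2) / (2 * norm (?e - p)) = 0" using ne by simp
    note bis = bisector[OF False eq_refl[OF ne], folded n_def, unfolded this]
    interpret reflection n 0 by (rule bis(1))
    have nr: "norm (refl z) = norm z" for z
      using norm_refl_sq[of z] by (simp add: power2_eq_iff_nonneg)
    have ir: "p \<bullet> refl z = refl p \<bullet> z" for z
      by (simp add: refl_def inner_diff_left inner_diff_right inner_commute)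
    have "(\<integral>\<^sup>+z. ennreal (of_bool (norm z < 1) * (p \<bullet> z)\<^sup>2) \<partial>lborel) = (\<integral>\<^sup>+z. ennreal (of_bool (norm (refl z) < 1) * (p \<bullet> refl z)\<^sup>2) \<partial>lborel)"
      by (rule nn_integral_refl[symmetric, OF measurable_disc_quadratic])
    also have "\<dots> = (\<integral>\<^sup>+z. ennreal (of_bool (norm z < 1) * (?e \<bullet> z)\<^sup>2) \<partial>lborel)"
      unfolding nr ir bis(2) ..
    finally show ?thesis using base by simp
  qed
qed

text \<open>The nonlocal energy rescaled to a fixed disc of increments. Divided by
  \<open>e\<^sup>2\<close> it integrates squared difference quotients, which allows a limit as
  \<open>e\<close> tends to 0.\<close>

definition diff_energy :: "real \<Rightarrow> (plane \<Rightarrow> real) \<Rightarrow> ennreal" where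
  "diff_energy e u = (\<integral>\<^sup>+x. \<integral>\<^sup>+z. ennreal (of_bool (norm z < 1) * (u (x + e *\<^sub>R z) - u x)\<^sup>2) \<partial>lborel \<partial>lborel)"

lemma measurable_diff_energy:
  assumes "u \<in> borel_measurable borel"
  shows "(\<lambda>p :: plane \<times> plane. ennreal (c * (of_bool (norm (snd p) < 1) * (u (fst p + e *\<^sub>R snd p) - u (fst p))\<^sup>2))) \<in> borel_measurable (lborel \<Otimes>\<^sub>M lborel)"
proof -
  have "(\<lambda>p :: plane \<times> plane. fst p + e *\<^sub>R snd p) \<in> borel_measurable (lborel \<Otimes>\<^sub>M lborel)"
    unfolding lborel_prod by (simp add: borel_measurable_continuous_onI continuous_intros)
  then have 1: "(\<lambda>p :: plane \<times> plane. u (fst p + e *\<^sub>R snd p)) \<in> borel_measurable (lborel \<Otimes>\<^sub>M lborel)"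
    by (rule measurable_compose[OF _ assms])
  have 2: "(\<lambda>p :: plane \<times> plane. u (fst p)) \<in> borel_measurable (lborel \<Otimes>\<^sub>M lborel)"
    using assms by measurable
  have 3: "(\<lambda>p :: plane \<times> plane. indicator (ball 0 1) (snd p) :: real) \<in> borel_measurable (lborel \<Otimes>\<^sub>M lborel)" by measurable
  show ?thesis unfolding of_bool_ball using 1 2 3 by measurable
qed

lemma nonlocal_energy_scale:
  assumes u: "u \<in> borel_measurable borel" and e: "0 < e"
  shows "nonlocal_energy e u = ennreal (e\<^sup>2) * diff_energy e u"
proof -
  have "(\<integral>\<^sup>+y. ennreal (of_bool (norm (x - y) < e) * (u x - u y)\<^sup>2) \<partial>lborel)
    = ennreal (e\<^sup>2) * (\<integral>\<^sup>+z. ennreal (of_bool (norm z < 1) * (u (x + e *\<^sub>R z) - u x)\<^sup>2) \<partial>lborel)" for x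
  proof -
    have b: "of_bool (norm (x - y) < e) = (indicator (ball x e) y :: real)" for y by (simp add: indicator_def dist_norm)
    have "(\<lambda>y. ennreal (of_bool (norm (x - y) < e) * (u x - u y)\<^sup>2)) \<in> borel_measurable borel"
    proof -
      have [measurable]: "ball x e \<in> sets borel" by simp
      note u[measurable]
      show ?thesis unfolding b by measurable
    qed
    from nn_integral_affine[OF this, of e x]
    have "(\<integral>\<^sup>+y. ennreal (of_bool (norm (x - y) < e) * (u x - u y)\<^sup>2) \<partial>lborel)
      = ennreal (e\<^sup>2) * (\<integral>\<^sup>+z. ennreal (of_bool (norm (x - (x + e *\<^sub>R z)) < e) * (u x - u (x + e *\<^sub>R z))\<^sup>2) \<partial>lborel)" using e by simp
    moreover have "norm (x - (x + e *\<^sub>R z)) < e \<longleftrightarrow> norm z < 1" for z using e by simp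
    ultimately show ?thesis by (simp only: power2_commute[of "u x"])
  qed
  then have "nonlocal_energy e u = (\<integral>\<^sup>+x. ennreal (e\<^sup>2) * (\<integral>\<^sup>+z. ennreal (of_bool (norm z < 1) * (u (x + e *\<^sub>R z) - u x)\<^sup>2) \<partial>lborel) \<partial>lborel)"
    unfolding nonlocal_energy_iterated[OF u] by simp
  also have "\<dots> = ennreal (e\<^sup>2) * diff_energy e u" unfolding diff_energy_def
    using lborel.borel_measurable_nn_integral[of "\<lambda>x z. ennreal (of_bool (norm z < 1) * (u (x + e *\<^sub>R z) - u x)\<^sup>2)" lborel]
      measurable_diff_energy[OF u, of 1 e]
    by (intro nn_integral_cmult) (simp add: split_beta')
  finally show ?thesis .
qed

text \<open>The increment is the integral of the directional derivative along the segment.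
  Cauchy-Schwarz on the unit interval, Fubini and translation invariance give the bound.\<close>

lemma shift_energy_le:
  fixes f :: "plane \<Rightarrow> real" and g :: "plane \<Rightarrow> plane"
  assumes fg: "\<And>x. (f has_derivative (\<lambda>h. g x \<bullet> h)) (at x)" and g: "continuous_on UNIV g"
  shows "(\<integral>\<^sup>+x. ennreal ((f (x + h) - f x)\<^sup>2) \<partial>lborel) \<le> (\<integral>\<^sup>+x. ennreal ((g x \<bullet> h)\<^sup>2) \<partial>lborel)"
proof -
  have cg: "continuous_on S (\<lambda>s. g (x + s *\<^sub>R h) \<bullet> h)" for x S
    by (intro continuous_intros continuous_on_compose2[OF g]) auto
  have pt: "ennreal ((f (x + h) - f x)\<^sup>2) \<le> (\<integral>\<^sup>+s. ennreal ((g (x + s *\<^sub>R h) \<bullet> h)\<^sup>2) * indicator {0..1} s \<partial>lborel)" for x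
  proof -
    have "((\<lambda>s. g (x + s *\<^sub>R h) \<bullet> h) has_integral (f (x + 1 *\<^sub>R h) - f (x + 0 *\<^sub>R h))) {0..1}"
    proof (rule fundamental_theorem_of_calculus)
      fix s :: real
      have 1: "((\<lambda>s. x + s *\<^sub>R h) has_derivative (\<lambda>s. s *\<^sub>R h)) (at s within {0..1})" by (auto intro!: derivative_eq_intros)
      have "((\<lambda>s. f (x + s *\<^sub>R h)) has_derivative (\<lambda>r. g (x + s *\<^sub>R h) \<bullet> (r *\<^sub>R h))) (at s within {0..1})"
        by (rule has_derivative_compose[OF 1 fg])
      then show "((\<lambda>s. f (x + s *\<^sub>R h)) has_vector_derivative g (x + s *\<^sub>R h) \<bullet> h) (at s within {0..1})"
        by (simp add: has_vector_derivative_def)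
    qed simp
    then have "f (x + h) - f x = integral {0..1} (\<lambda>s. (g (x + s *\<^sub>R h) \<bullet> h) * 1)" by (simp add: integral_unique)
    moreover have "(integral {0..1} (\<lambda>s. (g (x + s *\<^sub>R h) \<bullet> h) * 1))\<^sup>2 \<le> integral {0..1} (\<lambda>s. (g (x + s *\<^sub>R h) \<bullet> h)\<^sup>2) * integral {0..1} (\<lambda>s :: real. 1\<^sup>2 :: real)"
      using cauchy_schwarz_continuous[of 0 1 "\<lambda>s. g (x + s *\<^sub>R h) \<bullet> h" "\<lambda>_. 1", OF cg continuous_on_const] .
    ultimately have "(f (x + h) - f x)\<^sup>2 \<le> integral {0..1} (\<lambda>s. (g (x + s *\<^sub>R h) \<bullet> h)\<^sup>2) * integral {0..1} (\<lambda>s :: real. 1\<^sup>2 :: real)"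
      by simp
    then have "ennreal ((f (x + h) - f x)\<^sup>2) \<le> ennreal (integral {0..1} (\<lambda>s. (g (x + s *\<^sub>R h) \<bullet> h)\<^sup>2))" by (simp add: ennreal_leI)
    also have "\<dots> = (\<integral>\<^sup>+s. ennreal ((g (x + s *\<^sub>R h) \<bullet> h)\<^sup>2) * indicator {0..1} s \<partial>lborel)"
      by (intro nn_integral_has_integral_lebesgue'[symmetric] integrable_integral integrable_continuous_real continuous_intros cg) auto
    finally show ?thesis .
  qed
  have m1: "(\<lambda>x. ennreal ((g x \<bullet> h)\<^sup>2)) \<in> borel_measurable borel"
  proof -
    have "continuous_on UNIV (\<lambda>x. (g x \<bullet> h)\<^sup>2)" by (intro continuous_intros g)
    then show ?thesis using borel_measurable_continuous_onI by simp
  qed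
  have mp: "(\<lambda>p :: plane \<times> real. ennreal ((g (fst p + snd p *\<^sub>R h) \<bullet> h)\<^sup>2) * indicator {0..1} (snd p)) \<in> borel_measurable (lborel \<Otimes>\<^sub>M lborel)"
  proof -
    have "continuous_on UNIV (\<lambda>p :: plane \<times> real. (g (fst p + snd p *\<^sub>R h) \<bullet> h)\<^sup>2)"
      by (intro continuous_intros continuous_on_compose2[OF g]) auto
    then have "(\<lambda>p :: plane \<times> real. (g (fst p + snd p *\<^sub>R h) \<bullet> h)\<^sup>2) \<in> borel_measurable (lborel \<Otimes>\<^sub>M lborel)"
      unfolding lborel_prod using borel_measurable_continuous_onI by simp
    then show ?thesis by measurable
  qed
  have "(\<integral>\<^sup>+x. ennreal ((f (x + h) - f x)\<^sup>2) \<partial>lborel) \<le> (\<integral>\<^sup>+x. \<integral>\<^sup>+s. ennreal ((g (x + s *\<^sub>R h) \<bullet> h)\<^sup>2) * indicator {0..1} s \<partial>lborel \<partial>lborel)"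
    by (intro nn_integral_mono pt)
  also have "\<dots> = (\<integral>\<^sup>+s. \<integral>\<^sup>+x. ennreal ((g (x + s *\<^sub>R h) \<bullet> h)\<^sup>2) * indicator {0..1} s \<partial>lborel \<partial>lborel)"
    by (rule lborel_pair.Fubini'[symmetric]) (use mp in \<open>simp add: split_beta'\<close>)
  also have "\<dots> = (\<integral>\<^sup>+s. (\<integral>\<^sup>+x. ennreal ((g x \<bullet> h)\<^sup>2) \<partial>lborel) * indicator {0..1} s \<partial>(lborel :: real measure))"
  proof (rule nn_integral_cong)
    fix s :: real
    have ms: "(\<lambda>x. ennreal ((g (x + s *\<^sub>R h) \<bullet> h)\<^sup>2)) \<in> borel_measurable lborel"
      using measurable_compose[OF _ m1, of "\<lambda>x. x + s *\<^sub>R h" lborel] by simp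
    have "(\<integral>\<^sup>+x. ennreal ((g (x + s *\<^sub>R h) \<bullet> h)\<^sup>2) * indicator {0..1} s \<partial>lborel) = (\<integral>\<^sup>+x. ennreal ((g (x + s *\<^sub>R h) \<bullet> h)\<^sup>2) \<partial>lborel) * indicator {0..1} s"
      by (rule nn_integral_multc[OF ms])
    then show "(\<integral>\<^sup>+x. ennreal ((g (x + s *\<^sub>R h) \<bullet> h)\<^sup>2) * indicator {0..1} s \<partial>lborel) = (\<integral>\<^sup>+x. ennreal ((g x \<bullet> h)\<^sup>2) \<partial>lborel) * indicator {0..1} s"
      using nn_integral_translate[OF m1, of "s *\<^sub>R h"] by simp
  qed
  also have "\<dots> = (\<integral>\<^sup>+x. ennreal ((g x \<bullet> h)\<^sup>2) \<partial>lborel)"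
    by (subst nn_integral_cmult_indicator) auto
  finally show ?thesis .
qed

lemma measurable_directional:
  assumes g: "continuous_on UNIV g"
  shows "(\<lambda>p :: plane \<times> plane. ennreal (of_bool (norm (snd p) < 1) * (g (fst p) \<bullet> snd p)\<^sup>2)) \<in> borel_measurable (lborel \<Otimes>\<^sub>M lborel)"
proof -
  have "continuous_on UNIV (\<lambda>p :: plane \<times> plane. (g (fst p) \<bullet> snd p)\<^sup>2)"
    by (intro continuous_intros continuous_on_compose2[OF g]) auto
  then have [measurable]: "(\<lambda>p :: plane \<times> plane. (g (fst p) \<bullet> snd p)\<^sup>2) \<in> borel_measurable (lborel \<Otimes>\<^sub>M lborel)"
    unfolding lborel_prod using borel_measurable_continuous_onI by simp
  have [measurable]: "(\<lambda>p :: plane \<times> plane. indicator (ball 0 1) (snd p) :: real) \<in> borel_measurable (lborel \<Otimes>\<^sub>M lborel)" by measurable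
  show ?thesis unfolding of_bool_ball by measurable
qed

lemma directional_energy:
  assumes g: "continuous_on UNIV (g :: plane \<Rightarrow> plane)"
  shows "(\<integral>\<^sup>+x. \<integral>\<^sup>+z. ennreal (of_bool (norm z < 1) * (g x \<bullet> z)\<^sup>2) \<partial>lborel \<partial>lborel) = (\<integral>\<^sup>+x. ennreal ((norm (g x))\<^sup>2) \<partial>lborel) * disc_moment"
proof -
  have "continuous_on UNIV (\<lambda>x. (norm (g x))\<^sup>2)" by (intro continuous_intros g)
  then have "(\<lambda>x. ennreal ((norm (g x))\<^sup>2)) \<in> borel_measurable lborel" using borel_measurable_continuous_onI by simp
  then show ?thesis unfolding disc_moment_isotropic by (rule nn_integral_multc)
qed

text \<open>\<open>shift_energy_le\<close> for every increment in the disc of radius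
  \<open>e\<close>. The bound holds for each \<open>e\<close> and not only in the limit, so a
  comparison of nonlocal energies retains it.\<close>

lemma diff_energy_le:
  assumes fg: "\<And>x. (f has_derivative (\<lambda>h. g x \<bullet> h)) (at x)" and g: "continuous_on UNIV g"
  shows "diff_energy e f \<le> ennreal (e\<^sup>2) * ((\<integral>\<^sup>+x. ennreal ((norm (g x))\<^sup>2) \<partial>lborel) * disc_moment)"
proof -
  have cf: "continuous_on UNIV f" by (rule has_derivative_continuous_on[of _ _ "\<lambda>x h. g x \<bullet> h"]) (simp add: fg)
  have fm: "f \<in> borel_measurable borel" by (rule borel_measurable_continuous_onI[OF cf])
  have gm: "(\<lambda>x. ennreal ((g x \<bullet> z)\<^sup>2)) \<in> borel_measurable lborel" for z
  proof -
    have "continuous_on UNIV (\<lambda>x. (g x \<bullet> z)\<^sup>2)" by (intro continuous_intros g)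
    then show ?thesis using borel_measurable_continuous_onI by simp
  qed
  have fmz: "(\<lambda>x. ennreal ((f (x + e *\<^sub>R z) - f x)\<^sup>2)) \<in> borel_measurable lborel" for z
    using fm by measurable
  have "diff_energy e f = (\<integral>\<^sup>+z. \<integral>\<^sup>+x. ennreal (of_bool (norm z < 1) * (f (x + e *\<^sub>R z) - f x)\<^sup>2) \<partial>lborel \<partial>lborel)"
    unfolding diff_energy_def using measurable_diff_energy[OF fm, of 1 e]
    by (intro lborel_pair.Fubini'[symmetric]) (simp add: split_beta')
  also have "\<dots> \<le> (\<integral>\<^sup>+z. \<integral>\<^sup>+x. ennreal (e\<^sup>2) * ennreal (of_bool (norm z < 1) * (g x \<bullet> z)\<^sup>2) \<partial>lborel \<partial>lborel)"
  proof (rule nn_integral_mono)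
    fix z :: plane
    show "(\<integral>\<^sup>+x. ennreal (of_bool (norm z < 1) * (f (x + e *\<^sub>R z) - f x)\<^sup>2) \<partial>lborel) \<le> (\<integral>\<^sup>+x. ennreal (e\<^sup>2) * ennreal (of_bool (norm z < 1) * (g x \<bullet> z)\<^sup>2) \<partial>lborel)"
    proof (cases "norm z < 1")
      case True
      have "(\<integral>\<^sup>+x. ennreal ((f (x + e *\<^sub>R z) - f x)\<^sup>2) \<partial>lborel) \<le> (\<integral>\<^sup>+x. ennreal ((g x \<bullet> (e *\<^sub>R z))\<^sup>2) \<partial>lborel)"
        by (rule shift_energy_le[OF fg g])
      then show ?thesis using True by (simp add: power_mult_distrib ennreal_mult)
    qed simp
  qed
  also have "\<dots> = (\<integral>\<^sup>+x. \<integral>\<^sup>+z. ennreal (e\<^sup>2) * ennreal (of_bool (norm z < 1) * (g x \<bullet> z)\<^sup>2) \<partial>lborel \<partial>lborel)"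
    using measurable_directional[OF g] by (intro lborel_pair.Fubini') (simp add: split_beta')
  also have "\<dots> = (\<integral>\<^sup>+x. ennreal (e\<^sup>2) * (\<integral>\<^sup>+z. ennreal (of_bool (norm z < 1) * (g x \<bullet> z)\<^sup>2) \<partial>lborel) \<partial>lborel)"
    using measurable_disc_quadratic by (intro nn_integral_cong nn_integral_cmult) simp
  also have "\<dots> = ennreal (e\<^sup>2) * (\<integral>\<^sup>+x. \<integral>\<^sup>+z. ennreal (of_bool (norm z < 1) * (g x \<bullet> z)\<^sup>2) \<partial>lborel \<partial>lborel)"
    using lborel.borel_measurable_nn_integral[of "\<lambda>x z. ennreal (of_bool (norm z < 1) * (g x \<bullet> z)\<^sup>2)" lborel] measurable_directional[OF g]
    by (intro nn_integral_cmult) (simp add: split_beta')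
  finally show ?thesis unfolding directional_energy[OF g] .
qed

text \<open>The converse of \<open>diff_energy_le\<close>, by Fatou's lemma for the difference
  quotients. Together they transfer a Dirichlet bound from one C1 function to another through
  nonlocal energies alone.\<close>

lemma gradient_energy_le:
  assumes fg: "\<And>x. (f has_derivative (\<lambda>h. g x \<bullet> h)) (at x)" and g: "continuous_on UNIV g"
    and le: "\<And>e. 0 < e \<Longrightarrow> diff_energy e f \<le> ennreal (e\<^sup>2) * (C * disc_moment)"
  shows "(\<integral>\<^sup>+x. ennreal ((norm (g x))\<^sup>2) \<partial>lborel) \<le> C"
proof -
  have cf: "continuous_on UNIV f" by (rule has_derivative_continuous_on[of _ _ "\<lambda>x h. g x \<bullet> h"]) (simp add: fg)
  have fm: "f \<in> borel_measurable borel" by (rule borel_measurable_continuous_onI[OF cf])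
  define h where "h k = inverse (real (Suc k))" for k
  have h: "0 < h k" for k by (simp add: h_def)
  have hl: "filterlim h (at 0) sequentially"
    unfolding filterlim_at h_def using LIMSEQ_inverse_real_of_nat by (auto intro!: always_eventually)
  define F where "F k p = ennreal ((inverse (h k))\<^sup>2 * (of_bool (norm (snd p) < 1) * (f (fst p + h k *\<^sub>R snd p) - f (fst p))\<^sup>2))" for k and p :: "plane \<times> plane"
  have Fm: "F k \<in> borel_measurable (lborel \<Otimes>\<^sub>M lborel)" for k unfolding F_def by (rule measurable_diff_energy[OF fm])
  have "(\<integral>\<^sup>+p. ennreal (of_bool (norm (snd p) < 1) * (g (fst p) \<bullet> snd p)\<^sup>2) \<partial>(lborel \<Otimes>\<^sub>M lborel)) \<le> C * disc_moment"
  proof (rule nn_integral_fatou_AE[OF Fm])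
    show "AE p in lborel \<Otimes>\<^sub>M lborel. (\<lambda>k. F k p) \<longlonglongrightarrow> ennreal (of_bool (norm (snd p) < 1) * (g (fst p) \<bullet> snd p)\<^sup>2)"
    proof (rule AE_I2)
      fix p :: "plane \<times> plane"
      have d: "((\<lambda>s. f (fst p + s *\<^sub>R snd p)) has_real_derivative (g (fst p) \<bullet> snd p)) (at 0)"
      proof -
        have 1: "((\<lambda>s. fst p + s *\<^sub>R snd p) has_derivative (\<lambda>s. s *\<^sub>R snd p)) (at 0)" by (auto intro!: derivative_eq_intros)
        have "((\<lambda>s. f (fst p + s *\<^sub>R snd p)) has_derivative (\<lambda>r. g (fst p) \<bullet> (r *\<^sub>R snd p))) (at 0)"
          using has_derivative_compose[OF 1, of f "\<lambda>h. g (fst p) \<bullet> h"] fg[of "fst p"] by simp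
        then show ?thesis unfolding has_field_derivative_def by (rule has_derivative_eq_rhs) (simp add: fun_eq_iff)
      qed
      have "(\<lambda>k. (f (fst p + h k *\<^sub>R snd p) - f (fst p + 0 *\<^sub>R snd p)) / (h k - 0)) \<longlonglongrightarrow> g (fst p) \<bullet> snd p"
        using d unfolding has_field_derivative_iff by (rule filterlim_compose[OF _ hl])
      then have "(\<lambda>k. ennreal (of_bool (norm (snd p) < 1) * ((f (fst p + h k *\<^sub>R snd p) - f (fst p)) / h k)\<^sup>2)) \<longlonglongrightarrow> ennreal (of_bool (norm (snd p) < 1) * (g (fst p) \<bullet> snd p)\<^sup>2)"
        by (intro tendsto_intros) simp
      moreover have "of_bool (norm (snd p) < 1) * ((f (fst p + h k *\<^sub>R snd p) - f (fst p)) / h k)\<^sup>2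
         = (inverse (h k))\<^sup>2 * (of_bool (norm (snd p) < 1) * (f (fst p + h k *\<^sub>R snd p) - f (fst p))\<^sup>2)" for k
        by (simp add: divide_inverse power_mult_distrib)
      ultimately show "(\<lambda>k. F k p) \<longlonglongrightarrow> ennreal (of_bool (norm (snd p) < 1) * (g (fst p) \<bullet> snd p)\<^sup>2)" unfolding F_def by simp
    qed
    show "eventually (\<lambda>k. (\<integral>\<^sup>+p. F k p \<partial>(lborel \<Otimes>\<^sub>M lborel)) \<le> C * disc_moment) sequentially"
    proof (intro always_eventually allI)
      fix k
      have "(\<integral>\<^sup>+p. F k p \<partial>(lborel \<Otimes>\<^sub>M lborel)) = (\<integral>\<^sup>+p. ennreal ((inverse (h k))\<^sup>2) * ennreal (1 * (of_bool (norm (snd p) < 1) * (f (fst p + h k *\<^sub>R snd p) - f (fst p))\<^sup>2)) \<partial>(lborel \<Otimes>\<^sub>M lborel))"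
        unfolding F_def by (simp add: ennreal_mult)
      also have "\<dots> = ennreal ((inverse (h k))\<^sup>2) * (\<integral>\<^sup>+p. ennreal (1 * (of_bool (norm (snd p) < 1) * (f (fst p + h k *\<^sub>R snd p) - f (fst p))\<^sup>2)) \<partial>(lborel \<Otimes>\<^sub>M lborel))"
        by (rule nn_integral_cmult[OF measurable_diff_energy[OF fm]])
      also have "(\<integral>\<^sup>+p. ennreal (1 * (of_bool (norm (snd p) < 1) * (f (fst p + h k *\<^sub>R snd p) - f (fst p))\<^sup>2)) \<partial>(lborel \<Otimes>\<^sub>M lborel)) = diff_energy (h k) f"
        unfolding diff_energy_def using lborel.nn_integral_fst[OF measurable_diff_energy[OF fm, of 1 "h k"]] by simp
      also have "ennreal ((inverse (h k))\<^sup>2) * diff_energy (h k) f \<le> ennreal ((inverse (h k))\<^sup>2) * (ennreal ((h k)\<^sup>2) * (C * disc_moment))"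
        by (intro mult_left_mono le h) simp
      also have "\<dots> = C * disc_moment"
        using h[of k] by (simp add: mult.assoc[symmetric] ennreal_mult[symmetric] power_mult_distrib[symmetric])
      finally show "(\<integral>\<^sup>+p. F k p \<partial>(lborel \<Otimes>\<^sub>M lborel)) \<le> C * disc_moment" .
    qed
  qed
  then have "(\<integral>\<^sup>+x. ennreal ((norm (g x))\<^sup>2) \<partial>lborel) * disc_moment \<le> C * disc_moment"
    using lborel.nn_integral_fst[OF measurable_directional[OF g]] by (simp add: directional_energy[OF g])
  then show ?thesis
    using disc_moment_pos disc_moment_finite by (simp add: mult.commute[of _ disc_moment] ennreal_mult_le_mult_iff)
qed

section \<open>Mollification\<close>

definition mollifier0 :: "real \<Rightarrow> plane \<Rightarrow> real" where
  "mollifier0 d z = bump 0 (d\<^sup>2 - (norm z)\<^sup>2)"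

lemma mollifier0_nonneg: "0 \<le> mollifier0 d z" by (simp add: mollifier0_def bump_nonneg)

lemma mollifier0_outside: "0 < d \<Longrightarrow> d \<le> norm z \<Longrightarrow> mollifier0 d z = 0"
  using power_mono[of d "norm z" 2] by (auto simp: mollifier0_def bump_def not_less)

lemma mollifier0_Cc:
  assumes d: "0 < d" shows "mollifier0 d \<in> Cc_infty UNIV"
proof -
  have e: "mollifier0 d = (\<lambda>z. bump 0 (d\<^sup>2 - (z $ 1 * z $ 1 + z $ 2 * z $ 2)))"
    by (simp add: mollifier0_def fun_eq_iff norm_vec2 power2_eq_square)
  have "elem_smooth UNIV (mollifier0 d)" unfolding e by (intro elem_smooth.intros elem_smooth_diff)
  moreover have 0: "mollifier0 d x = 0" if "x \<notin> cball 0 d" for x using that d by (intro mollifier0_outside) auto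
  ultimately have "smooth (mollifier0 d)"
    by (intro smooth_elem_smooth[of UNIV "cball 0 d" "mollifier0 d"]) auto
  moreover have c: "closure {x. mollifier0 d x \<noteq> 0} \<subseteq> cball 0 d"
    by (rule closure_minimal[OF _ closed_cball]) (use 0 in blast)
  moreover have "compact (closure {x. mollifier0 d x \<noteq> 0})"
    using bounded_subset[OF bounded_cball c] by (simp add: compact_eq_bounded_closed)
  ultimately show ?thesis unfolding Cc_infty_def by auto
qed

definition "mollifier_mass d = (\<integral>z. mollifier0 d z \<partial>lborel)"

lemma mollifier_mass_pos: assumes d: "0 < d" shows "0 < mollifier_mass d"
proof (rule ccontr)
  note C = C1c_Cc_infty[OF mollifier0_Cc[OF d]]
  obtain K where K: "compact K" "\<And>x. x \<notin> K \<Longrightarrow> mollifier0 d x = 0" by (rule C1c_support[OF C]) blast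
  have i: "integrable lborel (mollifier0 d)" by (rule integrable_continuous_compact_support[OF C1c_continuous(1)[OF C] K])
  assume "\<not> 0 < mollifier_mass d"
  moreover have "0 \<le> mollifier_mass d" unfolding mollifier_mass_def by (intro integral_nonneg_AE AE_I2) (rule mollifier0_nonneg)
  ultimately have "(\<integral>z. mollifier0 d z \<partial>lborel) = 0" by (simp add: mollifier_mass_def)
  then have "mollifier0 d 0 = 0" by (intro continuous_nonneg_integral_0[OF C1c_continuous(1)[OF C] i mollifier0_nonneg])
  then show False using d by (simp add: mollifier0_def bump_def)
qed

definition mollifier :: "real \<Rightarrow> plane \<Rightarrow> real" where
  "mollifier d z = inverse (mollifier_mass d) * mollifier0 d z"

lemma mollifier:
  assumes d: "0 < d"
  shows "\<exists>k'. C1c UNIV (mollifier d) k'" "0 \<le> mollifier d z" "d \<le> norm z \<Longrightarrow> mollifier d z = 0"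
    "integrable lborel (mollifier d)" "(\<integral>z. mollifier d z \<partial>lborel) = 1" "norm z = norm z' \<Longrightarrow> mollifier d z = mollifier d z'"
proof -
  have C: "C1c UNIV (mollifier d) (\<lambda>x. inverse (mollifier_mass d) *\<^sub>R grad (mollifier0 d) x)"
    unfolding mollifier_def[abs_def] by (rule C1c_cmult[OF C1c_Cc_infty[OF mollifier0_Cc[OF d]]])
  then show "\<exists>k'. C1c UNIV (mollifier d) k'" by blast
  show "0 \<le> mollifier d z" using mollifier_mass_pos[OF d] mollifier0_nonneg[of d z] by (simp add: mollifier_def)
  show "d \<le> norm z \<Longrightarrow> mollifier d z = 0" using mollifier0_outside[OF d] by (simp add: mollifier_def)
  obtain K where K: "compact K" "\<And>x. x \<notin> K \<Longrightarrow> mollifier d x = 0" by (rule C1c_support[OF C]) blast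
  show "integrable lborel (mollifier d)" by (rule integrable_continuous_compact_support[OF C1c_continuous(1)[OF C] K])
  show "(\<integral>z. mollifier d z \<partial>lborel) = 1" unfolding mollifier_def[abs_def]
    using mollifier_mass_pos[OF d] by (simp add: mollifier_mass_def)
  show "norm z = norm z' \<Longrightarrow> mollifier d z = mollifier d z'" by (simp add: mollifier_def mollifier0_def)
qed

lemma integral_reflect_translate:
  fixes f :: "plane \<Rightarrow> real"
  assumes [measurable]: "f \<in> borel_measurable borel"
  shows "(\<integral>y. f (x - y) \<partial>lborel) = (\<integral>y. f y \<partial>lborel)"
proof -
  have "(\<integral>y. f y \<partial>lborel) = (\<integral>y. f y \<partial>density (distr lborel borel (\<lambda>z. x + (-1) *\<^sub>R z)) (\<lambda>_. ennreal (\<bar>-1\<bar>^DIM(plane))))"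
    by (subst lborel_affine[of "-1" x]) simp_all
  also have "\<dots> = (\<integral>y. f y \<partial>distr lborel borel (\<lambda>z. x - z))"
    by (simp add: density_1 one_ennreal_def[symmetric])
  also have "\<dots> = (\<integral>y. f (x - y) \<partial>lborel)" by (subst integral_distr) auto
  finally show ?thesis ..
qed

text \<open>Differentiation under the integral sign is uniform because the gradient of the kernel is uniformly continuous.\<close>

lemma convolution_has_derivative:
  fixes v k :: "plane \<Rightarrow> real"
  assumes v: "continuous_on UNIV v" "compact Kv" "\<And>x. x \<notin> Kv \<Longrightarrow> v x = 0" and k: "C1c UNIV k k'"
  defines "f \<equiv> \<lambda>x. \<integral>y. v y * k (x - y) \<partial>lborel" and "G \<equiv> \<lambda>x. \<integral>y. v y *\<^sub>R k' (x - y) \<partial>lborel"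
  shows "(f has_derivative (\<lambda>h. G x \<bullet> h)) (at x)" "continuous_on UNIV G"
proof -
  obtain K where K: "compact K" "\<And>x. x \<notin> K \<Longrightarrow> k x = 0" "\<And>x. x \<notin> K \<Longrightarrow> k' x = 0" by (rule C1c_support[OF k]) blast
  note ck = C1c_continuous(1)[OF k, of UNIV] and ck' = C1c_continuous(2)[OF k, of UNIV]
  have ik: "integrable lborel (\<lambda>y. v y * k (x - y))" "integrable lborel (\<lambda>y. v y *\<^sub>R k' (x - y))" for x
    by (rule integrable_continuous_compact_support[OF _ v(2)];
        use v in \<open>auto intro!: continuous_intros continuous_on_compose2[OF ck] continuous_on_compose2[OF ck']\<close>)+
  have iv: "integrable lborel (\<lambda>y. \<bar>v y\<bar>)"
    by (rule integrable_continuous_compact_support[OF _ v(2)]) (use v in \<open>auto intro!: continuous_intros\<close>)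
  define N where "N = (\<integral>y. \<bar>v y\<bar> \<partial>lborel)"
  have N0: "0 \<le> N" unfolding N_def by (intro integral_nonneg_AE AE_I2) simp
  have uc: "\<exists>r>0. \<forall>x y. norm (x - y) < r \<longrightarrow> norm (k' x - k' y) \<le> e" if e: "e > 0" for e
  proof -
    obtain B where B: "\<And>x. x \<in> K \<Longrightarrow> norm x \<le> B" using compact_imp_bounded[OF K(1)] by (auto simp: bounded_iff)
    have "uniformly_continuous_on (cball 0 (B + 1)) k'"
      by (rule compact_uniformly_continuous[OF C1c_continuous(2)[OF k]]) simp
    then obtain r where r: "r > 0" "\<And>x y. x \<in> cball 0 (B + 1) \<Longrightarrow> y \<in> cball 0 (B + 1) \<Longrightarrow> dist y x < r \<Longrightarrow> dist (k' y) (k' x) < e"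
      using e unfolding uniformly_continuous_on_def by metis
    have "norm (k' x - k' y) \<le> e" if xy: "norm (x - y) < min r 1" for x y
    proof (cases "norm x \<le> B \<or> norm y \<le> B")
      case True
      have "norm x \<le> norm y + norm (x - y)" "norm y \<le> norm x + norm (x - y)"
        using norm_triangle_sub[of x y] norm_triangle_sub[of y x] by (simp_all add: norm_minus_commute)
      then have "x \<in> cball 0 (B + 1)" "y \<in> cball 0 (B + 1)" using True xy by auto
      from r(2)[OF this(2,1)] show ?thesis using xy by (simp add: dist_norm)
    next
      case False
      then have "k' x = 0" "k' y = 0" using B K(3) by force+
      then show ?thesis using e by simp
    qed
    then show ?thesis using r(1) by (intro exI[of _ "min r 1"]) auto
  qed
  have "(\<lambda>h. G x \<bullet> h) = (\<lambda>h. G x \<bullet> h)" ..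
  show "(f has_derivative (\<lambda>h. G x \<bullet> h)) (at x)"
    unfolding has_derivative_at_alt
  proof (intro conjI allI impI)
    show "bounded_linear (\<lambda>h. G x \<bullet> h)" by (rule bounded_linear_inner_right)
    fix e :: real assume e: "0 < e"
    then have "0 < e / (N + 1)" using N0 by simp
    then obtain r where r: "r > 0" "\<And>x y. norm (x - y) < r \<Longrightarrow> norm (k' x - k' y) \<le> e / (N + 1)" using uc by meson
    have kd: "\<bar>k (a + h) - k a - k' a \<bullet> h\<bar> \<le> e / (N + 1) * norm h" if h: "norm h < r" for a h
    proof -
      have "norm ((k (a + h) - k' a \<bullet> (a + h)) - (k a - k' a \<bullet> a)) \<le> e / (N + 1) * norm ((a + h) - a)"
      proof (rule differentiable_bound[of "ball a r"])
        show "((\<lambda>b. k b - k' a \<bullet> b) has_derivative (\<lambda>s. (k' b - k' a) \<bullet> s)) (at b within ball a r)" for b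
          using has_derivative_diff[OF C1c_derivative[OF k] bounded_linear_imp_has_derivative[OF bounded_linear_inner_right]]
          by (simp add: inner_diff_left)
        show "onorm (\<lambda>s. (k' b - k' a) \<bullet> s) \<le> e / (N + 1)" if "b \<in> ball a r" for b
        proof (rule onorm_le)
          fix s
          have "norm ((k' b - k' a) \<bullet> s) \<le> norm (k' b - k' a) * norm s" by (simp add: Cauchy_Schwarz_ineq2)
          also have "\<dots> \<le> e / (N + 1) * norm s"
            using r(2)[of b a] that by (intro mult_right_mono) (auto simp: dist_norm norm_minus_commute)
          finally show "norm ((k' b - k' a) \<bullet> s) \<le> e / (N + 1) * norm s" .
        qed
      qed (use h r in \<open>auto simp: dist_norm\<close>)
      then show ?thesis by (simp add: inner_add_right algebra_simps)
    qed
    show "\<exists>d>0. \<forall>y. norm (y - x) < d \<longrightarrow> norm (f y - f x - G x \<bullet> (y - x)) \<le> e * norm (y - x)"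
    proof (intro exI[of _ r] conjI allI impI r(1))
      fix y assume y: "norm (y - x) < r"
      define h where "h = y - x"
      have Gh: "G x \<bullet> h = (\<integral>z. v z * (k' (x - z) \<bullet> h) \<partial>lborel)" "integrable lborel (\<lambda>z. v z * (k' (x - z) \<bullet> h))"
        unfolding G_def using integral_inner_left[OF ik(2)[of x], of h] integrable_inner_left[OF ik(2)[of x], of h] by auto
      have "f y - f x - G x \<bullet> h = (\<integral>z. v z * (k (y - z) - k (x - z) - k' (x - z) \<bullet> h) \<partial>lborel)"
        unfolding Gh(1) f_def using ik(1)[of y] ik(1)[of x] Gh(2) by (simp add: right_diff_distrib)
      also have "norm \<dots> \<le> (\<integral>z. norm (v z * (k (y - z) - k (x - z) - k' (x - z) \<bullet> h)) \<partial>lborel)" by (rule integral_norm_bound)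
      also have "\<dots> \<le> (\<integral>z. e / (N + 1) * norm h * \<bar>v z\<bar> \<partial>lborel)"
      proof (rule integral_mono)
        show "integrable lborel (\<lambda>z. norm (v z * (k (y - z) - k (x - z) - k' (x - z) \<bullet> h)))"
          using ik(1)[of y] ik(1)[of x] Gh(2) by (simp add: right_diff_distrib)
        show "integrable lborel (\<lambda>z. e / (N + 1) * norm h * \<bar>v z\<bar>)" using iv by simp
        fix z
        have "\<bar>k ((x - z) + h) - k (x - z) - k' (x - z) \<bullet> h\<bar> \<le> e / (N + 1) * norm h"
          by (rule kd) (use y in \<open>simp add: h_def\<close>)
        moreover have "(x - z) + h = y - z" by (simp add: h_def)
        ultimately have "\<bar>k (y - z) - k (x - z) - k' (x - z) \<bullet> h\<bar> \<le> e / (N + 1) * norm h" by simp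
        then have "\<bar>v z\<bar> * \<bar>k (y - z) - k (x - z) - k' (x - z) \<bullet> h\<bar> \<le> \<bar>v z\<bar> * (e / (N + 1) * norm h)" by (intro mult_left_mono) auto
        then show "norm (v z * (k (y - z) - k (x - z) - k' (x - z) \<bullet> h)) \<le> e / (N + 1) * norm h * \<bar>v z\<bar>"
          by (simp add: abs_mult mult_ac)
      qed
      also have "\<dots> = e * norm h * (N / (N + 1))" by (simp add: N_def)
      also have "\<dots> \<le> e * norm h * 1" using e N0 by (intro mult_left_mono) auto
      finally show "norm (f y - f x - G x \<bullet> (y - x)) \<le> e * norm (y - x)" by (simp add: h_def)
    qed
  qed
  show "continuous_on UNIV G"
  proof (rule continuous_onI)
    fix x and e :: real assume e: "0 < e"
    then have "0 < e / (N + 1)" using N0 by simp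
    then obtain r where r: "r > 0" "\<And>x y. norm (x - y) < r \<Longrightarrow> norm (k' x - k' y) \<le> e / (N + 1)" using uc by meson
    show "\<exists>d>0. \<forall>x'\<in>UNIV. dist x' x < d \<longrightarrow> dist (G x') (G x) \<le> e"
    proof (intro exI[of _ r] conjI ballI impI r(1))
      fix x' assume x': "dist x' x < r"
      have "G x' - G x = (\<integral>y. v y *\<^sub>R (k' (x' - y) - k' (x - y)) \<partial>lborel)"
        unfolding G_def using ik(2)[of x'] ik(2)[of x] by (simp add: scaleR_diff_right)
      also have "norm \<dots> \<le> (\<integral>y. norm (v y *\<^sub>R (k' (x' - y) - k' (x - y))) \<partial>lborel)" by (rule integral_norm_bound)
      also have "\<dots> \<le> (\<integral>y. e / (N + 1) * \<bar>v y\<bar> \<partial>lborel)"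
      proof (rule integral_mono)
        show "integrable lborel (\<lambda>y. norm (v y *\<^sub>R (k' (x' - y) - k' (x - y))))"
          using ik(2)[of x'] ik(2)[of x] by (simp add: scaleR_diff_right del: norm_scaleR)
        show "integrable lborel (\<lambda>y. e / (N + 1) * \<bar>v y\<bar>)" using iv by simp
        fix y
        have "norm (k' (x' - y) - k' (x - y)) \<le> e / (N + 1)"
          by (rule r(2)) (use x' in \<open>simp add: dist_norm\<close>)
        from mult_left_mono[OF this abs_ge_zero]
        show "norm (v y *\<^sub>R (k' (x' - y) - k' (x - y))) \<le> e / (N + 1) * \<bar>v y\<bar>"
          by (simp only: norm_scaleR mult.commute[of "e / (N + 1)"])
      qed
      also have "\<dots> = e * (N / (N + 1))" by (simp add: N_def)
      also have "\<dots> \<le> e * 1" using e N0 by (intro mult_left_mono) auto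
      finally show "dist (G x') (G x) \<le> e" by (simp add: dist_norm)
    qed
  qed
qed

text \<open>A radial competitor is only Lipschitz, while the one-dimensional argument needs a C1
  function. Convolution with a radial kernel keeps radial symmetry and the nonlocal bounds and
  changes the function by at most \<open>L * d\<close>.\<close>

locale mollified =
  fixes v :: "plane \<Rightarrow> real" and L R d :: real
  assumes lip: "\<And>x y. \<bar>v x - v y\<bar> \<le> L * norm (x - y)" and L: "0 \<le> L" and d: "0 < d"
    and supp: "\<And>x. R < norm x \<Longrightarrow> v x = 0" and rad: "\<And>x y. norm x = norm y \<Longrightarrow> v x = v y"
begin

definition vd :: "plane \<Rightarrow> real" where "vd x = (\<integral>y. v y * mollifier d (x - y) \<partial>lborel)"

lemma cv: "continuous_on S v" by (rule lipschitz_continuous[OF lip L])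
lemma vm [measurable]: "v \<in> borel_measurable borel" by (rule borel_measurable_continuous_onI[OF cv])
lemma km [measurable]: "mollifier d \<in> borel_measurable borel" using mollifier(4)[OF d] by simp
lemma v_cpt: "x \<notin> cball 0 R \<Longrightarrow> v x = 0" using supp by simp

lemma vd_alt: "vd x = (\<integral>z. mollifier d z * v (x - z) \<partial>lborel)"
  unfolding vd_def using integral_reflect_translate[of "\<lambda>z. mollifier d z * v (x - z)" x] by (simp add: mult.commute)

lemma integrable_kv: "integrable lborel (\<lambda>z. mollifier d z * v (x - z))"
proof -
  obtain k' where k: "C1c UNIV (mollifier d) k'" using mollifier(1)[OF d] by blast
  obtain K where K: "compact K" "\<And>x. x \<notin> K \<Longrightarrow> mollifier d x = 0" by (rule C1c_support[OF k]) blast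
  show ?thesis
    by (rule integrable_continuous_compact_support[OF _ K(1)])
       (use K in \<open>auto intro!: continuous_intros C1c_continuous(1)[OF k] continuous_on_compose2[OF cv]\<close>)
qed

lemma vd_C1: obtains G where "\<And>x. (vd has_derivative (\<lambda>h. G x \<bullet> h)) (at x)" "continuous_on UNIV G"
proof -
  obtain k' where k: "C1c UNIV (mollifier d) k'" using mollifier(1)[OF d] by blast
  note c = convolution_has_derivative[OF cv compact_cball v_cpt k]
  have "vd = (\<lambda>x. \<integral>y. v y * mollifier d (x - y) \<partial>lborel)" by (simp add: vd_def[abs_def])
  note eq = this
  show ?thesis
  proof (rule that)
    show "(vd has_derivative (\<lambda>h. (\<integral>y. v y *\<^sub>R k' (x - y) \<partial>lborel) \<bullet> h)) (at x)" for x
      unfolding eq by (rule c(1))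
  qed (rule c(2))
qed

lemma vd_close: "\<bar>vd x - v x\<bar> \<le> L * d"
proof -
  have "v x = (\<integral>z. mollifier d z * v x \<partial>lborel)" using mollifier(5)[OF d] by simp
  moreover have i: "integrable lborel (\<lambda>z. mollifier d z * v x)" using mollifier(4)[OF d] by simp
  ultimately have "vd x - v x = (\<integral>z. mollifier d z * (v (x - z) - v x) \<partial>lborel)"
    unfolding vd_alt using integrable_kv[of x] by (simp add: right_diff_distrib)
  also have "\<bar>\<dots>\<bar> \<le> (\<integral>z. \<bar>mollifier d z * (v (x - z) - v x)\<bar> \<partial>lborel)" by (rule integral_abs_bound)
  also have "\<dots> \<le> (\<integral>z. mollifier d z * (L * d) \<partial>lborel)"
  proof (rule integral_mono)
    show "integrable lborel (\<lambda>z. \<bar>mollifier d z * (v (x - z) - v x)\<bar>)" using integrable_kv[of x] i by (simp add: right_diff_distrib)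
    show "integrable lborel (\<lambda>z. mollifier d z * (L * d))" using mollifier(4)[OF d] by simp
    fix z
    show "\<bar>mollifier d z * (v (x - z) - v x)\<bar> \<le> mollifier d z * (L * d)"
    proof (cases "norm z < d")
      case True
      have "\<bar>v (x - z) - v x\<bar> \<le> L * norm z" using lip[of "x - z" x] by simp
      also have "\<dots> \<le> L * d" using True L by (intro mult_left_mono) auto
      finally show ?thesis using mollifier(2)[OF d, of z] by (simp add: abs_mult mult_left_mono)
    next
      case False
      then show ?thesis using mollifier(3)[OF d, of z] by simp
    qed
  qed
  also have "\<dots> = L * d" using mollifier(5)[OF d] by simp
  finally show ?thesis .
qed

lemma vd_support: assumes "R + d < norm x" shows "vd x = 0"
proof -
  have z0: "mollifier d z * v (x - z) = 0" for z
  proof (cases "norm z < d")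
    case True
    have "norm x \<le> norm (x - z) + norm z" using norm_triangle_sub[of x z] by simp
    then show ?thesis using assms True supp[of "x - z"] by simp
  next
    case False
    then show ?thesis using mollifier(3)[OF d, of z] by simp
  qed
  show ?thesis unfolding vd_alt z0 by simp
qed

text \<open>Points of equal norm are exchanged by the reflection in a line through the origin. It is
  linear and preserves the measure, the kernel and the radial function \<open>v\<close>, hence also
  the convolution.\<close>

lemma vd_radial: assumes "norm x = norm y" shows "vd x = vd y"
proof (cases "x = y")
  case False
  define n where "n = (1 / norm (y - x)) *\<^sub>R (y - x)"
  have "((norm y)\<^sup>2 - (norm x)\<^sup>2) / (2 * norm (y - x)) = 0" using assms by simp
  note bis = bisector[OF False eq_refl[OF assms], folded n_def, unfolded this]
  interpret reflection n 0 by (rule bis(1))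
  have nr: "norm (refl z) = norm z" for z using norm_refl_sq[of z] by (simp add: power2_eq_iff_nonneg)
  have lin: "refl (x - z) = refl x - refl z" for z
    by (simp add: refl_def inner_diff_left algebra_simps)
  have "vd y = (\<integral>z. mollifier d z * v (refl x - z) \<partial>lborel)" by (simp add: vd_alt bis(2))
  also have "\<dots> = (\<integral>z. mollifier d (refl z) * v (refl x - refl z) \<partial>lborel)"
    by (rule integral_refl(2)[OF integrable_kv, symmetric])
  also have "\<dots> = (\<integral>z. mollifier d z * v (x - z) \<partial>lborel)"
  proof -
    have "mollifier d (refl z) = mollifier d z" for z by (rule mollifier(6)[OF d nr])
    moreover have "v (refl x - refl z) = v (x - z)" for z unfolding lin[symmetric] by (rule rad[OF nr])
    ultimately show ?thesis by simp
  qed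
  finally show ?thesis by (simp add: vd_alt)
qed simp

text \<open>The mollified function is an average of translates of \<open>v\<close>. The nonlocal
  energy is convex, by Jensen's inequality, and invariant under translating both points
  together.\<close>

lemma vd_nonlocal: "nonlocal_energy e vd \<le> nonlocal_energy e v"
proof -
  define b where "b p = (of_bool (norm (fst p - snd p) < e) :: real)" for p :: "plane \<times> plane"
  have Js: "(vd x - vd y)\<^sup>2 \<le> (\<integral>z. mollifier d z * (v (x - z) - v (y - z))\<^sup>2 \<partial>lborel) \<and> integrable lborel (\<lambda>z. mollifier d z * (v (x - z) - v (y - z))\<^sup>2)" for x y
  proof -
    obtain k' where k: "C1c UNIV (mollifier d) k'" using mollifier(1)[OF d] by blast
    obtain K where K: "compact K" "\<And>x. x \<notin> K \<Longrightarrow> mollifier d x = 0" by (rule C1c_support[OF k]) blast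
    have i2: "integrable lborel (\<lambda>z. mollifier d z * (v (x - z) - v (y - z))\<^sup>2)"
      by (rule integrable_continuous_compact_support[OF _ K(1)])
         (use K in \<open>auto intro!: continuous_intros C1c_continuous(1)[OF k] continuous_on_compose2[OF cv]\<close>)
    \<comment> \<open>Splitting the kernel into two roots makes Cauchy-Schwarz into Jensen's
      inequality, as the kernel has mass 1.\<close>
    define s where "s z = sqrt (mollifier d z)" for z
    have s: "(s z)\<^sup>2 = mollifier d z" "s z * s z = mollifier d z" for z
      using mollifier(2)[OF d, of z] by (simp_all add: s_def)
    have [measurable]: "s \<in> borel_measurable borel" unfolding s_def by measurable
    have sq: "(s z * (v (x - z) - v (y - z)))\<^sup>2 = mollifier d z * (v (x - z) - v (y - z))\<^sup>2" for z
      by (simp add: power_mult_distrib s)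
    have pr: "s z * (s z * (v (x - z) - v (y - z))) = mollifier d z * v (x - z) - mollifier d z * v (y - z)" for z
      by (simp add: mult.assoc[symmetric] s right_diff_distrib)
    have "(\<integral>z. s z * (s z * (v (x - z) - v (y - z))) \<partial>lborel)\<^sup>2 \<le> (\<integral>z. (s z)\<^sup>2 \<partial>lborel) * (\<integral>z. (s z * (v (x - z) - v (y - z)))\<^sup>2 \<partial>lborel)"
      by (rule cauchy_schwarz_integral(2)) (use i2 mollifier(4)[OF d] in \<open>simp_all add: s sq\<close>)
    then have "(vd x - vd y)\<^sup>2 \<le> (\<integral>z. mollifier d z * (v (x - z) - v (y - z))\<^sup>2 \<partial>lborel)"
      unfolding sq s pr using integrable_kv[of x] integrable_kv[of y] mollifier(5)[OF d] by (simp add: vd_alt)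
    with i2 show ?thesis by blast
  qed
  have b0: "0 \<le> b p" for p by (simp add: b_def)
  have pt: "ennreal (b p * (vd (fst p) - vd (snd p))\<^sup>2) \<le> (\<integral>\<^sup>+z. ennreal (mollifier d z) * ennreal (b p * (v (fst p - z) - v (snd p - z))\<^sup>2) \<partial>lborel)" for p
  proof -
    note J = Js[of "fst p" "snd p"]
    have "ennreal (b p * (vd (fst p) - vd (snd p))\<^sup>2) \<le> ennreal (\<integral>z. b p * (mollifier d z * (v (fst p - z) - v (snd p - z))\<^sup>2) \<partial>lborel)"
      using J b0[of p] by (intro ennreal_leI) (simp add: mult_left_mono)
    also have "\<dots> = (\<integral>\<^sup>+z. ennreal (b p * (mollifier d z * (v (fst p - z) - v (snd p - z))\<^sup>2)) \<partial>lborel)"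
      using J b0[of p] mollifier(2)[OF d] by (intro nn_integral_eq_integral[symmetric]) auto
    also have "\<dots> = (\<integral>\<^sup>+z. ennreal (mollifier d z) * ennreal (b p * (v (fst p - z) - v (snd p - z))\<^sup>2) \<partial>lborel)"
      using b0[of p] mollifier(2)[OF d] by (intro nn_integral_cong) (simp add: ennreal_mult[symmetric] mult_ac)
    finally show ?thesis .
  qed
  have Vm: "(\<lambda>p :: plane \<times> plane. ennreal (b p * (v (fst p) - v (snd p))\<^sup>2)) \<in> borel_measurable borel"
    using measurable_nonlocal[OF vm, of e] unfolding b_def lborel_prod by simp
  have mm: "(\<lambda>q :: (plane \<times> plane) \<times> plane. ennreal (mollifier d (snd q)) * ennreal (b (fst q) * (v (fst (fst q) - snd q) - v (snd (fst q) - snd q))\<^sup>2)) \<in> borel_measurable (lborel \<Otimes>\<^sub>M lborel)"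
  proof -
    have "(\<lambda>q :: (plane \<times> plane) \<times> plane. (fst (fst q) - snd q, snd (fst q) - snd q)) \<in> borel_measurable borel"
      by (intro borel_measurable_continuous_onI continuous_intros)
    from measurable_compose[OF this Vm]
    have 1: "(\<lambda>q :: (plane \<times> plane) \<times> plane. ennreal (b (fst (fst q) - snd q, snd (fst q) - snd q) * (v (fst (fst q) - snd q) - v (snd (fst q) - snd q))\<^sup>2)) \<in> borel_measurable borel" by simp
    have b1: "b (fst (fst q) - snd q, snd (fst q) - snd q) = b (fst q)" for q :: "(plane \<times> plane) \<times> plane" by (simp add: b_def)
    have "(\<lambda>q :: (plane \<times> plane) \<times> plane. snd q) \<in> borel_measurable borel" by (intro borel_measurable_continuous_onI continuous_intros)
    from measurable_compose[OF this km] have 2: "(\<lambda>q :: (plane \<times> plane) \<times> plane. mollifier d (snd q)) \<in> borel_measurable borel" .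
    show ?thesis unfolding lborel_prod using 1[unfolded b1] 2 by simp
  qed
  have "nonlocal_energy e vd = (\<integral>\<^sup>+p. ennreal (b p * (vd (fst p) - vd (snd p))\<^sup>2) \<partial>lborel)"
    unfolding nonlocal_energy_def b_def lborel_prod ..
  also have "\<dots> \<le> (\<integral>\<^sup>+p. \<integral>\<^sup>+z. ennreal (mollifier d z) * ennreal (b p * (v (fst p - z) - v (snd p - z))\<^sup>2) \<partial>lborel \<partial>lborel)"
    by (intro nn_integral_mono pt)
  also have "\<dots> = (\<integral>\<^sup>+z. \<integral>\<^sup>+p. ennreal (mollifier d z) * ennreal (b p * (v (fst p - z) - v (snd p - z))\<^sup>2) \<partial>lborel \<partial>lborel)"
    by (rule lborel_pair.Fubini'[symmetric]) (use mm in \<open>simp add: split_beta'\<close>)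
  also have "\<dots> = (\<integral>\<^sup>+z. ennreal (mollifier d z) * nonlocal_energy e v \<partial>lborel)"
  proof (rule nn_integral_cong)
    fix z
    have tr: "ennreal (b p * (v (fst p - z) - v (snd p - z))\<^sup>2) = ennreal (b (p + (-z, -z)) * (v (fst (p + (-z, -z))) - v (snd (p + (-z, -z))))\<^sup>2)" for p
      by (simp add: b_def)
    have m: "(\<lambda>p :: plane \<times> plane. ennreal (b (p + (-z, -z)) * (v (fst (p + (-z, -z))) - v (snd (p + (-z, -z))))\<^sup>2)) \<in> borel_measurable lborel"
      using measurable_compose[OF _ Vm, of "\<lambda>p. p + (-z, -z)" lborel] by simp
    have "(\<integral>\<^sup>+p. ennreal (mollifier d z) * ennreal (b p * (v (fst p - z) - v (snd p - z))\<^sup>2) \<partial>lborel) = ennreal (mollifier d z) * (\<integral>\<^sup>+p. ennreal (b p * (v (fst p - z) - v (snd p - z))\<^sup>2) \<partial>lborel)"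
      unfolding tr by (rule nn_integral_cmult[OF m])
    also have "(\<integral>\<^sup>+p. ennreal (b p * (v (fst p - z) - v (snd p - z))\<^sup>2) \<partial>lborel) = (\<integral>\<^sup>+p. ennreal (b p * (v (fst p) - v (snd p))\<^sup>2) \<partial>lborel)"
      unfolding tr by (rule nn_integral_translate[OF Vm])
    also have "\<dots> = nonlocal_energy e v" unfolding nonlocal_energy_def b_def lborel_prod ..
    finally show "(\<integral>\<^sup>+p. ennreal (mollifier d z) * ennreal (b p * (v (fst p - z) - v (snd p - z))\<^sup>2) \<partial>lborel) = ennreal (mollifier d z) * nonlocal_energy e v" .
  qed
  also have "\<dots> = (\<integral>\<^sup>+z. ennreal (mollifier d z) \<partial>lborel) * nonlocal_energy e v" by (rule nn_integral_multc) simp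
  also have "(\<integral>\<^sup>+z. ennreal (mollifier d z) \<partial>lborel) = 1"
    using nn_integral_eq_integral[OF mollifier(4)[OF d]] mollifier(2,5)[OF d] by simp
  finally show ?thesis by simp
qed

end

text \<open>In logarithmic polar coordinates the origin lies at infinite \<open>t\<close>, where
  \<open>1 / t\<^sup>2\<close> is integrable; the condition \<open>R < 1\<close> keeps away from the
  singularity on the unit circle, which is \<open>t = 0\<close>.\<close>

lemma nn_integral_leray_weight_cball:
  assumes R: "0 < R" "R < 1"
  shows "(\<integral>\<^sup>+x\<in>cball 0 R. ennreal (leray_weight x) \<partial>lborel) < \<infinity>"
proof -
  define s where "s = - ln R"
  have s: "0 < s" using R by (simp add: s_def ln_less_zero)
  have le: "exp (- t) \<le> R \<Longrightarrow> s \<le> t" for t using R ln_mono[of "exp (- t)" R] by (simp add: s_def)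
  let ?f = "\<lambda>x. ennreal (leray_weight x) * indicator (cball 0 R) x"
  have [measurable]: "cball (0 :: plane) R \<in> sets borel" by simp
  have fm: "?f \<in> borel_measurable borel" by measurable
  have "(\<integral>\<^sup>+x\<in>cball 0 R. ennreal (leray_weight x) \<partial>lborel) = (\<integral>\<^sup>+x\<in>B1. ?f x \<partial>lborel)"
    using R by (intro nn_integral_cong) (auto simp: indicator_def)
  also have "\<dots> = (\<integral>\<^sup>+t\<in>{0<..}. (\<integral>\<^sup>+\<theta>\<in>{0<..<2*pi}. ?f (logpolar t \<theta>) \<partial>lborel) * ennreal (exp (- 2 * t)) \<partial>lborel)"
    by (rule nn_integral_logpolar[OF fm])
  also have "\<dots> \<le> (\<integral>\<^sup>+t. ennreal (2 * pi) * (ennreal (1 / t\<^sup>2) * indicator {s..} t) \<partial>lborel)"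
  proof (rule nn_integral_mono)
    fix t :: real
    show "(\<integral>\<^sup>+\<theta>\<in>{0<..<2*pi}. ?f (logpolar t \<theta>) \<partial>lborel) * ennreal (exp (- 2 * t)) * indicator {0<..} t
      \<le> ennreal (2 * pi) * (ennreal (1 / t\<^sup>2) * indicator {s..} t)"
    proof (cases "exp (- t) \<le> R")
      case True
      define w where "w = leray_weight (logpolar t 0)"
      have w: "leray_weight (logpolar t \<theta>) = w" for \<theta> by (simp add: w_def leray_weight_def)
      have "(\<integral>\<^sup>+\<theta>\<in>{0<..<2*pi}. ?f (logpolar t \<theta>) \<partial>lborel) = (\<integral>\<^sup>+\<theta>\<in>{0<..<2*pi}. ennreal w \<partial>lborel)"
        using True by (simp add: w)
      also have "\<dots> = ennreal w * ennreal (2 * pi)" by (subst nn_integral_cmult_indicator) auto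
      finally have "(\<integral>\<^sup>+\<theta>\<in>{0<..<2*pi}. ?f (logpolar t \<theta>) \<partial>lborel) * ennreal (exp (- 2 * t)) = ennreal (2 * pi) * (ennreal w * ennreal (exp (- 2 * t)))"
        by (simp only: mult_ac)
      also have "ennreal w * ennreal (exp (- 2 * t)) = ennreal (1 / t\<^sup>2)"
        using leray_weight_logpolar[of t 0] leray_weight_nonneg[of "logpolar t 0"]
        by (simp add: ennreal_mult[symmetric] w_def)
      finally show ?thesis using le[OF True] by (simp add: indicator_def)
    qed simp
  qed
  also have "\<dots> = ennreal (2 * pi) * (\<integral>\<^sup>+t. ennreal (1 / t\<^sup>2) * indicator {s..} t \<partial>lborel)"
    by (rule nn_integral_cmult) measurable
  also have "(\<integral>\<^sup>+t. ennreal (1 / t\<^sup>2) * indicator {s..} t \<partial>lborel) = ennreal (0 - (- 1 / s))"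
  proof (rule nn_integral_FTC_atLeast)
    show "DERIV (\<lambda>t. - 1 / t) t :> 1 / t\<^sup>2" if "s \<le> t" for t
      using s that by (auto intro!: derivative_eq_intros simp: power2_eq_square)
    show "((\<lambda>t. - 1 / t :: real) \<longlongrightarrow> 0) at_top"
      by (intro tendsto_divide_0[OF tendsto_const] filterlim_at_top_imp_at_infinity filterlim_ident)
  qed auto
  also have "ennreal (2 * pi) * ennreal (0 - (- 1 / s)) < \<infinity>" by (simp add: ennreal_mult_less_top)
  finally show ?thesis .
qed

section \<open>The Moser bound for radial C1 functions\<close>

lemma radial_circle:
  assumes "\<And>x y. norm x = norm y \<Longrightarrow> f x = f y" shows "f (logpolar t \<theta>) = f (logpolar t 0)"
  by (rule assms) simp

lemma nn_integral_radial:
  fixes h :: "plane \<Rightarrow> real"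
  assumes h: "h \<in> borel_measurable borel" "\<And>x. 0 \<le> h x"
    and k: "\<And>t \<theta>. 0 < t \<Longrightarrow> h (logpolar t \<theta>) * exp (- 2 * t) = k t"
    and km: "(\<lambda>t. indicator {0<..} t * k t) \<in> borel_measurable borel"
  shows "(\<integral>\<^sup>+x\<in>B1. ennreal (h x) \<partial>lborel) = ennreal (2 * pi) * (\<integral>\<^sup>+t\<in>{0<..}. ennreal (k t) \<partial>lborel)"
proof -
  have "(\<integral>\<^sup>+x\<in>B1. ennreal (h x) \<partial>lborel) = (\<integral>\<^sup>+t\<in>{0<..}. (\<integral>\<^sup>+\<theta>\<in>{0<..<2*pi}. ennreal (h (logpolar t \<theta>)) \<partial>lborel) * ennreal (exp (- 2 * t)) \<partial>lborel)"
    using h(1) by (intro nn_integral_logpolar) simp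
  also have "\<dots> = (\<integral>\<^sup>+t. ennreal (2 * pi) * ennreal (indicator {0<..} t * k t) \<partial>lborel)"
  proof (rule nn_integral_cong)
    fix t :: real
    show "(\<integral>\<^sup>+\<theta>\<in>{0<..<2*pi}. ennreal (h (logpolar t \<theta>)) \<partial>lborel) * ennreal (exp (- 2 * t)) * indicator {0<..} t = ennreal (2 * pi) * ennreal (indicator {0<..} t * k t)"
    proof (cases "0 < t")
      case True
      have hk: "h (logpolar t \<theta>) = k t * exp (2 * t)" for \<theta>
        unfolding k[OF True, of \<theta>, symmetric] by (simp add: mult.assoc exp_add[symmetric])
      have "(\<integral>\<^sup>+\<theta>\<in>{0<..<2*pi}. ennreal (h (logpolar t \<theta>)) \<partial>lborel) = ennreal (k t * exp (2 * t)) * ennreal (2 * pi)"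
        unfolding hk by (simp add: nn_integral_cmult_indicator)
      moreover have "ennreal (k t * exp (2 * t)) * ennreal (exp (- 2 * t)) = ennreal (k t)"
      proof -
        have "0 \<le> k t * exp (2 * t)" using h(2)[of "logpolar t 0"] unfolding hk .
        then have "ennreal (k t * exp (2 * t)) * ennreal (exp (- 2 * t)) = ennreal (k t * exp (2 * t) * exp (- 2 * t))"
          by (intro ennreal_mult[symmetric]) auto
        then show ?thesis by (simp add: mult.assoc exp_add[symmetric])
      qed
      ultimately show ?thesis using True by (simp add: mult_ac)
    qed simp
  qed
  also have "\<dots> = ennreal (2 * pi) * (\<integral>\<^sup>+t. ennreal (indicator {0<..} t * k t) \<partial>lborel)"
    using km by (intro nn_integral_cmult) simp
  also have "(\<integral>\<^sup>+t. ennreal (indicator {0<..} t * k t) \<partial>lborel) = (\<integral>\<^sup>+t\<in>{0<..}. ennreal (k t) \<partial>lborel)"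
    by (intro nn_integral_cong) (simp add: indicator_def)
  finally show ?thesis .
qed

lemma borel_measurable_on_Ioi:
  fixes k :: "real \<Rightarrow> real"
  assumes "continuous_on {0<..} k" shows "(\<lambda>t. indicator {0<..} t * k t) \<in> borel_measurable borel"
  using borel_measurable_continuous_on_indicator[OF _ assms] by simp

context leray_potential
begin

text \<open>\<open>f\<close> need not vanish at the origin, so it is no test function and the
  identity on the plane does not cover it. The one-dimensional identity is used up to a finite
  \<open>T\<close> instead. The bounds on the gradient and on the potential come in separately as
  \<open>D0\<close> and \<open>p\<close>, because they arise from different comparisons;
  \<open>q\<close> is the resulting energy bound.\<close>

lemma radial_C1_moser:
  fixes f :: "plane \<Rightarrow> real" and G :: "plane \<Rightarrow> plane"
  assumes fG: "\<And>x. (f has_derivative (\<lambda>h. G x \<bullet> h)) (at x)" and G: "continuous_on UNIV G"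
    and rad: "\<And>x y. norm x = norm y \<Longrightarrow> f x = f y"
    and supp: "\<And>x. R \<le> norm x \<Longrightarrow> f x = 0" and R: "0 < R" "R < 1"
    and D0: "(\<integral>\<^sup>+x. ennreal ((norm (G x))\<^sup>2) \<partial>lborel) \<le> ennreal D0" "0 \<le> D0"
    and p: "ennreal p \<le> (\<integral>\<^sup>+x. ennreal (W x * (f x)\<^sup>2) \<partial>lborel)" "0 \<le> p"
    and q: "D0 + \<mu> * p \<le> q" "0 < q"
  shows "(\<integral>\<^sup>+x\<in>B1. ennreal (exp (m_crit \<mu> * (f x)\<^sup>2 / q)) \<partial>lborel) \<le> ennreal (2 * pi) * ennreal (moser_const l)"
proof -
  have cf: "continuous_on S f" for S by (rule has_derivative_continuous_on[of _ _ "\<lambda>x h. G x \<bullet> h"]) (rule has_derivative_at_withinI[OF fG])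
  have fm[measurable]: "f \<in> borel_measurable borel" by (rule borel_measurable_continuous_onI[OF cf])
  define w where "w t = f (logpolar t 0)" for t
  define w' where "w' t = - (G (logpolar t 0) \<bullet> logpolar t 0)" for t
  have w: "f (logpolar t \<theta>) = w t" for t \<theta> unfolding w_def by (rule radial_circle[of f, OF rad])
  have der: "(w has_real_derivative w' t) (at t within S)" for t S
    unfolding w_def[abs_def] w'_def by (rule DERIV_along_logpolar[OF fG])
  \<comment> \<open>The profile is the same along all rays, so uniqueness of the derivative makes
    the radial derivative independent of the angle.\<close>
  have w'\<theta>: "- (G (logpolar t \<theta>) \<bullet> logpolar t \<theta>) = w' t" for t \<theta>
  proof -
    have "(w has_real_derivative - (G (logpolar t \<theta>) \<bullet> logpolar t \<theta>)) (at t)"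
      using DERIV_along_logpolar[OF fG[of "logpolar t \<theta>"], of UNIV] by (simp add: w)
    then show ?thesis using der[of t UNIV] by (rule DERIV_unique)
  qed
  have cw: "continuous_on S w" for S by (rule DERIV_continuous_on[OF der])
  have cw': "continuous_on S w'" for S unfolding w'_def
    by (intro continuous_intros continuous_on_logpolar continuous_on_compose2[OF G]) auto
  define s where "s = - ln R"
  have s: "0 < s" using R by (simp add: s_def ln_less_zero)
  have w0: "w t = 0" if "t \<le> s" for t
  proof -
    have "R \<le> exp (- t)" using that R exp_le_cancel_iff[of "ln R" "- t"] by (simp add: s_def)
    then show ?thesis unfolding w_def by (intro supp) simp
  qed
  have DD: "ennreal (2 * pi) * (\<integral>\<^sup>+t\<in>{0<..}. ennreal ((w' t)\<^sup>2) \<partial>lborel) \<le> ennreal D0"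
  proof -
    have "ennreal (2 * pi) * (\<integral>\<^sup>+t\<in>{0<..}. ennreal ((w' t)\<^sup>2) \<partial>lborel) = (\<integral>\<^sup>+x\<in>B1. ennreal ((G x \<bullet> x)\<^sup>2 / (norm x)\<^sup>2) \<partial>lborel)"
    proof (rule nn_integral_radial[symmetric])
      show "(\<lambda>x. (G x \<bullet> x)\<^sup>2 / (norm x)\<^sup>2) \<in> borel_measurable borel"
      proof -
        have "continuous_on UNIV (\<lambda>x. (G x \<bullet> x)\<^sup>2)" by (intro continuous_intros G)
        then have [measurable]: "(\<lambda>x. (G x \<bullet> x)\<^sup>2) \<in> borel_measurable borel" by (rule borel_measurable_continuous_onI)
        show ?thesis by measurable
      qed
      show "(G (logpolar t \<theta>) \<bullet> logpolar t \<theta>)\<^sup>2 / (norm (logpolar t \<theta>))\<^sup>2 * exp (- 2 * t) = (w' t)\<^sup>2" for t \<theta>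
        unfolding exp_norm_logpolar w'\<theta>[of t \<theta>, symmetric] by simp
      show "(\<lambda>t. indicator {0<..} t * (w' t)\<^sup>2) \<in> borel_measurable borel"
        by (intro borel_measurable_on_Ioi continuous_intros cw')
    qed simp
    also have "\<dots> \<le> (\<integral>\<^sup>+x. ennreal ((norm (G x))\<^sup>2) \<partial>lborel)"
    proof (rule nn_integral_mono)
      fix x
      have "(G x \<bullet> x)\<^sup>2 / (norm x)\<^sup>2 \<le> (norm (G x))\<^sup>2"
      proof (cases "x = 0")
        case False
        have "\<bar>G x \<bullet> x\<bar>\<^sup>2 \<le> (norm (G x) * norm x)\<^sup>2" by (intro power_mono Cauchy_Schwarz_ineq2) simp
        then show ?thesis using False by (simp add: field_simps power_mult_distrib)
      qed simp
      then show "ennreal ((G x \<bullet> x)\<^sup>2 / (norm x)\<^sup>2) * indicator B1 x \<le> ennreal ((norm (G x))\<^sup>2)"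
        by (auto simp: indicator_def intro: ennreal_leI)
    qed
    also note D0(1)
    finally show ?thesis .
  qed
  have cwt: "continuous_on {0<..} (\<lambda>t. (w t)\<^sup>2 / t\<^sup>2)" by (intro continuous_intros cw) auto
  have PP: "ennreal p \<le> ennreal (2 * pi) * (\<integral>\<^sup>+t\<in>{0<..}. ennreal ((w t)\<^sup>2 / t\<^sup>2) \<partial>lborel)"
  proof -
    have "ennreal p \<le> (\<integral>\<^sup>+x\<in>B1. ennreal (leray_weight x * (f x)\<^sup>2) \<partial>lborel)" using p(1) nn_W_le order_trans by blast
    also have "\<dots> = ennreal (2 * pi) * (\<integral>\<^sup>+t\<in>{0<..}. ennreal ((w t)\<^sup>2 / t\<^sup>2) \<partial>lborel)"
    proof (rule nn_integral_radial)
      show "leray_weight (logpolar t \<theta>) * (f (logpolar t \<theta>))\<^sup>2 * exp (- 2 * t) = (w t)\<^sup>2 / t\<^sup>2" for t \<theta>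
      proof -
        have "leray_weight (logpolar t \<theta>) * (f (logpolar t \<theta>))\<^sup>2 * exp (- 2 * t) = (leray_weight (logpolar t \<theta>) * exp (- 2 * t)) * (w t)\<^sup>2"
          by (simp only: w mult_ac)
        then show ?thesis unfolding leray_weight_logpolar by simp
      qed
      show "(\<lambda>t. indicator {0<..} t * ((w t)\<^sup>2 / t\<^sup>2)) \<in> borel_measurable borel" by (rule borel_measurable_on_Ioi[OF cwt])
    qed (auto simp: leray_weight_nonneg)
    finally show ?thesis .
  qed
  have main: "2 * pi * integral {t1..t2} (\<lambda>t. (w' t - a * w t / t)\<^sup>2) \<le> q" if t12: "0 < t1" "t1 \<le> t2" for t1 t2
  proof -
    define B where "B = integral {t1..t2} (\<lambda>t. (w' t - a * w t / t)\<^sup>2)"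
    \<comment> \<open>A starting point to the left of \<open>t1\<close> at which the profile
      vanishes, as \<open>ground_state_1d\<close> demands.\<close>
    define s0 where "s0 = min s t1"
    have s0: "0 < s0" "s0 \<le> t1" "w s0 = 0" using s t12 w0 by (auto simp: s0_def)
    have cE: "continuous_on {u..v} (\<lambda>t. (w' t - a * w t / t)\<^sup>2)" if "0 < u" for u v
      using that by (intro continuous_intros cw cw') auto
    \<comment> \<open>The identity between \<open>s0\<close> and \<open>T\<close>: the boundary term
      at \<open>T\<close> is nonnegative and is dropped, and of the deviation only the part between
      \<open>t1\<close> and \<open>t2\<close> is retained.\<close>
    have step: "ennreal (2 * pi) * (ennreal (- \<mu>) * (\<integral>\<^sup>+t\<in>{s0..T}. ennreal ((w t)\<^sup>2 / t\<^sup>2) \<partial>lborel)) + ennreal (2 * pi * B) \<le> ennreal D0" if T: "t2 \<le> T" for T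
    proof -
      have B1: "B \<le> integral {s0..T} (\<lambda>t. (w' t - a * w t / t)\<^sup>2)" unfolding B_def
        using s0 t12 T by (intro integral_subset_le integrable_continuous_real cE) auto
      have B0: "0 \<le> B" unfolding B_def using t12 by (intro integral_nonneg integrable_continuous_real cE) auto
      have "0 \<le> a * (w T)\<^sup>2 / T" using a(1) s0 t12 T by simp
      then have gs: "B + - \<mu> * integral {s0..T} (\<lambda>t. (w t)\<^sup>2 / t\<^sup>2) \<le> integral {s0..T} (\<lambda>t. (w' t)\<^sup>2)"
        using ground_state_1d[of s0 T w w' a, OF s0(1) _ der cw' s0(3)] B1 s0 t12 T unfolding a(3) by simp
      have cs: "continuous_on {s0..T} (\<lambda>t. (w t)\<^sup>2 / t\<^sup>2)" by (rule continuous_on_subset[OF cwt]) (use s0 in auto)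
      have eP: "ennreal (integral {s0..T} (\<lambda>t. (w t)\<^sup>2 / t\<^sup>2)) = (\<integral>\<^sup>+t\<in>{s0..T}. ennreal ((w t)\<^sup>2 / t\<^sup>2) \<partial>lborel)"
        by (intro nn_integral_has_integral_lebesgue'[symmetric] integrable_integral integrable_continuous_real cs) auto
      have "ennreal (integral {s0..T} (\<lambda>t. (w' t)\<^sup>2)) = (\<integral>\<^sup>+t\<in>{s0..T}. ennreal ((w' t)\<^sup>2) \<partial>lborel)"
        by (intro nn_integral_has_integral_lebesgue'[symmetric] integrable_integral integrable_continuous_real continuous_intros cw') auto
      also have "\<dots> \<le> (\<integral>\<^sup>+t\<in>{0<..}. ennreal ((w' t)\<^sup>2) \<partial>lborel)"
        using s0 by (intro nn_integral_mono) (auto simp: indicator_def)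
      finally have eD: "ennreal (integral {s0..T} (\<lambda>t. (w' t)\<^sup>2)) \<le> (\<integral>\<^sup>+t\<in>{0<..}. ennreal ((w' t)\<^sup>2) \<partial>lborel)" .
      have I0: "0 \<le> integral {s0..T} (\<lambda>t. (w t)\<^sup>2 / t\<^sup>2)" by (intro integral_nonneg integrable_continuous_real cs) auto
      have "ennreal (2 * pi) * (ennreal (- \<mu>) * (\<integral>\<^sup>+t\<in>{s0..T}. ennreal ((w t)\<^sup>2 / t\<^sup>2) \<partial>lborel)) + ennreal (2 * pi * B)
        = ennreal (2 * pi * (B + - \<mu> * integral {s0..T} (\<lambda>t. (w t)\<^sup>2 / t\<^sup>2)))"
      proof -
        define X where "X = integral {s0..T} (\<lambda>t. (w t)\<^sup>2 / t\<^sup>2)"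
        have nm: "0 \<le> - \<mu>" "0 \<le> 2 * pi" using mu by auto
        have "ennreal (2 * pi) * (ennreal (- \<mu>) * ennreal X) = ennreal (2 * pi * (- \<mu> * X))"
          by (simp only: ennreal_mult'[OF nm(1)] ennreal_mult'[OF nm(2)])
        moreover have "0 \<le> 2 * pi * (- \<mu> * X)" using I0 nm by (intro mult_nonneg_nonneg) (auto simp: X_def)
        ultimately have "ennreal (2 * pi) * (ennreal (- \<mu>) * ennreal X) + ennreal (2 * pi * B) = ennreal (2 * pi * (- \<mu> * X) + 2 * pi * B)"
          using B0 by (simp only:) (rule ennreal_plus[symmetric]; simp)
        also have "2 * pi * (- \<mu> * X) + 2 * pi * B = 2 * pi * (B + - \<mu> * X)" by (simp only: distrib_left add.commute)
        finally show ?thesis unfolding eP[symmetric] X_def .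
      qed
      also have "\<dots> \<le> ennreal (2 * pi * integral {s0..T} (\<lambda>t. (w' t)\<^sup>2))" using gs by (intro ennreal_leI mult_left_mono) auto
      also have "\<dots> = ennreal (2 * pi) * ennreal (integral {s0..T} (\<lambda>t. (w' t)\<^sup>2))" by (simp add: ennreal_mult')
      also have "\<dots> \<le> ennreal (2 * pi) * (\<integral>\<^sup>+t\<in>{0<..}. ennreal ((w' t)\<^sup>2) \<partial>lborel)" by (intro mult_left_mono eD) simp
      also note DD
      finally show ?thesis .
    qed
    have B0: "0 \<le> B" unfolding B_def using t12 by (intro integral_nonneg integrable_continuous_real cE) auto
    have e: "ennreal (2 * pi * - \<mu>) = ennreal (2 * pi) * ennreal (- \<mu>)" by (rule ennreal_mult') simp
    have "ennreal (- \<mu>) * ennreal p \<le> ennreal (- \<mu>) * (ennreal (2 * pi) * (\<integral>\<^sup>+t\<in>{0<..}. ennreal ((w t)\<^sup>2 / t\<^sup>2) \<partial>lborel))"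
      by (intro mult_left_mono PP) simp
    also have "\<dots> = (\<integral>\<^sup>+t. ennreal (2 * pi * - \<mu>) * (ennreal ((w t)\<^sup>2 / t\<^sup>2) * indicator {0<..} t) \<partial>lborel)"
    proof -
      have "(\<lambda>t. ennreal (indicator {0<..} t * ((w t)\<^sup>2 / t\<^sup>2))) \<in> borel_measurable lborel" using borel_measurable_on_Ioi[OF cwt] by simp
      moreover have "(\<lambda>t. ennreal (indicator {0<..} t * ((w t)\<^sup>2 / t\<^sup>2))) = (\<lambda>t. ennreal ((w t)\<^sup>2 / t\<^sup>2) * indicator {0<..} t)"
        by (auto simp: indicator_def fun_eq_iff)
      ultimately have hm0: "(\<lambda>t. ennreal ((w t)\<^sup>2 / t\<^sup>2) * indicator {0<..} t) \<in> borel_measurable lborel" by (simp only:)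
      show ?thesis unfolding nn_integral_cmult[OF hm0] e by (simp only: mult_ac)
    qed
    also have "\<dots> \<le> ennreal (D0 - 2 * pi * B)"
    \<comment> \<open>Letting \<open>T = t2 + k\<close> grow recovers the potential integral over
      the whole half-line.\<close>
    proof (rule nn_integral_fatou_AE)
      let ?h = "\<lambda>k t. ennreal (2 * pi * - \<mu>) * (ennreal ((w t)\<^sup>2 / t\<^sup>2) * indicator {s0..t2 + real k} t)"
      have hm: "(\<lambda>t. ennreal ((w t)\<^sup>2 / t\<^sup>2) * indicator {s0..t2 + real k} t) \<in> borel_measurable lborel" for k
      proof -
        have "(\<lambda>t. indicator {s0..t2 + real k} t *\<^sub>R ((w t)\<^sup>2 / t\<^sup>2)) \<in> borel_measurable borel"
          by (intro borel_measurable_continuous_on_indicator continuous_on_subset[OF cwt]) (use s0 in auto)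
        then have "(\<lambda>t. ennreal (indicator {s0..t2 + real k} t *\<^sub>R ((w t)\<^sup>2 / t\<^sup>2))) \<in> borel_measurable lborel" by simp
        moreover have "(\<lambda>t. ennreal (indicator {s0..t2 + real k} t *\<^sub>R ((w t)\<^sup>2 / t\<^sup>2))) = (\<lambda>t. ennreal ((w t)\<^sup>2 / t\<^sup>2) * indicator {s0..t2 + real k} t)"
          by (auto simp: indicator_def fun_eq_iff)
        ultimately show ?thesis by (simp only:)
      qed
      then show "?h k \<in> borel_measurable lborel" for k by simp
      show "AE t in lborel. (\<lambda>k. ?h k t) \<longlonglongrightarrow> ennreal (2 * pi * - \<mu>) * (ennreal ((w t)\<^sup>2 / t\<^sup>2) * indicator {0<..} t)"
      proof (rule AE_I2)
        fix t
        have "eventually (\<lambda>k. ennreal (2 * pi * - \<mu>) * (ennreal ((w t)\<^sup>2 / t\<^sup>2) * indicator {0<..} t) = ?h k t) sequentially"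
          using eventually_ge_at_top[of "nat \<lceil>t\<rceil>"]
        proof eventually_elim
          case (elim k)
          then have "t \<le> real k" by linarith
          then have "t \<le> t2 + real k" using t12 by linarith
          then show ?case using w0[of t] s0 by (cases "t < s0") (auto simp: indicator_def s0_def)
        qed
        then show "(\<lambda>k. ?h k t) \<longlonglongrightarrow> ennreal (2 * pi * - \<mu>) * (ennreal ((w t)\<^sup>2 / t\<^sup>2) * indicator {0<..} t)"
          by (rule Lim_transform_eventually[OF tendsto_const])
      qed
      show "eventually (\<lambda>k. (\<integral>\<^sup>+t. ?h k t \<partial>lborel) \<le> ennreal (D0 - 2 * pi * B)) sequentially"
      proof (intro always_eventually allI)
        fix k
        have "(\<integral>\<^sup>+t. ?h k t \<partial>lborel) = ennreal (2 * pi) * (ennreal (- \<mu>) * (\<integral>\<^sup>+t\<in>{s0..t2 + real k}. ennreal ((w t)\<^sup>2 / t\<^sup>2) \<partial>lborel))"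
          unfolding nn_integral_cmult[OF hm] e by (simp only: mult.assoc)
        also have "\<dots> \<le> ennreal (D0 - 2 * pi * B)" by (rule ennreal_add_le_imp[OF step]) (use B0 in auto)
        finally show "(\<integral>\<^sup>+t. ?h k t \<partial>lborel) \<le> ennreal (D0 - 2 * pi * B)" .
      qed
    qed
    finally have le0: "ennreal (- \<mu>) * ennreal p \<le> ennreal (D0 - 2 * pi * B)" .
    have "0 \<le> - \<mu>" using mu by simp
    then have le: "ennreal (- \<mu> * p) \<le> ennreal (D0 - 2 * pi * B)" using le0 by (simp only: ennreal_mult')
    \<comment> \<open>A negative number becomes 0 under \<open>ennreal\<close>; the sign of
      \<open>D0 - 2 * pi * B\<close> has to be secured before the inequality can be read off in the
      reals.\<close>
    have "ennreal (2 * pi * B) \<le> ennreal (2 * pi) * (ennreal (- \<mu>) * (\<integral>\<^sup>+t\<in>{s0..t2}. ennreal ((w t)\<^sup>2 / t\<^sup>2) \<partial>lborel)) + ennreal (2 * pi * B)"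
      by (rule add_increasing) simp_all
    also note step[OF order_refl]
    finally have "2 * pi * B \<le> D0" using D0(2) by (simp only: ennreal_le_iff)
    then have "0 \<le> D0 - 2 * pi * B" by simp
    then have "- \<mu> * p \<le> D0 - 2 * pi * B" using le by (simp only: ennreal_le_iff)
    then have "2 * pi * B \<le> D0 + \<mu> * p" by linarith
    then show ?thesis using q(1) by (simp add: B_def)
  qed
  \<comment> \<open>Division by the root of \<open>q\<close> normalizes the energy bound to
    \<open>1 / (2 * pi)\<close>.\<close>
  have "hardy_1d l a (\<lambda>t. w t / sqrt q) (\<lambda>t. w' t / sqrt q) s"
  proof
    show "((\<lambda>t. w t / sqrt q) has_real_derivative w' t / sqrt q) (at t)" for t by (intro DERIV_cdivide der)
    show "continuous_on {0<..} (\<lambda>t. w' t / sqrt q)" using q by (intro continuous_intros cw') auto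
    fix t1 t2 :: real assume t12: "0 < t1" "t1 \<le> t2"
    have "(w' t / sqrt q - a * (w t / sqrt q) / t)\<^sup>2 = (1 / q) * (w' t - a * w t / t)\<^sup>2" for t
    proof -
      have "w' t / sqrt q - a * (w t / sqrt q) / t = (w' t - a * w t / t) / sqrt q" by (simp add: diff_divide_distrib)
      then show ?thesis using q by (simp add: power_divide)
    qed
    then have "integral {t1..t2} (\<lambda>t. (w' t / sqrt q - a * (w t / sqrt q) / t)\<^sup>2) = (1 / q) * integral {t1..t2} (\<lambda>t. (w' t - a * w t / t)\<^sup>2)"
      by (simp only: Henstock_Kurzweil_Integration.integral_mult_right)
    also have "\<dots> \<le> 1 / (2 * pi)" using main[OF t12] q(2) by (simp add: field_simps)
    finally show "integral {t1..t2} (\<lambda>t. (w' t / sqrt q - a * (w t / sqrt q) / t)\<^sup>2) \<le> 1 / (2 * pi)" .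
  qed (use l s a_def w0 in auto)
  then have mo: "(\<integral>\<^sup>+t\<in>{0<..}. ennreal (exp (4 * pi * l * (w t / sqrt q)\<^sup>2 - 2 * t)) \<partial>lborel) \<le> ennreal (moser_const l)"
    by (rule hardy_1d.moser_integral)
  have "(\<integral>\<^sup>+x\<in>B1. ennreal (exp (m_crit \<mu> * (f x)\<^sup>2 / q)) \<partial>lborel) = ennreal (2 * pi) * (\<integral>\<^sup>+t\<in>{0<..}. ennreal (exp (4 * pi * l * (w t / sqrt q)\<^sup>2 - 2 * t)) \<partial>lborel)"
  proof (rule nn_integral_radial)
    show "exp (m_crit \<mu> * (f (logpolar t \<theta>))\<^sup>2 / q) * exp (- 2 * t) = exp (4 * pi * l * (w t / sqrt q)\<^sup>2 - 2 * t)" for t \<theta>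
      using q(2) by (simp add: w m_crit_l power_divide exp_add[symmetric])
    show "(\<lambda>t. indicator {0<..} t * exp (4 * pi * l * (w t / sqrt q)\<^sup>2 - 2 * t)) \<in> borel_measurable borel"
      using q(2) by (intro borel_measurable_on_Ioi continuous_intros cw) auto
  qed auto
  also have "\<dots> \<le> ennreal (2 * pi) * ennreal (moser_const l)" by (intro mult_left_mono mo) simp
  finally show ?thesis .
qed

end

section \<open>Decreasing potentials\<close>

context leray_potential
begin

lemma W_antimono:
  assumes anti: "antimono_on {0<..<1} V" and xy: "x \<noteq> 0" "norm x \<le> norm y" shows "W y \<le> W x"
proof (cases "norm y < 1")
  case True
  have "0 < norm x" using xy by simp
  then have y: "0 < norm y" using xy by linarith
  then have "V (norm y) \<le> V (norm x)" using monotone_onD[OF anti, of "norm x" "norm y"] xy True by auto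
  then show ?thesis using y xy True by (simp add: W_def)
next
  case False
  then show ?thesis using W_nonneg by (simp add: W_def)
qed

text \<open>Competitors are nonnegative, so a test function enters through its absolute value, which
  changes neither the potential term nor the exponential integral.\<close>

lemma nonlocal_energy_abs_le: "nonlocal_energy e (\<lambda>x. \<bar>u x\<bar>) \<le> nonlocal_energy e u"
  unfolding nonlocal_energy_def
proof (rule nn_integral_mono)
  fix p :: "plane \<times> plane"
  have "(\<bar>u (fst p)\<bar> - \<bar>u (snd p)\<bar>)\<^sup>2 \<le> (u (fst p) - u (snd p))\<^sup>2"
    unfolding abs_le_square_iff[symmetric] by (rule abs_triangle_ineq3)
  then show "ennreal (of_bool (norm (fst p - snd p) < e) * (\<bar>u (fst p)\<bar> - \<bar>u (snd p)\<bar>)\<^sup>2)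
    \<le> ennreal (of_bool (norm (fst p - snd p) < e) * (u (fst p) - u (snd p))\<^sup>2)"
    by (intro ennreal_leI mult_left_mono) auto
qed

text \<open>Polarization acts on the whole plane, where the exponential itself has an infinite
  integral. Subtracting 1 leaves a function of \<open>u\<close> that vanishes wherever
  \<open>u\<close> does.\<close>

lemma exp_integral_split:
  assumes m: "0 \<le> m" and u: "u \<in> borel_measurable borel" "\<And>x. x \<notin> B1 \<Longrightarrow> u x = 0"
  shows "(\<integral>\<^sup>+x\<in>B1. ennreal (exp (m * (u x)\<^sup>2)) \<partial>lborel) = emeasure lborel B1 + (\<integral>\<^sup>+x. ennreal (exp (m * (u x)\<^sup>2) - 1) \<partial>lborel)"
proof -
  have "ennreal (exp (m * (u x)\<^sup>2)) * indicator B1 x = indicator B1 x + ennreal (exp (m * (u x)\<^sup>2) - 1)" for x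
  proof (cases "x \<in> B1")
    case True
    have "1 \<le> exp (m * (u x)\<^sup>2)" using m by simp
    then have "ennreal (exp (m * (u x)\<^sup>2)) = ennreal 1 + ennreal (exp (m * (u x)\<^sup>2) - 1)"
      by (subst ennreal_plus[symmetric]) auto
    then show ?thesis using True by simp
  next
    case False
    then show ?thesis using u(2) by simp
  qed
  then have "(\<integral>\<^sup>+x\<in>B1. ennreal (exp (m * (u x)\<^sup>2)) \<partial>lborel) = (\<integral>\<^sup>+x. indicator B1 x + ennreal (exp (m * (u x)\<^sup>2) - 1) \<partial>lborel)" by simp
  also have "\<dots> = emeasure lborel B1 + (\<integral>\<^sup>+x. ennreal (exp (m * (u x)\<^sup>2) - 1) \<partial>lborel)"
    using u(1) by (subst nn_integral_add) auto
  finally show ?thesis .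
qed

text \<open>The absolute value of the test function is replaced by a radial competitor with the same
  exponential integral, and that by its mollifications. The bound on the Dirichlet energy reaches
  them through the nonlocal energies, the bound on the potential term by dominated convergence, and
  Fatou's lemma returns the result to the competitor.\<close>

lemma test_moser_decreasing:
  assumes anti: "antimono_on {0<..<1} V" and \<phi>: "C1c (B1 - {0}) \<phi> g" and E: "energy V \<mu> B1 \<phi> g \<le> 1"
  shows "(\<integral>\<^sup>+x\<in>B1. ennreal (exp (m_crit \<mu> * (\<phi> x)\<^sup>2)) \<partial>lborel) \<le> ennreal (2 * pi) * ennreal (moser_const l)"
proof -
  define m where "m = m_crit \<mu>"
  have m: "0 \<le> m" using l by (simp add: m_def m_crit_l)
  obtain K where K: "compact K" "K \<subseteq> B1 - {0}" "\<And>x. x \<notin> K \<Longrightarrow> \<phi> x = 0" by (rule C1c_support[OF \<phi>]) blast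
  obtain R where R: "0 < R" "R < 1" "\<And>x. R < norm x \<Longrightarrow> \<phi> x = 0"
  proof (cases "K = {}")
    case True
    then show ?thesis using that[of "1/2"] K by auto
  next
    case False
    obtain z where z: "z \<in> K" "\<And>y. y \<in> K \<Longrightarrow> norm y \<le> norm z"
      using continuous_attains_sup[OF K(1) False, of norm] by (auto intro: continuous_intros)
    have "0 < norm z" "norm z < 1" using z(1) K(2) by auto
    moreover have "\<phi> x = 0" if "norm z < norm x" for x using z(2)[of x] K(3)[of x] that by force
    ultimately show ?thesis by (rule that)
  qed
  obtain L where L: "0 < L" "\<And>x. norm (g x) \<le> L" by (rule C1c_bounded[OF \<phi>]) blast
  have \<phi>m[measurable]: "\<phi> \<in> borel_measurable borel" by (rule C1c_measurable(1)[OF \<phi>])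
  define v0 where "v0 x = \<bar>\<phi> x\<bar>" for x
  have c0: "competitor W m L R v0 v0"
    unfolding competitor_def v0_def using C1c_lipschitz[OF \<phi> L(2)] R(3) by (auto intro: order_trans[OF abs_triangle_ineq3])
  have Wc: "(\<integral>\<^sup>+x\<in>cball 0 r. ennreal (W x) \<partial>lborel) < \<infinity>" if "0 < r" "r < 1" for r
  proof (rule le_less_trans[OF nn_integral_mono nn_integral_leray_weight_cball[OF that]])
    show "ennreal (W x) * indicator (cball 0 r) x \<le> ennreal (leray_weight x) * indicator (cball 0 r) x" for x
      by (intro mult_right_mono ennreal_leI W_le) simp
  qed
  interpret S: symmetrization W m L R v0
    by (rule symmetrization.intro[OF m less_imp_le[OF L(1)] R(1) W_measurable W_nonneg W_antimono[OF anti] Wc[OF R(1,2)] c0])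
  obtain v where v: "competitor W m L R v0 v" and rad: "\<And>x y. norm x = norm y \<Longrightarrow> v x = v y" by (rule S.radial_competitor) blast
  note vm[measurable] = S.admD(5)[OF v]
  have NE: "nonlocal_energy e v \<le> ennreal (e\<^sup>2) * (ennreal (e\<^sup>2) * (ennreal (D g) * disc_moment))" if e: "0 < e" for e
  proof -
    have "nonlocal_energy e v \<le> nonlocal_energy e v0" using v by (simp add: competitor_def)
    also have "\<dots> \<le> nonlocal_energy e \<phi>" unfolding v0_def by (rule nonlocal_energy_abs_le)
    also have "\<dots> = ennreal (e\<^sup>2) * diff_energy e \<phi>" by (rule nonlocal_energy_scale[OF \<phi>m e])
    also have "diff_energy e \<phi> \<le> ennreal (e\<^sup>2) * (ennreal (D g) * disc_moment)"
      using diff_energy_le[OF C1c_derivative[OF \<phi>] C1c_continuous(2)[OF \<phi>], of e] unfolding nn_D[OF \<phi>] .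
    finally show ?thesis by (simp add: mult_left_mono)
  qed
  have Pv: "ennreal (P \<phi>) \<le> (\<integral>\<^sup>+x. ennreal (W x * (v x)\<^sup>2) \<partial>lborel)"
    using v unfolding competitor_def v0_def by (simp add: nn_P[OF \<phi>])
  \<comment> \<open>Room between the support and the unit circle: mollification enlarges the
    support, which must stay inside a disc on which the weight is integrable.\<close>
  define R' where "R' = (1 + R) / 2"
  have R': "R < R'" "R' < 1" "0 < R'" unfolding R'_def using R(1,2) by simp_all
  define d where "d k = (R' - R) / real (Suc (Suc k))" for k
  have d: "0 < d k" "d k < R' - R" for k
  proof -
    have X: "0 < R' - R" using R' by simp
    then show "0 < d k" by (simp add: d_def)
    have "(R' - R) * 1 < (R' - R) * real (Suc (Suc k))" by (rule mult_strict_left_mono[OF _ X]) simp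
    then show "d k < R' - R" unfolding d_def by (simp only: pos_divide_less_eq of_nat_0_less_iff zero_less_Suc mult_1_right)
  qed
  have d0: "d \<longlonglongrightarrow> 0" unfolding d_def by (rule LIMSEQ_Suc[OF LIMSEQ_Suc[OF lim_const_over_n]])
  have mol: "mollified v L R (d k)" for k
    by (rule mollified.intro[OF S.admD(1)[OF v] less_imp_le[OF L(1)] d(1) S.admD(3)[OF v] rad])
  define f where "f k = mollified.vd v (d k)" for k
  have close: "\<bar>f k x - v x\<bar> \<le> L * d k" for k x unfolding f_def by (rule mollified.vd_close[OF mol])
  have fsupp: "f k x = 0" if "R' \<le> norm x" for k x
    unfolding f_def by (rule mollified.vd_support[OF mol]) (use that d(2)[of k] in linarith)
  have flim: "(\<lambda>k. f k x) \<longlonglongrightarrow> v x" for x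
  proof -
    have "(\<lambda>k. L * d k) \<longlonglongrightarrow> L * 0" by (intro tendsto_intros d0)
    then have "(\<lambda>k. L * d k) \<longlonglongrightarrow> 0" by simp
    then have "(\<lambda>k. f k x - v x) \<longlonglongrightarrow> 0" by (rule Lim_null_comparison[rotated]) (use close in auto)
    then show ?thesis by (simp add: LIM_zero_iff)
  qed
  have fm[measurable]: "f k \<in> borel_measurable borel" for k
  proof -
    obtain G where "\<And>x. (f k has_derivative (\<lambda>h. G x \<bullet> h)) (at x)" unfolding f_def by (rule mollified.vd_C1[OF mol]) blast
    then have "continuous_on UNIV (f k)" by (intro has_derivative_continuous_on[of _ _ "\<lambda>x h. G x \<bullet> h"]) simp
    then show ?thesis by (rule borel_measurable_continuous_onI)
  qed
  define M where "M = L * (3 * R) + L * (R' - R)"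
  have fM: "\<bar>f k x\<bar> \<le> M" for k x
  proof -
    have "L * d k \<le> L * (R' - R)" using less_imp_le[OF d(2)] less_imp_le[OF L(1)] by (rule mult_left_mono)
    then show ?thesis using close[of k x] S.admD(2,6)[OF v, of x] unfolding M_def by linarith
  qed
  define p where "p k = enn2real (\<integral>\<^sup>+x. ennreal (W x * (f k x)\<^sup>2) \<partial>lborel)" for k
  define pv where "pv = enn2real (\<integral>\<^sup>+x. ennreal (W x * (v x)\<^sup>2) \<partial>lborel)"
  have [measurable]: "cball (0 :: plane) R' \<in> sets borel" by simp
  have dom: "ennreal (W x * (u x)\<^sup>2) \<le> ennreal (M\<^sup>2) * (ennreal (W x) * indicator (cball 0 R') x)"
    if "\<And>x. \<bar>u x\<bar> \<le> M" "\<And>x. R' \<le> norm x \<Longrightarrow> u x = 0" for u x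
  proof -
    have sq: "(u x)\<^sup>2 \<le> M\<^sup>2" using that(1)[of x] by (simp add: abs_le_square_iff[symmetric])
    have "W x * (u x)\<^sup>2 \<le> M\<^sup>2 * W x" using mult_left_mono[OF sq W_nonneg[of x]] by (simp add: mult.commute)
    then show ?thesis using that(2)[of x] W_nonneg[of x] by (cases "norm x \<le> R'") (auto simp: ennreal_mult[symmetric] intro: ennreal_leI)
  qed
  have domi: "(\<integral>\<^sup>+x. ennreal (M\<^sup>2) * (ennreal (W x) * indicator (cball 0 R') x) \<partial>lborel) < \<infinity>"
    using Wc[OF R'(3,2)] by (subst nn_integral_cmult) (auto simp: ennreal_mult_less_top)
  have vM: "\<bar>v x\<bar> \<le> M" for x
  proof -
    have "0 \<le> L * (R' - R)" using L(1) R'(1) by simp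
    then show ?thesis using S.admD(2,6)[OF v, of x] unfolding M_def by linarith
  qed
  have fin: "(\<integral>\<^sup>+x. ennreal (W x * (f k x)\<^sup>2) \<partial>lborel) < \<infinity>" for k
    by (rule le_less_trans[OF nn_integral_mono domi]) (rule dom[OF fM fsupp])
  have finv: "(\<integral>\<^sup>+x. ennreal (W x * (v x)\<^sup>2) \<partial>lborel) < \<infinity>"
    by (rule le_less_trans[OF nn_integral_mono domi]) (rule dom[OF vM], use S.admD(3)[OF v] R' in auto)
  have "(\<lambda>k. \<integral>\<^sup>+x. ennreal (W x * (f k x)\<^sup>2) \<partial>lborel) \<longlonglongrightarrow> (\<integral>\<^sup>+x. ennreal (W x * (v x)\<^sup>2) \<partial>lborel)"
  proof (rule nn_integral_dominated_convergence[OF _ _ _ _ domi])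
    show "AE x in lborel. ennreal (W x * (f k x)\<^sup>2) \<le> ennreal (M\<^sup>2) * (ennreal (W x) * indicator (cball 0 R') x)" for k
      by (rule AE_I2) (rule dom[OF fM fsupp])
    show "AE x in lborel. (\<lambda>k. ennreal (W x * (f k x)\<^sup>2)) \<longlonglongrightarrow> ennreal (W x * (v x)\<^sup>2)"
      by (intro AE_I2 tendsto_intros flim)
  qed measurable
  then have plim: "p \<longlonglongrightarrow> pv" unfolding p_def pv_def using finv by (intro tendsto_enn2real) auto
  have "ennreal pv = (\<integral>\<^sup>+x. ennreal (W x * (v x)\<^sup>2) \<partial>lborel)" unfolding pv_def using finv by simp
  then have "ennreal (P \<phi>) \<le> ennreal pv" using Pv by simp
  moreover have "0 \<le> pv" by (simp add: pv_def)
  ultimately have pvP: "P \<phi> \<le> pv" by (simp only: ennreal_le_iff)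
  have Dpv: "D g + \<mu> * pv \<le> 1"
  proof -
    have "\<mu> * pv \<le> \<mu> * P \<phi>" using mu pvP by (simp add: mult_left_mono_neg)
    then show ?thesis using E unfolding energy_test[OF \<phi>] by linarith
  qed
  \<comment> \<open>Mollification perturbs the potential term by \<open>p k - pv\<close>. This
    choice is at least 1, dominates \<open>D g + \<mu> * p k\<close> and tends to 1.\<close>
  define q where "q k = 1 + \<mu> * (p k - pv) + \<bar>\<mu> * (p k - pv)\<bar>" for k
  have q1: "1 \<le> q k" for k unfolding q_def by linarith
  have "q \<longlonglongrightarrow> 1 + \<mu> * (pv - pv) + \<bar>\<mu> * (pv - pv)\<bar>" unfolding q_def by (intro tendsto_intros plim)
  then have qlim: "q \<longlonglongrightarrow> 1" by simp
  have step: "(\<integral>\<^sup>+x\<in>B1. ennreal (exp (m * (f k x)\<^sup>2 / q k)) \<partial>lborel) \<le> ennreal (2 * pi) * ennreal (moser_const l)" for k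
  proof -
    obtain G where G: "\<And>x. (f k has_derivative (\<lambda>h. G x \<bullet> h)) (at x)" "continuous_on UNIV G"
      unfolding f_def by (rule mollified.vd_C1[OF mol]) blast
    have de: "diff_energy e (f k) \<le> ennreal (e\<^sup>2) * (ennreal (D g) * disc_moment)" if e: "0 < e" for e
    proof -
      have "ennreal (e\<^sup>2) * diff_energy e (f k) = nonlocal_energy e (f k)" by (rule nonlocal_energy_scale[OF fm e, symmetric])
      also have "\<dots> \<le> nonlocal_energy e v" unfolding f_def by (rule mollified.vd_nonlocal[OF mol])
      also note NE[OF e]
      finally show ?thesis using e by (subst (asm) ennreal_mult_le_mult_iff) auto
    qed
    have DG: "(\<integral>\<^sup>+x. ennreal ((norm (G x))\<^sup>2) \<partial>lborel) \<le> ennreal (D g)" by (rule gradient_energy_le[OF G de])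
    show ?thesis unfolding m_def
    proof (rule radial_C1_moser[OF G _ fsupp R'(3,2) DG D_nonneg])
      show "f k x = f k y" if "norm x = norm y" for x y unfolding f_def by (rule mollified.vd_radial[OF mol that])
      show "ennreal (p k) \<le> (\<integral>\<^sup>+x. ennreal (W x * (f k x)\<^sup>2) \<partial>lborel)" unfolding p_def using fin[of k] by simp
      show "0 \<le> p k" by (simp add: p_def)
      show "D g + \<mu> * p k \<le> q k" using Dpv unfolding q_def by (simp add: right_diff_distrib)
      show "0 < q k" using q1[of k] by simp
    qed
  qed
  have "(\<integral>\<^sup>+x\<in>B1. ennreal (exp (m * (v x)\<^sup>2)) \<partial>lborel) \<le> ennreal (2 * pi) * ennreal (moser_const l)"
  proof (rule nn_integral_fatou_AE)
    show "AE x in lborel. (\<lambda>k. ennreal (exp (m * (f k x)\<^sup>2 / q k)) * indicator B1 x) \<longlonglongrightarrow> ennreal (exp (m * (v x)\<^sup>2)) * indicator B1 x"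
    proof (rule AE_I2)
      fix x
      have "(\<lambda>k. ennreal (exp (m * (f k x)\<^sup>2 / q k))) \<longlonglongrightarrow> ennreal (exp (m * (v x)\<^sup>2 / 1))"
        by (intro tendsto_intros flim qlim) simp
      then show "(\<lambda>k. ennreal (exp (m * (f k x)\<^sup>2 / q k)) * indicator B1 x) \<longlonglongrightarrow> ennreal (exp (m * (v x)\<^sup>2)) * indicator B1 x"
        by (cases "x \<in> B1") auto
    qed
    show "eventually (\<lambda>k. (\<integral>\<^sup>+x\<in>B1. ennreal (exp (m * (f k x)\<^sup>2 / q k)) \<partial>lborel) \<le> ennreal (2 * pi) * ennreal (moser_const l)) sequentially"
      by (intro always_eventually allI step)
  qed measurable
  moreover have "(\<integral>\<^sup>+x\<in>B1. ennreal (exp (m * (\<phi> x)\<^sup>2)) \<partial>lborel) = (\<integral>\<^sup>+x\<in>B1. ennreal (exp (m * (v x)\<^sup>2)) \<partial>lborel)"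
  proof -
    have "\<phi> x = 0" "v x = 0" if "x \<notin> B1" for x using that R S.admD(3)[OF v, of x] by auto
    then show ?thesis using v exp_integral_split[OF m \<phi>m] exp_integral_split[OF m vm]
      by (simp add: competitor_def v0_def)
  qed
  ultimately show ?thesis by (simp add: m_def)
qed

lemma decreasing_moser:
  assumes anti: "antimono_on {0<..<1} V" and u: "u \<in> H_space V \<mu>" and n1: "H_norm V \<mu> u \<le> 1"
  shows "exp_integral (m_crit \<mu>) u \<le> ennreal (2 * pi) * ennreal (moser_const l)"
proof -
  obtain \<phi> u1 where \<phi>: "\<And>n. \<phi> n \<in> Cc_infty (B1 - {0})" and u1[measurable]: "u1 \<in> borel_measurable borel"
    and ae: "AE x in lebesgue. x \<in> B1 \<longrightarrow> u x = u1 x"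
    and lim: "(\<lambda>n. \<integral>\<^sup>+x. ennreal ((\<phi> n x - u1 x)\<^sup>2) \<partial>lborel) \<longlonglongrightarrow> 0"
    and tn: "(\<lambda>n. test_norm V \<mu> (\<phi> n)) \<longlonglongrightarrow> H_norm V \<mu> u"
    by (rule H_space_approx[OF u]) blast
  define c where "c n = inverse (max 1 (test_norm V \<mu> (\<phi> n)))" for n
  have c: "c \<longlonglongrightarrow> 1" unfolding c_def by (rule H_norm_scaled_tendsto[OF tn n1])
  note C = C1c_Cc_infty[OF \<phi>]
  have [measurable]: "\<phi> n \<in> borel_measurable borel" for n by (rule C1c_measurable(1)[OF C])
  obtain r where r: "strict_mono r" "AE x in lborel. (\<lambda>k. \<phi> (r k) x) \<longlonglongrightarrow> u1 x"
    by (rule AE_subseq_L2[of \<phi> lborel u1]) (use lim in auto)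
  have "exp_integral (m_crit \<mu>) u = (\<integral>\<^sup>+x\<in>B1. ennreal (exp (m_crit \<mu> * (u1 x)\<^sup>2)) \<partial>lborel)"
    by (rule exp_integral_eq[OF u1 ae])
  also have "\<dots> \<le> ennreal (2 * pi) * ennreal (moser_const l)"
  proof (rule nn_integral_fatou_AE)
    show "AE x in lborel. (\<lambda>k. ennreal (exp (m_crit \<mu> * (c (r k) * \<phi> (r k) x)\<^sup>2)) * indicator B1 x) \<longlonglongrightarrow> ennreal (exp (m_crit \<mu> * (u1 x)\<^sup>2)) * indicator B1 x"
      using r(2)
    proof eventually_elim
      case (elim x)
      have "(\<lambda>k. c (r k)) \<longlonglongrightarrow> 1" using LIMSEQ_subseq_LIMSEQ[OF c r(1)] by (simp add: o_def)
      then have "(\<lambda>k. ennreal (exp (m_crit \<mu> * (c (r k) * \<phi> (r k) x)\<^sup>2))) \<longlonglongrightarrow> ennreal (exp (m_crit \<mu> * (1 * u1 x)\<^sup>2))"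
        by (intro tendsto_intros elim)
      then show ?case by (cases "x \<in> B1") auto
    qed
    show "eventually (\<lambda>k. (\<integral>\<^sup>+x\<in>B1. ennreal (exp (m_crit \<mu> * (c (r k) * \<phi> (r k) x)\<^sup>2)) \<partial>lborel) \<le> ennreal (2 * pi) * ennreal (moser_const l)) sequentially"
      using test_moser_decreasing[OF anti C1c_cmult[OF C] energy_scaled_le_1[OF \<phi>]] by (intro always_eventually allI) (simp add: c_def)
  qed measurable
  finally show ?thesis .
qed

end

section \<open>Optimality\<close>

text \<open>\<open>bump 2\<close> is the derivative of \<open>bump 0\<close>; the bound comes from
  \<open>exp x\<close> being at least \<open>x\<^sup>2 / 2\<close> for positive
  \<open>x\<close>.\<close>

lemma bump_2_le: "bump 2 t \<le> 2"
proof (cases "t > 0")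
  case True
  have "(1 / t)\<^sup>2 / 2 \<le> exp (1 / t)" using exp_lower_Taylor_quadratic[of "1 / t"] zero_le_divide_1_iff[of t] True by linarith
  then have "exp (- (1 / t)) * ((1 / t)\<^sup>2 / 2) \<le> exp (- (1 / t)) * exp (1 / t)" by (intro mult_left_mono) auto
  also have "\<dots> = 1" by (simp add: exp_add[symmetric])
  finally show ?thesis using True by (simp add: bump_def power_one_over divide_le_eq mult.commute)
qed (simp add: bump_def)

text \<open>The root is a smooth substitute for the absolute value of \<open>y\<close>; subtracting
  \<open>1 / N\<close> restores the value 1 at \<open>y = 0\<close>.\<close>

definition leray_envelope :: "real \<Rightarrow> real \<Rightarrow> real \<Rightarrow> real" where
  "leray_envelope l N y = exp (- (l / 2) * (sqrt (y\<^sup>2 + 1 / N\<^sup>2) - 1 / N))"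

text \<open>A smooth cutoff at distance \<open>N\<close>; the factor \<open>exp 1\<close> normalizes
  its value at 0 to 1.\<close>

definition cutoff :: "real \<Rightarrow> real \<Rightarrow> real" where
  "cutoff N y = exp 1 * bump 0 (1 - (y / N)\<^sup>2)"

text \<open>As \<open>N \<rightarrow> \<infinity>\<close>, the profiles approach \<open>exp (- l \<bar>y\<bar> / 2)\<close>, which minimizes
  \<open>\<integral> (g'\<^sup>2 + (l\<^sup>2 / 4) g\<^sup>2)\<close> subject to \<open>g 0 = 1\<close>; the minimum is \<open>l\<close>.\<close>

definition leray_profile :: "real \<Rightarrow> real \<Rightarrow> real \<Rightarrow> real" where
  "leray_profile l N y = leray_envelope l N y * cutoff N y"

definition leray_profile' :: "real \<Rightarrow> real \<Rightarrow> real \<Rightarrow> real" where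
  "leray_profile' l N y = leray_envelope l N y *
     (exp 1 * (bump 2 (1 - (y / N)\<^sup>2) * (- (2 * y / N\<^sup>2))) - (l / 2) * (y / sqrt (y\<^sup>2 + 1 / N\<^sup>2)) * cutoff N y)"

lemma continuous_on_bump: "continuous_on S (bump k)"
  by (rule DERIV_continuous_on[OF has_field_derivative_at_within[OF bump_has_derivative]])

context
  fixes l N :: real
  assumes l: "0 < l" and N: "0 < N"
begin

lemma radicand_pos: "0 < y\<^sup>2 + 1 / N\<^sup>2" using N by (simp add: add_nonneg_pos)

lemma leray_profile_deriv: "(leray_profile l N has_real_derivative leray_profile' l N y) (at y)"
proof -
  have s: "((\<lambda>y. sqrt (y\<^sup>2 + 1 / N\<^sup>2)) has_real_derivative y / sqrt (y\<^sup>2 + 1 / N\<^sup>2)) (at y)"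
    using radicand_pos[of y] by (auto intro!: derivative_eq_intros simp: field_simps)
  have e: "((\<lambda>y. leray_envelope l N y) has_real_derivative leray_envelope l N y * (- (l / 2) * (y / sqrt (y\<^sup>2 + 1 / N\<^sup>2)))) (at y)"
    unfolding leray_envelope_def by (rule DERIV_cong[OF DERIV_fun_exp[OF DERIV_cmult[OF DERIV_diff[OF s DERIV_const]]]]) simp
  have q: "((\<lambda>y. 1 - (y / N)\<^sup>2) has_real_derivative - (2 * y / N\<^sup>2)) (at y)"
    using N by (auto intro!: derivative_eq_intros simp: power2_eq_square)
  have b: "(bump 0 has_real_derivative bump 2 t) (at t)" for t using bump_has_derivative[of 0 t] by (simp add: numeral_2_eq_2)
  have c: "((\<lambda>y. cutoff N y) has_real_derivative exp 1 * (bump 2 (1 - (y / N)\<^sup>2) * (- (2 * y / N\<^sup>2)))) (at y)"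
    unfolding cutoff_def by (rule DERIV_cmult DERIV_chain2[OF b q])+
  have "((\<lambda>y. leray_envelope l N y * cutoff N y) has_real_derivative
      leray_envelope l N y * (- (l / 2) * (y / sqrt (y\<^sup>2 + 1 / N\<^sup>2))) * cutoff N y
      + exp 1 * (bump 2 (1 - (y / N)\<^sup>2) * (- (2 * y / N\<^sup>2))) * leray_envelope l N y) (at y)"
    by (rule DERIV_mult[OF e c])
  moreover have "e * (- L * q) * c + A * e = e * (A - L * q * c)" for e L q c A :: real by (simp add: algebra_simps)
  ultimately show ?thesis unfolding leray_profile_def[abs_def] leray_profile'_def by (simp only:)
qed

lemma leray_profile_continuous: "continuous_on S (leray_profile l N)" "continuous_on S (leray_profile' l N)"
proof -
  show "continuous_on S (leray_profile l N)"
    by (rule DERIV_continuous_on[OF has_field_derivative_at_within[OF leray_profile_deriv]])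
  have "y\<^sup>2 + 1 / N\<^sup>2 \<noteq> 0" for y using radicand_pos[of y] by simp
  then show "continuous_on S (leray_profile' l N)"
    unfolding leray_profile'_def[abs_def] leray_envelope_def cutoff_def
    using N by (intro continuous_intros continuous_on_compose2[OF continuous_on_bump[of UNIV]]) auto
qed

lemma cutoff_bounds: "0 \<le> cutoff N y" "cutoff N y \<le> 1"
proof -
  show "0 \<le> cutoff N y" by (simp add: cutoff_def bump_nonneg)
  show "cutoff N y \<le> 1"
  proof (cases "0 < 1 - (y / N)\<^sup>2")
    case True
    have "1 \<le> 1 / (1 - (y / N)\<^sup>2)" using True by simp
    then show ?thesis using True by (simp add: cutoff_def bump_def exp_add[symmetric])
  qed (simp add: cutoff_def bump_def)
qed

lemma leray_profile_outside:
  assumes "N \<le> \<bar>y\<bar>" shows "leray_profile l N y = 0" "leray_profile' l N y = 0"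
proof -
  have "1 \<le> \<bar>y / N\<bar>" using assms N by simp
  then have "1 \<le> (y / N)\<^sup>2" using abs_le_square_iff[of 1 "y / N"] by simp
  then show "leray_profile l N y = 0" "leray_profile' l N y = 0"
    by (simp_all add: leray_profile_def leray_profile'_def cutoff_def bump_def)
qed

lemma leray_profile_0: "leray_profile l N 0 = 1"
proof -
  have "sqrt (1 / N\<^sup>2) = 1 / N" using N by (simp add: real_sqrt_divide)
  then show ?thesis by (simp add: leray_profile_def leray_envelope_def cutoff_def bump_def exp_add[symmetric])
qed

lemma leray_envelope_sq: "(leray_envelope l N y)\<^sup>2 \<le> exp (l / N) * exp (- l * \<bar>y\<bar>)"
proof -
  have "\<bar>y\<bar> \<le> sqrt (y\<^sup>2 + 1 / N\<^sup>2)" by (rule real_le_rsqrt) simp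
  then have "l * \<bar>y\<bar> \<le> l * sqrt (y\<^sup>2 + 1 / N\<^sup>2)" using l by simp
  then have "- l * (sqrt (y\<^sup>2 + 1 / N\<^sup>2) - 1 / N) \<le> l / N + - l * \<bar>y\<bar>" by (simp add: right_diff_distrib)
  moreover have "(leray_envelope l N y)\<^sup>2 = exp (- l * (sqrt (y\<^sup>2 + 1 / N\<^sup>2) - 1 / N))"
    unfolding leray_envelope_def power2_eq_square exp_add[symmetric] by simp
  ultimately show ?thesis by (simp only: exp_add[symmetric] exp_le_cancel_iff)
qed

lemma leray_profile_sq: "(leray_profile l N y)\<^sup>2 \<le> exp (l / N) * exp (- l * \<bar>y\<bar>)"
proof -
  have "(cutoff N y)\<^sup>2 \<le> 1" using cutoff_bounds[of y] by (simp add: power_le_one)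
  then have "(leray_envelope l N y)\<^sup>2 * (cutoff N y)\<^sup>2 \<le> (leray_envelope l N y)\<^sup>2 * 1" by (intro mult_left_mono) auto
  also note leray_envelope_sq[of y]
  finally show ?thesis by (simp add: leray_profile_def power_mult_distrib)
qed

text \<open>The slope \<open>l / 2\<close> belongs to the exponential envelope. The rest is the
  derivative of the cutoff: \<open>exp 1\<close> from its normalization, 2 from
  \<open>bump_2_le\<close> and \<open>2 / N\<close> from the inner derivative inside the
  support.\<close>

lemma leray_profile'_sq:
  "(leray_profile' l N y)\<^sup>2 \<le> (l / 2 + 4 * exp 1 / N)\<^sup>2 * (exp (l / N) * exp (- l * \<bar>y\<bar>))"
proof (cases "N \<le> \<bar>y\<bar>")
  case True
  then show ?thesis by (simp add: leray_profile_outside)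
next
  case False
  define A where "A = exp 1 * (bump 2 (1 - (y / N)\<^sup>2) * (- (2 * y / N\<^sup>2)))"
  define B where "B = (l / 2) * (y / sqrt (y\<^sup>2 + 1 / N\<^sup>2)) * cutoff N y"
  have "\<bar>2 * y / N\<^sup>2\<bar> \<le> 2 / N"
    using False N by (simp add: abs_mult power2_eq_square field_simps)
  then have "\<bar>bump 2 (1 - (y / N)\<^sup>2)\<bar> * \<bar>2 * y / N\<^sup>2\<bar> \<le> 2 * (2 / N)"
    using bump_2_le bump_nonneg by (intro mult_mono) auto
  then have "exp 1 * (\<bar>bump 2 (1 - (y / N)\<^sup>2)\<bar> * \<bar>2 * y / N\<^sup>2\<bar>) \<le> exp 1 * (2 * (2 / N))" by (rule mult_left_mono) simp
  moreover have "\<bar>A\<bar> = exp 1 * (\<bar>bump 2 (1 - (y / N)\<^sup>2)\<bar> * \<bar>2 * y / N\<^sup>2\<bar>)"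
    unfolding A_def by (simp only: abs_mult abs_minus_cancel abs_exp_cancel)
  ultimately have A: "\<bar>A\<bar> \<le> 4 * exp 1 / N" by (simp add: mult.commute)
  have "\<bar>y\<bar> \<le> sqrt (y\<^sup>2 + 1 / N\<^sup>2)" by (rule real_le_rsqrt) simp
  then have "\<bar>y / sqrt (y\<^sup>2 + 1 / N\<^sup>2)\<bar> \<le> 1" using radicand_pos[of y] by (simp add: divide_le_eq_1)
  then have "\<bar>y / sqrt (y\<^sup>2 + 1 / N\<^sup>2)\<bar> * \<bar>cutoff N y\<bar> \<le> 1 * 1" using cutoff_bounds[of y] by (intro mult_mono) auto
  then have "(l / 2) * (\<bar>y / sqrt (y\<^sup>2 + 1 / N\<^sup>2)\<bar> * \<bar>cutoff N y\<bar>) \<le> (l / 2) * 1" using l by (intro mult_left_mono) auto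
  then have B: "\<bar>B\<bar> \<le> l / 2" using l by (simp add: B_def abs_mult)
  have "\<bar>A - B\<bar> \<le> l / 2 + 4 * exp 1 / N" using A B by linarith
  then have "(A - B)\<^sup>2 \<le> (l / 2 + 4 * exp 1 / N)\<^sup>2" unfolding abs_le_square_iff[symmetric] by linarith
  then have "(A - B)\<^sup>2 * (leray_envelope l N y)\<^sup>2 \<le> (l / 2 + 4 * exp 1 / N)\<^sup>2 * (exp (l / N) * exp (- l * \<bar>y\<bar>))"
    using leray_envelope_sq[of y] by (intro mult_mono) auto
  then show ?thesis by (simp add: leray_profile'_def A_def B_def power_mult_distrib mult.commute)
qed

end

text \<open>The substitution \<open>w = sqrt t * g (ln t)\<close> makes the Hardy functional
  invariant under translation of \<open>ln t\<close>. The peak sits at \<open>t = T\<close>, where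
  the value is \<open>sqrt T\<close>, and the energy bound does not depend on
  \<open>T\<close>.\<close>

definition moser_fun :: "real \<Rightarrow> real \<Rightarrow> real \<Rightarrow> real \<Rightarrow> real" where
  "moser_fun l N T t = (if 0 < t then sqrt t * leray_profile l N (ln t - ln T) else 0)"

definition moser_fun' :: "real \<Rightarrow> real \<Rightarrow> real \<Rightarrow> real \<Rightarrow> real" where
  "moser_fun' l N T t = (leray_profile l N (ln t - ln T) / 2 + leray_profile' l N (ln t - ln T)) / sqrt t"

text \<open>The coefficient of \<open>exp (- l * \<bar>y\<bar>)\<close> in the pointwise bound times
  the integral \<open>2 / l\<close> of this exponential. The term \<open>\<nu> / N\<close> pays for
  a potential that is known only up to the factor \<open>1 - 1 / N\<close>.\<close>

definition moser_energy :: "real \<Rightarrow> real \<Rightarrow> real \<Rightarrow> real" where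
  "moser_energy l \<nu> N = (((l / 2 + 4 * exp 1 / N)\<^sup>2 + l\<^sup>2 / 4 + \<nu> / N) * exp (l / N)) * (2 / l)"

lemma moser_energy_tendsto: assumes "0 < l" shows "(moser_energy l \<nu> \<longlongrightarrow> l) at_top"
proof -
  have i: "((\<lambda>N. c / N :: real) \<longlongrightarrow> 0) at_top" for c by (rule tendsto_divide_0[OF tendsto_const filterlim_at_top_imp_at_infinity[OF filterlim_ident]])
  have "((\<lambda>N. (((l / 2 + 4 * exp 1 / N)\<^sup>2 + l\<^sup>2 / 4 + \<nu> / N) * exp (l / N)) * (2 / l)) \<longlongrightarrow> (((l / 2 + 0)\<^sup>2 + l\<^sup>2 / 4 + 0) * exp 0) * (2 / l)) at_top"
    by (intro tendsto_intros i)
  moreover have "(((l / 2 + 0)\<^sup>2 + l\<^sup>2 / 4 + 0) * exp 0) * (2 / l) = l" using assms by (simp add: power2_eq_square field_simps)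
  ultimately show ?thesis by (simp add: moser_energy_def[abs_def])
qed

context
  fixes l N T :: real
  assumes l: "0 < l" and N: "0 < N" and T: "0 < T"
begin

lemma moser_fun_deriv: assumes "0 < t" shows "(moser_fun l N T has_real_derivative moser_fun' l N T t) (at t)"
proof -
  have y: "((\<lambda>t. ln t - ln T) has_real_derivative 1 / t) (at t)" using assms by (auto intro!: derivative_eq_intros)
  have "((\<lambda>t. sqrt t * leray_profile l N (ln t - ln T)) has_real_derivative
    (inverse (sqrt t) / 2) * leray_profile l N (ln t - ln T) + leray_profile' l N (ln t - ln T) * (1 / t) * sqrt t) (at t)"
    by (rule DERIV_mult[OF DERIV_real_sqrt[OF assms] DERIV_chain2[OF leray_profile_deriv[OF l N] y]])
  moreover have "(inverse (sqrt t) / 2) * leray_profile l N (ln t - ln T) + leray_profile' l N (ln t - ln T) * (1 / t) * sqrt t = moser_fun' l N T t"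
  proof -
    have "1 / t * sqrt t = inverse (sqrt t)" using assms by (simp add: field_simps)
    then have "leray_profile' l N (ln t - ln T) * (1 / t) * sqrt t = leray_profile' l N (ln t - ln T) * inverse (sqrt t)"
      by (simp only: mult.assoc)
    then show ?thesis unfolding moser_fun'_def divide_inverse[of _ "sqrt t"] by (simp only: distrib_right) simp
  qed
  ultimately have d: "((\<lambda>t. sqrt t * leray_profile l N (ln t - ln T)) has_real_derivative moser_fun' l N T t) (at t)" by simp
  have ev: "eventually (\<lambda>t. sqrt t * leray_profile l N (ln t - ln T) = moser_fun l N T t) (nhds t)"
    using eventually_nhds_in_open[OF open_greaterThan[of 0], of t] assms by (auto simp: moser_fun_def elim: eventually_mono)
  show ?thesis by (rule DERIV_cong_ev[OF refl ev refl, THEN iffD1, OF d])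
qed

lemma moser_fun_continuous: "continuous_on {0<..} (moser_fun l N T)" "continuous_on {0<..} (moser_fun' l N T)"
proof -
  show "continuous_on {0<..} (moser_fun l N T)"
    by (rule DERIV_continuous_on[OF has_field_derivative_at_within[OF moser_fun_deriv]]) simp
  show "continuous_on {0<..} (moser_fun' l N T)" unfolding moser_fun'_def[abs_def]
    by (intro continuous_intros continuous_on_compose2[OF leray_profile_continuous(1)[OF l N, of UNIV]]
      continuous_on_compose2[OF leray_profile_continuous(2)[OF l N, of UNIV]]) auto
qed

lemma moser_fun_outside:
  assumes "t \<notin> {T * exp (- N)<..<T * exp N}" shows "moser_fun l N T t = 0" "0 < t \<Longrightarrow> moser_fun' l N T t = 0"
proof -
  have k: "N \<le> \<bar>ln t - ln T\<bar>" if t: "0 < t"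
  proof (cases "t \<le> T * exp (- N)")
    case True
    then have "ln t \<le> ln (T * exp (- N))" using t T by simp
    then show ?thesis using T by (simp add: ln_mult)
  next
    case False
    then have "T * exp N \<le> t" using assms by auto
    then have "ln (T * exp N) \<le> ln t" using t T by simp
    then show ?thesis using T by (simp add: ln_mult)
  qed
  show "moser_fun l N T t = 0" using k leray_profile_outside(1)[OF l N] by (simp add: moser_fun_def)
  show "0 < t \<Longrightarrow> moser_fun' l N T t = 0" using k leray_profile_outside[OF l N] by (simp add: moser_fun'_def)
qed

lemma moser_fun_energy:
  assumes \<nu>: "0 \<le> \<nu>" and \<mu>: "\<mu> = l\<^sup>2 / 4 - 1 / 4" "- \<mu> \<le> \<nu>"
  shows "integral {T * exp (- N)..T * exp N} (\<lambda>t. (moser_fun' l N T t)\<^sup>2)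
    + \<mu> * ((1 - 1 / N) * integral {T * exp (- N)..T * exp N} (\<lambda>t. (moser_fun l N T t)\<^sup>2 / t\<^sup>2)) \<le> moser_energy l \<nu> N"
proof -
  define t0 where "t0 = T * exp (- N)"
  define t1 where "t1 = T * exp N"
  have t0: "0 < t0" "t0 \<le> T" "T \<le> t1" using T N by (simp_all add: t0_def t1_def)
  define C where "C = ((l / 2 + 4 * exp 1 / N)\<^sup>2 + l\<^sup>2 / 4 + \<nu> / N) * exp (l / N)"
  have C: "0 \<le> C" using \<nu> N by (auto simp: C_def)
  define y where "y t = ln t - ln T" for t
  define g where "g t = leray_profile l N (y t)" for t
  define g' where "g' t = leray_profile' l N (y t)" for t
  have yd: "(y has_real_derivative 1 / t) (at t)" if "0 < t" for t
    unfolding y_def using that by (auto intro!: derivative_eq_intros)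
  define F where "F t = C * (exp (- l * \<bar>y t\<bar>) / t)" for t
  \<comment> \<open>The mixed term \<open>g * g' / t\<close> is the derivative of
    \<open>g\<^sup>2 / 2\<close> and integrates to 0, as \<open>g\<close> vanishes at both ends;
    \<open>F\<close> bounds the quadratic rest.\<close>
  have point: "(moser_fun' l N T t)\<^sup>2 + \<mu> * ((1 - 1 / N) * ((moser_fun l N T t)\<^sup>2 / t\<^sup>2)) \<le> g t * g' t / t + F t" if t: "0 < t" for t
  proof -
    have "(moser_fun' l N T t)\<^sup>2 = (g t / 2 + g' t)\<^sup>2 / t"
      using t by (simp add: moser_fun'_def g_def g'_def y_def power_divide)
    moreover have "(moser_fun l N T t)\<^sup>2 / t\<^sup>2 = (g t)\<^sup>2 / t"
      using t by (simp add: moser_fun_def g_def y_def power_mult_distrib) (simp add: power2_eq_square)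
    ultimately have "(moser_fun' l N T t)\<^sup>2 + \<mu> * ((1 - 1 / N) * ((moser_fun l N T t)\<^sup>2 / t\<^sup>2))
      = ((g t / 2 + g' t)\<^sup>2 + \<mu> * (1 - 1 / N) * (g t)\<^sup>2) / t" by (simp add: add_divide_distrib)
    also have "(g t / 2 + g' t)\<^sup>2 + \<mu> * (1 - 1 / N) * (g t)\<^sup>2 = g t * g' t + ((g' t)\<^sup>2 + (l\<^sup>2 / 4 + - \<mu> / N) * (g t)\<^sup>2)"
    proof -
      have "(G / 2 + G')\<^sup>2 + (L - 1 / 4) * (1 - i) * G\<^sup>2 = G * G' + (G'\<^sup>2 + (L + - (L - 1 / 4) * i) * G\<^sup>2)" for G G' L i :: real
        by (simp add: power2_eq_square field_simps)
      moreover have "- \<mu> / N = - (l\<^sup>2 / 4 - 1 / 4) * (1 / N)" by (simp add: \<mu>(1))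
      ultimately show ?thesis by (simp only: \<mu>(1))
    qed
    also have "\<dots> \<le> g t * g' t + C * exp (- l * \<bar>y t\<bar>)"
    proof -
      have "(l\<^sup>2 / 4 + - \<mu> / N) * (g t)\<^sup>2 \<le> (l\<^sup>2 / 4 + \<nu> / N) * (exp (l / N) * exp (- l * \<bar>y t\<bar>))"
      proof (rule mult_mono)
        show "l\<^sup>2 / 4 + - \<mu> / N \<le> l\<^sup>2 / 4 + \<nu> / N" using divide_right_mono[OF \<mu>(2), of N] N by linarith
        show "(g t)\<^sup>2 \<le> exp (l / N) * exp (- l * \<bar>y t\<bar>)" unfolding g_def by (rule leray_profile_sq[OF l N])
      qed (use \<nu> N in auto)
      moreover have "(g' t)\<^sup>2 \<le> (l / 2 + 4 * exp 1 / N)\<^sup>2 * (exp (l / N) * exp (- l * \<bar>y t\<bar>))"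
        unfolding g'_def by (rule leray_profile'_sq[OF l N])
      moreover have "C * exp (- l * \<bar>y t\<bar>) = (l / 2 + 4 * exp 1 / N)\<^sup>2 * (exp (l / N) * exp (- l * \<bar>y t\<bar>))
         + (l\<^sup>2 / 4 + \<nu> / N) * (exp (l / N) * exp (- l * \<bar>y t\<bar>))"
        unfolding C_def by (simp only: distrib_right mult.assoc add.assoc)
      ultimately show ?thesis by linarith
    qed
    finally show ?thesis using t unfolding F_def by (simp add: add_divide_distrib divide_right_mono)
  qed
  have cw: "continuous_on {t0..t1} (moser_fun l N T)" "continuous_on {t0..t1} (moser_fun' l N T)"
    using t0 by (auto intro: continuous_on_subset[OF moser_fun_continuous(1)] continuous_on_subset[OF moser_fun_continuous(2)])
  have i1: "(\<lambda>t. (moser_fun' l N T t)\<^sup>2) integrable_on {t0..t1}" by (intro integrable_continuous_real continuous_intros cw)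
  have i2: "(\<lambda>t. \<mu> * ((1 - 1 / N) * ((moser_fun l N T t)\<^sup>2 / t\<^sup>2))) integrable_on {t0..t1}"
    using t0 by (intro integrable_continuous_real continuous_intros cw) auto
  have h1: "((\<lambda>t. g t * g' t / t) has_integral ((g t1)\<^sup>2 / 2 - (g t0)\<^sup>2 / 2)) {t0..t1}"
  proof (rule fundamental_theorem_of_calculus)
    fix t assume "t \<in> {t0..t1}"
    then have "0 < t" using t0 by auto
    have "(g has_real_derivative g' t * (1 / t)) (at t)" unfolding g_def g'_def
      by (rule DERIV_chain2[OF leray_profile_deriv[OF l N] yd[OF \<open>0 < t\<close>]])
    then have "((\<lambda>t. (g t)\<^sup>2 / 2) has_real_derivative g t * g' t / t) (at t)"
      by (auto intro!: derivative_eq_intros)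
    then show "((\<lambda>t. (g t)\<^sup>2 / 2) has_vector_derivative g t * g' t / t) (at t within {t0..t1})"
      by (simp add: has_real_derivative_iff_has_vector_derivative[symmetric] has_field_derivative_at_within)
  qed (use t0 in auto)
  have "g t0 = 0" "g t1 = 0"
    using leray_profile_outside(1)[OF l N] T N by (simp_all add: g_def y_def t0_def t1_def ln_mult)
  then have h1: "((\<lambda>t. g t * g' t / t) has_integral 0) {t0..t1}" using h1 by simp
  \<comment> \<open>The absolute value of \<open>y\<close> is resolved by splitting at
    \<open>T\<close>, where \<open>y\<close> changes sign.\<close>
  have h2: "(F has_integral (C * (exp (l * y T) / l) - C * (exp (l * y t0) / l))) {t0..T}"
  proof (rule fundamental_theorem_of_calculus)
    fix t assume t: "t \<in> {t0..T}"
    then have t': "0 < t" "y t \<le> 0" using t0 by (auto simp: y_def)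
    have "((\<lambda>t. C * (exp (l * y t) / l)) has_real_derivative C * (exp (l * y t) * (l * (1 / t)) / l)) (at t)"
      by (intro DERIV_cmult DERIV_cdivide DERIV_fun_exp yd t')
    moreover have "C * (exp (l * y t) * (l * (1 / t)) / l) = F t" using t' l by (simp add: F_def)
    ultimately show "((\<lambda>t. C * (exp (l * y t) / l)) has_vector_derivative F t) (at t within {t0..T})"
      by (simp add: has_real_derivative_iff_has_vector_derivative[symmetric] has_field_derivative_at_within)
  qed (use t0 in auto)
  have h3: "(F has_integral (C * (exp (- l * y t1) / - l) - C * (exp (- l * y T) / - l))) {T..t1}"
  proof (rule fundamental_theorem_of_calculus)
    fix t assume t: "t \<in> {T..t1}"
    then have t': "0 < t" "0 \<le> y t" using T by (auto simp: y_def)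
    have "((\<lambda>t. C * (exp (- l * y t) / - l)) has_real_derivative C * (exp (- l * y t) * (- l * (1 / t)) / - l)) (at t)"
      by (intro DERIV_cmult DERIV_cdivide DERIV_fun_exp yd t')
    moreover have "C * (exp (- l * y t) * (- l * (1 / t)) / - l) = F t" using t' l by (simp add: F_def)
    ultimately show "((\<lambda>t. C * (exp (- l * y t) / - l)) has_vector_derivative F t) (at t within {T..t1})"
      by (simp add: has_real_derivative_iff_has_vector_derivative[symmetric] has_field_derivative_at_within)
  qed (use t0 in auto)
  define S where "S = (C * (exp (l * y T) / l) - C * (exp (l * y t0) / l)) + (C * (exp (- l * y t1) / - l) - C * (exp (- l * y T) / - l))"
  have h4: "(F has_integral S) {t0..t1}" unfolding S_def
    by (rule has_integral_combine[OF t0(2,3) h2 h3])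
  have "0 \<le> C * (exp (l * y t0) / l)" "0 \<le> C * (exp (- l * y t1) / l)" using C l by auto
  moreover have e: "C * (exp (l * y T) / l) = C / l" "C * (exp (- l * y T) / - l) = - (C / l)" "C * (exp (- l * y t1) / - l) = - (C * (exp (- l * y t1) / l))"
    "C * (2 / l) = C / l + C / l"
    by (simp_all add: y_def)
  ultimately have S: "S \<le> C * (2 / l)" unfolding S_def e by linarith
  have "integral {t0..t1} (\<lambda>t. (moser_fun' l N T t)\<^sup>2) + \<mu> * ((1 - 1 / N) * integral {t0..t1} (\<lambda>t. (moser_fun l N T t)\<^sup>2 / t\<^sup>2))
    = integral {t0..t1} (\<lambda>t. (moser_fun' l N T t)\<^sup>2 + \<mu> * ((1 - 1 / N) * ((moser_fun l N T t)\<^sup>2 / t\<^sup>2)))"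
    by (simp only: Henstock_Kurzweil_Integration.integral_mult_right[symmetric])
       (rule Henstock_Kurzweil_Integration.integral_add[symmetric, OF i1 i2])
  also have "\<dots> \<le> integral {t0..t1} (\<lambda>t. g t * g' t / t + F t)"
    by (rule integral_le[OF integrable_add[OF i1 i2] has_integral_integrable[OF has_integral_add[OF h1 h4]] point]) (use t0 in auto)
  also have "\<dots> = S" using has_integral_add[OF h1 h4] by (simp add: integral_unique)
  finally show ?thesis using S unfolding t0_def t1_def moser_energy_def C_def by linarith
qed

end

lemma exp_half_ln: "0 < z \<Longrightarrow> exp (1 / 2 * ln z) = sqrt z"
  using powr_half_sqrt[of z] by (simp add: powr_def)

text \<open>The function is rewritten with the operations of \<open>elem_smooth\<close> on the
  punctured disc; the cutoff confines it to a closed annulus \<open>K\<close>, and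
  \<open>smooth_elem_smooth\<close> extends it by 0.\<close>

lemma moser_fun_Cc_infty:
  assumes l: "0 < l" and N: "0 < N" and T: "0 < T"
  shows "(\<lambda>x. c * moser_fun l N T (- ln (norm x))) \<in> Cc_infty (B1 - {0})"
proof -
  define S where "S = B1 - {0 :: plane}"
  define K where "K = cball (0 :: plane) (exp (- (T * exp (- N)))) - ball 0 (exp (- (T * exp N)))"
  have t0: "0 < T * exp (- N)" using T by simp
  have cK: "compact K" unfolding K_def by (intro compact_diff compact_cball open_ball)
  have KS: "K \<subseteq> S"
  proof
    fix x assume "x \<in> K"
    then have x: "norm x \<le> exp (- (T * exp (- N)))" "exp (- (T * exp N)) \<le> norm x" by (auto simp: K_def)
    have "exp (- (T * exp (- N))) < 1" using t0 by simp
    then have "norm x < 1" using x by linarith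
    moreover have "0 < norm x" using less_le_trans[OF exp_gt_zero x(2)] .
    ultimately show "x \<in> S" by (simp add: S_def)
  qed
  have out: "c * moser_fun l N T (- ln (norm x)) = 0" if "x \<notin> K" for x :: plane
  proof -
    have "- ln (norm x) \<notin> {T * exp (- N)<..<T * exp N}"
    proof
      assume i: "- ln (norm x) \<in> {T * exp (- N)<..<T * exp N}"
      then have "x \<noteq> 0" using t0 by auto
      then have "norm x = exp (ln (norm x))" by simp
      moreover have "exp (- (T * exp N)) \<le> exp (ln (norm x))" "exp (ln (norm x)) \<le> exp (- (T * exp (- N)))" using i by auto
      ultimately show False using that by (simp add: K_def)
    qed
    then show ?thesis by (simp add: moser_fun_outside(1)[OF l N T])
  qed
  \<comment> \<open>\<open>- ln (norm x)\<close> through the squared norm, a polynomial in the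
    coordinates. For the same reason roots appear below as exponentials of half a logarithm.\<close>
  define s where "s x = (- 1 / 2) * ln (x $ 1 * x $ 1 + x $ 2 * x $ 2)" for x :: plane
  define y where "y x = ln (s x) - ln T" for x
  define z where "z x = exp (1 / 2 * ln (y x * y x + 1 / N\<^sup>2))" for x
  define f where "f x = c * (exp (1 / 2 * ln (s x)) * (exp ((- (l / 2)) * (z x - 1 / N)) * (exp 1 * bump 0 (1 - (y x * (1 / N)) * (y x * (1 / N))))))" for x
  have sq: "x $ 1 * x $ 1 + x $ 2 * x $ 2 = (norm x)\<^sup>2" for x :: plane by (simp add: norm_vec2 power2_eq_square)
  have s: "s x = - ln (norm x)" "0 < s x" if "x \<in> S" for x
  proof -
    have "0 < norm x" "norm x < 1" using that by (auto simp: S_def)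
    then show "s x = - ln (norm x)" "0 < s x" unfolding s_def sq by (simp_all add: ln_realpow)
  qed
  have es: "elem_smooth S s" unfolding s_def[abs_def]
  proof (intro elem_smooth.mult[OF elem_smooth.const] elem_smooth.ln)
    show "elem_smooth S (\<lambda>x. x $ 1 * x $ 1 + x $ 2 * x $ 2)"
      by (intro elem_smooth.add elem_smooth.mult elem_smooth.coord)
    show "0 < x $ 1 * x $ 1 + x $ 2 * x $ 2" if "x \<in> S" for x unfolding sq using that by (simp add: S_def)
  qed
  have ey: "elem_smooth S y" unfolding y_def[abs_def]
    by (rule elem_smooth_diff[OF elem_smooth.ln[OF es] elem_smooth.const]) (rule s)
  have pos: "0 < y x * y x + 1 / N\<^sup>2" for x using radicand_pos[OF l N, of "y x"] by (simp add: power2_eq_square)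
  have ez: "elem_smooth S z" unfolding z_def[abs_def]
    by (rule elem_smooth.exp[OF elem_smooth.mult[OF elem_smooth.const elem_smooth.ln[OF elem_smooth.add[OF elem_smooth.mult[OF ey ey] elem_smooth.const]]]]) (rule pos)
  have yN: "elem_smooth S (\<lambda>x. y x * (1 / N))" by (rule elem_smooth.mult[OF ey elem_smooth.const])
  have e1: "elem_smooth S (\<lambda>x. exp (1 / 2 * ln (s x)))"
    by (rule elem_smooth.exp[OF elem_smooth.mult[OF elem_smooth.const elem_smooth.ln[OF es]]]) (rule s)
  have e2: "elem_smooth S (\<lambda>x. exp ((- (l / 2)) * (z x - 1 / N)))"
    by (rule elem_smooth.exp[OF elem_smooth.mult[OF elem_smooth.const elem_smooth_diff[OF ez elem_smooth.const]]])
  have e3: "elem_smooth S (\<lambda>x. exp 1 * bump 0 (1 - (y x * (1 / N)) * (y x * (1 / N))))"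
    by (rule elem_smooth.mult[OF elem_smooth.const elem_smooth.bump[OF elem_smooth_diff[OF elem_smooth.const elem_smooth.mult[OF yN yN]]]])
  have ef: "elem_smooth S f" unfolding f_def[abs_def]
    by (rule elem_smooth.mult[OF elem_smooth.const elem_smooth.mult[OF e1 elem_smooth.mult[OF e2 e3]]])
  have eq: "c * moser_fun l N T (- ln (norm x)) = f x" if x: "x \<in> S" for x
  proof -
    have zx: "z x = sqrt ((y x)\<^sup>2 + 1 / N\<^sup>2)" using exp_half_ln[OF pos] by (simp add: z_def power2_eq_square)
    show ?thesis using s[OF x] exp_half_ln[OF s(2)[OF x]]
      unfolding f_def moser_fun_def leray_profile_def leray_envelope_def cutoff_def zx
      by (simp add: y_def power2_eq_square)
  qed
  have sm: "smooth (\<lambda>x. c * moser_fun l N T (- ln (norm x)))"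
    by (rule smooth_elem_smooth[OF _ compact_imp_closed[OF cK] KS ef eq out]) (auto simp: S_def intro: open_delete)
  have sub: "closure {x. c * moser_fun l N T (- ln (norm x)) \<noteq> 0} \<subseteq> K"
    by (rule closure_minimal[OF _ compact_imp_closed[OF cK]]) (use out in blast)
  have "compact (closure {x :: plane. c * moser_fun l N T (- ln (norm x)) \<noteq> 0})"
    by (rule compact_eq_bounded_closed[THEN iffD2, OF conjI[OF bounded_subset[OF compact_imp_bounded[OF cK] sub] closed_closure]])
  then show ?thesis unfolding Cc_infty_def using sub sm KS unfolding S_def by blast
qed

lemma grad_moser_fun:
  assumes l: "0 < l" and N: "0 < N" and T: "0 < T" and x: "x \<in> B1 - {0}"
  shows "grad (\<lambda>x. c * moser_fun l N T (- ln (norm x))) x = (- c * moser_fun' l N T (- ln (norm x)) / norm x) *\<^sub>R sgn x"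
proof (rule grad_eq)
  have r: "0 < norm x" "norm x < 1" using x by auto
  have m: "(moser_fun l N T has_real_derivative moser_fun' l N T (- ln (norm x))) (at (- ln (norm x)))"
    by (rule moser_fun_deriv[OF l N T]) (use r in simp)
  have d: "((\<lambda>r. - ln r) has_real_derivative - (1 / norm x)) (at (norm x))" using r by (auto intro!: derivative_eq_intros)
  have "((\<lambda>r. moser_fun l N T (- ln r)) has_real_derivative moser_fun' l N T (- ln (norm x)) * - (1 / norm x)) (at (norm x))"
    by (rule DERIV_chain2[where f = "moser_fun l N T" and g = "\<lambda>r. - ln r" and x = "norm x", OF m d])
  then have "((\<lambda>r. c * moser_fun l N T (- ln r)) has_real_derivative c * (moser_fun' l N T (- ln (norm x)) * - (1 / norm x))) (at (norm x))"
    by (rule DERIV_cmult)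
  then have "GDERIV (\<lambda>x. c * moser_fun l N T (- ln (norm x))) x :> (c * (moser_fun' l N T (- ln (norm x)) * - (1 / norm x))) *\<^sub>R sgn x"
    using x by (intro GDERIV_DERIV_compose[OF GDERIV_norm]) auto
  moreover have "c * (moser_fun' l N T (- ln (norm x)) * - (1 / norm x)) = - c * moser_fun' l N T (- ln (norm x)) / norm x" by simp
  ultimately show "((\<lambda>x. c * moser_fun l N T (- ln (norm x))) has_derivative (\<lambda>h. ((- c * moser_fun' l N T (- ln (norm x)) / norm x) *\<^sub>R sgn x) \<bullet> h)) (at x)"
    by (simp only: gderiv_def inner_commute)
qed

lemma nn_integral_Ioi_interval:
  fixes k :: "real \<Rightarrow> real"
  assumes k: "continuous_on {t0..t1} k" "\<And>t. 0 \<le> k t" "\<And>t. 0 < t \<Longrightarrow> t \<notin> {t0..t1} \<Longrightarrow> k t = 0" and t0: "0 < t0"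
  shows "(\<integral>\<^sup>+t\<in>{0<..}. ennreal (k t) \<partial>lborel) = ennreal (integral {t0..t1} k)"
proof -
  have "(\<integral>\<^sup>+t\<in>{0<..}. ennreal (k t) \<partial>lborel) = (\<integral>\<^sup>+t\<in>{t0..t1}. ennreal (k t) \<partial>lborel)"
    using k(3) t0 by (intro nn_integral_cong) (auto simp: indicator_def)
  also have "\<dots> = ennreal (integral {t0..t1} k)"
    by (intro nn_integral_has_integral_lebesgue' integrable_integral integrable_continuous_real k)
  finally show ?thesis .
qed

section \<open>Test functions concentrating at the origin\<close>

context leray_potential
begin

text \<open>Since \<mu> is negative, a lower bound on \<open>V\<close> bounds the energy from above.
  It is needed only for \<open>t \<ge> T * exp (- N)\<close>, which contains the support.\<close>

lemma moser_test_energy: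
  assumes N: "1 \<le> N" and T: "0 < T" and c: "c\<^sup>2 * (2 * pi * moser_energy l (- \<mu>) N) \<le> 1"
    and V: "\<And>r. 0 < r \<Longrightarrow> r \<le> exp (- (T * exp (- N))) \<Longrightarrow> 1 - 1 / N \<le> V r * r\<^sup>2 * (- ln r)\<^sup>2"
  defines "u \<equiv> \<lambda>x. c * moser_fun l N T (- ln (norm x))"
  shows "energy V \<mu> B1 u (grad u) \<le> 1"
proof -
  have N0: "0 < N" using N by simp
  define t0 where "t0 = T * exp (- N)"
  define t1 where "t1 = T * exp N"
  have t0: "0 < t0" using T by (simp add: t0_def)
  define w where "w = moser_fun l N T"
  define w' where "w' = moser_fun' l N T"
  note cw = moser_fun_continuous(1)[OF l(1) N0 T, folded w_def] and cw' = moser_fun_continuous(2)[OF l(1) N0 T, folded w'_def]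
  have cI: "continuous_on {t0..t1} w" "continuous_on {t0..t1} w'"
    using t0 by (auto intro: continuous_on_subset[OF cw] continuous_on_subset[OF cw'])
  have w0: "w t = 0" "w' t = 0" if "0 < t" "t \<notin> {t0..t1}" for t
    using moser_fun_outside[OF l(1) N0 T, of t] that by (auto simp: w_def w'_def t0_def t1_def)
  have C: "C1c (B1 - {0}) u (grad u)" unfolding u_def by (rule C1c_Cc_infty[OF moser_fun_Cc_infty[OF l(1) N0 T]])
  note [measurable] = C1c_measurable[OF C]
  define I1 where "I1 = integral {t0..t1} (\<lambda>t. (w' t)\<^sup>2)"
  define I2 where "I2 = integral {t0..t1} (\<lambda>t. (w t)\<^sup>2 / t\<^sup>2)"
  have I0: "0 \<le> I1" "0 \<le> I2" unfolding I1_def I2_def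
    using t0 by (intro integral_nonneg integrable_continuous_real continuous_intros cI; auto)+
  have ul: "u (logpolar t \<theta>) = c * w t" for t \<theta> by (simp add: u_def w_def)
  have "ennreal (D (grad u)) = (\<integral>\<^sup>+x. ennreal ((norm (grad u x))\<^sup>2) \<partial>lborel)" by (rule nn_D[OF C, symmetric])
  also have "\<dots> = (\<integral>\<^sup>+x\<in>B1. ennreal ((norm (grad u x))\<^sup>2) \<partial>lborel)"
  proof -
    obtain K where K: "K \<subseteq> B1 - {0}" "\<And>x. x \<notin> K \<Longrightarrow> grad u x = 0" by (rule C1c_support[OF C]) blast
    have "ennreal ((norm (grad u x))\<^sup>2) = ennreal ((norm (grad u x))\<^sup>2) * indicator B1 x" for x
    proof (cases "x \<in> K")
      case True
      then have "x \<in> B1" using K(1) by blast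
      then show ?thesis by simp
    next
      case False
      then show ?thesis using K(2) by simp
    qed
    then show ?thesis by (simp only:)
  qed
  also have "\<dots> = ennreal (2 * pi) * (\<integral>\<^sup>+t\<in>{0<..}. ennreal (c\<^sup>2 * (w' t)\<^sup>2) \<partial>lborel)"
  proof (rule nn_integral_radial)
    show "(norm (grad u (logpolar t \<theta>)))\<^sup>2 * exp (- 2 * t) = c\<^sup>2 * (w' t)\<^sup>2" if t: "0 < t" for t \<theta>
    proof -
      have n: "norm (logpolar t \<theta>) = exp (- t)" by simp
      have "0 < norm (logpolar t \<theta>)" "norm (logpolar t \<theta>) < 1" unfolding n using t by auto
      then have x: "logpolar t \<theta> \<in> B1 - {0}" by (simp only: mem_ball_0 Diff_iff singleton_iff zero_less_norm_iff) blast
      then have "norm (sgn (logpolar t \<theta>)) = 1" by (simp add: norm_sgn)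
      then have "(norm (grad u (logpolar t \<theta>)))\<^sup>2 = (c\<^sup>2 * (w' t)\<^sup>2) / (norm (logpolar t \<theta>))\<^sup>2"
        unfolding u_def grad_moser_fun[OF l(1) N0 T x] by (simp add: w'_def power_mult_distrib power_divide)
      then show ?thesis by (simp only: exp_norm_logpolar)
    qed
    show "(\<lambda>t. indicator {0<..} t * (c\<^sup>2 * (w' t)\<^sup>2)) \<in> borel_measurable borel"
      by (intro borel_measurable_on_Ioi continuous_intros cw')
  qed auto
  also have "(\<integral>\<^sup>+t\<in>{0<..}. ennreal (c\<^sup>2 * (w' t)\<^sup>2) \<partial>lborel) = ennreal (integral {t0..t1} (\<lambda>t. c\<^sup>2 * (w' t)\<^sup>2))"
    by (rule nn_integral_Ioi_interval) (use w0 t0 in \<open>auto intro!: continuous_intros cI\<close>)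
  also have "integral {t0..t1} (\<lambda>t. c\<^sup>2 * (w' t)\<^sup>2) = c\<^sup>2 * I1" by (simp add: I1_def)
  also have "ennreal (2 * pi) * ennreal (c\<^sup>2 * I1) = ennreal (2 * pi * (c\<^sup>2 * I1))" by (rule ennreal_mult'[symmetric]) simp
  finally have D: "D (grad u) = 2 * pi * (c\<^sup>2 * I1)" using D_nonneg I0(1) by simp
  have "ennreal (2 * pi * ((1 - 1 / N) * c\<^sup>2 * I2)) = ennreal (2 * pi) * ennreal ((1 - 1 / N) * c\<^sup>2 * I2)" by (rule ennreal_mult') simp
  also have eI: "(1 - 1 / N) * c\<^sup>2 * I2 = integral {t0..t1} (\<lambda>t. (1 - 1 / N) * c\<^sup>2 * ((w t)\<^sup>2 / t\<^sup>2))"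
    unfolding I2_def by (rule Henstock_Kurzweil_Integration.integral_mult_right[symmetric])
  also have "ennreal \<dots> = (\<integral>\<^sup>+t\<in>{0<..}. ennreal ((1 - 1 / N) * c\<^sup>2 * ((w t)\<^sup>2 / t\<^sup>2)) \<partial>lborel)"
    by (rule nn_integral_Ioi_interval[symmetric]) (use w0 t0 N in \<open>auto intro!: continuous_intros cI\<close>)
  also have "ennreal (2 * pi) * \<dots> = (\<integral>\<^sup>+x\<in>B1. ennreal ((1 - 1 / N) * (leray_weight x * (u x)\<^sup>2)) \<partial>lborel)"
  proof (rule nn_integral_radial[symmetric])
    show "(1 - 1 / N) * (leray_weight (logpolar t \<theta>) * (u (logpolar t \<theta>))\<^sup>2) * exp (- 2 * t) = (1 - 1 / N) * c\<^sup>2 * ((w t)\<^sup>2 / t\<^sup>2)" for t \<theta>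
    proof -
      have "(1 - 1 / N) * (leray_weight (logpolar t \<theta>) * (u (logpolar t \<theta>))\<^sup>2) * exp (- 2 * t)
        = (1 - 1 / N) * (leray_weight (logpolar t \<theta>) * exp (- 2 * t)) * (u (logpolar t \<theta>))\<^sup>2" by (simp only: mult_ac)
      then show ?thesis unfolding leray_weight_logpolar ul by (simp add: power_mult_distrib)
    qed
    show "(\<lambda>t. indicator {0<..} t * ((1 - 1 / N) * c\<^sup>2 * ((w t)\<^sup>2 / t\<^sup>2))) \<in> borel_measurable borel"
      by (intro borel_measurable_on_Ioi continuous_intros cw) auto
    show "(\<lambda>x. (1 - 1 / N) * (leray_weight x * (u x)\<^sup>2)) \<in> borel_measurable borel" unfolding leray_weight_def by measurable
    show "0 \<le> (1 - 1 / N) * (leray_weight x * (u x)\<^sup>2)" for x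
      using N by (intro mult_nonneg_nonneg leray_weight_nonneg) auto
  qed
  also have "\<dots> \<le> (\<integral>\<^sup>+x. ennreal (W x * (u x)\<^sup>2) \<partial>lborel)"
  proof (rule nn_integral_mono)
    fix x :: plane
    show "ennreal ((1 - 1 / N) * (leray_weight x * (u x)\<^sup>2)) * indicator B1 x \<le> ennreal (W x * (u x)\<^sup>2)"
    proof (cases "x \<in> B1 \<and> u x \<noteq> 0")
      case True
      then have "w (- ln (norm x)) \<noteq> 0" by (auto simp: u_def w_def)
      then have i: "- ln (norm x) \<in> {t0<..<t1}"
        using moser_fun_outside(1)[OF l(1) N0 T, of "- ln (norm x)"] by (auto simp: w_def t0_def t1_def)
      then have x0: "0 < norm x" using t0 by (cases "x = 0") auto
      have x1: "norm x < 1" using True by simp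
      have "ln (norm x) \<le> - t0" using i by simp
      then have "exp (ln (norm x)) \<le> exp (- t0)" by simp
      then have "norm x \<le> exp (- t0)" unfolding exp_ln[OF x0] .
      then have "1 - 1 / N \<le> V (norm x) * (norm x)\<^sup>2 * (- ln (norm x))\<^sup>2" by (intro V x0) (simp add: t0_def)
      then have v: "1 - 1 / N \<le> V (norm x) * ((norm x)\<^sup>2 * (ln (norm x))\<^sup>2)" by (simp add: mult.assoc)
      have "ln (norm x) \<noteq> 0" using i t0 by auto
      then have "0 < (norm x)\<^sup>2 * (ln (norm x))\<^sup>2" using x0 by simp
      then have "(1 - 1 / N) * leray_weight x \<le> W x"
        using v True x0 by (simp add: leray_weight_def W_def pos_divide_le_eq)
      then have "(1 - 1 / N) * leray_weight x * (u x)\<^sup>2 \<le> W x * (u x)\<^sup>2" by (rule mult_right_mono) simp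
      then show ?thesis using True by (simp add: mult.assoc ennreal_leI)
    qed (auto simp: indicator_def)
  qed
  also note nn_P[OF C]
  finally have P: "2 * pi * ((1 - 1 / N) * c\<^sup>2 * I2) \<le> P u" unfolding eI using P_nonneg by (simp only: ennreal_le_iff)
  have mu2: "\<mu> = l\<^sup>2 / 4 - 1 / 4" using l(3) by linarith
  have main: "I1 + \<mu> * ((1 - 1 / N) * I2) \<le> moser_energy l (- \<mu>) N"
    unfolding I1_def I2_def w_def w'_def t0_def t1_def
    by (rule moser_fun_energy[OF l(1) N0 T _ mu2 order_refl]) (use mu in simp)
  have "energy V \<mu> B1 u (grad u) = D (grad u) + \<mu> * P u" by (rule energy_test[OF C])
  also have "\<dots> \<le> 2 * pi * (c\<^sup>2 * I1) + \<mu> * (2 * pi * ((1 - 1 / N) * c\<^sup>2 * I2))"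
    unfolding D using mult_left_mono_neg[OF P less_imp_le[OF mu(2)]] by simp
  also have "\<dots> = c\<^sup>2 * (2 * pi * (I1 + \<mu> * ((1 - 1 / N) * I2)))" by (simp only: distrib_left mult_ac)
  also have "\<dots> \<le> c\<^sup>2 * (2 * pi * moser_energy l (- \<mu>) N)" using main by (intro mult_left_mono) auto
  finally show ?thesis using c by linarith
qed

text \<open>For \<open>t\<close> between \<open>T * exp (- y)\<close> and \<open>T\<close> the
  hypothesis makes the exponent \<open>\<alpha> * u\<^sup>2\<close> at least \<open>2 * t\<close>,
  so it beats the Jacobian and the integrand is at least 1 on an interval whose length is
  proportional to \<open>T\<close>.\<close>

lemma moser_test_exp_integral:
  assumes N: "1 \<le> N" and T: "0 < T" and y: "0 < y" and \<alpha>: "\<And>z. - y \<le> z \<Longrightarrow> z \<le> 0 \<Longrightarrow> 2 \<le> \<alpha> * c\<^sup>2 * (leray_profile l N z)\<^sup>2"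
  shows "ennreal (2 * pi * (T * (1 - exp (- y)))) \<le> exp_integral \<alpha> (\<lambda>x. c * moser_fun l N T (- ln (norm x)))"
proof -
  have N0: "0 < N" using N by simp
  define w where "w = moser_fun l N T"
  define u where "u x = c * w (- ln (norm x))" for x :: plane
  have C: "C1c (B1 - {0}) u (grad u)" unfolding u_def w_def by (rule C1c_Cc_infty[OF moser_fun_Cc_infty[OF l(1) N0 T]])
  note [measurable] = C1c_measurable[OF C]
  note cw = moser_fun_continuous(1)[OF l(1) N0 T, folded w_def]
  have "T * exp (- y) \<le> T" using T y by simp
  then have "ennreal (T * (1 - exp (- y))) = emeasure lborel {T * exp (- y)..T}" by (simp add: right_diff_distrib)
  also have "\<dots> = (\<integral>\<^sup>+t. indicator {T * exp (- y)..T} t \<partial>lborel)" by simp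
  also have "\<dots> \<le> (\<integral>\<^sup>+t\<in>{0<..}. ennreal (exp (\<alpha> * (c * w t)\<^sup>2 - 2 * t)) \<partial>lborel)"
  proof (rule nn_integral_mono)
    fix t :: real
    show "indicator {T * exp (- y)..T} t \<le> ennreal (exp (\<alpha> * (c * w t)\<^sup>2 - 2 * t)) * indicator {0<..} t"
    proof (cases "t \<in> {T * exp (- y)..T}")
      case True
      then have t: "0 < t" using T less_le_trans[of 0 "T * exp (- y)" t] by simp
      have "ln (T * exp (- y)) \<le> ln t" "ln t \<le> ln T" using True t T by auto
      then have "- y \<le> ln t - ln T" "ln t - ln T \<le> 0" using T by (simp_all add: ln_mult)
      then have "2 * t \<le> (\<alpha> * c\<^sup>2 * (leray_profile l N (ln t - ln T))\<^sup>2) * t" using t by (intro mult_right_mono \<alpha>) auto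
      also have "\<dots> = \<alpha> * (c * w t)\<^sup>2" using t by (simp add: w_def moser_fun_def power_mult_distrib)
      finally have "ennreal 1 \<le> ennreal (exp (\<alpha> * (c * w t)\<^sup>2 - 2 * t))" by (intro ennreal_leI) simp
      then show ?thesis using True t by simp
    qed simp
  qed
  finally have le: "ennreal (T * (1 - exp (- y))) \<le> (\<integral>\<^sup>+t\<in>{0<..}. ennreal (exp (\<alpha> * (c * w t)\<^sup>2 - 2 * t)) \<partial>lborel)" .
  have "ennreal (2 * pi * (T * (1 - exp (- y)))) = ennreal (2 * pi) * ennreal (T * (1 - exp (- y)))" by (rule ennreal_mult') simp
  also have "\<dots> \<le> ennreal (2 * pi) * (\<integral>\<^sup>+t\<in>{0<..}. ennreal (exp (\<alpha> * (c * w t)\<^sup>2 - 2 * t)) \<partial>lborel)" by (rule mult_left_mono[OF le]) simp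
  also have "\<dots> = (\<integral>\<^sup>+x\<in>B1. ennreal (exp (\<alpha> * (u x)\<^sup>2)) \<partial>lborel)"
  proof (rule nn_integral_radial[symmetric])
    show "exp (\<alpha> * (u (logpolar t \<theta>))\<^sup>2) * exp (- 2 * t) = exp (\<alpha> * (c * w t)\<^sup>2 - 2 * t)" for t \<theta>
      by (simp add: u_def exp_add[symmetric])
    show "(\<lambda>t. indicator {0<..} t * exp (\<alpha> * (c * w t)\<^sup>2 - 2 * t)) \<in> borel_measurable borel"
      by (intro borel_measurable_on_Ioi continuous_intros cw)
  qed auto
  also have "\<dots> = exp_integral \<alpha> u" by (rule exp_integral_eq[symmetric]) auto
  finally show ?thesis unfolding u_def w_def .
qed

text \<open>\<alpha> determines \<open>N\<close> and the factor \<open>c\<close> once and for all;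
  along the sequence only the position \<open>T n\<close> of the peak moves to infinity.\<close>

lemma concentrating_sequence:
  assumes lim: "((\<lambda>r. V r * r\<^sup>2 * (- ln r)\<^sup>2) \<longlongrightarrow> 1) (at_right 0)" and \<alpha>: "m_crit \<mu> < \<alpha>"
  obtains u :: "nat \<Rightarrow> plane \<Rightarrow> real" where "\<And>n. u n \<in> H_space V \<mu>" "\<And>n. radial (u n)" "\<And>n. H_norm V \<mu> (u n) \<le> 1"
    "concentrating_at V \<mu> u 0" "(\<lambda>n. exp_integral \<alpha> (u n)) \<longlonglongrightarrow> \<infinity>"
proof -
  have "l < \<alpha> / (4 * pi)" using \<alpha> by (simp add: m_crit_l field_simps)
  from order_tendstoD(2)[OF moser_energy_tendsto[OF l(1)] this]
  have "eventually (\<lambda>N. moser_energy l (- \<mu>) N < \<alpha> / (4 * pi) \<and> 2 \<le> N) at_top"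
    using eventually_ge_at_top[of 2] by eventually_elim simp
  then obtain N where N: "moser_energy l (- \<mu>) N < \<alpha> / (4 * pi)" "2 \<le> N"
    using eventually_happens'[OF trivial_limit_at_top_linorder] by blast
  have N0: "0 < N" "1 \<le> N" using N by auto
  define A where "A = 2 * pi * moser_energy l (- \<mu>) N"
  have A: "0 < A"
  proof -
    have "0 < (l / 2 + 4 * exp 1 / N)\<^sup>2" using l(1) N0 by (intro zero_less_power add_pos_pos) auto
    moreover have "0 \<le> - \<mu> / N" using mu N0 by (intro divide_nonneg_pos) auto
    moreover have "0 \<le> l\<^sup>2 / 4" by simp
    ultimately have "0 < (l / 2 + 4 * exp 1 / N)\<^sup>2 + l\<^sup>2 / 4 + - \<mu> / N" by linarith
    then show ?thesis unfolding A_def moser_energy_def using l(1) by (intro mult_pos_pos) auto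
  qed
  \<comment> \<open>Normalizes the energy bound \<open>A\<close> to 1. The choice of
    \<open>N\<close> gives \<open>2 * A < \<alpha>\<close>, which leaves a surplus over the Jacobian
    at the peak.\<close>
  define c where "c = 1 / sqrt A"
  have c2: "c\<^sup>2 = 1 / A" using A by (simp add: c_def power_divide)
  have "2 * A < \<alpha>" using N(1) by (simp add: A_def field_simps)
  define k where "k z = \<alpha> * c\<^sup>2 * (leray_profile l N z)\<^sup>2" for z
  \<comment> \<open>The strict inequality at the peak extends by continuity to an interval of fixed
    length in \<open>ln t\<close>.\<close>
  have "2 < k 0" using \<open>2 * A < \<alpha>\<close> A by (simp add: k_def c2 leray_profile_0[OF l(1) N0(1)] field_simps)
  moreover have "isCont k 0" unfolding k_def
    using leray_profile_continuous(1)[OF l(1) N0(1), of UNIV] by (intro continuous_intros) (simp add: continuous_on_eq_continuous_at)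
  then have "(k \<longlongrightarrow> k 0) (nhds 0)" by (simp add: isCont_def tendsto_at_iff_tendsto_nhds)
  ultimately have "eventually (\<lambda>z. 2 < k z) (nhds 0)" by (intro order_tendstoD(1))
  then obtain d where d: "0 < d" "\<And>z. dist z 0 < d \<Longrightarrow> 2 < \<alpha> * c\<^sup>2 * (leray_profile l N z)\<^sup>2"
    unfolding k_def eventually_nhds_metric by blast
  define y where "y = d / 2"
  have y: "0 < y" "2 \<le> \<alpha> * c\<^sup>2 * (leray_profile l N z)\<^sup>2" if "- y \<le> z" "z \<le> 0" for z
    using d(1) d(2)[of z] that by (auto simp: y_def dist_real_def)
  have y0: "0 < y" using d(1) by (simp add: y_def)
  have "1 - 1 / N < 1" using N0 by simp
  from order_tendstoD(1)[OF lim this] obtain b where b: "0 < b" "\<And>r. 0 < r \<Longrightarrow> r < b \<Longrightarrow> 1 - 1 / N < V r * r\<^sup>2 * (- ln r)\<^sup>2"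
    unfolding eventually_at_right_field by blast
  \<comment> \<open>The constant part pushes the support into the region \<open>norm x < b\<close>,
    where \<open>V\<close> is close to the Leray weight; the summand \<open>n\<close> drives the
    peak to infinity.\<close>
  define T where "T n = exp N * (1 + \<bar>ln b\<bar>) + real n" for n
  have T: "0 < T n" for n unfolding T_def by (intro add_pos_nonneg mult_pos_pos) auto
  define u where "u n = (\<lambda>x :: plane. c * moser_fun l N (T n) (- ln (norm x)))" for n
  have uC: "u n \<in> Cc_infty (B1 - {0})" for n unfolding u_def by (rule moser_fun_Cc_infty[OF l(1) N0(1) T])
  have C: "C1c (B1 - {0}) (u n) (grad (u n))" for n by (rule C1c_Cc_infty[OF uC])
  have wg: "AE x in lebesgue. x \<in> B1 \<longrightarrow> weak_grad (u n) x = grad (u n) x" for n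
    by (rule weak_grad_test[OF C1c_mono[OF C]]) auto
  have En: "energy V \<mu> S (u n) (weak_grad (u n)) = (\<integral>x. indicator S x * (norm (grad (u n) x))\<^sup>2 \<partial>lborel) + \<mu> * (\<integral>x. indicator S x * (W x * (u n x)\<^sup>2) \<partial>lborel)"
    if "S \<in> sets borel" "S \<subseteq> B1" for S n
    by (rule energy_eq[OF that C1c_measurable[OF C] _ wg D_integrable[OF C] P_integrable[OF C]]) simp
  have E1: "energy V \<mu> B1 (u n) (weak_grad (u n)) \<le> 1" for n
  proof -
    obtain K where K: "K \<subseteq> B1 - {0}" "\<And>x. x \<notin> K \<Longrightarrow> grad (u n) x = 0" by (rule C1c_support[OF C]) blast
    have out: "AE x in lborel. x \<notin> B1 \<longrightarrow> grad (u n) x = 0" by (rule AE_I2) (use K in blast)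
    have "energy V \<mu> B1 (u n) (weak_grad (u n)) = D (grad (u n)) + \<mu> * P (u n)"
      by (rule energy_B1_eq[OF C1c_measurable[OF C] _ wg out D_integrable[OF C] P_integrable[OF C]]) simp
    also have "\<dots> = energy V \<mu> B1 (u n) (grad (u n))" by (rule energy_test[OF C, symmetric])
    also have "\<dots> \<le> 1" unfolding u_def
    proof (rule moser_test_energy[OF N0(2) T])
      show "c\<^sup>2 * (2 * pi * moser_energy l (- \<mu>) N) \<le> 1" using A by (simp add: c2 A_def[symmetric])
      fix r :: real assume r: "0 < r" "r \<le> exp (- (T n * exp (- N)))"
      have "T n * exp (- N) = (1 + \<bar>ln b\<bar>) + real n * exp (- N)"
        unfolding T_def by (simp add: distrib_right exp_minus field_simps)
      moreover have "0 \<le> real n * exp (- N)" by simp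
      ultimately have "- (T n * exp (- N)) < ln b" by linarith
      then have "exp (- (T n * exp (- N))) < exp (ln b)" by simp
      then have "r < b" using r(2) b(1) by simp
      then show "1 - 1 / N \<le> V r * r\<^sup>2 * (- ln r)\<^sup>2" using b(2)[OF r(1)] by simp
    qed
    finally show ?thesis .
  qed
  show thesis
  proof (rule that)
    show "u n \<in> H_space V \<mu>" for n by (rule H_space_test[OF uC])
    show "radial (u n)" for n by (simp add: radial_def u_def)
    show "H_norm V \<mu> (u n) \<le> 1" for n unfolding H_norm_def using E1[of n] by simp
    show "concentrating_at V \<mu> u 0" unfolding concentrating_at_def
    proof (intro ballI allI impI)
      fix r \<epsilon> :: real assume r: "r \<in> {0<..<1}" and \<epsilon>: "0 < \<epsilon>"
      \<comment> \<open>From this index on \<open>T n * exp (- N)\<close> is at least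
        \<open>- ln r\<close>, so the whole support lies in the ball of radius \<open>r\<close> and
        the outer energy is exactly 0.\<close>
      define n0 where "n0 = Suc (nat \<lceil>- ln r * exp N\<rceil>)"
      have "energy V \<mu> (B1 - ball 0 r) (u n) (weak_grad (u n)) < \<epsilon>" if n: "n0 \<le> n" for n
      proof -
        have "- ln r * exp N \<le> real (nat \<lceil>- ln r * exp N\<rceil>)" by linarith
        also have "\<dots> \<le> real n" using Suc_leD[OF n[unfolded n0_def]] by (rule of_nat_mono)
        also have "\<dots> \<le> T n" unfolding T_def by simp
        finally have "- ln r * exp N * exp (- N) \<le> T n * exp (- N)" by (rule mult_right_mono) simp
        then have rT: "- ln r \<le> T n * exp (- N)" by (simp add: mult.assoc exp_add[symmetric])
        have u0: "u n x = 0" if "r \<le> norm x" for x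
        proof -
          have "0 < r" using r by simp
          then have "0 < norm x" using that by linarith
          then have "ln r \<le> ln (norm x)" using that r by simp
          then show ?thesis unfolding u_def using rT by (simp add: moser_fun_outside(1)[OF l(1) N0(1) T])
        qed
        have g0: "grad (u n) x = 0" if x: "x \<in> B1 - ball 0 r" for x
        proof -
          have x': "x \<in> B1 - {0}" "r \<le> norm x" using x r by auto
          then have "ln r \<le> ln (norm x)" "0 < - ln (norm x)" using r by (simp_all add: less_le_trans)
          then have "moser_fun' l N (T n) (- ln (norm x)) = 0" using rT by (intro moser_fun_outside(2)[OF l(1) N0(1) T]) auto
          then show ?thesis unfolding u_def grad_moser_fun[OF l(1) N0(1) T x'(1)] by simp
        qed
        have i0: "indicator (B1 - ball 0 r) x * (norm (grad (u n) x))\<^sup>2 = (0 :: real)" "indicator (B1 - ball 0 r) x * (W x * (u n x)\<^sup>2) = 0" for x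
          using g0[of x] u0[of x] by (auto simp: indicator_def)
        have "B1 - ball (0 :: plane) r \<in> sets borel" "B1 - ball (0 :: plane) r \<subseteq> B1" by auto
        then have "energy V \<mu> (B1 - ball 0 r) (u n) (weak_grad (u n)) = 0" by (simp only: En i0) simp
        then show ?thesis using \<epsilon> by simp
      qed
      then show "\<exists>n\<^sub>0>0. \<forall>n\<ge>n\<^sub>0. energy V \<mu> (B1 - ball 0 r) (u n) (weak_grad (u n)) < \<epsilon>"
        by (intro exI[of _ n0]) (auto simp: n0_def)
    qed
    have "filterlim (\<lambda>n. 2 * pi * (T n * (1 - exp (- y)))) at_top sequentially"
    proof -
      have "filterlim (\<lambda>n. exp N * (1 + \<bar>ln b\<bar>) + real n) at_top sequentially"
        by (rule filterlim_tendsto_add_at_top[OF tendsto_const filterlim_real_sequentially])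
      then have "filterlim (\<lambda>n. (2 * pi * (1 - exp (- y))) * T n) at_top sequentially"
        unfolding T_def using y0 by (intro filterlim_tendsto_pos_mult_at_top[OF tendsto_const]) auto
      then show ?thesis by (simp only: mult_ac)
    qed
    then have "(\<lambda>n. ennreal (2 * pi * (T n * (1 - exp (- y))))) \<longlonglongrightarrow> \<infinity>"
      by (simp add: ennreal_tendsto_top_eq_at_top)
    then show "(\<lambda>n. exp_integral \<alpha> (u n)) \<longlonglongrightarrow> \<infinity>"
    proof (rule tendsto_sandwich[rotated 2, OF _ tendsto_const])
      show "eventually (\<lambda>n. ennreal (2 * pi * (T n * (1 - exp (- y)))) \<le> exp_integral \<alpha> (u n)) sequentially"
        unfolding u_def by (intro always_eventually allI moser_test_exp_integral[OF N0(2) T y0] y(2))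
      show "eventually (\<lambda>n. exp_integral \<alpha> (u n) \<le> \<infinity>) sequentially" by simp
    qed
  qed
qed

end

theorem theorem1p7:
  fixes \<mu> :: real and V :: "real \<Rightarrow> real"
  assumes "- 1 / 4 < \<mu>" and "\<mu> < 0"
    and "continuous_on {0<..<1} V"
    and "\<forall>r\<in>{0<..<1}. 0 \<le> V r"
    and "\<forall>r\<in>{0<..<1}. V r \<le> 1 / (r\<^sup>2 * (- ln r)\<^sup>2)"
  shows
    "((SUP u\<in>{u \<in> H_space V \<mu>. radial u \<and> H_norm V \<mu> u \<le> 1}. exp_integral (m_crit \<mu>) u) < \<infinity> \<and>
      (\<forall>\<alpha>>m_crit \<mu>. ((\<lambda>r. V r * r\<^sup>2 * (- ln r)\<^sup>2) \<longlongrightarrow> 1) (at_right 0) \<longrightarrow>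
         (\<exists>u :: nat \<Rightarrow> plane \<Rightarrow> real.
            (\<forall>n. u n \<in> H_space V \<mu> \<and> radial (u n) \<and> H_norm V \<mu> (u n) \<le> 1) \<and>
            concentrating_at V \<mu> u 0 \<and>
            (\<lambda>n. exp_integral \<alpha> (u n)) \<longlonglongrightarrow> \<infinity>))) \<and>
     (antimono_on {0<..<1} V \<longrightarrow>
        (SUP u\<in>{u \<in> H_space V \<mu>. H_norm V \<mu> u \<le> 1}. exp_integral (m_crit \<mu>) u) < \<infinity>) \<and>
     (((\<lambda>r. V r * r\<^sup>2 * (- ln r)\<^sup>2) \<longlongrightarrow> 1) (at_right 0) \<longrightarrow>
        (\<forall>\<alpha>>m_crit \<mu>.
           \<exists>u :: nat \<Rightarrow> plane \<Rightarrow> real.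
             (\<forall>n. u n \<in> H_space V \<mu> \<and> H_norm V \<mu> (u n) \<le> 1) \<and>
             concentrating_at V \<mu> u 0 \<and>
             (\<lambda>n. exp_integral \<alpha> (u n)) \<longlonglongrightarrow> \<infinity>))"
proof -
  interpret leray_potential \<mu> V by (rule leray_potential.intro) (use assms in auto)
  \<comment> \<open>The common bound for both suprema depends on \<mu> alone.\<close>
  have M: "ennreal (2 * pi) * ennreal (moser_const l) < \<infinity>" by (simp add: ennreal_mult_less_top)
  have optimal: "\<exists>u :: nat \<Rightarrow> plane \<Rightarrow> real. (\<forall>n. u n \<in> H_space V \<mu> \<and> radial (u n) \<and> H_norm V \<mu> (u n) \<le> 1) \<and>
      concentrating_at V \<mu> u 0 \<and> (\<lambda>n. exp_integral \<alpha> (u n)) \<longlonglongrightarrow> \<infinity>"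
    if "m_crit \<mu> < \<alpha>" "((\<lambda>r. V r * r\<^sup>2 * (- ln r)\<^sup>2) \<longlongrightarrow> 1) (at_right 0)" for \<alpha>
    by (rule concentrating_sequence[OF that(2,1)]) blast
  have "(SUP u\<in>{u \<in> H_space V \<mu>. radial u \<and> H_norm V \<mu> u \<le> 1}. exp_integral (m_crit \<mu>) u) < \<infinity>"
    by (rule le_less_trans[OF SUP_least M]) (auto intro: radial_moser)
  moreover have "(SUP u\<in>{u \<in> H_space V \<mu>. H_norm V \<mu> u \<le> 1}. exp_integral (m_crit \<mu>) u) < \<infinity>" if "antimono_on {0<..<1} V"
    by (rule le_less_trans[OF SUP_least M]) (auto intro: decreasing_moser[OF that])
  ultimately show ?thesis using optimal by blast
qed

end
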